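(* Let $(u_0,v_0)\in\Sigma$ and $(u_{0,n},v_{0,n})\in\Sigma$, $n\in\mathbb N$, be such that $d_\Sigma\left((u_{0,n},v_{0,n}),(u_0,v_0)\right)\to0$ as $n\to\infty$. Let $(u,v)$ and $(u_n,v_n)$ be the solutions of the nonlocal two-component Novikov system with initial data $(u_0,v_0)$ and $(u_{0,n},v_{0,n})$, respectively, constructed through the associated ODE system as described in the context. Then for all $T>0$ $$\|u_n-u\|_{L^\infty([-T,T]\times\mathbb R)}+\|v_n-v\|_{L^\infty([-T,T]\times\mathbb R)}\to0,\qquad n\to\infty.$$
   Context: **Space.** $\Sigma=\{(f,g): f,g\in H^1(\mathbb R),\ \int_{\mathbb R}(\partial_xf)^2(\partial_xg)^2dx<\infty\}$ with metric $d_\Sigma^2((f_1,g_1),(f_2,g_2))=\|f_1-f_2\|_{H^1}^2+\|g_1-g_2\|_{H^1}^2+\|(\partial_xf_1)\partial_xg_1-(\partial_xf_2)\partial_xg_2\|_{L^2}^2$. **Nonlocal two-component Novikov system.** $\partial_tu+uv\partial_xu+\partial_xP_1+P_2=0$, $\partial_tv+uv\partial_xv+\partial_xS_1+S_2=0$, with $P_1=(1-\partial_x^2)^{-1}(u^2v+u(\partial_xu)\partial_xv+\frac12v(\partial_xu)^2)$, $P_2=\frac12(1-\partial_x^2)^{-1}((\partial_xu)^2\partial_xv)$, $S_1=(1-\partial_x^2)^{-1}(uv^2+v(\partial_xu)\partial_xv+\frac12u(\partial_xv)^2)$, $S_2=\frac12(1-\partial_x^2)^{-1}((\partial_xu)(\partial_xv)^2)$;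 $(1-\partial_x^2)^{-1}$ is convolution with $\frac12e^{-|x|}$. **Associated ODE system.** Given $(u_0,v_0)\in\Sigma$, let $y_0$ be the strictly increasing function with $\int_0^{y_0(\xi)}(1+(\partial_xu_0)^2)(1+(\partial_xv_0)^2)dx=\xi$. The unknowns $(U,V,W,Z,q)(t,\xi)$ solve $$\begin{aligned} &\partial_tU=-\partial_xP_1-P_2,\qquad \partial_tV=-\partial_xS_1-S_2,\\ &\partial_tW=2U^2V\cos^2\tfrac W2-V\sin^2\tfrac W2-2(P_1+\partial_xP_2)\cos^2\tfrac W2,\\ &\partial_tZ=2UV^2\cos^2\tfrac Z2-U\sin^2\tfrac Z2-2(S_1+\partial_xS_2)\cos^2\tfrac Z2,\\ &\partial_tq=q\big(U^2V+\tfrac12V-P_1-\partial_xP_2\big)\sin W+q\big(UV^2+\tfrac12U-S_1-\partial_xS_2\big)\sin Z, \end{aligned}$$ with $U(0,\xi)=u_0(y_0(\xi))$, $V(0,\xi)=v_0(y_0(\xi))$, $W(0,\xi)=2\arctan(\partial_xu_0)(y_0(\xi))$, $Z(0,\xi)=2\arctan(\partial_xv_0)(y_0(\xi))$ (values in $[-\pi,\pi]$), $q(0,\xi)=1$. In this system the symbols $P_j,\partial_xP_j,S_j,\partial_xS_j$ are the functions of $(t,\xi)$ defined by: $\mathcal E(t,\xi,\eta)=\exp\big(-\big|\int_\eta^\xi(q\cos^2\frac W2\cos^2\frac Z2)(t,s)ds\big|\big)$, $p_1=q(U^2V\cos^2\frac W2\cos^2\frac Z2+\frac14U\sin W\sin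 Z+\frac12V\sin^2\frac W2\cos^2\frac Z2)$, $s_1=q(UV^2\cos^2\frac W2\cos^2\frac Z2+\frac12U\cos^2\frac W2\sin^2\frac Z2+\frac14V\sin W\sin Z)$, $p_2=q\sin^2\frac W2\sin Z$, $s_2=q\sin W\sin^2\frac Z2$; $P_j(t,\xi)=c_j\int_{\mathbb R}\mathcal E(t,\xi,\eta)p_j(t,\eta)d\eta$, $(\partial_xP_j)(t,\xi)=c_j\big(\int_\xi^\infty-\int_{-\infty}^\xi\big)\mathcal E(t,\xi,\eta)p_j(t,\eta)d\eta$ with $c_1=\frac12$, $c_2=\frac18$, and $S_j,\partial_xS_j$ likewise with $s_j$ in place of $p_j$. This Cauchy problem has a unique global solution, continuous in $t$ with values in $E=(H^1\cap W^{1,4})^2\times(L^2\cap L^\infty)^2\times L^\infty$ on every $[-T,T]$, with $q$ bounded between positive constants there ($W,Z$ being understood modulo $2\pi$, since the right-hand side is $2\pi$-periodic in them). **Construction of $(u,v)$.** $y(t,\xi)=y_0(\xi)+\int_0^t(UV)(\tau,\xi)d\tau$, and $u(t,x)=U(t,\xi)$, $v(t,x)=V(t,\xi)$ if $x=y(t,\xi)$. For each $t$, $y(t,\cdot)$ is nondecreasing and onto $\mathbb R$, and $U(t,\cdot),V(t,\cdot)$ are constant on its level sets, so this is well defined. $(u_n,v_n)$ is obtained in the same way from $(u_{0,n},v_{0,n})$. *)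

theory Defs
  imports "HOL-Analysis.Analysis" "HOL-Probability.Essential_Supremum"
begin

text \<open>
  Elements of Lebesgue spaces on the line are represented by Borel functions
  \<open>real \<Rightarrow> real\<close> up to equality almost everywhere; every class of Lebesgue measurable functions
  contains a Borel function.
\<close>

definition Lp_space :: "real \<Rightarrow> (real \<Rightarrow> real) set" where
  "Lp_space p = {f \<in> borel_measurable lborel. integrable lborel (\<lambda>x. \<bar>f x\<bar> powr p)}"

definition Lp_norm :: "real \<Rightarrow> (real \<Rightarrow> real) \<Rightarrow> real" where
  "Lp_norm p f = (LINT x|lborel. \<bar>f x\<bar> powr p) powr (1 / p)"

definition Linf_space :: "(real \<Rightarrow> real) set" where
  "Linf_space = {f \<in> borel_measurable lborel. \<exists>C. AE x in lborel. \<bar>f x\<bar> \<le> C}"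

definition Linf_norm :: "(real \<Rightarrow> real) \<Rightarrow> real" where
  "Linf_norm f = real_of_ereal (esssup lborel (\<lambda>x. ereal \<bar>f x\<bar>))"

definition test_fun :: "(real \<Rightarrow> real) \<Rightarrow> bool" where
  "test_fun \<phi> \<longleftrightarrow> (\<forall>k x. ((deriv ^^ k) \<phi>) field_differentiable (at x))
     \<and> (\<exists>R. \<forall>x. \<bar>x\<bar> > R \<longrightarrow> \<phi> x = 0)"

definition loc_integrable :: "(real \<Rightarrow> real) \<Rightarrow> bool" where
  "loc_integrable f \<longleftrightarrow> f \<in> borel_measurable lborel \<and> (\<forall>a b. set_integrable lborel {a..b} f)"

definition has_weak_deriv :: "(real \<Rightarrow> real) \<Rightarrow> (real \<Rightarrow> real) \<Rightarrow> bool" where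
  "has_weak_deriv f g \<longleftrightarrow> loc_integrable f \<and> loc_integrable g \<and>
     (\<forall>\<phi>. test_fun \<phi> \<longrightarrow>
        (LINT x|lborel. f x * deriv \<phi> x) = - (LINT x|lborel. g x * \<phi> x))"

text \<open>
  A representative of the weak derivative. It is determined only almost everywhere, and only its
  almost-everywhere class matters below.
\<close>

definition wderiv :: "(real \<Rightarrow> real) \<Rightarrow> real \<Rightarrow> real" where
  "wderiv f = (SOME g. has_weak_deriv f g)"

text \<open>
  \<open>W^{1,p}(\<real>)\<close>. Every class contains exactly one continuous function, and the class is identified
  with it, so that point values such as \<open>u0 (y0 \<xi>)\<close> make sense.
\<close>

definition W1p_space :: "real \<Rightarrow> (real \<Rightarrow> real) set" where
  "W1p_space p = {f. continuous_on UNIV f \<and> f \<in> Lp_space p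
     \<and> (\<exists>g. has_weak_deriv f g) \<and> wderiv f \<in> Lp_space p}"

definition W1p_norm :: "real \<Rightarrow> (real \<Rightarrow> real) \<Rightarrow> real" where
  "W1p_norm p f = (Lp_norm p f powr p + Lp_norm p (wderiv f) powr p) powr (1 / p)"

abbreviation H1_space :: "(real \<Rightarrow> real) set" where
  "H1_space \<equiv> W1p_space 2"

abbreviation H1_norm :: "(real \<Rightarrow> real) \<Rightarrow> real" where
  "H1_norm \<equiv> W1p_norm 2"

definition Sigma_space :: "((real \<Rightarrow> real) \<times> (real \<Rightarrow> real)) set" where
  "Sigma_space = {(f, g). f \<in> H1_space \<and> g \<in> H1_space
     \<and> integrable lborel (\<lambda>x. (wderiv f x)\<^sup>2 * (wderiv g x)\<^sup>2)}"

fun d_Sigma ::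
  "(real \<Rightarrow> real) \<times> (real \<Rightarrow> real) \<Rightarrow> (real \<Rightarrow> real) \<times> (real \<Rightarrow> real) \<Rightarrow> real" where
  "d_Sigma (f1, g1) (f2, g2) = sqrt ((H1_norm (f1 - f2))\<^sup>2 + (H1_norm (g1 - g2))\<^sup>2
     + (Lp_norm 2 (\<lambda>x. wderiv f1 x * wderiv g1 x - wderiv f2 x * wderiv g2 x))\<^sup>2)"


text \<open>
  The unknowns \<open>(U, V, W, Z, q)\<close> at a fixed time, as functions of \<open>\<xi>\<close>, and the Banach space
  \<open>E = (H^1 \<inter> W^{1,4})^2 \<times> (L^2 \<inter> L^\<infinity>)^2 \<times> L^\<infinity>\<close>.
\<close>

type_synonym state =
  "(real \<Rightarrow> real) \<times> (real \<Rightarrow> real) \<times> (real \<Rightarrow> real) \<times> (real \<Rightarrow> real) \<times> (real \<Rightarrow> real)"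

definition E_space :: "state set" where
  "E_space = {(U, V, W, Z, q).
     U \<in> H1_space \<inter> W1p_space 4 \<and> V \<in> H1_space \<inter> W1p_space 4
     \<and> W \<in> Lp_space 2 \<inter> Linf_space \<and> Z \<in> Lp_space 2 \<inter> Linf_space \<and> q \<in> Linf_space}"

fun E_norm :: "state \<Rightarrow> real" where
  "E_norm (U, V, W, Z, q) =
     H1_norm U + W1p_norm 4 U + H1_norm V + W1p_norm 4 V
     + Lp_norm 2 W + Linf_norm W + Lp_norm 2 Z + Linf_norm Z + Linf_norm q"

fun scale_state :: "real \<Rightarrow> state \<Rightarrow> state" where
  "scale_state c (U, V, W, Z, q) =
     (\<lambda>\<xi>. c * U \<xi>, \<lambda>\<xi>. c * V \<xi>, \<lambda>\<xi>. c * W \<xi>, \<lambda>\<xi>. c * Z \<xi>, \<lambda>\<xi>. c * q \<xi>)"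

definition E_continuous :: "(real \<Rightarrow> state) \<Rightarrow> bool" where
  "E_continuous X \<longleftrightarrow> (\<forall>t. X t \<in> E_space) \<and> (\<forall>t. ((\<lambda>s. E_norm (X s - X t)) \<longlongrightarrow> 0) (at t))"

definition has_E_derivative :: "(real \<Rightarrow> state) \<Rightarrow> state \<Rightarrow> real \<Rightarrow> bool" where
  "has_E_derivative X X' t \<longleftrightarrow> X' \<in> E_space \<and>
     ((\<lambda>h. E_norm (scale_state (1 / h) (X (t + h) - X t) - X')) \<longlongrightarrow> 0) (at 0)"


fun kernel :: "state \<Rightarrow> real \<Rightarrow> real \<Rightarrow> real" where
  "kernel (U, V, W, Z, q) \<xi> \<eta> =
     exp (- \<bar>LBINT s=ereal \<eta>..ereal \<xi>. q s * (cos (W s / 2))\<^sup>2 * (cos (Z s / 2))\<^sup>2\<bar>)"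

fun p1 :: "state \<Rightarrow> real \<Rightarrow> real" where
  "p1 (U, V, W, Z, q) \<eta> = q \<eta> *
     ((U \<eta>)\<^sup>2 * V \<eta> * (cos (W \<eta> / 2))\<^sup>2 * (cos (Z \<eta> / 2))\<^sup>2
      + 1/4 * U \<eta> * sin (W \<eta>) * sin (Z \<eta>)
      + 1/2 * V \<eta> * (sin (W \<eta> / 2))\<^sup>2 * (cos (Z \<eta> / 2))\<^sup>2)"

fun s1 :: "state \<Rightarrow> real \<Rightarrow> real" where
  "s1 (U, V, W, Z, q) \<eta> = q \<eta> *
     (U \<eta> * (V \<eta>)\<^sup>2 * (cos (W \<eta> / 2))\<^sup>2 * (cos (Z \<eta> / 2))\<^sup>2
      + 1/2 * U \<eta> * (cos (W \<eta> / 2))\<^sup>2 * (sin (Z \<eta> / 2))\<^sup>2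
      + 1/4 * V \<eta> * sin (W \<eta>) * sin (Z \<eta>))"

fun p2 :: "state \<Rightarrow> real \<Rightarrow> real" where
  "p2 (U, V, W, Z, q) \<eta> = q \<eta> * (sin (W \<eta> / 2))\<^sup>2 * sin (Z \<eta>)"

fun s2 :: "state \<Rightarrow> real \<Rightarrow> real" where
  "s2 (U, V, W, Z, q) \<eta> = q \<eta> * sin (W \<eta>) * (sin (Z \<eta> / 2))\<^sup>2"

definition nonloc :: "real \<Rightarrow> state \<Rightarrow> (real \<Rightarrow> real) \<Rightarrow> real \<Rightarrow> real" where
  "nonloc c X p \<xi> = c * (LINT \<eta>|lborel. kernel X \<xi> \<eta> * p \<eta>)"

definition nonloc_x :: "real \<Rightarrow> state \<Rightarrow> (real \<Rightarrow> real) \<Rightarrow> real \<Rightarrow> real" where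
  "nonloc_x c X p \<xi> = c * ((LINT \<eta>:{\<xi><..}|lborel. kernel X \<xi> \<eta> * p \<eta>)
     - (LINT \<eta>:{..<\<xi>}|lborel. kernel X \<xi> \<eta> * p \<eta>))"

fun ode_rhs :: "state \<Rightarrow> state" where
  "ode_rhs (U, V, W, Z, q) =
    (let X = (U, V, W, Z, q);
         P1 = nonloc (1/2) X (p1 X); P1x = nonloc_x (1/2) X (p1 X);
         P2 = nonloc (1/8) X (p2 X); P2x = nonloc_x (1/8) X (p2 X);
         S1 = nonloc (1/2) X (s1 X); S1x = nonloc_x (1/2) X (s1 X);
         S2 = nonloc (1/8) X (s2 X); S2x = nonloc_x (1/8) X (s2 X)
     in (\<lambda>\<xi>. - P1x \<xi> - P2 \<xi>,
         \<lambda>\<xi>. - S1x \<xi> - S2 \<xi>,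
         \<lambda>\<xi>. 2 * (U \<xi>)\<^sup>2 * V \<xi> * (cos (W \<xi> / 2))\<^sup>2 - V \<xi> * (sin (W \<xi> / 2))\<^sup>2
              - 2 * (P1 \<xi> + P2x \<xi>) * (cos (W \<xi> / 2))\<^sup>2,
         \<lambda>\<xi>. 2 * U \<xi> * (V \<xi>)\<^sup>2 * (cos (Z \<xi> / 2))\<^sup>2 - U \<xi> * (sin (Z \<xi> / 2))\<^sup>2
              - 2 * (S1 \<xi> + S2x \<xi>) * (cos (Z \<xi> / 2))\<^sup>2,
         \<lambda>\<xi>. q \<xi> * ((U \<xi>)\<^sup>2 * V \<xi> + 1/2 * V \<xi> - P1 \<xi> - P2x \<xi>) * sin (W \<xi>)
              + q \<xi> * (U \<xi> * (V \<xi>)\<^sup>2 + 1/2 * U \<xi> - S1 \<xi> - S2x \<xi>) * sin (Z \<xi>)))"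


definition y_init :: "(real \<Rightarrow> real) \<Rightarrow> (real \<Rightarrow> real) \<Rightarrow> real \<Rightarrow> real" where
  "y_init u0 v0 = (THE y. strict_mono y \<and>
     (\<forall>\<xi>. (LBINT x=ereal 0..ereal (y \<xi>). (1 + (wderiv u0 x)\<^sup>2) * (1 + (wderiv v0 x)\<^sup>2)) = \<xi>))"

text \<open>
  Global solutions of the Cauchy problem, as differentiable curves in \<open>E\<close>. The angles \<open>W\<close> and
  \<open>Z\<close> are understood modulo \<open>2\<pi>\<close>: they are real-valued lifts, continuous in time, of functions
  with values in \<open>\<real>/2\<pi>\<int>\<close>, so their initial values are prescribed modulo \<open>2\<pi>\<close> only. The right-hand
  side is \<open>2\<pi>\<close>-periodic in both, so the choice of lift does not affect \<open>U\<close>, \<open>V\<close>, \<open>q\<close>.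
\<close>

definition ode_solution ::
  "(real \<Rightarrow> real) \<Rightarrow> (real \<Rightarrow> real) \<Rightarrow> (real \<Rightarrow> real \<Rightarrow> real) \<Rightarrow> (real \<Rightarrow> real \<Rightarrow> real)
    \<Rightarrow> (real \<Rightarrow> real \<Rightarrow> real) \<Rightarrow> (real \<Rightarrow> real \<Rightarrow> real) \<Rightarrow> (real \<Rightarrow> real \<Rightarrow> real) \<Rightarrow> bool" where
  "ode_solution u0 v0 U V W Z q \<longleftrightarrow>
     (let y0 = y_init u0 v0; X = (\<lambda>t. (U t, V t, W t, Z t, q t)) in
       (\<forall>\<xi>. U 0 \<xi> = u0 (y0 \<xi>)) \<and> (\<forall>\<xi>. V 0 \<xi> = v0 (y0 \<xi>))
       \<and> (AE \<xi> in lborel. \<exists>k::int. W 0 \<xi> = 2 * arctan (wderiv u0 (y0 \<xi>)) + 2 * pi * of_int k)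
       \<and> (AE \<xi> in lborel. \<exists>k::int. Z 0 \<xi> = 2 * arctan (wderiv v0 (y0 \<xi>)) + 2 * pi * of_int k)
       \<and> (AE \<xi> in lborel. q 0 \<xi> = 1)
       \<and> E_continuous X
       \<and> (\<forall>T>0. \<exists>c>0. \<exists>C. \<forall>t\<in>{-T..T}. AE \<xi> in lborel. c \<le> q t \<xi> \<and> q t \<xi> \<le> C)
       \<and> (\<forall>t. has_E_derivative X (ode_rhs (X t)) t))"

definition char_y ::
  "(real \<Rightarrow> real) \<Rightarrow> (real \<Rightarrow> real) \<Rightarrow> (real \<Rightarrow> real \<Rightarrow> real) \<Rightarrow> (real \<Rightarrow> real \<Rightarrow> real)
    \<Rightarrow> real \<Rightarrow> real \<Rightarrow> real" where
  "char_y u0 v0 U V t \<xi> = y_init u0 v0 \<xi> + (LBINT \<tau>=ereal 0..ereal t. U \<tau> \<xi> * V \<tau> \<xi>)"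

text \<open>
  \<open>(u, v)\<close> is the solution with data \<open>(u0, v0)\<close> constructed through the ODE system. Since
  \<open>char_y u0 v0 U V t\<close> is onto, the last clause determines \<open>u\<close> and \<open>v\<close> everywhere.
\<close>

definition constructed_solution ::
  "(real \<Rightarrow> real) \<Rightarrow> (real \<Rightarrow> real) \<Rightarrow> (real \<Rightarrow> real \<Rightarrow> real) \<Rightarrow> (real \<Rightarrow> real \<Rightarrow> real) \<Rightarrow> bool" where
  "constructed_solution u0 v0 u v \<longleftrightarrow>
     (\<exists>U V W Z q. ode_solution u0 v0 U V W Z q \<and>
        (\<forall>t x \<xi>. x = char_y u0 v0 U V t \<xi> \<longrightarrow> u t x = U t \<xi> \<and> v t x = V t \<xi>))"

text \<open>
  The \<open>L^\<infinity>([-T,T] \<times> \<real>)\<close> norm. It is \<open>\<infinity>\<close> if the function is not Borel measurable on the strip.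
\<close>

definition strip_norm :: "real \<Rightarrow> (real \<Rightarrow> real \<Rightarrow> real) \<Rightarrow> ereal" where
  "strip_norm T f = esssup (restrict_space lborel ({-T..T} \<times> (UNIV :: real set)))
     (\<lambda>(t, x). ereal \<bar>f t x\<bar>)"

end

theory Submission
  imports Defs
begin

text \<open>
  In Lagrangian coordinates the system is an ordinary differential equation whose right-hand side is
  smooth in \<open>U, V, q\<close> and in the sines and cosines of \<open>W, Z\<close>, but convergence of the data in \<open>\<Sigma>\<close> does
  not give convergence of the initial angles in \<open>L^\<infinity>\<close>. The solutions are therefore compared in a weaker
  norm: the supremum norm for \<open>U, V\<close> and \<open>sup\<^sub>\<xi> \<integral> exp (-\<kappa> \<bar>\<xi> - \<eta>\<bar>) \<bar>f \<eta>\<bar> d\<eta>\<close> for \<open>W, Z\<close> (modulo \<open>2\<pi>\<close>)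
  and \<open>q\<close>. It is finite for bounded functions, it is strong enough to pass the exponential decay of
  the nonlocal kernel from the reference solution to its neighbours, and the right-hand side is
  Lipschitz in it on a neighbourhood of the reference solution with a constant that depends on the
  reference solution only. Hence no a priori bounds for the approximating solutions are needed, and
  Gronwall's argument gives \<open>U\<^sub>n \<longlonglongrightarrow> U\<close>, \<open>V\<^sub>n \<longlonglongrightarrow> V\<close> uniformly on \<open>[-T, T] \<times> \<real>\<close>. The initial angles
  converge in this norm because the labels \<open>y\<^sub>0\<close> converge uniformly and their densities in \<open>L\<^sup>1\<close>.
  Finally \<open>u\<close> is uniformly continuous on the strip: it is continuous because \<open>(t, \<xi>) \<mapsto> (t, y t \<xi>)\<close> is
  proper and \<open>U\<close> is constant on its fibres, and it vanishes at infinity; so the convergence of the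
  characteristics carries the uniform convergence over to \<open>u\<^sub>n\<close> and \<open>v\<^sub>n\<close>.
\<close>

subsection \<open>Smooth cut-offs and weak derivatives\<close>

text \<open>The kernel decays like the exponential of minus the integral of q cos^2(W/2) cos^2(Z/2),
  an integrand with no positive pointwise lower bound. But \<open>W\<close> and \<open>Z\<close> are
  square integrable, so the set where one of them exceeds pi/2 in modulus has finite measure,
  uniformly for bounded times, and off this set the integrand is at least c/4 if q is at least c.
  This is the rate 4 \<kappa> with \<kappa> = c/16. Of the four units, two are given up in passing
  to a neighbouring solution, one turns the difference of the exponents into a weighted norm, and
  one keeps the integrals convergent. The ambiguity of the angles is removed once, at time 0, by
  adding a function of \<xi> with values in the multiples of 2 pi. Being independent of time it
  leaves the time derivatives alone, and by periodicity the right-hand side does not see it. So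
  closeness is measured against the shifted solution, while the equations are those of the unshifted
  one. As \<open>wderiv\<close> is an arbitrary representative, specified only through test
  functions, the work starts from explicit smooth cut-offs, which yield the fundamental theorem of
  calculus for \<open>H1_space\<close>.\<close>

definition bump :: "real poly \<Rightarrow> nat \<Rightarrow> real \<Rightarrow> real" where
  "bump p m x = (if 0 < x \<and> x < 1
     then poly p x * (1 / (x * (1 - x))) ^ m * exp (- (1 / (x * (1 - x)))) else 0)"

text \<open>A single term of the exponential series, the one of degree \<open>m + 2\<close>, is at
  most \<open>exp t\<close>. The two surplus powers become the quadratic decay.\<close>

lemma power_mult_exp_minus_le:
  fixes t :: real
  assumes "0 < t"
  shows "t ^ m * exp (- t) \<le> fact (m + 2) / t\<^sup>2"
proof -
  have "t ^ (m + 2) / fact (m + 2) \<le> exp t"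
  proof -
    have s: "(\<lambda>n. t ^ n / fact n) sums exp t"
      using exp_converges[of t] by (simp add: divide_inverse mult.commute)
    have "(\<Sum>n\<in>{m + 2}. t ^ n / fact n) \<le> (\<Sum>n. t ^ n / fact n)"
      using assms by (intro sum_le_suminf sums_summable[OF s]) auto
    then show ?thesis using sums_unique[OF s] by simp
  qed
  then have "t ^ m * t\<^sup>2 \<le> fact (m + 2) * exp t"
    by (simp add: divide_simps power_add mult_ac power2_eq_square del: fact_Suc)
  then show ?thesis
    using assms by (simp add: divide_simps exp_minus mult.commute del: fact_Suc)
qed

text \<open>Quadratic vanishing at 0 and at 1, for all \<open>p\<close> and \<open>m\<close> alike,
  is what gives every member of the family the derivative 0 at the two gluing points.\<close>

lemma bump_quadratic_bound:
  obtains C where "\<And>x. \<bar>bump p m x\<bar> \<le> C * x\<^sup>2" "\<And>x. \<bar>bump p m x\<bar> \<le> C * (x - 1)\<^sup>2"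
proof -
  have "bounded (poly p ` {0..1})"
    by (intro compact_imp_bounded compact_continuous_image continuous_intros) auto
  then obtain K where K: "\<And>x. 0 \<le> x \<Longrightarrow> x \<le> 1 \<Longrightarrow> \<bar>poly p x\<bar> \<le> K"
    by (fastforce simp: bounded_iff)
  then have K0: "0 \<le> K" using order_trans[OF abs_ge_zero K[of 0]] by simp
  let ?C = "K * fact (m + 2) :: real"
  have b: "\<bar>bump p m x\<bar> \<le> ?C * (x * (1 - x))\<^sup>2" if "0 < x" "x < 1" for x
  proof -
    have t: "0 < 1 / (x * (1 - x))" using that by simp
    have "\<bar>bump p m x\<bar> = \<bar>poly p x\<bar> * ((1 / (x * (1 - x))) ^ m * exp (- (1 / (x * (1 - x)))))"
      using that by (simp add: bump_def abs_mult)
    also have "\<dots> \<le> K * (fact (m + 2) / (1 / (x * (1 - x)))\<^sup>2)"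
      using that K0 t by (intro mult_mono K power_mult_exp_minus_le) auto
    finally show ?thesis by (simp add: power_divide)
  qed
  have C0: "0 \<le> ?C" using K0 by simp
  show ?thesis
  proof (rule that[of ?C])
    fix x :: real
    show "\<bar>bump p m x\<bar> \<le> ?C * x\<^sup>2"
    proof (cases "0 < x \<and> x < 1")
      case True
      then have "(x * (1 - x))\<^sup>2 \<le> x\<^sup>2"
        by (intro power_mono) (auto simp: mult_left_le)
      then show ?thesis using b[of x] True C0 by (meson mult_left_mono order_trans)
    next
      case False
      then have "bump p m x = 0" unfolding bump_def by (rule if_not_P)
      then show ?thesis using C0 by simp
    qed
    show "\<bar>bump p m x\<bar> \<le> ?C * (x - 1)\<^sup>2"
    proof (cases "0 < x \<and> x < 1")
      case True
      then have "(x * (1 - x))\<^sup>2 \<le> (1 - x)\<^sup>2"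
        by (intro power_mono) (auto simp: mult_left_le_one_le)
      then have "(x * (1 - x))\<^sup>2 \<le> (x - 1)\<^sup>2" by (simp add: power2_commute)
      from mult_left_mono[OF this C0] show ?thesis using b[of x] True by linarith
    next
      case False
      then have "bump p m x = 0" unfolding bump_def by (rule if_not_P)
      then show ?thesis using C0 by simp
    qed
  qed
qed

lemma has_real_derivative_zeroI:
  fixes f :: "real \<Rightarrow> real"
  assumes "\<And>y. \<bar>f y\<bar> \<le> C * (y - x)\<^sup>2"
  shows "(f has_real_derivative 0) (at x)"
proof -
  have fx: "f x = 0" using assms[of x] by simp
  have "((\<lambda>h. (f (x + h) - f x) / h) \<longlongrightarrow> 0) (at 0)"
  proof (rule tendsto_rabs_zero_cancel, rule tendsto_sandwich[of "\<lambda>_. 0" _ _ "\<lambda>h. C * \<bar>h\<bar>"])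
    show "\<forall>\<^sub>F h in at 0. \<bar>(f (x + h) - f x) / h\<bar> \<le> C * \<bar>h\<bar>"
    proof (rule eventually_mono[OF eventually_neq_at_within[of 0]])
      fix h :: real assume "h \<noteq> 0"
      then show "\<bar>(f (x + h) - f x) / h\<bar> \<le> C * \<bar>h\<bar>"
        using assms[of "x + h"] by (simp add: fx abs_divide divide_simps power2_eq_square abs_mult_self_eq mult.assoc)
    qed
  qed (auto intro!: tendsto_eq_intros)
  then show ?thesis by (simp add: DERIV_def)
qed

text \<open>The parameters \<open>p\<close> and \<open>m\<close> exist for the sake of this closure
  property. With t = 1/(x(1-x)) one has t' = -(1-2x) t^2, and x(1-x) t = 1 brings all terms of the
  derivative to the common power t^(m+2), so that the derivative belongs to the family
  again.\<close>

lemma bump_has_derivative: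
  "(bump p m has_real_derivative
     bump (pderiv p * [:0, 1, -1:]\<^sup>2 - of_nat m * p * [:1, -2:] * [:0, 1, -1:] + p * [:1, -2:]) (m + 2) x)
   (at x)"
proof -
  obtain C where C: "\<And>x. \<bar>bump p m x\<bar> \<le> C * x\<^sup>2" "\<And>x. \<bar>bump p m x\<bar> \<le> C * (x - 1)\<^sup>2"
    using bump_quadratic_bound by blast
  let ?q = "pderiv p * [:0, 1, -1:]\<^sup>2 - of_nat m * p * [:1, -2:] * [:0, 1, -1:] + p * [:1, -2:]"
  consider "x < 0 \<or> 1 < x" | "x = 0" | "x = 1" | "0 < x" "x < 1" by linarith
  then show ?thesis
  proof cases
    case 1
    then have z: "bump ?q (m + 2) x = 0" by (auto simp: bump_def)
    have "\<forall>\<^sub>F y in nhds x. y \<in> {..<0} \<union> {1<..}"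
      using 1 by (intro eventually_nhds_in_open) auto
    then have ev: "\<forall>\<^sub>F y in nhds x. bump p m y = 0"
      by (rule eventually_mono) (auto simp: bump_def)
    show ?thesis unfolding z
      using DERIV_cong_ev[OF refl ev refl, THEN iffD2, OF DERIV_const] .
  next
    case 2
    have z: "bump ?q (m + 2) x = 0" unfolding bump_def 2 by simp
    show ?thesis unfolding z by (rule has_real_derivative_zeroI[of _ C]) (use C(1) 2 in simp)
  next
    case 3
    have z: "bump ?q (m + 2) x = 0" unfolding bump_def 3 by simp
    show ?thesis unfolding z by (rule has_real_derivative_zeroI[of _ C]) (use C(2) 3 in simp)
  next
    case 4
    define t where "t = (\<lambda>y::real. 1 / (y * (1 - y)))"
    have d: "(t has_real_derivative - (1 - 2 * x) * (t x)\<^sup>2) (at x)"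
      unfolding t_def using 4
      by (auto intro!: derivative_eq_intros simp: divide_simps power2_eq_square)
    have "\<forall>\<^sub>F y in nhds x. y \<in> {0<..<1}"
      using 4 by (intro eventually_nhds_in_open) auto
    then have ev: "\<forall>\<^sub>F y in nhds x. bump p m y = poly p y * t y ^ m * exp (- t y)"
      by (rule eventually_mono) (simp add: bump_def t_def)
    have xt: "x * (1 - x) * t x = 1" unfolding t_def using 4 by simp
    have w2: "(x * (1 - x))\<^sup>2 * t x ^ (m + 2) = t x ^ m"
    proof -
      have "(x * (1 - x))\<^sup>2 * t x ^ (m + 2) = (x * (1 - x) * t x)\<^sup>2 * t x ^ m"
        by (simp add: power_mult_distrib power_add mult_ac power2_eq_square)
      then show ?thesis by (simp add: xt)
    qed
    \<comment> \<open>The exponent \<open>m - 1\<close> is truncated at 0. For \<open>m = 0\<close>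
      the factor \<open>real m\<close> annihilates both sides, hence the case distinction.\<close>
    have w1: "real m * t x ^ (m - 1) * (t x)\<^sup>2 = real m * (x * (1 - x)) * t x ^ (m + 2)"
    proof (cases m)
      case (Suc k)
      have "(x * (1 - x)) * t x ^ (m + 2) = (x * (1 - x) * t x) * (t x ^ k * (t x)\<^sup>2)"
        using Suc by (simp add: power_add mult_ac power2_eq_square)
      then have "(x * (1 - x)) * t x ^ (m + 2) = t x ^ (m - 1) * (t x)\<^sup>2" 
        using xt Suc by simp
      then show ?thesis by (simp only: mult.assoc)
    qed simp
    have D: "((\<lambda>y. poly p y * t y ^ m * exp (- t y)) has_real_derivative
        (poly (pderiv p) x * t x ^ m
          + poly p x * (real m * t x ^ (m - 1) * (- (1 - 2 * x) * (t x)\<^sup>2))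
          + poly p x * t x ^ m * ((1 - 2 * x) * (t x)\<^sup>2)) * exp (- t x)) (at x)"
    proof -
      have e: "((\<lambda>y. exp (- t y)) has_real_derivative exp (- t x) * - (- (1 - 2 * x) * (t x)\<^sup>2)) (at x)"
        by (rule DERIV_chain2[OF DERIV_exp]) (rule DERIV_minus[OF d])
      have tp: "((\<lambda>y. t y ^ m) has_real_derivative real m * (- (1 - 2 * x) * (t x)\<^sup>2 * t x ^ (m - Suc 0))) (at x)"
        by (rule DERIV_power[OF d])
      show ?thesis
      proof (rule DERIV_cong[OF DERIV_mult[OF DERIV_mult[OF poly_DERIV tp] e]])
        have ring: "(p' * T + M * (- w * s * T') * P) * E + E * - (- w * s) * (P * T)
            = (p' * T + P * (M * T' * (- w * s)) + P * T * (w * s)) * E" for p' T M w s T' P E :: real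
          by (simp add: algebra_simps)
        show "(poly (pderiv p) x * t x ^ m + real m * (- (1 - 2 * x) * (t x)\<^sup>2 * t x ^ (m - Suc 0)) * poly p x) * exp (- t x)
           + exp (- t x) * - (- (1 - 2 * x) * (t x)\<^sup>2) * (poly p x * t x ^ m)
          = (poly (pderiv p) x * t x ^ m
          + poly p x * (real m * t x ^ (m - 1) * (- (1 - 2 * x) * (t x)\<^sup>2))
          + poly p x * t x ^ m * ((1 - 2 * x) * (t x)\<^sup>2)) * exp (- t x)"
          unfolding One_nat_def by (rule ring)
      qed
    qed
    have "(poly (pderiv p) x * t x ^ m
          + poly p x * (real m * t x ^ (m - 1) * (- (1 - 2 * x) * (t x)\<^sup>2))
          + poly p x * t x ^ m * ((1 - 2 * x) * (t x)\<^sup>2)) * exp (- t x)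
        = poly ?q x * t x ^ (m + 2) * exp (- t x)"
    proof -
      have "poly p x * (real m * t x ^ (m - 1) * (- (1 - 2 * x) * (t x)\<^sup>2))
        = - (poly p x * (1 - 2 * x) * (real m * t x ^ (m - 1) * (t x)\<^sup>2))" by (simp add: algebra_simps)
      also have "\<dots> = - (real m * poly p x * (1 - 2 * x) * (x * (1 - x))) * t x ^ (m + 2)"
        unfolding w1 by (simp add: algebra_simps)
      finally have e1: "poly p x * (real m * t x ^ (m - 1) * (- (1 - 2 * x) * (t x)\<^sup>2)) = \<dots>" .
      have e2: "poly (pderiv p) x * t x ^ m = poly (pderiv p) x * (x * (1 - x))\<^sup>2 * t x ^ (m + 2)"
        using w2 by (simp add: mult.assoc)
      have e3: "poly p x * t x ^ m * ((1 - 2 * x) * (t x)\<^sup>2) = poly p x * (1 - 2 * x) * t x ^ (m + 2)"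
        by (simp add: power_add mult_ac power2_eq_square)
      have q: "poly ?q x = poly (pderiv p) x * (x * (1 - x))\<^sup>2
          - real m * poly p x * (1 - 2 * x) * (x * (1 - x)) + poly p x * (1 - 2 * x)"
      proof -
        have a: "poly [:0, 1, -1:] x = x * (1 - x)" by (simp add: algebra_simps)
        have b: "poly [:1, -2:] x = 1 - 2 * x" by (simp add: algebra_simps)
        show ?thesis
          by (simp only: poly_diff poly_add poly_mult poly_power poly_of_nat a b)
      qed
      show ?thesis unfolding e1 e2 e3 q by (simp add: algebra_simps)
    qed
    also have "\<dots> = bump ?q (m + 2) x" using 4 by (simp add: bump_def t_def)
    finally have "((\<lambda>y. poly p y * t y ^ m * exp (- t y)) has_real_derivative bump ?q (m + 2) x) (at x)"
      using D by simp
    then show ?thesis by (rule DERIV_cong_ev[OF refl ev refl, THEN iffD2])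
  qed
qed

lemma continuous_on_bump: "continuous_on A (bump p m)"
  by (rule DERIV_continuous_on[OF has_field_derivative_at_within[OF bump_has_derivative]])

text \<open>The lower limit -1 lies strictly to the left of the support of the bump, so that 0 is an
  interior point when the integral is differentiated. The total mass is not normalised; it stays as
  the factor \<open>step_fun 1\<close> and is cancelled at the end.\<close>

definition step_fun :: "real \<Rightarrow> real" where
  "step_fun x = integral {-1..x} (bump 1 0)"

lemma step_fun_eq_0: "x \<le> 0 \<Longrightarrow> step_fun x = 0"
  unfolding step_fun_def by (subst integral_cong[of _ _ "\<lambda>_. 0"]) (auto simp: bump_def)

lemma step_fun_has_derivative: "(step_fun has_real_derivative bump 1 0 x) (at x)"
proof (cases "x < 0")
  case True
  then have "\<forall>\<^sub>F y in nhds x. y \<in> {..<0}" by (intro eventually_nhds_in_open) auto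
  then have ev: "\<forall>\<^sub>F y in nhds x. step_fun y = 0"
    by (rule eventually_mono) (auto simp: step_fun_eq_0)
  have z: "bump 1 0 x = 0" using True by (simp add: bump_def)
  show ?thesis unfolding z
    using DERIV_cong_ev[OF refl ev refl, THEN iffD2, OF DERIV_const] .
next
  case False
  have "((\<lambda>x. integral {-1..x} (bump 1 0)) has_real_derivative bump 1 0 x) (at x within {-1..x + 1})"
    using False by (intro integral_has_real_derivative continuous_on_bump) auto
  moreover have "at x within {-1..x + 1} = at x"
    using False by (intro at_within_interior) auto
  ultimately show ?thesis unfolding step_fun_def[abs_def] by simp
qed

lemma step_fun_eq_1: "1 \<le> x \<Longrightarrow> step_fun x = step_fun 1"
proof -
  assume x: "1 \<le> x"
  show ?thesis
  proof (cases "x = 1")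
    case False
    then have "1 < x" using x by simp
    then show ?thesis
    proof (rule DERIV_isconst2[of 1 x step_fun x])
      show "continuous_on {1..x} step_fun"
        by (rule DERIV_continuous_on[OF has_field_derivative_at_within[OF step_fun_has_derivative]])
      show "(step_fun has_real_derivative 0) (at y)" if "1 < y" "y < x" for y
        using step_fun_has_derivative[of y] that by (simp add: bump_def)
    qed (use x in auto)
  qed simp
qed

lemma bump_1_0_nonneg: "0 \<le> bump 1 0 x"
  by (simp add: bump_def)

lemma step_fun_mono: "mono step_fun"
  using step_fun_has_derivative bump_1_0_nonneg
  by (intro monoI) (meson DERIV_nonneg_imp_nondecreasing)

lemma step_fun_1_pos: "0 < step_fun 1"
proof -
  obtain z where z: "0 < z" "z < 1" "step_fun 1 - step_fun 0 = (1 - 0) * bump 1 0 z"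
    using MVT2[of 0 1 step_fun "bump 1 0"] step_fun_has_derivative by auto
  then have "0 < bump 1 0 z" by (simp add: bump_def)
  then show ?thesis using z step_fun_eq_0[of 0] by simp
qed

lemma step_fun_bounds: "0 \<le> step_fun x" "step_fun x \<le> step_fun 1"
  using step_fun_mono[THEN monoD] step_fun_eq_0[of "min x 0"] step_fun_eq_1[of "max x 1"]
  by (metis min.cobounded1 min.cobounded2, metis max.cobounded1 max.cobounded2)

text \<open>Up to the factor \<open>step_fun 1\<close> this is a smooth approximation of the
  indicator of \<open>{a<..b}\<close>, with ramps of width 1/n to the right of both end
  points.\<close>

definition cut_off :: "real \<Rightarrow> real \<Rightarrow> nat \<Rightarrow> real \<Rightarrow> real" where
  "cut_off a b n x = step_fun (real n * (x - a)) - step_fun (real n * (x - b))"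

lemma cut_off_has_derivative:
  "(cut_off a b n has_real_derivative
     real n * bump 1 0 (real n * (x - a)) - real n * bump 1 0 (real n * (x - b))) (at x)"
  unfolding cut_off_def[abs_def]
  by (rule derivative_eq_intros DERIV_chain2[OF step_fun_has_derivative] refl | simp)+

lemma test_fun_cut_off:
  assumes "0 < n"
  shows "test_fun (cut_off a b n)"
proof -
  \<comment> \<open>A set of functions closed under differentiation; all iterated derivatives then
    stay in it by induction. The cut-off is inserted by hand because it is a primitive of a bump and
    not itself of the displayed form.\<close>
  define Q where "Q = insert (cut_off a b n)
    {\<lambda>x. c * bump p m (real n * (x - a)) - c * bump p m (real n * (x - b)) | c p m. True}"
  have Q: "\<exists>f'\<in>Q. \<forall>x. (f has_real_derivative f' x) (at x)" if "f \<in> Q" for f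
    using that unfolding Q_def
  proof (elim insertE CollectE exE conjE)
    assume "f = cut_off a b n"
    then show "\<exists>f'\<in>insert (cut_off a b n)
      {\<lambda>x. c * bump p m (real n * (x - a)) - c * bump p m (real n * (x - b)) | c p m. True}.
      \<forall>x. (f has_real_derivative f' x) (at x)"
      by (intro bexI[of _ "\<lambda>x. real n * bump 1 0 (real n * (x - a)) - real n * bump 1 0 (real n * (x - b))"]
          insertI2 CollectI exI[of _ "real n"] exI[of _ 1] exI[of _ 0])
         (use cut_off_has_derivative in auto)
  next
    fix c p m
    assume f: "f = (\<lambda>x. c * bump p m (real n * (x - a)) - c * bump p m (real n * (x - b)))"
    let ?q = "pderiv p * [:0, 1, -1:]\<^sup>2 - of_nat m * p * [:1, -2:] * [:0, 1, -1:] + p * [:1, -2:]"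
    have "(f has_real_derivative (c * real n) * bump ?q (m + 2) (real n * (x - a))
       - (c * real n) * bump ?q (m + 2) (real n * (x - b))) (at x)" for x
      unfolding f
      by (rule derivative_eq_intros DERIV_chain2[OF bump_has_derivative] refl | simp)+
    then show "\<exists>f'\<in>insert (cut_off a b n)
      {\<lambda>x. c * bump p m (real n * (x - a)) - c * bump p m (real n * (x - b)) | c p m. True}.
      \<forall>x. (f has_real_derivative f' x) (at x)"
      by (intro bexI[of _ "\<lambda>x. (c * real n) * bump ?q (m + 2) (real n * (x - a))
         - (c * real n) * bump ?q (m + 2) (real n * (x - b))"]
          insertI2 CollectI exI[of _ "c * real n"] exI[of _ ?q] exI[of _ "m + 2"]) auto
  qed
  have iter: "(deriv ^^ k) (cut_off a b n) \<in> Q" for k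
  proof (induction k)
    case (Suc k)
    then obtain f' where f': "f' \<in> Q"
        "\<forall>x. ((deriv ^^ k) (cut_off a b n) has_real_derivative f' x) (at x)"
      using Q by blast
    then have "(deriv ^^ Suc k) (cut_off a b n) = f'"
      by (auto intro: DERIV_imp_deriv)
    then show ?case using f' by simp
  qed (simp add: Q_def)
  have "cut_off a b n x = 0" if "\<bar>x\<bar> > \<bar>a\<bar> + \<bar>b\<bar> + 1" for x
  proof (cases "x < 0")
    case True
    then have "real n * (x - a) \<le> 0" "real n * (x - b) \<le> 0"
      using that assms by (auto intro!: mult_nonneg_nonpos)
    then show ?thesis by (simp add: cut_off_def step_fun_eq_0)
  next
    case False
    then have "1 * 1 \<le> real n * (x - a)" "1 * 1 \<le> real n * (x - b)"
      using that assms by (intro mult_mono; simp)+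
    then show ?thesis by (simp add: cut_off_def step_fun_eq_1[of "real n * (x - a)"] step_fun_eq_1[of "real n * (x - b)"])
  qed
  moreover have "\<forall>k x. ((deriv ^^ k) (cut_off a b n)) field_differentiable (at x)"
    using iter Q unfolding field_differentiable_def by metis
  ultimately show ?thesis
    unfolding test_fun_def by (intro conjI exI[of _ "\<bar>a\<bar> + \<bar>b\<bar> + 1"]) auto
qed

lemma loc_integrable_Icc: "loc_integrable f \<Longrightarrow> set_integrable lborel {a..b} f"
  by (simp add: loc_integrable_def)

lemma cut_off_abs_le: "\<bar>cut_off a b n x\<bar> \<le> step_fun 1"
  using step_fun_bounds[of "real n * (x - a)"] step_fun_bounds[of "real n * (x - b)"]
  by (auto simp: cut_off_def)

lemma cut_off_eq_0:
  assumes "a \<le> b" "0 < n" "x \<le> a \<or> b + 1 \<le> x"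
  shows "cut_off a b n x = 0"
  using assms(3)
proof
  assume "x \<le> a"
  then have "real n * (x - a) \<le> 0" "real n * (x - b) \<le> 0"
    using assms by (auto intro!: mult_nonneg_nonpos)
  then show ?thesis by (simp add: cut_off_def step_fun_eq_0)
next
  assume "b + 1 \<le> x"
  then have "1 * 1 \<le> real n * (x - a)" "1 * 1 \<le> real n * (x - b)"
    using assms by (intro mult_mono; simp)+
  then show ?thesis by (simp add: cut_off_def step_fun_eq_1[of "real n * (x - a)"] step_fun_eq_1[of "real n * (x - b)"])
qed

lemma step_fun_scaled_tendsto:
  "(\<lambda>n. step_fun (real (Suc n) * y)) \<longlonglongrightarrow> (if 0 < y then step_fun 1 else 0)"
proof (cases "0 < y")
  case True
  then obtain N where N: "1 < real N * y" using reals_Archimedean3[of y] by auto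
  have "\<forall>\<^sub>F n in sequentially. step_fun (real (Suc n) * y) = step_fun 1"
  proof (rule eventually_mono[OF eventually_ge_at_top[of N]])
    fix n assume "N \<le> n"
    then have "real N * y \<le> real (Suc n) * y" using True by (intro mult_right_mono) auto
    then show "step_fun (real (Suc n) * y) = step_fun 1" using N by (intro step_fun_eq_1) linarith
  qed
  then show ?thesis using True by (simp add: tendsto_eventually)
next
  case False
  then show ?thesis
    by (intro tendsto_eventually always_eventually allI)
       (simp add: step_fun_eq_0 mult_nonneg_nonpos)
qed

section \<open>Weak derivatives and the fundamental theorem of calculus\<close>

lemma borel_measurable_bump[measurable]: "bump p m \<in> borel_measurable borel"
  using continuous_on_bump borel_measurable_continuous_onI by blast

lemma borel_measurable_step_fun[measurable]: "step_fun \<in> borel_measurable borel"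
  using DERIV_continuous_on[OF has_field_derivative_at_within[OF step_fun_has_derivative]]
  by (rule borel_measurable_continuous_onI)

lemma borel_measurable_cut_off[measurable]: "cut_off a b n \<in> borel_measurable borel"
  unfolding cut_off_def[abs_def] by measurable

lemma bump_integral: "(LINT s|lborel. bump 1 0 s) = step_fun 1"
  and integrable_bump: "integrable lborel (bump 1 0)"
proof -
  have i: "set_integrable lborel {0..1} (bump 1 0)"
    by (rule borel_integrable_atLeastAtMost') (rule continuous_on_bump)
  have e: "(\<lambda>x. indicator {0..1} x *\<^sub>R bump 1 0 x) = bump 1 0"
    by (auto simp: bump_def indicator_def)
  show "integrable lborel (bump 1 0)" using i unfolding set_integrable_def e .
  have "(LBINT s=ereal 0..ereal 1. bump 1 0 s) = step_fun 1 - step_fun 0"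
    by (rule interval_integral_FTC_finite)
       (auto intro!: continuous_on_bump
         has_field_derivative_at_within[OF step_fun_has_derivative, unfolded has_real_derivative_iff_has_vector_derivative])
  then show "(LINT s|lborel. bump 1 0 s) = step_fun 1"
    by (simp add: interval_integral_Icc set_lebesgue_integral_def step_fun_eq_0 e[unfolded real_scaleR_def])
qed

text \<open>The derivative of a cut-off consists of two approximate point masses. The substitution x
  = a + s/(n+1) moves the scaling into the argument of \<open>f\<close>, where continuity and
  dominated convergence apply on the support of the bump.\<close>

lemma mollify_tendsto:
  fixes f :: "real \<Rightarrow> real"
  assumes "continuous_on UNIV f"
  shows "(\<lambda>n. LINT x|lborel. f x * (real (Suc n) * bump 1 0 (real (Suc n) * (x - a))))
    \<longlonglongrightarrow> f a * step_fun 1"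
    and "integrable lborel (\<lambda>x. f x * (real (Suc n) * bump 1 0 (real (Suc n) * (x - a))))"
proof -
  have [measurable]: "f \<in> borel_measurable borel"
    using assms by (rule borel_measurable_continuous_onI)
  have "compact (f ` {a..a + 1})"
    by (intro compact_continuous_image continuous_on_subset[OF assms]) auto
  then obtain K where K: "\<And>x. a \<le> x \<Longrightarrow> x \<le> a + 1 \<Longrightarrow> \<bar>f x\<bar> \<le> K"
    using compact_imp_bounded[THEN bounded_iff[THEN iffD1]] by fastforce
  have bd: "\<bar>f (a + s / real (Suc n)) * bump 1 0 s\<bar> \<le> K * bump 1 0 s" for s n
  proof (cases "0 < s \<and> s < 1")
    case True
    then have "s / real (Suc n) \<le> 1" by (simp add: divide_simps)
    then have "\<bar>f (a + s / real (Suc n))\<bar> \<le> K" using True by (intro K) auto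
    then show ?thesis using bump_1_0_nonneg[of s] by (simp add: abs_mult mult_right_mono)
  next
    case False
    then have "bump 1 0 s = 0" unfolding bump_def by (rule if_not_P)
    then show ?thesis by simp
  qed
  have int: "integrable lborel (\<lambda>s. f (a + s / real (Suc n)) * bump 1 0 s)" for n
    by (rule Bochner_Integration.integrable_bound[OF integrable_mult_right[OF integrable_bump, of K]])
       (use bd order_trans[OF bd abs_ge_self] in auto)
  have shift: "(\<lambda>s. f (a + s / real (Suc n)) * bump 1 0 s)
    = (\<lambda>s. (\<lambda>x. f x * bump 1 0 (real (Suc n) * (x - a))) (a + (1 / real (Suc n)) * s))" for n
    by (auto simp: fun_eq_iff)
  have "integrable lborel (\<lambda>x. f x * bump 1 0 (real (Suc n) * (x - a)))" 
    using int[of n] unfolding shift by (subst (asm) lborel_integrable_real_affine_iff) auto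
  from integrable_mult_right[OF this, of "real (Suc n)"]
  show "integrable lborel (\<lambda>x. f x * (real (Suc n) * bump 1 0 (real (Suc n) * (x - a))))"
    by (simp add: mult_ac)
  have eq: "(LINT x|lborel. f x * (real (Suc n) * bump 1 0 (real (Suc n) * (x - a))))
    = (LINT s|lborel. f (a + s / real (Suc n)) * bump 1 0 s)" for n
  proof -
    have "(LINT x|lborel. f x * (real (Suc n) * bump 1 0 (real (Suc n) * (x - a))))
      = (LINT x|lborel. real (Suc n) * (f x * bump 1 0 (real (Suc n) * (x - a))))"
      by (simp add: mult_ac)
    also have "\<dots> = real (Suc n) * (LINT x|lborel. f x * bump 1 0 (real (Suc n) * (x - a)))"
      by simp
    also have "(LINT x|lborel. f x * bump 1 0 (real (Suc n) * (x - a)))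
      = \<bar>1 / real (Suc n)\<bar> *\<^sub>R (LINT s|lborel. (\<lambda>x. f x * bump 1 0 (real (Suc n) * (x - a))) (a + (1 / real (Suc n)) * s))"
      by (rule lborel_integral_real_affine) auto
    finally show ?thesis unfolding shift by simp
  qed
  have "(\<lambda>n. LINT s|lborel. f (a + s / real (Suc n)) * bump 1 0 s) \<longlonglongrightarrow> (LINT s|lborel. f a * bump 1 0 s)"
  proof (rule integral_dominated_convergence[where w = "\<lambda>s. K * bump 1 0 s"])
    have lim: "(\<lambda>n. f (a + s / real (Suc n))) \<longlonglongrightarrow> f a" for s
    proof (rule isCont_tendsto_compose[of _ f])
      show "isCont f a" using assms by (simp add: continuous_on_eq_continuous_at)
      have "(\<lambda>n. a + s * (1 / real (Suc n))) \<longlonglongrightarrow> a + s * 0"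
        by (intro tendsto_intros LIMSEQ_Suc lim_1_over_n)
      then show "(\<lambda>n. a + s / real (Suc n)) \<longlonglongrightarrow> a" by simp
    qed
    show "AE s in lborel. (\<lambda>n. f (a + s / real (Suc n)) * bump 1 0 s) \<longlonglongrightarrow> f a * bump 1 0 s"
      by (intro AE_I2 tendsto_intros lim)
    show "integrable lborel (\<lambda>s. K * bump 1 0 s)"
      by (rule integrable_mult_right[OF integrable_bump])
  qed (use bd in auto)
  then show "(\<lambda>n. LINT x|lborel. f x * (real (Suc n) * bump 1 0 (real (Suc n) * (x - a))))
    \<longlonglongrightarrow> f a * step_fun 1"
    unfolding eq by (simp add: bump_integral)
qed

text \<open>Test with \<open>cut_off a b n\<close>. Its derivative tends to the difference of point
  masses at \<open>a\<close> and \<open>b\<close>, and the cut-off itself to a multiple of the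
  indicator of \<open>{a<..b}\<close>, dominated by a multiple of the indicator of
  \<open>{a..b + 1}\<close>. The common factor \<open>step_fun 1\<close> is positive and
  cancels.\<close>

lemma weak_deriv_integral:
  fixes f g :: "real \<Rightarrow> real"
  assumes f: "continuous_on UNIV f" and w: "has_weak_deriv f g" and ab: "a \<le> b"
  shows "(LINT x:{a..b}|lborel. g x) = f b - f a"
proof -
  have g: "loc_integrable g" using w by (simp add: has_weak_deriv_def)
  then have [measurable]: "g \<in> borel_measurable borel" by (simp add: loc_integrable_def)
  have deriv: "deriv (cut_off a b n) x = real n * bump 1 0 (real n * (x - a)) - real n * bump 1 0 (real n * (x - b))"
    for n x by (rule DERIV_imp_deriv) (rule cut_off_has_derivative)
  have eq: "(LINT x|lborel. f x * (real (Suc n) * bump 1 0 (real (Suc n) * (x - a))))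
     - (LINT x|lborel. f x * (real (Suc n) * bump 1 0 (real (Suc n) * (x - b))))
     = - (LINT x|lborel. g x * cut_off a b (Suc n) x)" for n
  proof -
    have "(LINT x|lborel. f x * deriv (cut_off a b (Suc n)) x) = - (LINT x|lborel. g x * cut_off a b (Suc n) x)"
      using w test_fun_cut_off[of "Suc n" a b] by (simp add: has_weak_deriv_def)
    then show ?thesis
      unfolding deriv right_diff_distrib[of "f x" for x]
      by (subst (asm) Bochner_Integration.integral_diff[OF mollify_tendsto(2)[OF f] mollify_tendsto(2)[OF f]])
  qed
  have "(\<lambda>n. LINT x|lborel. g x * cut_off a b (Suc n) x)
     \<longlonglongrightarrow> (LINT x|lborel. g x * (indicator {a<..b} x * step_fun 1))"
  proof (rule integral_dominated_convergence[where w = "\<lambda>x. step_fun 1 * (indicator {a..b + 1} x * \<bar>g x\<bar>)"])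
    show "integrable lborel (\<lambda>x. step_fun 1 * (indicator {a..b + 1} x * \<bar>g x\<bar>))"
      using set_integrable_abs[OF loc_integrable_Icc[OF g, of a "b + 1"]]
      by (simp add: set_integrable_def)
    have "(\<lambda>n. cut_off a b (Suc n) x) \<longlonglongrightarrow> indicator {a<..b} x * step_fun 1" for x
    proof -
      have "(\<lambda>n. cut_off a b (Suc n) x) \<longlonglongrightarrow>
        (if 0 < x - a then step_fun 1 else 0) - (if 0 < x - b then step_fun 1 else 0)"
        unfolding cut_off_def by (intro tendsto_diff step_fun_scaled_tendsto)
      also have "(if 0 < x - a then step_fun 1 else 0) - (if 0 < x - b then step_fun 1 else 0)
         = indicator {a<..b} x * step_fun 1"
        using ab by (auto simp: indicator_def)
      finally show ?thesis .
    qed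
    then show "AE x in lborel. (\<lambda>n. g x * cut_off a b (Suc n) x)
        \<longlonglongrightarrow> g x * (indicator {a<..b} x * step_fun 1)"
      by (intro AE_I2 tendsto_mult tendsto_const)
    show "AE x in lborel. norm (g x * cut_off a b (Suc n) x)
        \<le> step_fun 1 * (indicator {a..b + 1} x * \<bar>g x\<bar>)" for n
    proof (intro AE_I2)
      fix x
      show "norm (g x * cut_off a b (Suc n) x) \<le> step_fun 1 * (indicator {a..b + 1} x * \<bar>g x\<bar>)"
      proof (cases "x \<in> {a..b + 1}")
        case True
        then show ?thesis using mult_left_mono[OF cut_off_abs_le[of a b "Suc n" x] abs_ge_zero[of "g x"]]
          by (simp add: abs_mult mult_ac)
      next
        case False
        then have "cut_off a b (Suc n) x = 0" using ab by (intro cut_off_eq_0) auto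
        then show ?thesis using step_fun_1_pos by simp
      qed
    qed
  qed measurable
  then have "(\<lambda>n. - (LINT x|lborel. g x * cut_off a b (Suc n) x))
     \<longlonglongrightarrow> - ((LINT x:{a<..b}|lborel. g x) * step_fun 1)"
    by (intro tendsto_minus) (simp only: set_lebesgue_integral_def real_scaleR_def mult.assoc[symmetric]
          integral_mult_left_zero mult.commute[of "g x" for x])
  moreover have "(\<lambda>n. - (LINT x|lborel. g x * cut_off a b (Suc n) x))
     \<longlonglongrightarrow> f a * step_fun 1 - f b * step_fun 1"
    unfolding eq[symmetric] by (intro tendsto_diff mollify_tendsto(1)[OF f])
  ultimately have "- ((LINT x:{a<..b}|lborel. g x) * step_fun 1) = f a * step_fun 1 - f b * step_fun 1"
    by (rule LIMSEQ_unique)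
  then have "(LINT x:{a<..b}|lborel. g x) * step_fun 1 = (f b - f a) * step_fun 1"
    by (simp add: algebra_simps)
  then have 1: "(LINT x:{a<..b}|lborel. g x) = f b - f a"
    using step_fun_1_pos by simp
  have "(LINT x:{a<..b}|lborel. g x) = (LINT x:{a..b}|lborel. g x)"
    using interval_integral_Ioc[OF ab, of g] interval_integral_Icc[OF ab, of g] by simp
  then show ?thesis using 1 by simp
qed

subsection \<open>The space \<open>H\<^sup>1\<close>\<close>

text \<open>On a bounded window the positive and the negative part of \<open>g - h\<close> are
  densities of finite measures. These agree on all half-lines, hence everywhere, and densities are
  unique almost everywhere.\<close>

lemma AE_eq_if_Icc_integral_eq:
  fixes g h :: "real \<Rightarrow> real"
  assumes g: "loc_integrable g" and h: "loc_integrable h"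
    and eq: "\<And>a b. a \<le> b \<Longrightarrow> (LINT x:{a..b}|lborel. g x) = (LINT x:{a..b}|lborel. h x)"
  shows "AE x in lborel. g x = h x"
proof -
  have [measurable]: "g \<in> borel_measurable borel" "h \<in> borel_measurable borel"
    using g h by (auto simp: loc_integrable_def)
  have loc: "AE x in lborel. indicator {-real N..real N} x * g x = indicator {-real N..real N} x * h x" for N :: nat
  proof -
    define d where "d = (\<lambda>x. indicator {-real N..real N} x * (g x - h x))"
    have [measurable]: "d \<in> borel_measurable borel" by (simp add: d_def)
    have d: "integrable lborel d"
      using Bochner_Integration.integrable_diff[OF loc_integrable_Icc[OF g, unfolded set_integrable_def] loc_integrable_Icc[OF h, unfolded set_integrable_def], of "-real N" "real N" "-real N" "real N"]
      by (simp add: d_def right_diff_distrib)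
    have dpm: "integrable lborel (\<lambda>x. max 0 (d x))" "integrable lborel (\<lambda>x. max 0 (- d x))"
      using d by auto
    have dI: "(LINT x:{a<..}|lborel. d x) = 0" for a
    proof (cases "max a (- real N) \<le> real N")
      case True
      let ?a = "max a (- real N)"
      have "(LINT x:{a<..}|lborel. d x) = (LINT x:{?a..real N}|lborel. g x - h x)"
        unfolding set_lebesgue_integral_def
        by (rule integral_cong_AE)
           (use AE_lborel_singleton[of ?a] in \<open>auto simp: d_def indicator_def split: if_splits elim!: eventually_mono\<close>)
      also have "\<dots> = 0"
        using loc_integrable_Icc[OF g] loc_integrable_Icc[OF h] eq[OF True] by (subst set_integral_diff) auto
      finally show ?thesis .
    next
      case False
      then have "indicator {a<..} x *\<^sub>R d x = 0" for x by (auto simp: d_def indicator_def)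
      then show ?thesis unfolding set_lebesgue_integral_def by (simp only: Bochner_Integration.integral_zero)
    qed
    have em: "emeasure (density lborel (\<lambda>x. ennreal (max 0 (f x)))) {a<..}
        = ennreal (LINT x:{a<..}|lborel. max 0 (f x))"
      if f: "integrable lborel (\<lambda>x. max 0 (f x))" and [measurable]: "f \<in> borel_measurable borel"
      for f :: "real \<Rightarrow> real" and a
    proof -
      have "emeasure (density lborel (\<lambda>x. ennreal (max 0 (f x)))) {a<..}
         = (\<integral>\<^sup>+x. ennreal (indicator {a<..} x * max 0 (f x)) \<partial>lborel)"
        by (subst emeasure_density) (auto intro!: nn_integral_cong simp: indicator_def)
      also have "\<dots> = ennreal (LINT x|lborel. indicator {a<..} x * max 0 (f x))"
        using integrable_mult_indicator[OF _ f, of "{a<..}"] by (intro nn_integral_eq_integral) auto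
      finally show ?thesis by (simp add: set_lebesgue_integral_def)
    qed
    have "density lborel (\<lambda>x. ennreal (max 0 (d x))) = density lborel (\<lambda>x. ennreal (max 0 (- d x)))"
    proof (rule measure_eqI_lessThan)
      fix a :: real
      have "(LINT x:{a<..}|lborel. max 0 (d x)) - (LINT x:{a<..}|lborel. max 0 (- d x)) = (LINT x:{a<..}|lborel. d x)"
      proof (subst set_integral_diff(2)[symmetric])
        show "set_integrable lborel {a<..} (\<lambda>x. max 0 (d x))" "set_integrable lborel {a<..} (\<lambda>x. max 0 (- d x))"
          unfolding set_integrable_def
          using integrable_mult_indicator[OF _ dpm(1), of "{a<..}"] integrable_mult_indicator[OF _ dpm(2), of "{a<..}"]
          by auto
      qed (auto intro!: set_lebesgue_integral_cong)
      then have "(LINT x:{a<..}|lborel. max 0 (d x)) = (LINT x:{a<..}|lborel. max 0 (- d x))"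
        using dI[of a] by simp
      then show "emeasure (density lborel (\<lambda>x. ennreal (max 0 (d x)))) {a<..}
        = emeasure (density lborel (\<lambda>x. ennreal (max 0 (- d x)))) {a<..}"
        using dpm by (simp add: em)
      show "emeasure (density lborel (\<lambda>x. ennreal (max 0 (d x)))) {a<..} < \<infinity>"
        using dpm by (simp add: em)
    qed auto
    then have "AE x in lborel. ennreal (max 0 (d x)) = ennreal (max 0 (- d x))"
      by (intro sigma_finite_measure.density_unique[OF sigma_finite_lborel]) auto
    \<comment> \<open>At most one of \<open>max 0 (d x)\<close> and \<open>max 0 (- d x)\<close> is
      nonzero, so their equality makes both vanish.\<close>
    then have "AE x in lborel. d x = 0"
      by (elim eventually_mono) (auto simp: max_def split: if_splits)
    then show ?thesis by (elim eventually_mono) (auto simp: d_def algebra_simps)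
  qed
  have "AE x in lborel. \<forall>N::nat. indicator {-real N..real N} x * g x = indicator {-real N..real N} x * h x"
    using loc by (intro AE_all_countable[THEN iffD2] allI)
  then show ?thesis
  proof (elim eventually_mono)
    fix x assume N: "\<forall>N::nat. indicator {-real N..real N} x * g x = indicator {-real N..real N} x * h x"
    obtain N :: nat where "\<bar>x\<bar> \<le> real N" using real_arch_simple by blast
    then have "x \<in> {-real N..real N}" by auto
    then show "g x = h x" using N[rule_format, of N] by simp
  qed
qed

lemma test_fun_continuous: "test_fun \<phi> \<Longrightarrow> continuous_on UNIV \<phi>" "test_fun \<phi> \<Longrightarrow> continuous_on UNIV (deriv \<phi>)"
proof -
  assume "test_fun \<phi>"
  then have d: "((deriv ^^ k) \<phi>) field_differentiable (at x)" for k x by (simp add: test_fun_def)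
  show "continuous_on UNIV \<phi>" "continuous_on UNIV (deriv \<phi>)"
    using d[of 0, THEN field_differentiable_imp_continuous_at] d[of 1, THEN field_differentiable_imp_continuous_at]
    by (auto intro!: continuous_at_imp_continuous_on)
qed

lemma integrable_loc_mult_compact_support:
  fixes f \<phi> :: "real \<Rightarrow> real"
  assumes f: "loc_integrable f" and \<phi>: "continuous_on UNIV \<phi>" and z: "\<And>x. \<bar>x\<bar> > R \<Longrightarrow> \<phi> x = 0"
  shows "integrable lborel (\<lambda>x. f x * \<phi> x)"
proof -
  have [measurable]: "f \<in> borel_measurable borel" using f by (auto simp: loc_integrable_def)
  have [measurable]: "\<phi> \<in> borel_measurable borel" by (rule borel_measurable_continuous_onI[OF \<phi>])
  have "compact (\<phi> ` {-R..R})"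
    by (intro compact_continuous_image continuous_on_subset[OF \<phi>]) auto
  then obtain K where K: "\<And>x. \<bar>x\<bar> \<le> R \<Longrightarrow> \<bar>\<phi> x\<bar> \<le> K"
    using compact_imp_bounded[THEN bounded_iff[THEN iffD1]] by (fastforce simp: abs_le_iff)
  have "integrable lborel (\<lambda>x. K * (indicator {-R..R} x *\<^sub>R f x))"
    using loc_integrable_Icc[OF f, of "-R" R] unfolding set_integrable_def by (intro integrable_mult_right)
  then show ?thesis
  proof (rule Bochner_Integration.integrable_bound)
    show "AE x in lborel. norm (f x * \<phi> x) \<le> norm (K * (indicator {-R..R} x *\<^sub>R f x))"
    proof (intro AE_I2)
      fix x
      show "norm (f x * \<phi> x) \<le> norm (K * (indicator {-R..R} x *\<^sub>R f x))"
      proof (cases "\<bar>x\<bar> \<le> R")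
        case True
        then show ?thesis using K[OF True]
          by (auto simp: abs_mult abs_le_iff mult.commute[of "\<bar>f x\<bar>"] intro!: mult_right_mono)
      qed (simp add: z)
    qed
  qed measurable
qed

lemma deriv_eq_0_outside:
  fixes \<phi> :: "real \<Rightarrow> real"
  assumes "\<And>x. \<bar>x\<bar> > R \<Longrightarrow> \<phi> x = 0" "\<bar>x\<bar> > R"
  shows "deriv \<phi> x = 0"
proof -
  have "open {x::real. \<bar>x\<bar> > R}" by (intro open_Collect_less continuous_intros)
  then have "\<forall>\<^sub>F y in nhds x. \<phi> y = 0"
    using assms eventually_nhds_in_open[of "{x. \<bar>x\<bar> > R}" x] by (auto elim!: eventually_mono)
  from DERIV_cong_ev[OF refl this refl, THEN iffD2, OF DERIV_const]
  show ?thesis by (rule DERIV_imp_deriv)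
qed

lemma loc_integrable_lincomb:
  assumes "loc_integrable f" "loc_integrable g"
  shows "loc_integrable (\<lambda>x. c * f x + d * g x)"
  using assms unfolding loc_integrable_def by (auto intro!: set_integral_add set_integrable_mult_right)

lemma has_weak_deriv_lincomb:
  assumes f: "has_weak_deriv f f'" and g: "has_weak_deriv g g'"
  shows "has_weak_deriv (\<lambda>x. c * f x + d * g x) (\<lambda>x. c * f' x + d * g' x)"
  unfolding has_weak_deriv_def
proof (intro conjI allI impI)
  show "loc_integrable (\<lambda>x. c * f x + d * g x)" "loc_integrable (\<lambda>x. c * f' x + d * g' x)"
    using f g by (auto simp: has_weak_deriv_def intro: loc_integrable_lincomb)
  fix \<phi> assume t: "test_fun \<phi>"
  then obtain R where R: "\<And>x. \<bar>x\<bar> > R \<Longrightarrow> \<phi> x = 0" by (auto simp: test_fun_def)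
  have i0: "integrable lborel (\<lambda>x. h x * \<phi> x)" if "loc_integrable h" for h
    by (rule integrable_loc_mult_compact_support[OF that test_fun_continuous(1)[OF t] R])
  have i1: "integrable lborel (\<lambda>x. h x * deriv \<phi> x)" if "loc_integrable h" for h
    by (rule integrable_loc_mult_compact_support[OF that test_fun_continuous(2)[OF t] deriv_eq_0_outside[OF R]])
  have l: "loc_integrable f" "loc_integrable f'" "loc_integrable g" "loc_integrable g'"
    using f g by (auto simp: has_weak_deriv_def)
  have "(LINT x|lborel. (c * f x + d * g x) * deriv \<phi> x)
     = c * (LINT x|lborel. f x * deriv \<phi> x) + d * (LINT x|lborel. g x * deriv \<phi> x)"
    using i1[OF l(1)] i1[OF l(3)] by (simp add: distrib_right mult.assoc)
  moreover have "(LINT x|lborel. (c * f' x + d * g' x) * \<phi> x)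
     = c * (LINT x|lborel. f' x * \<phi> x) + d * (LINT x|lborel. g' x * \<phi> x)"
    using i0[OF l(2)] i0[OF l(4)] by (simp add: distrib_right mult.assoc)
  moreover have "(LINT x|lborel. f x * deriv \<phi> x) = - (LINT x|lborel. f' x * \<phi> x)"
      "(LINT x|lborel. g x * deriv \<phi> x) = - (LINT x|lborel. g' x * \<phi> x)"
    using f g t by (auto simp: has_weak_deriv_def)
  ultimately show "(LINT x|lborel. (c * f x + d * g x) * deriv \<phi> x)
     = - (LINT x|lborel. (c * f' x + d * g' x) * \<phi> x)" by simp
qed

lemma has_weak_deriv_unique:
  assumes "continuous_on UNIV f" "has_weak_deriv f g" "has_weak_deriv f h"
  shows "AE x in lborel. g x = h x"
  using assms weak_deriv_integral[OF assms(1)]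
  by (intro AE_eq_if_Icc_integral_eq) (auto simp: has_weak_deriv_def)

section \<open>Membership, norms and Sobolev estimates for \<open>H1_space\<close>\<close>

lemma Lp_space_2_iff: "f \<in> Lp_space 2 \<longleftrightarrow> f \<in> borel_measurable borel \<and> integrable lborel (\<lambda>x. (f x)\<^sup>2)"
  by (simp add: Lp_space_def)

lemma Lp_norm_2_power2: "(Lp_norm 2 f)\<^sup>2 = (LINT x|lborel. (f x)\<^sup>2)"
proof -
  have "0 \<le> (LINT x|lborel. (f x)\<^sup>2)" by simp
  then show ?thesis by (simp add: Lp_norm_def powr_half_sqrt)
qed

lemma Lp_norm_nonneg: "0 \<le> Lp_norm p f"
  by (simp add: Lp_norm_def)

lemma W1p_norm_nonneg: "0 \<le> W1p_norm p f"
  by (simp add: W1p_norm_def)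

lemma H1_norm_power2: "(H1_norm f)\<^sup>2 = (LINT x|lborel. (f x)\<^sup>2) + (LINT x|lborel. (wderiv f x)\<^sup>2)"
proof -
  have "0 \<le> (LINT x|lborel. (f x)\<^sup>2) + (LINT x|lborel. (wderiv f x)\<^sup>2)" by simp
  then show ?thesis
    by (simp add: W1p_norm_def powr_half_sqrt Lp_norm_nonneg Lp_norm_2_power2)
qed

lemma has_weak_deriv_wderiv: "has_weak_deriv f g \<Longrightarrow> has_weak_deriv f (wderiv f)"
  unfolding wderiv_def by (rule someI[of "has_weak_deriv f"])

lemma H1_spaceD:
  assumes "f \<in> H1_space"
  shows "continuous_on UNIV f" "f \<in> borel_measurable borel" "integrable lborel (\<lambda>x. (f x)\<^sup>2)"
    "has_weak_deriv f (wderiv f)" "wderiv f \<in> borel_measurable borel"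
    "integrable lborel (\<lambda>x. (wderiv f x)\<^sup>2)" "loc_integrable (wderiv f)"
proof -
  obtain g where "has_weak_deriv f g" using assms by (auto simp: W1p_space_def)
  then show w: "has_weak_deriv f (wderiv f)" by (rule has_weak_deriv_wderiv)
  then show "loc_integrable (wderiv f)" by (simp add: has_weak_deriv_def)
qed (use assms in \<open>simp_all add: W1p_space_def Lp_space_2_iff\<close>)

lemma H1_space_integral:
  assumes "f \<in> H1_space" "a \<le> b"
  shows "(LINT x:{a..b}|lborel. wderiv f x) = f b - f a"
  by (rule weak_deriv_integral[OF H1_spaceD(1)[OF assms(1)] H1_spaceD(4)[OF assms(1)] assms(2)])

lemma integrable_power2_lincomb:
  fixes f g :: "'a \<Rightarrow> real"
  assumes "integrable M (\<lambda>x. (f x)\<^sup>2)" "integrable M (\<lambda>x. (g x)\<^sup>2)"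
    and [measurable]: "f \<in> borel_measurable M" "g \<in> borel_measurable M"
  shows "integrable M (\<lambda>x. (c * f x + d * g x)\<^sup>2)"
proof (rule Bochner_Integration.integrable_bound[of _ "\<lambda>x. 2 * c\<^sup>2 * (f x)\<^sup>2 + 2 * d\<^sup>2 * (g x)\<^sup>2"])
  show "integrable M (\<lambda>x. 2 * c\<^sup>2 * (f x)\<^sup>2 + 2 * d\<^sup>2 * (g x)\<^sup>2)"
    using assms by (intro Bochner_Integration.integrable_add integrable_mult_right)
  have "(c * u + d * v)\<^sup>2 \<le> 2 * c\<^sup>2 * u\<^sup>2 + 2 * d\<^sup>2 * v\<^sup>2" for u v :: real
    using sum_squares_bound[of "c * u" "d * v"] by (simp add: power2_sum power_mult_distrib)
  then show "AE x in M. norm ((c * f x + d * g x)\<^sup>2) \<le> norm (2 * c\<^sup>2 * (f x)\<^sup>2 + 2 * d\<^sup>2 * (g x)\<^sup>2)"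
    by (intro AE_I2) simp
qed measurable

text \<open>Since \<open>wderiv\<close> chooses a representative, it is linear only almost
  everywhere. That much follows because the chosen derivative and the linear combination of
  derivatives are both weak derivatives of the same continuous function.\<close>

lemma H1_lincomb:
  assumes f: "f \<in> H1_space" and g: "g \<in> H1_space"
  shows "(\<lambda>x. c * f x + d * g x) \<in> H1_space"
    and "AE x in lborel. wderiv (\<lambda>x. c * f x + d * g x) x = c * wderiv f x + d * wderiv g x"
proof -
  let ?h = "\<lambda>x. c * f x + d * g x"
  note F = H1_spaceD[OF f] and G = H1_spaceD[OF g]
  have w: "has_weak_deriv ?h (\<lambda>x. c * wderiv f x + d * wderiv g x)"
    using F G by (intro has_weak_deriv_lincomb)
  have cont: "continuous_on UNIV ?h" using F G by (intro continuous_intros)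
  have w': "has_weak_deriv ?h (wderiv ?h)" by (rule has_weak_deriv_wderiv[OF w])
  show ae: "AE x in lborel. wderiv ?h x = c * wderiv f x + d * wderiv g x"
    by (rule has_weak_deriv_unique[OF cont w' w])
  have [measurable]: "wderiv ?h \<in> borel_measurable borel"
    using w' by (simp add: has_weak_deriv_def loc_integrable_def)
  have "integrable lborel (\<lambda>x. (wderiv ?h x)\<^sup>2)"
    using integrable_power2_lincomb[OF F(6) G(6), of c d] F(5) G(5)
    by (subst integrable_cong_AE[of _ _ "\<lambda>x. (c * wderiv f x + d * wderiv g x)\<^sup>2"])
       (use ae in \<open>auto elim!: eventually_mono\<close>)
  moreover have "integrable lborel (\<lambda>x. (?h x)\<^sup>2)"
    using integrable_power2_lincomb[OF F(3) G(3), of c d] F(2) G(2) by auto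
  ultimately show "?h \<in> H1_space"
    using cont w F(2) G(2) by (auto simp: W1p_space_def Lp_space_2_iff)
qed

lemma H1_diff:
  assumes "f \<in> H1_space" "g \<in> H1_space"
  shows "f - g \<in> H1_space" "AE x in lborel. wderiv (f - g) x = wderiv f x - wderiv g x"
proof -
  have e: "f - g = (\<lambda>x. 1 * f x + (-1) * g x)" by (auto simp: fun_eq_iff)
  show "f - g \<in> H1_space" "AE x in lborel. wderiv (f - g) x = wderiv f x - wderiv g x"
    using H1_lincomb[OF assms, of 1 "-1"] unfolding e by auto
qed

text \<open>This takes the place of the Cauchy-Schwarz inequality: an integral of \<bar>g\<bar> is
  exchanged for a small multiple of a length plus a large multiple of an integral of g^2, with
  \<open>e\<close> to be chosen later.\<close>

lemma abs_le_add_square_div: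
  fixes y :: real assumes "0 < e"
  shows "\<bar>y\<bar> \<le> e + y\<^sup>2 / e"
proof -
  have "0 \<le> (\<bar>y\<bar> - e)\<^sup>2 + e * \<bar>y\<bar>" using assms by simp
  then have "e * \<bar>y\<bar> \<le> e\<^sup>2 + y\<^sup>2" by (simp add: power2_diff algebra_simps power2_eq_square)
  then show ?thesis using assms by (simp add: field_simps power2_eq_square)
qed

lemma set_integrable_UNIV_subset:
  fixes f :: "real \<Rightarrow> real"
  assumes "integrable lborel f" "A \<in> sets borel"
  shows "set_integrable lborel A f"
  unfolding set_integrable_def using assms by (intro integrable_mult_indicator) auto

lemma Icc_integral_abs_le:
  fixes g :: "real \<Rightarrow> real"
  assumes [measurable]: "g \<in> borel_measurable borel" and g2: "integrable lborel (\<lambda>x. (g x)\<^sup>2)"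
    and "0 < e" "a \<le> b"
  shows "set_integrable lborel {a..b} g"
    and "(LINT x:{a..b}|lborel. \<bar>g x\<bar>) \<le> e * (b - a) + (LINT x:{a..b}|lborel. (g x)\<^sup>2) / e"
proof -
  have i1: "set_integrable lborel {a..b} (\<lambda>x. e)"
    by (rule borel_integrable_atLeastAtMost') (intro continuous_intros)
  have i2: "set_integrable lborel {a..b} (\<lambda>x. (g x)\<^sup>2 / e)"
    using set_integrable_UNIV_subset[OF g2] by (intro set_integrable_divide) auto
  have i: "set_integrable lborel {a..b} (\<lambda>x. e + (g x)\<^sup>2 / e)"
    using i1 i2 by (rule set_integral_add)
  show gi: "set_integrable lborel {a..b} g"
    by (rule set_integrable_bound[OF i])
       (use abs_le_add_square_div[OF \<open>0 < e\<close>] \<open>0 < e\<close> in \<open>auto simp: set_borel_measurable_def\<close>)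
  have "(LINT x:{a..b}|lborel. \<bar>g x\<bar>) \<le> (LINT x:{a..b}|lborel. e + (g x)\<^sup>2 / e)"
    by (rule set_integral_mono[OF set_integrable_abs[OF gi] i abs_le_add_square_div[OF \<open>0 < e\<close>]])
  also have "\<dots> = e * (b - a) + (LINT x:{a..b}|lborel. (g x)\<^sup>2) / e"
    using set_integral_add(2)[OF i1 i2] \<open>a \<le> b\<close> by (simp add: set_integral_const set_integral_divide_zero mult.commute)
  finally show "(LINT x:{a..b}|lborel. \<bar>g x\<bar>) \<le> e * (b - a) + (LINT x:{a..b}|lborel. (g x)\<^sup>2) / e" .
qed

lemma set_integral_le_UNIV:
  fixes f :: "real \<Rightarrow> real"
  assumes "integrable lborel f" "A \<in> sets borel" "\<And>x. 0 \<le> f x"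
  shows "(LINT x:A|lborel. f x) \<le> (LINT x|lborel. f x)"
  unfolding set_lebesgue_integral_def
  using assms set_integrable_UNIV_subset[OF assms(1,2)] unfolding set_integrable_def
  by (intro integral_mono) (auto simp: indicator_def)

lemma abs_set_integral_le:
  fixes f :: "'a \<Rightarrow> real"
  shows "\<bar>LINT x:A|M. f x\<bar> \<le> (LINT x:A|M. \<bar>f x\<bar>)"
proof -
  have "\<bar>LINT x|M. indicator A x * f x\<bar> \<le> (LINT x|M. \<bar>indicator A x * f x\<bar>)" by (rule integral_abs_bound)
  then show ?thesis by (simp add: set_lebesgue_integral_def abs_mult)
qed

text \<open>Minimising over \<open>e\<close> would give Hoelder continuity with exponent 1/2. The
  form with a free parameter is directly usable in epsilon arguments.\<close>

lemma H1_modulus: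
  assumes f: "f \<in> H1_space" and "0 < e"
  shows "\<bar>f b - f a\<bar> \<le> e * \<bar>b - a\<bar> + (H1_norm f)\<^sup>2 / e"
proof -
  have *: "\<bar>f b - f a\<bar> \<le> e * (b - a) + (H1_norm f)\<^sup>2 / e" if "a \<le> b" for a b
  proof -
    have "\<bar>f b - f a\<bar> \<le> (LINT x:{a..b}|lborel. \<bar>wderiv f x\<bar>)"
      unfolding H1_space_integral[OF f that, symmetric] by (rule abs_set_integral_le)
    also have "\<dots> \<le> e * (b - a) + (LINT x:{a..b}|lborel. (wderiv f x)\<^sup>2) / e"
      using H1_spaceD[OF f] that \<open>0 < e\<close> by (intro Icc_integral_abs_le)
    also have "(LINT x:{a..b}|lborel. (wderiv f x)\<^sup>2) \<le> (LINT x|lborel. (wderiv f x)\<^sup>2)"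
      using H1_spaceD[OF f] by (intro set_integral_le_UNIV) auto
    also have "\<dots> \<le> (H1_norm f)\<^sup>2" unfolding H1_norm_power2 by simp
    finally show ?thesis using \<open>0 < e\<close> by (simp add: divide_right_mono)
  qed
  show ?thesis using *[of a b] *[of b a] by (cases "a \<le> b") (auto simp: abs_minus_commute)
qed

text \<open>For z in the unit window, \<bar>f x\<bar> is at most \<bar>f z\<bar> plus the integral
  of the modulus of the derivative over the window. Averaging over z leaves only local integrals,
  which yields both boundedness and decay at infinity.\<close>

lemma H1_local_bound:
  assumes f: "f \<in> H1_space" and "0 < e"
  shows "\<bar>f x\<bar> \<le> 2 * e + (LINT y:{x..x + 1}|lborel. (f y)\<^sup>2 + (wderiv f y)\<^sup>2) / e"
proof -
  note F = H1_spaceD[OF f]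
  have i1: "set_integrable lborel {x..x + 1} f" and l1: "(LINT y:{x..x + 1}|lborel. \<bar>f y\<bar>) \<le> e * (x + 1 - x) + (LINT y:{x..x + 1}|lborel. (f y)\<^sup>2) / e"
    using F \<open>0 < e\<close> by (intro Icc_integral_abs_le; simp)+
  have i2: "set_integrable lborel {x..x + 1} (wderiv f)" 
    and l2: "(LINT y:{x..x + 1}|lborel. \<bar>wderiv f y\<bar>) \<le> e * (x + 1 - x) + (LINT y:{x..x + 1}|lborel. (wderiv f y)\<^sup>2) / e"
    using F \<open>0 < e\<close> by (intro Icc_integral_abs_le; simp)+
  let ?A = "LINT y:{x..x + 1}|lborel. \<bar>wderiv f y\<bar>"
  have c: "set_integrable lborel {x..x + 1} (\<lambda>y. c)" for c :: real
    by (rule borel_integrable_atLeastAtMost') (intro continuous_intros)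
  have le: "\<bar>f x\<bar> \<le> \<bar>f z\<bar> + ?A" if z: "z \<in> {x..x + 1}" for z
  proof -
    have "\<bar>f z - f x\<bar> \<le> (LINT y:{x..z}|lborel. \<bar>wderiv f y\<bar>)"
      using H1_space_integral[OF f, of x z, symmetric] z abs_set_integral_le by simp
    also have "\<dots> \<le> ?A"
      unfolding set_lebesgue_integral_def using z
      by (intro integral_mono set_integrable_subset[OF set_integrable_abs[OF i2], unfolded set_integrable_def]
            set_integrable_abs[OF i2, unfolded set_integrable_def])
         (auto simp: indicator_def)
    finally show ?thesis by linarith
  qed
  have "\<bar>f x\<bar> = (LINT z:{x..x + 1}|lborel. \<bar>f x\<bar>)" by (simp add: set_integral_const)
  also have "\<dots> \<le> (LINT z:{x..x + 1}|lborel. \<bar>f z\<bar> + ?A)"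
    by (rule set_integral_mono[OF c set_integral_add(1)[OF set_integrable_abs[OF i1] c] le])
  also have "\<dots> = (LINT z:{x..x + 1}|lborel. \<bar>f z\<bar>) + ?A"
    using set_integral_add(2)[OF set_integrable_abs[OF i1] c] by (simp add: set_integral_const)
  also have "\<dots> \<le> 2 * e + ((LINT y:{x..x + 1}|lborel. (f y)\<^sup>2) + (LINT y:{x..x + 1}|lborel. (wderiv f y)\<^sup>2)) / e"
    using l1 l2 by (simp add: add_divide_distrib)
  also have "(LINT y:{x..x + 1}|lborel. (f y)\<^sup>2) + (LINT y:{x..x + 1}|lborel. (wderiv f y)\<^sup>2)
    = (LINT y:{x..x + 1}|lborel. (f y)\<^sup>2 + (wderiv f y)\<^sup>2)"
    using F by (intro set_integral_add(2)[symmetric] set_integrable_UNIV_subset) auto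
  finally show ?thesis .
qed

lemma H1_sup_bound:
  assumes f: "f \<in> H1_space"
  shows "\<bar>f x\<bar> \<le> 3 * H1_norm f"
proof -
  have le: "(LINT y:{x..x + 1}|lborel. (f y)\<^sup>2 + (wderiv f y)\<^sup>2) \<le> (H1_norm f)\<^sup>2"
  proof -
    have "(LINT y:{x..x + 1}|lborel. (f y)\<^sup>2 + (wderiv f y)\<^sup>2) \<le> (LINT y|lborel. (f y)\<^sup>2 + (wderiv f y)\<^sup>2)"
      using H1_spaceD[OF f] by (intro set_integral_le_UNIV) auto
    also have "\<dots> = (H1_norm f)\<^sup>2"
      using H1_spaceD[OF f] by (simp add: H1_norm_power2)
    finally show ?thesis .
  qed
  have *: "\<bar>f x\<bar> \<le> 2 * e + (H1_norm f)\<^sup>2 / e" if "0 < e" for e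
    using H1_local_bound[OF f that, of x] divide_right_mono[OF le, of e] that by simp
  show ?thesis
  proof (cases "H1_norm f = 0")
    case True
    then have "\<bar>f x\<bar> \<le> 0 + e" if "0 < e" for e using *[of "e / 2"] that by simp
    then have "\<bar>f x\<bar> \<le> 0" by (rule field_le_epsilon)
    then show ?thesis using True by simp
  next
    case False
    then have "0 < H1_norm f" using W1p_norm_nonneg[of 2 f] by linarith
    from *[OF this] show ?thesis using False by (simp add: power2_eq_square)
  qed
qed

lemma integrable_tail_small:
  fixes f :: "real \<Rightarrow> real"
  assumes f: "integrable lborel f" and "0 < e"
  obtains R where "0 < R" "(LINT x:{x. R < \<bar>x\<bar>}|lborel. \<bar>f x\<bar>) < e"
proof -
  have [measurable]: "f \<in> borel_measurable borel" using f by (simp add: borel_measurable_integrable)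
  have "(\<lambda>n. LINT x|lborel. indicator {x. real n < \<bar>x\<bar>} x * \<bar>f x\<bar>) \<longlonglongrightarrow> integral\<^sup>L lborel (\<lambda>_::real. 0::real)"
  proof (rule integral_dominated_convergence[where w = "\<lambda>x. \<bar>f x\<bar>" and f = "\<lambda>_. 0" and s = "\<lambda>n x. indicator {x. real n < \<bar>x\<bar>} x * \<bar>f x\<bar>"])
    show "AE x in lborel. (\<lambda>n. indicator {x. real n < \<bar>x\<bar>} x * \<bar>f x\<bar>) \<longlonglongrightarrow> 0"
    proof (intro AE_I2 tendsto_eventually)
      fix x
      obtain N :: nat where N: "\<bar>x\<bar> \<le> real N" using real_arch_simple by blast
      show "\<forall>\<^sub>F n in sequentially. indicator {x. real n < \<bar>x\<bar>} x * \<bar>f x\<bar> = 0"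
        by (rule eventually_mono[OF eventually_ge_at_top[of N]]) (use N in \<open>auto simp: indicator_def\<close>)
    qed
    show "AE x in lborel. norm (indicator {x. real n < \<bar>x\<bar>} x * \<bar>f x\<bar>) \<le> \<bar>f x\<bar>" for n
      by (intro AE_I2) (simp add: indicator_def)
    show "integrable lborel (\<lambda>x. \<bar>f x\<bar>)" using f by (rule integrable_abs)
  qed measurable
  then have "\<forall>\<^sub>F n in sequentially. (LINT x|lborel. indicator {x. real n < \<bar>x\<bar>} x * \<bar>f x\<bar>) < e"
    using \<open>0 < e\<close> by (intro order_tendstoD(2)) auto
  then obtain N where "\<And>n. N \<le> n \<Longrightarrow> (LINT x|lborel. indicator {x. real n < \<bar>x\<bar>} x * \<bar>f x\<bar>) < e"
    unfolding eventually_sequentially by blast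
  from this[of "Suc N"] have "(LINT x|lborel. indicator {x. real (Suc N) < \<bar>x\<bar>} x * \<bar>f x\<bar>) < e"
    by (simp del: of_nat_Suc)
  then show ?thesis by (intro that[of "real (Suc N)"]) (simp_all only: set_lebesgue_integral_def real_scaleR_def of_nat_0_less_iff zero_less_Suc)
qed

lemma H1_vanish_at_infinity:
  assumes f: "f \<in> H1_space" and "0 < e"
  obtains R where "\<And>x. R < \<bar>x\<bar> \<Longrightarrow> \<bar>f x\<bar> < e"
proof -
  let ?g = "\<lambda>y. (f y)\<^sup>2 + (wderiv f y)\<^sup>2"
  have i: "integrable lborel ?g" using H1_spaceD[OF f] by auto
  \<comment> \<open>With parameter e/4 the local bound reads e/2 + (tail)/(e/4), and a tail below
    e^2/8 makes this less than e. The points must satisfy R + 1 < \<bar>x\<bar> because for negative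
    x the window from x to x + 1 extends towards the origin.\<close>
  have e2: "0 < e\<^sup>2 / 8" using \<open>0 < e\<close> by simp
  obtain R where R: "0 < R" "(LINT x:{x. R < \<bar>x\<bar>}|lborel. \<bar>?g x\<bar>) < e\<^sup>2 / 8"
    by (rule integrable_tail_small[OF i e2])
  have "\<bar>f x\<bar> < e" if x: "R + 1 < \<bar>x\<bar>" for x
  proof -
    have "(LINT y:{x..x + 1}|lborel. ?g y) \<le> (LINT y:{y. R < \<bar>y\<bar>}|lborel. \<bar>?g y\<bar>)"
      unfolding set_lebesgue_integral_def
    proof (rule integral_mono)
      show "integrable lborel (\<lambda>y. indicator {x..x + 1} y *\<^sub>R ?g y)"
        using set_integrable_UNIV_subset[OF i] by (auto simp: set_integrable_def)
      show "integrable lborel (\<lambda>y. indicator {y. R < \<bar>y\<bar>} y *\<^sub>R \<bar>?g y\<bar>)"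
        using set_integrable_UNIV_subset[OF integrable_abs[OF i], of "{y. R < \<bar>y\<bar>}"]
        by (auto simp: set_integrable_def)
    qed (use x in \<open>auto simp: indicator_def\<close>)
    then have "(LINT y:{x..x + 1}|lborel. ?g y) < e\<^sup>2 / 8" using R by linarith
    then have "(LINT y:{x..x + 1}|lborel. ?g y) / (e / 4) < (e\<^sup>2 / 8) / (e / 4)"
      using \<open>0 < e\<close> by (intro divide_strict_right_mono) auto
    moreover have "(e\<^sup>2 / 8) / (e / 4) = e / 2" using \<open>0 < e\<close> by (simp add: power2_eq_square)
    ultimately show ?thesis using H1_local_bound[OF f, of "e / 4" x] \<open>0 < e\<close> by simp
  qed
  then show ?thesis by (rule that)
qed

subsection \<open>The Lagrangian label\<close>

text \<open>The density of the labels is written as 1 + h with \<open>h\<close> integrable. The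
  summand 1 makes the cumulative function expanding, so its inverse is Lipschitz with constant 1;
  the summand \<open>h\<close> makes two densities comparable in L1.\<close>

locale excess_density =
  fixes h :: "real \<Rightarrow> real"
  assumes h_integrable: "integrable lborel h" and h_nonneg: "\<And>x. 0 \<le> h x"
begin

text \<open>Subtracting two integrals over half-lines gives the oriented integral from 0 to
  \<open>y\<close> of 1 + h for either sign of \<open>y\<close>.\<close>

definition cumul :: "real \<Rightarrow> real" where
  "cumul y = y + (LINT t:{..y}|lborel. h t) - (LINT t:{..0}|lborel. h t)"

definition lag :: "real \<Rightarrow> real" where
  "lag = inv cumul"

lemma h_measurable[measurable]: "h \<in> borel_measurable borel"
  using h_integrable by (simp add: borel_measurable_integrable)

lemma h_set_integrable: "A \<in> sets borel \<Longrightarrow> set_integrable lborel A h"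
  by (rule set_integrable_UNIV_subset[OF h_integrable])

lemma cumul_diff:
  assumes "a \<le> b"
  shows "cumul b - cumul a = (b - a) + (LINT t:{a<..b}|lborel. h t)"
proof -
  have "{..b} = {..a} \<union> {a<..b}" using assms by auto
  then have "(LINT t:{..b}|lborel. h t) = (LINT t:{..a}|lborel. h t) + (LINT t:{a<..b}|lborel. h t)"
    using set_integral_Un[OF _ h_set_integrable h_set_integrable, of "{..a}" "{a<..b}"]
    by (simp add: Int_def)
  then show ?thesis by (simp add: cumul_def)
qed

lemma h_set_integral_nonneg: "0 \<le> (LINT t:A|lborel. h t)"
  unfolding set_lebesgue_integral_def by (intro integral_nonneg_AE AE_I2) (simp add: h_nonneg)

lemma cumul_expanding: "a \<le> b \<Longrightarrow> b - a \<le> cumul b - cumul a"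
  using cumul_diff[of a b] h_set_integral_nonneg[of "{a<..b}"] by simp

lemma cumul_strict_mono: "strict_mono cumul"
  using cumul_expanding by (intro strict_monoI) (smt (verit))

lemma cumul_continuous: "continuous_on UNIV cumul"
proof -
  have "isCont (\<lambda>y. LINT t:{..y}|lborel. h t) x" for x
  proof (rule continuous_at_sequentiallyI)
    fix u :: "nat \<Rightarrow> real" assume u: "u \<longlonglongrightarrow> x"
    show "(\<lambda>n. LINT t:{..u n}|lborel. h t) \<longlonglongrightarrow> (LINT t:{..x}|lborel. h t)"
      unfolding set_lebesgue_integral_def
    proof (rule integral_dominated_convergence[where w = h])
      show "AE t in lborel. (\<lambda>n. indicator {..u n} t *\<^sub>R h t) \<longlonglongrightarrow> indicator {..x} t *\<^sub>R h t"
        using AE_lborel_singleton[of x]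
      proof (rule eventually_mono)
        fix t assume "t \<noteq> x"
        then consider "t < x" | "x < t" by linarith
        then have "\<forall>\<^sub>F n in sequentially. indicator {..u n} t *\<^sub>R h t = indicator {..x} t *\<^sub>R h t"
        proof cases
          case 1
          show ?thesis
            using order_tendstoD(1)[OF u 1] by (rule eventually_mono) (use 1 in \<open>auto simp: indicator_def\<close>)
        next
          case 2
          show ?thesis
            using order_tendstoD(2)[OF u 2] by (rule eventually_mono) (use 2 in \<open>auto simp: indicator_def\<close>)
        qed
        then show "(\<lambda>n. indicator {..u n} t *\<^sub>R h t) \<longlonglongrightarrow> indicator {..x} t *\<^sub>R h t"
          by (rule tendsto_eventually)
      qed
      show "AE t in lborel. norm (indicator {..u n} t *\<^sub>R h t) \<le> h t" for n
        by (intro AE_I2) (simp add: indicator_def h_nonneg)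
    qed (use h_integrable in auto)
  qed
  then have "continuous_on UNIV (\<lambda>y. LINT t:{..y}|lborel. h t)"
    by (simp add: continuous_at_imp_continuous_on)
  then show ?thesis unfolding cumul_def[abs_def] by (intro continuous_intros)
qed

lemma cumul_0: "cumul 0 = 0"
  by (simp add: cumul_def)

lemma cumul_surj: "\<exists>y. cumul y = \<xi>"
proof -
  have "cumul (- \<bar>\<xi>\<bar>) \<le> \<xi>" "\<xi> \<le> cumul \<bar>\<xi>\<bar>"
    using cumul_expanding[of "-\<bar>\<xi>\<bar>" 0] cumul_expanding[of 0 "\<bar>\<xi>\<bar>"] cumul_0 by linarith+
  then show ?thesis
    using IVT'[of cumul "-\<bar>\<xi>\<bar>" \<xi> "\<bar>\<xi>\<bar>"] continuous_on_subset[OF cumul_continuous] by auto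
qed

lemma cumul_lag[simp]: "cumul (lag \<xi>) = \<xi>"
  unfolding lag_def by (rule f_inv_into_f) (use cumul_surj[of \<xi>] in auto)

lemma lag_cumul[simp]: "lag (cumul y) = y"
  using cumul_strict_mono cumul_lag strict_mono_eq by blast

lemma lag_less_iff: "lag \<xi> < lag \<eta> \<longleftrightarrow> \<xi> < \<eta>"
  using strict_mono_less[OF cumul_strict_mono, of "lag \<xi>" "lag \<eta>"] by simp

lemma lag_le_iff: "lag \<xi> \<le> lag \<eta> \<longleftrightarrow> \<xi> \<le> \<eta>"
  using strict_mono_less_eq[OF cumul_strict_mono, of "lag \<xi>" "lag \<eta>"] by simp

lemma lag_lipschitz: "\<bar>lag \<xi> - lag \<eta>\<bar> \<le> \<bar>\<xi> - \<eta>\<bar>"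
  using cumul_expanding[of "lag \<xi>" "lag \<eta>"] cumul_expanding[of "lag \<eta>" "lag \<xi>"]
  by (cases "lag \<xi> \<le> lag \<eta>") auto

lemma lag_continuous: "continuous_on UNIV lag"
  by (rule continuous_onI) (metis dist_real_def lag_lipschitz le_less_trans less_imp_le)

lemma lag_measurable[measurable]: "lag \<in> borel_measurable borel"
  by (rule borel_measurable_continuous_onI[OF lag_continuous])

lemma cumul_eq_interval_integral: "(LBINT x=ereal 0..ereal y. 1 + h x) = cumul y"
proof -
  have *: "(LBINT x=ereal a..ereal b. 1 + h x) = cumul b - cumul a" if "a \<le> b" for a b
  proof -
    have i: "set_integrable lborel {a<..b} (\<lambda>x. 1::real)"
      by (rule set_integrable_subset[of _ "{a..b}"]) (auto intro: borel_integrable_atLeastAtMost')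
    have "(LBINT x=ereal a..ereal b. 1 + h x) = (LINT x:{a<..b}|lborel. 1 + h x)"
      using that by (rule interval_integral_Ioc)
    also have "\<dots> = (LINT x:{a<..b}|lborel. 1::real) + (LINT x:{a<..b}|lborel. h x)"
      using i h_set_integrable by (intro set_integral_add) auto
    finally show ?thesis using that by (simp add: cumul_diff set_integral_const)
  qed
  show ?thesis
  proof (cases "0 \<le> y")
    case True then show ?thesis using *[of 0 y] cumul_0 by simp
  next
    case False
    then have "(LBINT x=ereal y..ereal 0. 1 + h x) = - cumul y" using *[of y 0] cumul_0 by simp
    then show ?thesis by (subst interval_integral_endpoints_reverse) simp
  qed
qed

lemma lag_unique:
  "(THE y. strict_mono y \<and> (\<forall>\<xi>. (LBINT x=ereal 0..ereal (y \<xi>). 1 + h x) = \<xi>)) = lag"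
proof (rule the_equality)
  show "strict_mono lag \<and> (\<forall>\<xi>. (LBINT x=ereal 0..ereal (lag \<xi>). 1 + h x) = \<xi>)"
    unfolding cumul_eq_interval_integral by (auto intro!: strict_monoI simp: lag_less_iff)
  fix y assume "strict_mono y \<and> (\<forall>\<xi>. (LBINT x=ereal 0..ereal (y \<xi>). 1 + h x) = \<xi>)"
  then have "cumul (y \<xi>) = \<xi>" for \<xi> unfolding cumul_eq_interval_integral by blast
  then show "y = lag" by (metis lag_cumul ext)
qed

text \<open>The change of variables d\<xi> = (1 + h) dx as an identity of measures. On
  \<open>{a<..b}\<close> both sides give \<open>cumul b - cumul a\<close>, since the preimage under
  \<open>lag\<close> is again a half-open interval, and these intervals generate the Borel
  sets.\<close>

lemma distr_lag: "distr lborel borel lag = density lborel (\<lambda>x. ennreal (1 + h x))"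
proof -
  let ?E = "range (\<lambda>(a, b). {a<..b::real})"
  have eq: "emeasure (distr lborel borel lag) {a<..b} = emeasure (density lborel (\<lambda>x. ennreal (1 + h x))) {a<..b}
      \<and> emeasure (distr lborel borel lag) {a<..b} \<noteq> \<infinity>" for a b
  proof (cases "a \<le> b")
    case True
    have "lag -` {a<..b} = {cumul a<..cumul b}"
      using lag_less_iff[of "cumul a"] lag_le_iff[of _ "cumul b"] by auto
    then have 1: "emeasure (distr lborel borel lag) {a<..b} = ennreal (cumul b - cumul a)"
      using cumul_expanding[OF True] True by (simp add: emeasure_distr)
    have i: "set_integrable lborel {a<..b} (\<lambda>x. 1::real)"
      by (rule set_integrable_subset[of _ "{a..b}"]) (auto intro: borel_integrable_atLeastAtMost')
    have i2: "set_integrable lborel {a<..b} (\<lambda>x. 1 + h x)"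
      using set_integral_add(1)[OF i h_set_integrable] by simp
    have "emeasure (density lborel (\<lambda>x. ennreal (1 + h x))) {a<..b}
       = (\<integral>\<^sup>+x. ennreal (indicator {a<..b} x *\<^sub>R (1 + h x)) \<partial>lborel)"
      by (subst emeasure_density) (auto intro!: nn_integral_cong simp: indicator_def)
    also have "\<dots> = ennreal (LINT x:{a<..b}|lborel. 1 + h x)"
      unfolding set_lebesgue_integral_def using i2 h_nonneg unfolding set_integrable_def
      by (intro nn_integral_eq_integral AE_I2) (auto simp: indicator_def)
    also have "(LINT x:{a<..b}|lborel. 1 + h x) = (LINT x:{a<..b}|lborel. 1::real) + (LINT x:{a<..b}|lborel. h x)"
      using i h_set_integrable by (intro set_integral_add) auto
    finally show ?thesis using 1 True by (simp add: cumul_diff set_integral_const)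
  qed simp
  show ?thesis
  proof (rule measure_eqI_generator_eq[where E = ?E and \<Omega> = UNIV and A = "\<lambda>i. {- real i<..real i}"])
    show "Int_stable ?E"
    proof (rule Int_stableI)
      fix A B assume "A \<in> ?E" "B \<in> ?E"
      then obtain a b c d where "A = {a<..b}" "B = {c<..d}" by auto
      then have "A \<inter> B = (\<lambda>(a, b). {a<..b}) (max a c, min b d)" by auto
      then show "A \<inter> B \<in> ?E" by blast
    qed
    show "sets (distr lborel borel lag) = sigma_sets UNIV ?E"
      by (subst sets_distr) (simp add: borel_sigma_sets_Ioc)
    show "sets (density lborel (\<lambda>x. ennreal (1 + h x))) = sigma_sets UNIV ?E"
      by (subst sets_density, subst sets_lborel) (simp add: borel_sigma_sets_Ioc)
    show "range (\<lambda>i. {- real i<..real i}) \<subseteq> ?E" by auto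
    show "(\<Union>i. {- real i<..real i}) = UNIV"
    proof (intro set_eqI iffI UNIV_I)
      fix x :: real
      obtain n :: nat where "\<bar>x\<bar> < real n" using reals_Archimedean2 by blast
      then show "x \<in> (\<Union>i. {- real i<..real i})" by (intro UN_I[of n]) auto
    qed
    show "emeasure (distr lborel borel lag) {- real i<..real i} \<noteq> \<infinity>" for i
      using eq by blast
    show "emeasure (distr lborel borel lag) X = emeasure (density lborel (\<lambda>x. ennreal (1 + h x))) X"
      if "X \<in> ?E" for X
      using that eq by auto
  qed simp
qed

lemma lag_substitution:
  fixes F :: "real \<Rightarrow> real"
  assumes [measurable]: "F \<in> borel_measurable borel"
  shows "integrable lborel (\<lambda>\<xi>. F (lag \<xi>)) \<longleftrightarrow> integrable lborel (\<lambda>x. (1 + h x) * F x)"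
    and "(LINT \<xi>|lborel. F (lag \<xi>)) = (LINT x|lborel. (1 + h x) * F x)"
proof -
  have nn: "0 \<le> 1 + h x" for x using h_nonneg[of x] by simp
  have "integrable lborel (\<lambda>\<xi>. F (lag \<xi>)) \<longleftrightarrow> integrable (distr lborel borel lag) F"
    by (rule integrable_distr_eq[symmetric]) auto
  also have "\<dots> \<longleftrightarrow> integrable lborel (\<lambda>x. (1 + h x) * F x)"
    unfolding distr_lag using nn by (subst integrable_density) auto
  finally show "integrable lborel (\<lambda>\<xi>. F (lag \<xi>)) \<longleftrightarrow> integrable lborel (\<lambda>x. (1 + h x) * F x)" .
  have "(LINT \<xi>|lborel. F (lag \<xi>)) = integral\<^sup>L (distr lborel borel lag) F"
    by (rule integral_distr[symmetric]) auto
  also have "\<dots> = (LINT x|lborel. (1 + h x) * F x)"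
    unfolding distr_lag using nn by (subst integral_density) auto
  finally show "(LINT \<xi>|lborel. F (lag \<xi>)) = (LINT x|lborel. (1 + h x) * F x)" .
qed

end

section \<open>Stability of the label map under L1 perturbations of the density\<close>

lemma cumul_dist:
  assumes "excess_density h" "excess_density k"
  shows "\<bar>excess_density.cumul h y - excess_density.cumul k y\<bar> \<le> 2 * (LINT x|lborel. \<bar>h x - k x\<bar>)"
proof -
  interpret H: excess_density h by fact
  interpret K: excess_density k by fact
  have i: "integrable lborel (\<lambda>x. \<bar>h x - k x\<bar>)" using H.h_integrable K.h_integrable by auto
  have *: "\<bar>(LINT t:{..y}|lborel. h t) - (LINT t:{..y}|lborel. k t)\<bar> \<le> (LINT x|lborel. \<bar>h x - k x\<bar>)" for y
  proof -
    have "(LINT t:{..y}|lborel. h t) - (LINT t:{..y}|lborel. k t) = (LINT t:{..y}|lborel. h t - k t)"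
      using H.h_set_integrable K.h_set_integrable by (intro set_integral_diff(2)[symmetric]) auto
    also have "\<bar>\<dots>\<bar> \<le> (LINT t:{..y}|lborel. \<bar>h t - k t\<bar>)" by (rule abs_set_integral_le)
    also have "\<dots> \<le> (LINT x|lborel. \<bar>h x - k x\<bar>)" using i by (intro set_integral_le_UNIV) auto
    finally show ?thesis .
  qed
  \<comment> \<open>The half-line integrals are compared once at \<open>y\<close> and once at 0,
    where \<open>cumul\<close> is normalised; hence the factor 2.\<close>
  show ?thesis using *[of y] *[of 0] by (simp add: H.cumul_def K.cumul_def)
qed

text \<open>Because the cumulative function of \<open>h\<close> is expanding, it suffices to compare
  its values at the two labels. At the second label this turns into the difference of both
  cumulative functions at one and the same point.\<close>

lemma lag_dist:
  assumes "excess_density h" "excess_density k"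
  shows "\<bar>excess_density.lag h \<xi> - excess_density.lag k \<xi>\<bar> \<le> 2 * (LINT x|lborel. \<bar>h x - k x\<bar>)"
proof -
  interpret H: excess_density h by fact
  interpret K: excess_density k by fact
  have "\<bar>H.lag \<xi> - K.lag \<xi>\<bar> \<le> \<bar>H.cumul (H.lag \<xi>) - H.cumul (K.lag \<xi>)\<bar>"
    using H.cumul_expanding[of "H.lag \<xi>" "K.lag \<xi>"] H.cumul_expanding[of "K.lag \<xi>" "H.lag \<xi>"]
    by (cases "H.lag \<xi> \<le> K.lag \<xi>") auto
  also have "\<dots> = \<bar>H.cumul (K.lag \<xi>) - K.cumul (K.lag \<xi>)\<bar>" by simp
  also have "\<dots> \<le> 2 * (LINT x|lborel. \<bar>h x - k x\<bar>)" by (rule cumul_dist[OF assms])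
  finally show ?thesis .
qed

text \<open>The map \<open>cumul h\<close> after \<open>lag k\<close> sends the
  \<open>k\<close>-label of a point of the line to its \<open>h\<close>-label. It is uniformly near
  the identity.\<close>

lemma cumul_lag_dist:
  assumes "excess_density h" "excess_density k"
  shows "\<bar>excess_density.cumul h (excess_density.lag k \<xi>) - \<xi>\<bar> \<le> 2 * (LINT x|lborel. \<bar>h x - k x\<bar>)"
  using cumul_dist[OF assms, of "excess_density.lag k \<xi>"] excess_density.cumul_lag[OF assms(2), of \<xi>]
  by simp

text \<open>What the product of 1 + u_x^2 and 1 + v_x^2 has beyond 1, expanded so that each summand
  corresponds to one of the three terms of \<open>d_Sigma\<close>.\<close>

definition excess :: "(real \<Rightarrow> real) \<Rightarrow> (real \<Rightarrow> real) \<Rightarrow> real \<Rightarrow> real" where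
  "excess u v x = (wderiv u x)\<^sup>2 + (wderiv v x)\<^sup>2 + (wderiv u x * wderiv v x)\<^sup>2"

lemma Sigma_spaceD:
  assumes "(u, v) \<in> Sigma_space"
  shows "u \<in> H1_space" "v \<in> H1_space" "integrable lborel (\<lambda>x. (wderiv u x * wderiv v x)\<^sup>2)"
  using assms by (auto simp: Sigma_space_def power_mult_distrib)

lemma excess_density_excess:
  assumes "(u, v) \<in> Sigma_space"
  shows "excess_density (excess u v)"
  unfolding excess_def[abs_def] using Sigma_spaceD[OF assms] H1_spaceD(6)
  by unfold_locales (auto intro!: Bochner_Integration.integrable_add)

lemma y_init_eq_lag:
  assumes "(u, v) \<in> Sigma_space"
  shows "y_init u v = excess_density.lag (excess u v)"
proof -
  have e: "(1 + (wderiv u x)\<^sup>2) * (1 + (wderiv v x)\<^sup>2) = 1 + excess u v x" for x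
    by (simp add: excess_def algebra_simps power_mult_distrib)
  show ?thesis
    unfolding y_init_def e by (rule excess_density.lag_unique[OF excess_density_excess[OF assms]])
qed

text \<open>Young's inequality for the mixed term 2 b (a - b). The small weight falls on the fixed
  function \<open>b\<close>, the large one on the difference that tends to 0.\<close>

lemma abs_diff_squares_le:
  fixes a b :: real assumes "0 < e"
  shows "\<bar>a\<^sup>2 - b\<^sup>2\<bar> \<le> e * b\<^sup>2 + (1 + 1 / e) * (a - b)\<^sup>2"
proof -
  have "\<bar>a\<^sup>2 - b\<^sup>2\<bar> = \<bar>(a - b)\<^sup>2 + 2 * b * (a - b)\<bar>"
    by (simp add: power2_eq_square algebra_simps)
  also have "\<dots> \<le> (a - b)\<^sup>2 + \<bar>2 * b * (a - b)\<bar>" by (metis abs_triangle_ineq abs_power2)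
  also have "\<bar>2 * b * (a - b)\<bar> \<le> e * b\<^sup>2 + (a - b)\<^sup>2 / e"
  proof -
    have "0 \<le> (e * \<bar>b\<bar> - \<bar>a - b\<bar>)\<^sup>2" by simp
    also have "\<dots> = e\<^sup>2 * b\<^sup>2 + (a - b)\<^sup>2 - e * (2 * (\<bar>b\<bar> * \<bar>a - b\<bar>))"
      by (simp only: power2_diff power_mult_distrib power2_abs mult_ac)
    also have "2 * (\<bar>b\<bar> * \<bar>a - b\<bar>) = \<bar>2 * b * (a - b)\<bar>"
      by (simp only: abs_mult abs_numeral mult.assoc)
    finally have "e * \<bar>2 * b * (a - b)\<bar> \<le> e * (e * b\<^sup>2 + (a - b)\<^sup>2 / e)"
      using assms by (simp add: distrib_left power2_eq_square mult.assoc)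
    then show ?thesis using assms by (simp only: mult_le_cancel_left_pos)
  qed
  finally show ?thesis by (simp add: algebra_simps)
qed

lemma tendsto_0_squeeze:
  fixes f g :: "nat \<Rightarrow> real"
  assumes "g \<longlonglongrightarrow> 0" "\<And>n. 0 \<le> f n" "\<And>n. f n \<le> g n"
  shows "f \<longlonglongrightarrow> 0"
  by (rule tendsto_sandwich[OF always_eventually always_eventually tendsto_const assms(1)])
     (use assms in blast)+

lemma L1_tendsto_squares:
  fixes f :: "real \<Rightarrow> real" and fn :: "nat \<Rightarrow> real \<Rightarrow> real"
  assumes fm[measurable]: "f \<in> borel_measurable borel" "\<And>n. fn n \<in> borel_measurable borel"
    and f2: "integrable lborel (\<lambda>x. (f x)\<^sup>2)" "\<And>n. integrable lborel (\<lambda>x. (fn n x)\<^sup>2)"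
    and lim: "(\<lambda>n. LINT x|lborel. (fn n x - f x)\<^sup>2) \<longlonglongrightarrow> 0"
  shows "(\<lambda>n. LINT x|lborel. \<bar>(fn n x)\<^sup>2 - (f x)\<^sup>2\<bar>) \<longlonglongrightarrow> 0"
proof (rule LIMSEQ_I)
  fix r :: real assume r: "0 < r"
  define A where "A = (LINT x|lborel. (f x)\<^sup>2)"
  have A: "0 \<le> A" by (simp add: A_def)
  \<comment> \<open>The summand 1 in the denominator covers A = 0 and makes e A strictly less than
    r/2.\<close>
  define e where "e = r / (2 * (A + 1))"
  have e: "0 < e" "e * A < r / 2"
    using r A by (auto simp: e_def field_simps)
  have d: "integrable lborel (\<lambda>x. (fn n x - f x)\<^sup>2)" for n
    using integrable_power2_lincomb[OF f2(2)[of n] f2(1), of 1 "-1"] by simp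
  have "(\<lambda>n. (1 + 1 / e) * (LINT x|lborel. (fn n x - f x)\<^sup>2)) \<longlonglongrightarrow> (1 + 1 / e) * 0"
    by (intro tendsto_intros lim)
  then have "\<forall>\<^sub>F n in sequentially. (1 + 1 / e) * (LINT x|lborel. (fn n x - f x)\<^sup>2) < r / 2"
    using r by (intro order_tendstoD(2)) auto
  then obtain N where N: "\<And>n. N \<le> n \<Longrightarrow> (1 + 1 / e) * (LINT x|lborel. (fn n x - f x)\<^sup>2) < r / 2"
    by (auto simp: eventually_sequentially)
  have le: "(LINT x|lborel. \<bar>(fn n x)\<^sup>2 - (f x)\<^sup>2\<bar>) \<le> e * A + (1 + 1 / e) * (LINT x|lborel. (fn n x - f x)\<^sup>2)" for n
  proof -
    have "(LINT x|lborel. \<bar>(fn n x)\<^sup>2 - (f x)\<^sup>2\<bar>) \<le> (LINT x|lborel. e * (f x)\<^sup>2 + (1 + 1 / e) * (fn n x - f x)\<^sup>2)"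
      using f2 d abs_diff_squares_le[OF e(1)]
      by (intro integral_mono integrable_abs Bochner_Integration.integrable_diff
            Bochner_Integration.integrable_add integrable_mult_right) auto
    also have "\<dots> = e * A + (1 + 1 / e) * (LINT x|lborel. (fn n x - f x)\<^sup>2)"
      unfolding A_def using f2 d by (subst Bochner_Integration.integral_add) auto
    finally show ?thesis .
  qed
  have "norm ((LINT x|lborel. \<bar>(fn n x)\<^sup>2 - (f x)\<^sup>2\<bar>) - 0) < r" if "N \<le> n" for n
  proof -
    have "0 \<le> (LINT x|lborel. \<bar>(fn n x)\<^sup>2 - (f x)\<^sup>2\<bar>)" by simp
    then show ?thesis using le[of n] N[OF that] e unfolding real_norm_def by linarith
  qed
  then show "\<exists>no. \<forall>n\<ge>no. norm ((LINT x|lborel. \<bar>(fn n x)\<^sup>2 - (f x)\<^sup>2\<bar>) - 0) < r" by blast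
qed

lemma H1_norm_diff_wderiv:
  assumes "f \<in> H1_space" "g \<in> H1_space"
  shows "(LINT x|lborel. (wderiv f x - wderiv g x)\<^sup>2) \<le> (H1_norm (f - g))\<^sup>2"
proof -
  have "(LINT x|lborel. (wderiv f x - wderiv g x)\<^sup>2) = (LINT x|lborel. (wderiv (f - g) x)\<^sup>2)"
    using H1_diff[OF assms] H1_spaceD(5)[OF assms(1)] H1_spaceD(5)[OF assms(2)] H1_spaceD(5)[OF H1_diff(1)[OF assms]]
    by (intro integral_cong_AE) (auto elim!: eventually_mono)
  then show ?thesis by (simp add: H1_norm_power2)
qed

locale Sigma_convergent =
  fixes u0 v0 :: "real \<Rightarrow> real" and u0n v0n :: "nat \<Rightarrow> real \<Rightarrow> real"
  assumes limit_in_Sigma: "(u0, v0) \<in> Sigma_space"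
    and seq_in_Sigma: "\<And>n. (u0n n, v0n n) \<in> Sigma_space"
    and d_Sigma_tendsto: "(\<lambda>n. d_Sigma (u0n n, v0n n) (u0, v0)) \<longlonglongrightarrow> 0"
begin

lemma d_Sigma_parts_tendsto:
  "(\<lambda>n. H1_norm (u0n n - u0)) \<longlonglongrightarrow> 0" "(\<lambda>n. H1_norm (v0n n - v0)) \<longlonglongrightarrow> 0"
  "(\<lambda>n. LINT x|lborel. (wderiv (u0n n) x * wderiv (v0n n) x - wderiv u0 x * wderiv v0 x)\<^sup>2) \<longlonglongrightarrow> 0"
proof -
  let ?a = "\<lambda>n. H1_norm (u0n n - u0)" and ?b = "\<lambda>n. H1_norm (v0n n - v0)"
  let ?c = "\<lambda>n. Lp_norm 2 (\<lambda>x. wderiv (u0n n) x * wderiv (v0n n) x - wderiv u0 x * wderiv v0 x)"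
  let ?d = "\<lambda>n. d_Sigma (u0n n, v0n n) (u0, v0)"
  have "?a n \<le> ?d n" "?b n \<le> ?d n" "?c n \<le> ?d n" for n
    by (auto intro!: real_le_rsqrt)
  note le = this
  show "?a \<longlonglongrightarrow> 0" by (rule tendsto_0_squeeze[OF d_Sigma_tendsto W1p_norm_nonneg le(1)])
  show "?b \<longlonglongrightarrow> 0" by (rule tendsto_0_squeeze[OF d_Sigma_tendsto W1p_norm_nonneg le(2)])
  have "?c \<longlonglongrightarrow> 0"
    by (rule tendsto_0_squeeze[OF d_Sigma_tendsto Lp_norm_nonneg le(3)])
  from tendsto_power[OF this, of 2]
  show "(\<lambda>n. LINT x|lborel. (wderiv (u0n n) x * wderiv (v0n n) x - wderiv u0 x * wderiv v0 x)\<^sup>2) \<longlonglongrightarrow> 0"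
    by (simp add: Lp_norm_2_power2)
qed

lemma wderiv_L2_tendsto:
  "(\<lambda>n. LINT x|lborel. (wderiv (u0n n) x - wderiv u0 x)\<^sup>2) \<longlonglongrightarrow> 0"
  "(\<lambda>n. LINT x|lborel. (wderiv (v0n n) x - wderiv v0 x)\<^sup>2) \<longlonglongrightarrow> 0"
proof -
  have *: "(\<lambda>n. LINT x|lborel. (wderiv (fn n) x - wderiv f x)\<^sup>2) \<longlonglongrightarrow> 0"
    if "\<And>n. fn n \<in> H1_space" "f \<in> H1_space" "(\<lambda>n. H1_norm (fn n - f)) \<longlonglongrightarrow> 0" for fn f
  proof (rule tendsto_0_squeeze)
    show "(\<lambda>n. (H1_norm (fn n - f))\<^sup>2) \<longlonglongrightarrow> 0"
      using tendsto_power[OF that(3), of 2] by simp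
  qed (use H1_norm_diff_wderiv[OF that(1,2)] in simp_all)
  show "(\<lambda>n. LINT x|lborel. (wderiv (u0n n) x - wderiv u0 x)\<^sup>2) \<longlonglongrightarrow> 0"
    "(\<lambda>n. LINT x|lborel. (wderiv (v0n n) x - wderiv v0 x)\<^sup>2) \<longlonglongrightarrow> 0"
    by (rule *[OF Sigma_spaceD(1)[OF seq_in_Sigma] Sigma_spaceD(1)[OF limit_in_Sigma] d_Sigma_parts_tendsto(1)],
        rule *[OF Sigma_spaceD(2)[OF seq_in_Sigma] Sigma_spaceD(2)[OF limit_in_Sigma] d_Sigma_parts_tendsto(2)])
qed

text \<open>The product term of \<open>d_Sigma\<close> enters here: convergence of the two
  derivatives in L2 alone does not control the product of their squares in L1.\<close>

lemma excess_L1_tendsto: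
  "(\<lambda>n. LINT x|lborel. \<bar>excess (u0n n) (v0n n) x - excess u0 v0 x\<bar>) \<longlonglongrightarrow> 0"
proof -
  note S = Sigma_spaceD[OF limit_in_Sigma] and Sn = Sigma_spaceD[OF seq_in_Sigma]
  note U = H1_spaceD(5,6)[OF S(1)] and V = H1_spaceD(5,6)[OF S(2)]
    and Un = H1_spaceD(5,6)[OF Sn(1)] and Vn = H1_spaceD(5,6)[OF Sn(2)]
  note [measurable] = U(1) V(1) Un(1) Vn(1)
  let ?p = "\<lambda>n x. \<bar>(wderiv (u0n n) x)\<^sup>2 - (wderiv u0 x)\<^sup>2\<bar>"
  let ?q = "\<lambda>n x. \<bar>(wderiv (v0n n) x)\<^sup>2 - (wderiv v0 x)\<^sup>2\<bar>"
  let ?r = "\<lambda>n x. \<bar>(wderiv (u0n n) x * wderiv (v0n n) x)\<^sup>2 - (wderiv u0 x * wderiv v0 x)\<^sup>2\<bar>"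
  have i: "integrable lborel (?p n)" "integrable lborel (?q n)" "integrable lborel (?r n)" for n
    using U V Un Vn S(3) Sn(3) by auto
  have lim: "(\<lambda>n. (LINT x|lborel. ?p n x) + (LINT x|lborel. ?q n x) + (LINT x|lborel. ?r n x)) \<longlonglongrightarrow> 0 + 0 + 0"
    by (intro tendsto_add L1_tendsto_squares[OF U(1) Un(1) U(2) Un(2) wderiv_L2_tendsto(1)]
        L1_tendsto_squares[OF V(1) Vn(1) V(2) Vn(2) wderiv_L2_tendsto(2)]
        L1_tendsto_squares[OF _ _ S(3) Sn(3) d_Sigma_parts_tendsto(3)] borel_measurable_times U(1) V(1) Un(1) Vn(1))
  have le: "(LINT x|lborel. \<bar>excess (u0n n) (v0n n) x - excess u0 v0 x\<bar>)
     \<le> (LINT x|lborel. ?p n x) + (LINT x|lborel. ?q n x) + (LINT x|lborel. ?r n x)" for n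
  proof -
    have "(LINT x|lborel. \<bar>excess (u0n n) (v0n n) x - excess u0 v0 x\<bar>) \<le> (LINT x|lborel. ?p n x + ?q n x + ?r n x)"
    proof (rule integral_mono)
      show "integrable lborel (\<lambda>x. \<bar>excess (u0n n) (v0n n) x - excess u0 v0 x\<bar>)"
        by (intro integrable_abs Bochner_Integration.integrable_diff excess_density.h_integrable
            excess_density_excess limit_in_Sigma seq_in_Sigma)
      show "integrable lborel (\<lambda>x. ?p n x + ?q n x + ?r n x)"
        using i[of n] by (intro Bochner_Integration.integrable_add)
      have "\<bar>(a + b + c) - (a' + b' + c')\<bar> \<le> \<bar>a - a'\<bar> + \<bar>b - b'\<bar> + \<bar>c - c'\<bar>"
        for a b c a' b' c' :: real by linarith
      then show "\<bar>excess (u0n n) (v0n n) x - excess u0 v0 x\<bar> \<le> ?p n x + ?q n x + ?r n x" for x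
        unfolding excess_def .
    qed
    also have "\<dots> = (LINT x|lborel. ?p n x) + (LINT x|lborel. ?q n x) + (LINT x|lborel. ?r n x)"
      by (simp only: Bochner_Integration.integral_add[OF Bochner_Integration.integrable_add[OF i(1,2)] i(3)]
            Bochner_Integration.integral_add[OF i(1,2)])
    finally show ?thesis .
  qed
  show ?thesis
    by (rule tendsto_0_squeeze[OF lim[simplified]]) (simp, rule le)
qed

end

subsection \<open>Exponentially weighted \<open>L\<^sup>1\<close> norms\<close>

text \<open>The centre \<xi> remains an argument. Suprema over it are expressed by bounds that hold
  for every \<xi>, so that no supremum has to be formed.\<close>

definition wnorm :: "real \<Rightarrow> (real \<Rightarrow> real) \<Rightarrow> real \<Rightarrow> real" where
  "wnorm \<kappa> f \<xi> = (LINT \<eta>|lborel. exp (- \<kappa> * \<bar>\<xi> - \<eta>\<bar>) * \<bar>f \<eta>\<bar>)"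

lemma has_bochner_integral_exp_abs:
  fixes \<kappa> :: real
  assumes \<kappa>: "0 < \<kappa>"
  shows "has_bochner_integral lborel (\<lambda>\<eta>. exp (- \<kappa> * \<bar>\<xi> - \<eta>\<bar>)) (2 / \<kappa>)"
proof -
  have "(\<integral>\<^sup>+x. ennreal (exp (- \<kappa> * x)) * indicator {0..} x \<partial>lborel) = 0 - (- exp (- \<kappa> * 0) / \<kappa>)"
  proof (rule nn_integral_FTC_atLeast)
    show "((\<lambda>x. - exp (- \<kappa> * x) / \<kappa>) has_real_derivative exp (- \<kappa> * x)) (at x)" for x
      using \<kappa> by (auto intro!: derivative_eq_intros)
    have "LIM x at_top. - (\<kappa> * x) :> at_bot"
      unfolding filterlim_uminus_at_top[symmetric]
      by (rule filterlim_tendsto_pos_mult_at_top[OF tendsto_const \<kappa> filterlim_ident])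
    then have "((\<lambda>x. exp (- \<kappa> * x)) \<longlongrightarrow> 0) at_top"
      by (intro filterlim_compose[OF exp_at_bot]) simp
    from tendsto_mult_right[OF this, of "- 1 / \<kappa>"]
    show "((\<lambda>x. - exp (- \<kappa> * x) / \<kappa>) \<longlongrightarrow> 0) at_top" by simp
  qed auto
  then have "(\<integral>\<^sup>+x. ennreal (indicator {0..} x *\<^sub>R exp (- \<kappa> * \<bar>x\<bar>)) \<partial>lborel) = ennreal (1 / \<kappa>)"
    by (subst (asm) nn_integral_cong[where v = "\<lambda>x. ennreal (indicator {0..} x *\<^sub>R exp (- \<kappa> * \<bar>x\<bar>))"])
       (auto simp: indicator_def)
  then have "has_bochner_integral lborel (\<lambda>x. indicator {0..} x *\<^sub>R exp (- \<kappa> * \<bar>x\<bar>)) (1 / \<kappa>)"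
    using \<kappa> by (intro has_bochner_integral_nn_integral) auto
  then have "has_bochner_integral lborel (\<lambda>x. exp (- \<kappa> * \<bar>x\<bar>)) (2 *\<^sub>R (1 / \<kappa>))"
    by (rule has_bochner_integral_even_function) simp
  then have "has_bochner_integral lborel (\<lambda>\<eta>. exp (- \<kappa> * \<bar>\<xi> + (-1) * \<eta>\<bar>)) (2 *\<^sub>R (1 / \<kappa>) /\<^sub>R \<bar>-1\<bar>)"
    by (subst lborel_has_bochner_integral_real_affine_iff[symmetric, of "-1"]) auto
  then show ?thesis by simp
qed

lemma integrable_exp_abs: "0 < (\<kappa>::real) \<Longrightarrow> integrable lborel (\<lambda>\<eta>. exp (- \<kappa> * \<bar>\<xi> - \<eta>\<bar>))"
  and integral_exp_abs: "0 < (\<kappa>::real) \<Longrightarrow> (LINT \<eta>|lborel. exp (- \<kappa> * \<bar>\<xi> - \<eta>\<bar>)) = 2 / \<kappa>"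
  using has_bochner_integral_exp_abs has_bochner_integral_iff by blast+

definition ess_bounded :: "(real \<Rightarrow> real) \<Rightarrow> bool" where
  "ess_bounded f \<longleftrightarrow> f \<in> borel_measurable borel \<and> (\<exists>C. AE x in lborel. \<bar>f x\<bar> \<le> C)"

lemma ess_bounded_eq_Linf: "ess_bounded f \<longleftrightarrow> f \<in> Linf_space"
  by (simp add: ess_bounded_def Linf_space_def)

lemma ess_boundedI: "f \<in> borel_measurable borel \<Longrightarrow> AE x in lborel. \<bar>f x\<bar> \<le> C \<Longrightarrow> ess_bounded f"
  by (auto simp: ess_bounded_def)

lemma ess_bounded_measurable[measurable_dest]: "ess_bounded f \<Longrightarrow> f \<in> borel_measurable borel"
  by (simp add: ess_bounded_def)

lemma ess_bounded_add: "ess_bounded f \<Longrightarrow> ess_bounded g \<Longrightarrow> ess_bounded (\<lambda>x. f x + g x)"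
  unfolding ess_bounded_def
proof (elim conjE exE, intro conjI)
  fix C D assume "AE x in lborel. \<bar>f x\<bar> \<le> C" "AE x in lborel. \<bar>g x\<bar> \<le> D"
  then have "AE x in lborel. \<bar>f x + g x\<bar> \<le> C + D" by eventually_elim linarith
  then show "\<exists>C. AE x in lborel. \<bar>f x + g x\<bar> \<le> C" by blast
qed measurable

lemma ess_bounded_mult: "ess_bounded f \<Longrightarrow> ess_bounded g \<Longrightarrow> ess_bounded (\<lambda>x. f x * g x)"
  unfolding ess_bounded_def
proof (elim conjE exE, intro conjI)
  fix C D assume "AE x in lborel. \<bar>f x\<bar> \<le> C" "AE x in lborel. \<bar>g x\<bar> \<le> D"
  then have "AE x in lborel. \<bar>f x * g x\<bar> \<le> C * D"
  proof eventually_elim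
    case (elim x)
    then show ?case unfolding abs_mult by (intro mult_mono) auto
  qed
  then show "\<exists>C. AE x in lborel. \<bar>f x * g x\<bar> \<le> C" by blast
qed measurable

lemma ess_bounded_const: "ess_bounded (\<lambda>x. c)"
  by (rule ess_boundedI[of _ "\<bar>c\<bar>"]) auto

lemma ess_bounded_cmult: "ess_bounded f \<Longrightarrow> ess_bounded (\<lambda>x. c * f x)"
  by (rule ess_bounded_mult[OF ess_bounded_const])

lemma ess_bounded_diff: "ess_bounded f \<Longrightarrow> ess_bounded g \<Longrightarrow> ess_bounded (\<lambda>x. f x - g x)"
  using ess_bounded_add[of f "\<lambda>x. (-1) * g x"] ess_bounded_cmult[of g "-1"] by simp

lemma wnorm_integrable:
  assumes \<kappa>: "0 < \<kappa>" and f: "ess_bounded f"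
  shows "integrable lborel (\<lambda>\<eta>. exp (- \<kappa> * \<bar>\<xi> - \<eta>\<bar>) * \<bar>f \<eta>\<bar>)"
proof -
  obtain C where C: "AE x in lborel. \<bar>f x\<bar> \<le> C" using f by (auto simp: ess_bounded_def)
  have [measurable]: "f \<in> borel_measurable borel" using f by (simp add: ess_bounded_def)
  show ?thesis
    by (rule Bochner_Integration.integrable_bound[OF integrable_mult_left[OF integrable_exp_abs[OF \<kappa>, of \<xi>], of C]])
       (use C in \<open>auto elim!: eventually_mono\<close>)
qed

lemma wnorm_nonneg: "0 \<le> wnorm \<kappa> f \<xi>"
  unfolding wnorm_def by (intro integral_nonneg_AE AE_I2) simp

lemma wnorm_mono:
  assumes \<kappa>: "0 < \<kappa>" and g: "ess_bounded g" and f: "f \<in> borel_measurable borel"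
    and le: "AE x in lborel. \<bar>f x\<bar> \<le> \<bar>g x\<bar>"
  shows "wnorm \<kappa> f \<xi> \<le> wnorm \<kappa> g \<xi>"
proof -
  obtain C where "AE x in lborel. \<bar>g x\<bar> \<le> C" using g by (auto simp: ess_bounded_def)
  with le have "AE x in lborel. \<bar>f x\<bar> \<le> C" by eventually_elim linarith
  then have "ess_bounded f" using f by (auto simp: ess_bounded_def)
  then show ?thesis
    unfolding wnorm_def using le g \<kappa>
    by (intro integral_mono_AE wnorm_integrable) (auto elim!: eventually_mono intro!: mult_left_mono)
qed

lemma wnorm_const: "0 < \<kappa> \<Longrightarrow> wnorm \<kappa> (\<lambda>x. c) \<xi> = \<bar>c\<bar> * (2 / \<kappa>)"
  unfolding wnorm_def using integral_exp_abs[of \<kappa> \<xi>] by simp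

lemma wnorm_le_const:
  assumes "0 < \<kappa>" "f \<in> borel_measurable borel" "AE x in lborel. \<bar>f x\<bar> \<le> C" "0 \<le> C"
  shows "wnorm \<kappa> f \<xi> \<le> C * (2 / \<kappa>)"
proof -
  have "wnorm \<kappa> f \<xi> \<le> wnorm \<kappa> (\<lambda>x. C) \<xi>"
    using assms by (intro wnorm_mono ess_bounded_const) auto
  then show ?thesis using wnorm_const[OF assms(1), of C \<xi>] assms(4) by simp
qed

lemma wnorm_cmult: "wnorm \<kappa> (\<lambda>x. c * f x) \<xi> = \<bar>c\<bar> * wnorm \<kappa> f \<xi>"
  unfolding wnorm_def by (simp add: abs_mult mult.left_commute)

lemma wnorm_abs: "wnorm \<kappa> (\<lambda>x. \<bar>f x\<bar>) \<xi> = wnorm \<kappa> f \<xi>"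
  unfolding wnorm_def by simp

lemma wnorm_triangle:
  assumes \<kappa>: "0 < \<kappa>" and f: "ess_bounded f" and g: "ess_bounded g"
  shows "wnorm \<kappa> (\<lambda>x. f x + g x) \<xi> \<le> wnorm \<kappa> f \<xi> + wnorm \<kappa> g \<xi>"
proof -
  have "wnorm \<kappa> (\<lambda>x. f x + g x) \<xi> \<le>
    (LINT \<eta>|lborel. exp (- \<kappa> * \<bar>\<xi> - \<eta>\<bar>) * \<bar>f \<eta>\<bar> + exp (- \<kappa> * \<bar>\<xi> - \<eta>\<bar>) * \<bar>g \<eta>\<bar>)"
    unfolding wnorm_def distrib_left[symmetric]
    using wnorm_integrable[OF \<kappa> ess_bounded_add[OF f g], of \<xi>]
      Bochner_Integration.integrable_add[OF wnorm_integrable[OF \<kappa> f, of \<xi>] wnorm_integrable[OF \<kappa> g, of \<xi>]]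
    by (intro integral_mono) (simp_all add: distrib_left mult_left_mono flip: distrib_left)
  also have "\<dots> = wnorm \<kappa> f \<xi> + wnorm \<kappa> g \<xi>"
    unfolding wnorm_def by (intro Bochner_Integration.integral_add wnorm_integrable \<kappa> f g)
  finally show ?thesis .
qed

text \<open>Together with \<open>wnorm_const\<close> this explains why the norm suits the initial
  angles: uniformly small functions and functions small in L1 are both small in it, uniformly in the
  centre.\<close>

lemma wnorm_le_L1:
  assumes \<kappa>: "0 < \<kappa>" and f: "integrable lborel f"
  shows "wnorm \<kappa> f \<xi> \<le> (LINT x|lborel. \<bar>f x\<bar>)"
  unfolding wnorm_def
proof (rule integral_mono')
  fix x
  have "exp (- \<kappa> * \<bar>\<xi> - x\<bar>) \<le> 1" using \<kappa> by simp
  from mult_right_mono[OF this, of "\<bar>f x\<bar>"]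
  show "exp (- \<kappa> * \<bar>\<xi> - x\<bar>) * \<bar>f x\<bar> \<le> \<bar>f x\<bar>" by simp
qed (use f in auto)

subsection \<open>Convergence of the initial angles\<close>

text \<open>Uniform continuity up to an exceptional function that is small in \<open>L\<^sup>1\<close>: it replaces the
  density of the continuous functions with compact support.\<close>

lemma L2_uniformly_continuous_approx:
  fixes \<omega> :: "real \<Rightarrow> real"
  assumes [measurable]: "\<omega> \<in> borel_measurable borel" and C: "\<And>x. \<bar>\<omega> x\<bar> \<le> C"
    and \<omega>2: "integrable lborel (\<lambda>x. (\<omega> x)\<^sup>2)" and "0 < e"
  obtains F K d where "F \<in> borel_measurable borel" "\<And>x. 0 \<le> F x" "\<And>x. F x \<le> K"
    "integrable lborel F" "(LINT x|lborel. F x) \<le> e" "0 < d"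
    "\<And>x y. \<bar>x - y\<bar> < d \<Longrightarrow> \<bar>\<omega> x - \<omega> y\<bar> \<le> e + F x + F y"
proof -
  have C0: "0 \<le> C" using C[of 0] by linarith
  \<comment> \<open>Beyond radius R both values are estimated separately by c plus their square over
    c, so that the two constants add up to \<open>e\<close> and the squares go into the exceptional
    function.\<close>
  define c where "c = e / 2"
  have c: "0 < c" using \<open>0 < e\<close> by (simp add: c_def)
  have ce: "0 < c * (e / 2)" using c \<open>0 < e\<close> by simp
  obtain R where R: "0 < R" "(LINT x:{x. R < \<bar>x\<bar>}|lborel. \<bar>(\<omega> x)\<^sup>2\<bar>) < c * (e / 2)"
    by (rule integrable_tail_small[OF \<omega>2 ce])
  \<comment> \<open>By the definition of \<open>measurable_on\<close> this provides continuous
    functions converging to \<omega> off a negligible set. Truncating them at height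
    \<open>C\<close> makes dominated convergence available.\<close>
  have "\<omega> measurable_on UNIV"
    by (intro lebesgue_measurable_imp_measurable_on measurable_completion) auto
  then obtain N g where N: "negligible N" and g: "\<And>n. continuous_on UNIV (g n)"
    and lim: "\<And>x. x \<notin> N \<Longrightarrow> (\<lambda>n. g n x) \<longlonglongrightarrow> \<omega> x"
    unfolding measurable_on_def by (auto simp del: One_nat_def)
  define \<phi> where "\<phi> = (\<lambda>n x. max (- C) (min C (g n x)))"
  have \<phi>c: "continuous_on UNIV (\<phi> n)" for n
    unfolding \<phi>_def by (intro continuous_intros g)
  have [measurable]: "\<phi> n \<in> borel_measurable borel" for n
    by (rule borel_measurable_continuous_onI[OF \<phi>c])
  have \<phi>b: "\<bar>\<phi> n x\<bar> \<le> C" for n x using C0 by (auto simp: \<phi>_def)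
  \<comment> \<open>The radius R + 2 leaves room: if \<bar>x\<bar> is at most R + 1 and y is nearer
    to x than 1, both points lie in the window.\<close>
  let ?J = "{- (R + 2)..R + 2}"
  have "(\<lambda>n. LINT x|lborel. indicator ?J x * \<bar>\<omega> x - \<phi> n x\<bar>) \<longlonglongrightarrow> (LINT x|lborel. indicator ?J x * \<bar>\<omega> x - \<omega> x\<bar>)"
  proof (rule integral_dominated_convergence[where w = "\<lambda>x. indicator ?J x * (2 * C)"])
    have "AE x in lebesgue. x \<notin> N"
      using N by (intro AE_not_in) (simp add: negligible_iff_null_sets)
    then have "AE x in lborel. x \<notin> N" unfolding AE_completion_iff .
    then show "AE x in lborel. (\<lambda>n. indicator ?J x * \<bar>\<omega> x - \<phi> n x\<bar>) \<longlonglongrightarrow> indicator ?J x * \<bar>\<omega> x - \<omega> x\<bar>"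
    proof (rule eventually_mono)
      fix x assume "x \<notin> N"
      then have "(\<lambda>n. \<phi> n x) \<longlonglongrightarrow> max (- C) (min C (\<omega> x))"
        unfolding \<phi>_def by (intro tendsto_intros lim)
      moreover have "max (- C) (min C (\<omega> x)) = \<omega> x" using C[of x] by auto
      ultimately show "(\<lambda>n. indicator ?J x * \<bar>\<omega> x - \<phi> n x\<bar>) \<longlonglongrightarrow> indicator ?J x * \<bar>\<omega> x - \<omega> x\<bar>"
        by (intro tendsto_intros) simp
    qed
    show "integrable lborel (\<lambda>x. indicator ?J x * (2 * C))"
      by (intro integrable_mult_left integrable_real_indicator) (auto simp: emeasure_lborel_Icc_eq)
    show "AE x in lborel. norm (indicator ?J x * \<bar>\<omega> x - \<phi> n x\<bar>) \<le> indicator ?J x * (2 * C)" for n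
    proof (intro AE_I2)
      fix x
      have "\<bar>\<omega> x - \<phi> n x\<bar> \<le> 2 * C" using C[of x] \<phi>b[of n x] by linarith
      then show "norm (indicator ?J x * \<bar>\<omega> x - \<phi> n x\<bar>) \<le> indicator ?J x * (2 * C)"
        by (simp add: indicator_def)
    qed
  qed measurable
  then have "\<forall>\<^sub>F n in sequentially. (LINT x|lborel. indicator ?J x * \<bar>\<omega> x - \<phi> n x\<bar>) < e / 2"
    using \<open>0 < e\<close> by (intro order_tendstoD(2)) auto
  then obtain n where n: "(LINT x|lborel. indicator ?J x * \<bar>\<omega> x - \<phi> n x\<bar>) < e / 2"
    using eventually_happens trivial_limit_sequentially by blast
  have "uniformly_continuous_on ?J (\<phi> n)"
    by (intro compact_uniformly_continuous continuous_on_subset[OF \<phi>c]) auto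
  then obtain d0 where d0: "0 < d0"
    "\<And>x y. x \<in> ?J \<Longrightarrow> y \<in> ?J \<Longrightarrow> \<bar>y - x\<bar> < d0 \<Longrightarrow> \<bar>\<phi> n y - \<phi> n x\<bar> < e"
    using \<open>0 < e\<close> unfolding uniformly_continuous_on_def dist_real_def by metis
  \<comment> \<open>The exceptional function is G + H: the error of the continuous approximation
    inside the window, and the rescaled square of \<omega> on the tails.\<close>
  define G where "G = (\<lambda>x. indicator ?J x * \<bar>\<omega> x - \<phi> n x\<bar>)"
  define H where "H = (\<lambda>x. indicator {x. R < \<bar>x\<bar>} x * \<bar>(\<omega> x)\<^sup>2\<bar> / c)"
  have [measurable]: "G \<in> borel_measurable borel" "H \<in> borel_measurable borel"
    unfolding G_def H_def by measurable
  have G: "0 \<le> G x" "G x \<le> 2 * C" for x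
    using C[of x] \<phi>b[of n x] C0 by (auto simp: G_def indicator_def)
  have H: "0 \<le> H x" "H x \<le> C\<^sup>2 / c" for x
  proof -
    show "0 \<le> H x" using c by (auto simp: H_def)
    have "(\<omega> x)\<^sup>2 \<le> C\<^sup>2" using power_mono[OF C[of x], of 2] by simp
    then have "indicator {x. R < \<bar>x\<bar>} x * \<bar>(\<omega> x)\<^sup>2\<bar> \<le> C\<^sup>2" by (simp add: indicator_def)
    then show "H x \<le> C\<^sup>2 / c" unfolding H_def using c by (intro divide_right_mono) auto
  qed
  have Gi: "integrable lborel G"
  proof (rule Bochner_Integration.integrable_bound[of _ "\<lambda>x. indicator ?J x * (2 * C)"])
    show "integrable lborel (\<lambda>x. indicator ?J x * (2 * C))"
      by (intro integrable_mult_left integrable_real_indicator) (auto simp: emeasure_lborel_Icc_eq)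
    show "AE x in lborel. norm (G x) \<le> norm (indicator ?J x * (2 * C))"
    proof (intro AE_I2)
      fix x
      show "norm (G x) \<le> norm (indicator ?J x * (2 * C))"
      proof (cases "x \<in> ?J")
        case True
        then have "indicator ?J x = (1::real)" by (rule indicator_eq_1_iff[THEN iffD2])
        then show ?thesis using G[of x] C0 by (simp only: real_norm_def mult_1 abs_of_nonneg)
      qed (simp add: G_def)
    qed
  qed measurable
  have Hi: "integrable lborel H"
    using integrable_divide[OF set_integrable_UNIV_subset[OF integrable_abs[OF \<omega>2], of "{x. R < \<bar>x\<bar>}", unfolded set_integrable_def], of c]
    by (simp add: H_def)
  show ?thesis
  proof (rule that[of "\<lambda>x. G x + H x" "2 * C + C\<^sup>2 / c" "min d0 1"])
    show "0 \<le> G x + H x" "G x + H x \<le> 2 * C + C\<^sup>2 / c" for x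
      using G[of x] H[of x] by auto
    show "integrable lborel (\<lambda>x. G x + H x)" using Gi Hi by auto
    have "(LINT x|lborel. H x) = (LINT x:{x. R < \<bar>x\<bar>}|lborel. \<bar>(\<omega> x)\<^sup>2\<bar>) / c"
      by (simp add: H_def set_lebesgue_integral_def)
    also have "\<dots> \<le> e / 2" using R c by (simp add: field_simps)
    finally have "(LINT x|lborel. H x) \<le> e / 2" .
    moreover have "(LINT x|lborel. G x) \<le> e / 2" using n unfolding G_def by simp
    ultimately show "(LINT x|lborel. G x + H x) \<le> e" using Gi Hi by simp
    show "0 < min d0 1" using d0 by simp
    fix x y :: real assume xy: "\<bar>x - y\<bar> < min d0 1"
    show "\<bar>\<omega> x - \<omega> y\<bar> \<le> e + (G x + H x) + (G y + H y)"
    proof (cases "\<bar>x\<bar> \<le> R + 1")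
      case True
      then have J: "x \<in> ?J" "y \<in> ?J" using xy by auto
      then have "\<bar>\<phi> n x - \<phi> n y\<bar> < e" using d0(2)[of y x] xy by auto
      moreover have "G x = \<bar>\<omega> x - \<phi> n x\<bar>" "G y = \<bar>\<omega> y - \<phi> n y\<bar>" using J by (auto simp: G_def)
      ultimately show ?thesis using H(1)[of x] H(1)[of y] by linarith
    next
      case False
      then have "R < \<bar>x\<bar>" "R < \<bar>y\<bar>" using xy by auto
      then have "H x = (\<omega> x)\<^sup>2 / c" "H y = (\<omega> y)\<^sup>2 / c" by (auto simp: H_def)
      then have "\<bar>\<omega> x\<bar> \<le> c + H x" "\<bar>\<omega> y\<bar> \<le> c + H y"
        using abs_le_add_square_div[OF c] by auto
      then show ?thesis using G(1)[of x] G(1)[of y] by (simp add: c_def)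
    qed
  qed measurable
qed

lemma integrable_upper_tail_small:
  fixes h :: "real \<Rightarrow> real"
  assumes h: "integrable lborel h" and h0: "\<And>x. 0 \<le> h x" and "0 < e"
  obtains M where "0 < M" "(LINT x|lborel. (if M < h x then h x else 0)) < e"
proof -
  have [measurable]: "h \<in> borel_measurable borel" using h by (simp add: borel_measurable_integrable)
  have "(\<lambda>n. LINT x|lborel. (if real n < h x then h x else 0)) \<longlonglongrightarrow> integral\<^sup>L lborel (\<lambda>_::real. 0::real)"
  proof (rule integral_dominated_convergence[where w = h])
    show "AE x in lborel. (\<lambda>n. if real n < h x then h x else 0) \<longlonglongrightarrow> 0"
    proof (intro AE_I2 tendsto_eventually)
      fix x
      obtain N :: nat where N: "h x \<le> real N" using real_arch_simple by blast
      show "\<forall>\<^sub>F n in sequentially. (if real n < h x then h x else 0) = 0"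
        by (rule eventually_mono[OF eventually_ge_at_top[of N]]) (use N in auto)
    qed
    show "AE x in lborel. norm (if real n < h x then h x else 0) \<le> h x" for n
      using h0 by (intro AE_I2) auto
  qed (use h in auto)
  then have "\<forall>\<^sub>F n in sequentially. (LINT x|lborel. (if real n < h x then h x else 0)) < e"
    using \<open>0 < e\<close> by (intro order_tendstoD(2)) auto
  then obtain N where "\<And>n. N \<le> n \<Longrightarrow> (LINT x|lborel. (if real n < h x then h x else 0)) < e"
    unfolding eventually_sequentially by blast
  from this[of "Suc N"] show ?thesis by (intro that[of "real (Suc N)"]) (simp_all del: of_nat_Suc)
qed

text \<open>Substitute with the density 1 + k and write it as (1 + h) + (k - h). The first part,
  substituted back with the density of \<open>h\<close>, gives exactly the integral of
  \<open>F\<close>; the second is bounded through F \<le> K.\<close>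

lemma composition_L1_bound:
  fixes F :: "real \<Rightarrow> real"
  assumes h: "excess_density h" and k: "excess_density k"
    and [measurable]: "F \<in> borel_measurable borel" and F: "\<And>x. 0 \<le> F x" "\<And>x. F x \<le> K" "integrable lborel F"
  shows "integrable lborel (\<lambda>\<xi>. F (excess_density.cumul h (excess_density.lag k \<xi>)))"
    and "(LINT \<xi>|lborel. F (excess_density.cumul h (excess_density.lag k \<xi>)))
      \<le> (LINT x|lborel. F x) + K * (LINT x|lborel. \<bar>k x - h x\<bar>)"
proof -
  interpret H: excess_density h by fact
  interpret K: excess_density k by fact
  have [measurable]: "H.cumul \<in> borel_measurable borel"
    by (rule borel_measurable_continuous_onI[OF H.cumul_continuous])
  let ?G = "\<lambda>x. F (H.cumul x)"
  have i1: "integrable lborel (\<lambda>x. (1 + h x) * ?G x)"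
    using H.lag_substitution(1)[of ?G] F(3) by simp
  have e1: "(LINT x|lborel. (1 + h x) * ?G x) = (LINT x|lborel. F x)"
    using H.lag_substitution(2)[of ?G] by simp
  have i0: "integrable lborel (\<lambda>x. k x - h x)"
    using H.h_integrable K.h_integrable by auto
  have i2: "integrable lborel (\<lambda>x. (k x - h x) * ?G x)"
    by (rule Bochner_Integration.integrable_bound[OF integrable_mult_right[OF i0, of K]])
       (use F in \<open>auto intro!: AE_I2 mult_mono order_trans[OF F(2) abs_ge_self] simp: abs_mult mult.commute[of "\<bar>K\<bar>"]\<close>)
  have e: "(1 + k x) * ?G x = (1 + h x) * ?G x + (k x - h x) * ?G x" for x by (simp add: algebra_simps)
  have "integrable lborel (\<lambda>x. (1 + k x) * ?G x)"
    unfolding e using i1 i2 by (rule Bochner_Integration.integrable_add)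
  then show "integrable lborel (\<lambda>\<xi>. ?G (K.lag \<xi>))"
    using K.lag_substitution(1)[of ?G] by simp
  have "(LINT \<xi>|lborel. ?G (K.lag \<xi>)) = (LINT x|lborel. F x) + (LINT x|lborel. (k x - h x) * ?G x)"
    using K.lag_substitution(2)[of ?G] Bochner_Integration.integral_add[OF i1 i2] e1 unfolding e by simp
  also have "(LINT x|lborel. (k x - h x) * ?G x) \<le> (LINT x|lborel. K * \<bar>k x - h x\<bar>)"
  proof (rule integral_mono[OF i2])
    fix x
    have "(k x - h x) * ?G x \<le> \<bar>k x - h x\<bar> * ?G x" using F by (intro mult_right_mono) auto
    also have "\<dots> \<le> \<bar>k x - h x\<bar> * K" using F by (intro mult_left_mono) auto
    finally show "(k x - h x) * ?G x \<le> K * \<bar>k x - h x\<bar>" by (simp add: mult.commute)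
  qed (use i0 in auto)
  finally show "(LINT \<xi>|lborel. ?G (K.lag \<xi>)) \<le> (LINT x|lborel. F x) + K * (LINT x|lborel. \<bar>k x - h x\<bar>)"
    by simp
qed

lemma arctan_lipschitz: "\<bar>arctan x - arctan y\<bar> \<le> \<bar>x - y\<bar>"
proof -
  have *: "arctan b - arctan a \<le> b - a" if ab: "a < b" for a b :: real
  proof -
    obtain z where "arctan b - arctan a = (b - a) * inverse (1 + z\<^sup>2)"
      using MVT2[OF ab, of arctan "\<lambda>x. inverse (1 + x\<^sup>2)"] DERIV_arctan by auto
    moreover have "inverse (1 + z\<^sup>2) \<le> 1" by (simp add: inverse_le_1_iff)
    ultimately show ?thesis using ab mult_left_mono[of "inverse (1 + z\<^sup>2)" 1 "b - a"] by simp
  qed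
  consider "x = y" | "x < y" | "y < x" by linarith
  then show ?thesis
  proof cases
    case 2
    then show ?thesis using *[OF 2] arctan_monotone[OF 2] by simp
  next
    case 3
    then show ?thesis using *[OF 3] arctan_monotone[OF 3] by simp
  qed simp
qed

lemma two_arctan_bounds:
  "\<bar>2 * arctan x\<bar> \<le> pi" "\<bar>2 * arctan x - 2 * arctan y\<bar> \<le> 2 * pi"
  "\<bar>2 * arctan x - 2 * arctan y\<bar> \<le> 2 * \<bar>x - y\<bar>"
proof -
  show "\<bar>2 * arctan x\<bar> \<le> pi" "\<bar>2 * arctan x - 2 * arctan y\<bar> \<le> 2 * pi"
    using arctan_bounded[of x] arctan_bounded[of y] by linarith+
  have "\<bar>2 * arctan x - 2 * arctan y\<bar> = 2 * \<bar>arctan x - arctan y\<bar>"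
    by (simp only: right_diff_distrib[symmetric] abs_mult abs_numeral)
  then show "\<bar>2 * arctan x - 2 * arctan y\<bar> \<le> 2 * \<bar>x - y\<bar>"
    using arctan_lipschitz[of x y] by simp
qed

text \<open>The difference is split at the point \<open>lag (hn n) \<eta>\<close>. There the change
  of the function, \<Delta>, is small in L2 after substitution. What remains is one fixed function
  \<omega> evaluated at the labels \<theta> and \<eta> of nearby points, which is small by uniform
  continuity up to an L1-small exception.\<close>

lemma arctan_lag_tendsto:
  fixes a h :: "real \<Rightarrow> real" and an hn :: "nat \<Rightarrow> real \<Rightarrow> real"
  assumes h: "excess_density h" and hn: "\<And>n. excess_density (hn n)"
    and hlim: "(\<lambda>n. LINT x|lborel. \<bar>hn n x - h x\<bar>) \<longlonglongrightarrow> 0"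
    and am: "a \<in> borel_measurable borel" "\<And>n. an n \<in> borel_measurable borel"
    and a2: "integrable lborel (\<lambda>x. (a x)\<^sup>2)" "\<And>n. integrable lborel (\<lambda>x. (an n x)\<^sup>2)"
    and alim: "(\<lambda>n. LINT x|lborel. (an n x - a x)\<^sup>2) \<longlonglongrightarrow> 0"
    and \<kappa>: "0 < \<kappa>" and \<epsilon>: "0 < \<epsilon>"
  shows "\<forall>\<^sub>F n in sequentially. \<forall>\<xi>. wnorm \<kappa> (\<lambda>\<eta>. 2 * arctan (an n (excess_density.lag (hn n) \<eta>))
    - 2 * arctan (a (excess_density.lag h \<eta>))) \<xi> \<le> \<epsilon>"
proof -
  interpret H: excess_density h by fact
  note [measurable] = am
  have hm[measurable]: "hn n \<in> borel_measurable borel" "excess_density.lag (hn n) \<in> borel_measurable borel"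
    "H.cumul \<in> borel_measurable borel" for n
    using excess_density.h_measurable[OF hn] excess_density.lag_measurable[OF hn]
      borel_measurable_continuous_onI[OF H.cumul_continuous] by auto
  have di: "integrable lborel (\<lambda>x. (an n x - a x)\<^sup>2)" for n
    using integrable_power2_lincomb[OF a2(2)[of n] a2(1), of 1 "-1"] by simp
  have hi: "integrable lborel (\<lambda>x. \<bar>hn n x - h x\<bar>)" for n
    using H.h_integrable excess_density.h_integrable[OF hn[of n]] by auto
  \<comment> \<open>The total is 2 e (2/\<kappa>) from the uniform part plus 4 e from the L1 part,
    that is, at most \<epsilon>/2 + \<epsilon>/4.\<close>
  define e where "e = min (\<epsilon> / 8 * \<kappa>) (\<epsilon> / 16)"
  have e: "0 < e" "e * (2 / \<kappa>) \<le> \<epsilon> / 4" "e \<le> \<epsilon> / 16"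
    using \<kappa> \<epsilon> by (auto simp: e_def min_def field_simps)

  define \<omega> where "\<omega> = (\<lambda>\<eta>. 2 * arctan (a (H.lag \<eta>)))"
  have \<omega>m[measurable]: "\<omega> \<in> borel_measurable borel" unfolding \<omega>_def by measurable
  have \<omega>2: "integrable lborel (\<lambda>\<eta>. (\<omega> \<eta>)\<^sup>2)"
  proof -
    have b: "(2 * arctan x)\<^sup>2 \<le> 4 * x\<^sup>2" "(2 * arctan x)\<^sup>2 \<le> pi\<^sup>2" for x :: real
      using power_mono[OF two_arctan_bounds(3)[of x 0], of 2] power_mono[OF two_arctan_bounds(1)[of x], of 2]
      by (auto simp: power_mult_distrib)
    have "integrable lborel (\<lambda>x. (1 + h x) * (2 * arctan (a x))\<^sup>2)"
    proof (rule Bochner_Integration.integrable_bound[of _ "\<lambda>x. 4 * (a x)\<^sup>2 + pi\<^sup>2 * h x"])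
      show "integrable lborel (\<lambda>x. 4 * (a x)\<^sup>2 + pi\<^sup>2 * h x)"
        using a2 H.h_integrable by auto
      have "(1 + h x) * (2 * arctan (a x))\<^sup>2 \<le> 4 * (a x)\<^sup>2 + pi\<^sup>2 * h x" for x
        using b(1)[of "a x"] mult_left_mono[OF b(2)[of "a x"] H.h_nonneg[of x]]
        unfolding distrib_right mult_1 mult.commute[of "pi\<^sup>2"] by linarith
      then show "AE x in lborel. norm ((1 + h x) * (2 * arctan (a x))\<^sup>2) \<le> norm (4 * (a x)\<^sup>2 + pi\<^sup>2 * h x)"
        using H.h_nonneg by (intro AE_I2) (simp add: abs_mult)
    qed measurable
    then show ?thesis
      using H.lag_substitution(1)[of "\<lambda>x. (2 * arctan (a x))\<^sup>2"] by (simp add: \<omega>_def)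
  qed
  obtain F K d where Fm[measurable]: "F \<in> borel_measurable borel" and F: "\<And>x. 0 \<le> F x" "\<And>x. F x \<le> K"
    "integrable lborel F" "(LINT x|lborel. F x) \<le> e" and d: "0 < d"
    "\<And>x y. \<bar>x - y\<bar> < d \<Longrightarrow> \<bar>\<omega> x - \<omega> y\<bar> \<le> e + F x + F y"
    by (rule L2_uniformly_continuous_approx[OF \<omega>m _ \<omega>2 e(1), of pi])
       (use two_arctan_bounds(1) in \<open>auto simp: \<omega>_def\<close>)
  have K0: "0 \<le> K" using F(1,2)[of 0] by linarith
  define \<theta> where "\<theta> = (\<lambda>n \<eta>. H.cumul (excess_density.lag (hn n) \<eta>))"
  have [measurable]: "\<theta> n \<in> borel_measurable borel" for n unfolding \<theta>_def by measurable

  define \<Delta> where "\<Delta> = (\<lambda>n x. 2 * arctan (an n x) - 2 * arctan (a x))"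
  have [measurable]: "\<Delta> n \<in> borel_measurable borel" for n unfolding \<Delta>_def by measurable
  \<comment> \<open>The weight \<open>h\<close> may be unbounded, whereas \<open>an n - a\<close> is
    small only in L2 without weight. Below height \<open>M\<close> the weight is estimated by
    \<open>M\<close>; above it \<Delta>^2 is estimated by 4 pi^2, and this tail contributes less
    than e^2.\<close>
  obtain M where M: "0 < M" "(LINT x|lborel. (if M < h x then h x else 0)) < e * e / (4 * pi\<^sup>2)"
    by (rule integrable_upper_tail_small[OF H.h_integrable H.h_nonneg, of "e * e / (4 * pi\<^sup>2)"]) (use e in auto)
  let ?tail = "\<lambda>x. if M < h x then h x else 0"
  have tail_i: "integrable lborel ?tail"
    by (rule Bochner_Integration.integrable_bound[OF H.h_integrable]) (use H.h_nonneg in auto)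
  have \<Delta>2: "(\<Delta> n x)\<^sup>2 \<le> 4 * (an n x - a x)\<^sup>2" "(\<Delta> n x)\<^sup>2 \<le> 4 * pi\<^sup>2" for n x
    using power_mono[OF two_arctan_bounds(3)[of "an n x" "a x"], of 2] power_mono[OF two_arctan_bounds(2)[of "an n x" "a x"], of 2]
    by (auto simp: power_mult_distrib \<Delta>_def)
  \<comment> \<open>Three errors in the integral of (1 + hn) \<Delta>^2: the L2 distance of the
    functions on the set of bounded density, the part of \<open>h\<close> above \<open>M\<close>,
    and the replacement of \<open>hn n\<close> by \<open>h\<close>.\<close>
  let ?B = "\<lambda>n x. 4 * (1 + M) * (an n x - a x)\<^sup>2 + 4 * pi\<^sup>2 * ?tail x + 4 * pi\<^sup>2 * \<bar>hn n x - h x\<bar>"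
  have B_i: "integrable lborel (?B n)" for n
    using di hi tail_i by (intro Bochner_Integration.integrable_add integrable_mult_right)
  have B: "(1 + hn n x) * (\<Delta> n x)\<^sup>2 \<le> ?B n x" for n x
  proof -
    have "(1 + hn n x) * (\<Delta> n x)\<^sup>2 = (\<Delta> n x)\<^sup>2 + h x * (\<Delta> n x)\<^sup>2 + (hn n x - h x) * (\<Delta> n x)\<^sup>2"
      by (simp add: algebra_simps)
    also have "(hn n x - h x) * (\<Delta> n x)\<^sup>2 \<le> \<bar>hn n x - h x\<bar> * (4 * pi\<^sup>2)"
      using \<Delta>2(2)[of n x] by (intro mult_mono) auto
    also have "h x * (\<Delta> n x)\<^sup>2 \<le> M * (4 * (an n x - a x)\<^sup>2) + ?tail x * (4 * pi\<^sup>2)"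
    proof (cases "M < h x")
      case True
      then have "h x * (\<Delta> n x)\<^sup>2 \<le> ?tail x * (4 * pi\<^sup>2)"
        using \<Delta>2(2)[of n x] H.h_nonneg by (simp add: mult_left_mono)
      then show ?thesis using M by (meson add_increasing mult_nonneg_nonneg less_imp_le zero_le_numeral zero_le_power2)
    next
      case False
      then have "h x * (\<Delta> n x)\<^sup>2 \<le> M * (4 * (an n x - a x)\<^sup>2)"
        using \<Delta>2(1)[of n x] H.h_nonneg M by (intro mult_mono) auto
      then show ?thesis using False by simp
    qed
    also note \<Delta>2(1)[of n x]
    finally show ?thesis by (simp add: algebra_simps)
  qed
  have \<Delta>i: "integrable lborel (\<lambda>x. (1 + hn n x) * (\<Delta> n x)\<^sup>2)" for n
  proof (rule Bochner_Integration.integrable_bound[OF B_i[of n]])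
    show "AE x in lborel. norm ((1 + hn n x) * (\<Delta> n x)\<^sup>2) \<le> norm (?B n x)"
    proof (intro AE_I2)
      fix x
      have "0 \<le> (1 + hn n x) * (\<Delta> n x)\<^sup>2" using excess_density.h_nonneg[OF hn, of n x] by simp
      then show "norm ((1 + hn n x) * (\<Delta> n x)\<^sup>2) \<le> norm (?B n x)"
        using B[of n x] unfolding real_norm_def by linarith
    qed
  qed measurable
  have \<Delta>lag_i: "integrable lborel (\<lambda>\<eta>. (\<Delta> n (excess_density.lag (hn n) \<eta>))\<^sup>2)" for n
    using excess_density.lag_substitution(1)[OF hn, of "\<lambda>x. (\<Delta> n x)\<^sup>2" n] \<Delta>i by simp

  have "(\<lambda>n. 4 * (1 + M) * (LINT x|lborel. (an n x - a x)\<^sup>2) + 4 * pi\<^sup>2 * (LINT x|lborel. ?tail x)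
      + 4 * pi\<^sup>2 * (LINT x|lborel. \<bar>hn n x - h x\<bar>))
    \<longlonglongrightarrow> 4 * (1 + M) * 0 + 4 * pi\<^sup>2 * (LINT x|lborel. ?tail x) + 4 * pi\<^sup>2 * 0"
    by (intro tendsto_intros alim hlim)
  moreover have "4 * (1 + M) * 0 + 4 * pi\<^sup>2 * (LINT x|lborel. ?tail x) + 4 * pi\<^sup>2 * 0 < e * e"
    using M(2) by (simp add: field_simps)
  ultimately have ev1: "\<forall>\<^sub>F n in sequentially. 4 * (1 + M) * (LINT x|lborel. (an n x - a x)\<^sup>2)
      + 4 * pi\<^sup>2 * (LINT x|lborel. ?tail x) + 4 * pi\<^sup>2 * (LINT x|lborel. \<bar>hn n x - h x\<bar>) < e * e"
    by (rule order_tendstoD(2))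
  have "(\<lambda>n. 2 * (LINT x|lborel. \<bar>hn n x - h x\<bar>)) \<longlonglongrightarrow> 2 * 0" by (intro tendsto_intros hlim)
  then have ev2: "\<forall>\<^sub>F n in sequentially. 2 * (LINT x|lborel. \<bar>hn n x - h x\<bar>) < d"
    using d(1) by (intro order_tendstoD(2)) auto
  have "(\<lambda>n. K * (LINT x|lborel. \<bar>hn n x - h x\<bar>)) \<longlonglongrightarrow> K * 0" by (intro tendsto_intros hlim)
  then have ev3: "\<forall>\<^sub>F n in sequentially. K * (LINT x|lborel. \<bar>hn n x - h x\<bar>) < e"
    using e(1) by (intro order_tendstoD(2)) auto

  show ?thesis
    using ev1 ev2 ev3
  proof eventually_elim
    case (elim n)
    show ?case
    proof (intro allI)
      fix \<xi>
      let ?L = "excess_density.lag (hn n)"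
      let ?A = "\<lambda>\<eta>. (\<Delta> n (?L \<eta>))\<^sup>2 / e" and ?C = "\<lambda>\<eta>. F (\<theta> n \<eta>) + F \<eta>"
      have A_i: "integrable lborel ?A" using \<Delta>lag_i by auto
      have "(LINT \<eta>|lborel. (\<Delta> n (?L \<eta>))\<^sup>2) = (LINT x|lborel. (1 + hn n x) * (\<Delta> n x)\<^sup>2)"
        using excess_density.lag_substitution(2)[OF hn, of "\<lambda>x. (\<Delta> n x)\<^sup>2" n] by simp
      also have "\<dots> \<le> (LINT x|lborel. ?B n x)" by (rule integral_mono[OF \<Delta>i B_i B])
      also have "\<dots> = 4 * (1 + M) * (LINT x|lborel. (an n x - a x)\<^sup>2)
        + 4 * pi\<^sup>2 * (LINT x|lborel. ?tail x) + 4 * pi\<^sup>2 * (LINT x|lborel. \<bar>hn n x - h x\<bar>)"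
      proof -
        note i1 = integrable_mult_right[OF di[of n], of "4 * (1 + M)"]
          and i2 = integrable_mult_right[OF tail_i, of "4 * pi\<^sup>2"]
          and i3 = integrable_mult_right[OF hi[of n], of "4 * pi\<^sup>2"]
        show ?thesis
          by (simp only: Bochner_Integration.integral_add[OF Bochner_Integration.integrable_add[OF i1 i2] i3]
              Bochner_Integration.integral_add[OF i1 i2] integral_mult_right_zero)
      qed
      finally have "(LINT \<eta>|lborel. (\<Delta> n (?L \<eta>))\<^sup>2) \<le> e * e" using elim(1) by linarith
      then have A: "(LINT \<eta>|lborel. ?A \<eta>) \<le> e" using e(1) by (simp add: field_simps)
      have C_i: "integrable lborel ?C" 
        unfolding \<theta>_def using composition_L1_bound(1)[OF h hn Fm F(1-3)] F(3) by (rule Bochner_Integration.integrable_add)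
      have "(LINT \<eta>|lborel. ?C \<eta>) = (LINT \<eta>|lborel. F (\<theta> n \<eta>)) + (LINT \<eta>|lborel. F \<eta>)"
        unfolding \<theta>_def using composition_L1_bound(1)[OF h hn Fm F(1-3)] F(3) by (rule Bochner_Integration.integral_add)
      also have "\<dots> \<le> 3 * e"
        using composition_L1_bound(2)[OF h hn Fm F(1-3), of n] F(4) elim(3) unfolding \<theta>_def by linarith
      finally have C: "(LINT \<eta>|lborel. ?C \<eta>) \<le> 3 * e" .
      have pt: "\<bar>2 * arctan (an n (?L \<eta>)) - 2 * arctan (a (H.lag \<eta>))\<bar> \<le> \<bar>2 * e + (?A \<eta> + ?C \<eta>)\<bar>" for \<eta>
      proof -
        \<comment> \<open>The label \<theta> is defined so that \<omega> at \<theta> equals 2 arctan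
          of \<open>a\<close> at \<open>lag (hn n) \<eta>\<close>; this makes the splitting below an
          identity.\<close>
        have "\<bar>\<theta> n \<eta> - \<eta>\<bar> \<le> 2 * (LINT x|lborel. \<bar>h x - hn n x\<bar>)"
          unfolding \<theta>_def by (rule cumul_lag_dist[OF h hn])
        also have "\<dots> < d" using elim(2) by (simp add: abs_minus_commute)
        finally have "\<bar>\<omega> (\<theta> n \<eta>) - \<omega> \<eta>\<bar> \<le> e + F (\<theta> n \<eta>) + F \<eta>" by (rule d(2))
        moreover have "\<bar>\<Delta> n (?L \<eta>)\<bar> \<le> e + ?A \<eta>" by (rule abs_le_add_square_div[OF e(1)])
        moreover have "2 * arctan (an n (?L \<eta>)) - 2 * arctan (a (H.lag \<eta>))
          = \<Delta> n (?L \<eta>) + (\<omega> (\<theta> n \<eta>) - \<omega> \<eta>)"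
          by (simp add: \<Delta>_def \<omega>_def \<theta>_def)
        ultimately show ?thesis by linarith
      qed
      have AC: "integrable lborel (\<lambda>\<eta>. ?A \<eta> + ?C \<eta>)" using A_i C_i by (rule Bochner_Integration.integrable_add)
      have [measurable]: "?L \<in> borel_measurable borel" by measurable
      have "ess_bounded ?A"
        using \<Delta>2(2) e(1) by (intro ess_boundedI[of _ "4 * pi\<^sup>2 / e"] AE_I2) (auto simp: divide_right_mono)
      moreover have "ess_bounded ?C"
      proof (rule ess_boundedI[of _ "K + K"])
        show "AE x in lborel. \<bar>?C x\<bar> \<le> K + K"
        proof (intro AE_I2)
          show "\<bar>?C x\<bar> \<le> K + K" for x
            using F(1,2)[of x] F(1,2)[of "\<theta> n x"] by linarith
        qed
      qed measurable
      ultimately have ACb: "ess_bounded (\<lambda>\<eta>. ?A \<eta> + ?C \<eta>)" by (rule ess_bounded_add)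
      have "wnorm \<kappa> (\<lambda>\<eta>. 2 * arctan (an n (?L \<eta>)) - 2 * arctan (a (H.lag \<eta>))) \<xi>
        \<le> wnorm \<kappa> (\<lambda>\<eta>. 2 * e + (?A \<eta> + ?C \<eta>)) \<xi>"
        using pt by (intro wnorm_mono[OF \<kappa>] ess_bounded_add[OF ess_bounded_const ACb] AE_I2) measurable
      also have "\<dots> \<le> wnorm \<kappa> (\<lambda>\<eta>. 2 * e) \<xi> + wnorm \<kappa> (\<lambda>\<eta>. ?A \<eta> + ?C \<eta>) \<xi>"
        by (rule wnorm_triangle[OF \<kappa> ess_bounded_const ACb])
      also have "wnorm \<kappa> (\<lambda>\<eta>. 2 * e) \<xi> = 2 * (e * (2 / \<kappa>))" using wnorm_const[OF \<kappa>, of "2 * e" \<xi>] e(1) by simp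
      also have "wnorm \<kappa> (\<lambda>\<eta>. ?A \<eta> + ?C \<eta>) \<xi> \<le> (LINT \<eta>|lborel. \<bar>?A \<eta> + ?C \<eta>\<bar>)"
        by (rule wnorm_le_L1[OF \<kappa> AC])
      also have "(LINT \<eta>|lborel. \<bar>?A \<eta> + ?C \<eta>\<bar>) = (LINT \<eta>|lborel. ?A \<eta>) + (LINT \<eta>|lborel. ?C \<eta>)"
        using e(1) F(1) by (subst Bochner_Integration.integral_add[OF A_i C_i, symmetric]) (intro Bochner_Integration.integral_cong refl abs_of_nonneg add_nonneg_nonneg; simp)
      also have "\<dots> \<le> 4 * e" using A C by linarith
      finally show "wnorm \<kappa> (\<lambda>\<eta>. 2 * arctan (an n (?L \<eta>)) - 2 * arctan (a (H.lag \<eta>))) \<xi> \<le> \<epsilon>"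
        using e \<epsilon> by linarith
    qed
  qed
qed

subsection \<open>Lipschitz estimates for the right-hand side\<close>

lemma ess_bounded_set_integrable:
  assumes k: "ess_bounded k"
  shows "set_integrable lborel {a..b} k"
proof -
  obtain C where C: "AE x in lborel. \<bar>k x\<bar> \<le> C" using k by (auto simp: ess_bounded_def)
  have "set_integrable lborel {a..b} (\<lambda>_. C)"
    by (rule borel_integrable_atLeastAtMost') (intro continuous_intros)
  then show ?thesis
    by (rule set_integrable_bound)
       (use C k in \<open>auto simp: set_borel_measurable_def ess_bounded_def elim!: eventually_mono\<close>)
qed

lemma ess_bounded_interval_integrable:
  assumes "ess_bounded k"
  shows "interval_lebesgue_integrable lborel (ereal a) (ereal b) k"
proof -
  have "set_integrable lborel (einterval (ereal a) (ereal b)) k" for a b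
    by (rule set_integrable_subset[OF ess_bounded_set_integrable[OF assms, of a b]]) auto
  then show ?thesis by (simp add: interval_lebesgue_integrable_def)
qed

lemma interval_integral_split:
  assumes "ess_bounded k"
  shows "(LBINT s=ereal a..ereal b. k s) + (LBINT s=ereal b..ereal c. k s) = (LBINT s=ereal a..ereal c. k s)"
  by (rule interval_integral_sum)
     (use ess_bounded_interval_integrable[OF assms] in \<open>simp flip: ereal_min ereal_max\<close>)

lemma interval_integral_abs_le_set:
  assumes k: "ess_bounded k"
  shows "\<bar>LBINT s=ereal a..ereal b. k s\<bar> \<le> (LINT s:{min a b..max a b}|lborel. \<bar>k s\<bar>)"
proof -
  have *: "\<bar>LBINT s=ereal a..ereal b. k s\<bar> \<le> (LINT s:{a..b}|lborel. \<bar>k s\<bar>)" if "a \<le> b" for a b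
    using abs_set_integral_le[of lborel "{a..b}" k] that by (simp add: interval_integral_Icc)
  show ?thesis
  proof (cases "a \<le> b")
    case False
    then show ?thesis using *[of b a] interval_integral_endpoints_reverse[of "ereal a" "ereal b" k] by simp
  qed (use * in simp)
qed

lemma interval_integral_continuous:
  assumes k: "ess_bounded k"
  shows "continuous_on UNIV (\<lambda>\<eta>. LBINT s=ereal \<eta>..ereal \<xi>. k s)"
proof -
  obtain C where C: "AE x in lborel. \<bar>k x\<bar> \<le> C" using k by (auto simp: ess_bounded_def)
  define D where "D = \<bar>C\<bar>"
  have D: "AE x in lborel. \<bar>k x\<bar> \<le> D" "0 \<le> D" using C by (auto simp: D_def elim!: eventually_mono)
  have kb: "ess_bounded (\<lambda>s. \<bar>k s\<bar>)" using k by (auto simp: ess_bounded_def)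
  have le: "\<bar>LBINT s=ereal a..ereal b. k s\<bar> \<le> D * \<bar>a - b\<bar>" for a b
  proof -
    have "\<bar>LBINT s=ereal a..ereal b. k s\<bar> \<le> (LINT s:{min a b..max a b}|lborel. \<bar>k s\<bar>)"
      by (rule interval_integral_abs_le_set[OF k])
    also have "\<dots> \<le> (LINT s:{min a b..max a b}|lborel. D)"
      by (intro set_integral_mono_AE ess_bounded_set_integrable kb ess_bounded_const) (use D in \<open>auto elim!: eventually_mono\<close>)
    also have "\<dots> = D * \<bar>a - b\<bar>" by (auto simp: set_integral_const min_def max_def)
    finally show ?thesis .
  qed
  show ?thesis
  proof (rule continuous_onI)
    fix x e :: real assume e: "0 < e"
    show "\<exists>d>0. \<forall>x'\<in>UNIV. dist x' x < d \<longrightarrow>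
      dist (LBINT s=ereal x'..ereal \<xi>. k s) (LBINT s=ereal x..ereal \<xi>. k s) \<le> e"
    proof (intro exI[of _ "e / (D + 1)"] conjI ballI impI)
      show "0 < e / (D + 1)" using e D by simp
      fix x' assume "dist x' x < e / (D + 1)"
      then have "\<bar>x' - x\<bar> * (D + 1) \<le> e" using D by (simp add: dist_real_def pos_less_divide_eq)
      then have "D * \<bar>x' - x\<bar> \<le> e" using abs_ge_zero[of "x' - x"] unfolding distrib_left mult_1_right mult.commute[of D] by linarith
      then show "dist (LBINT s=ereal x'..ereal \<xi>. k s) (LBINT s=ereal x..ereal \<xi>. k s) \<le> e"
        using le[of x' x] interval_integral_split[OF k, of x' x \<xi>] by (simp add: dist_real_def)
    qed
  qed
qed

text \<open>A point s between \<eta> and \<xi> is nearer to \<xi> than \<eta> is, so its weight is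
  the larger one. Hence one unit of exponential decay pays for passing from an integral over an
  interval to the weighted norm.\<close>

lemma interval_integral_abs_le_wnorm:
  assumes \<kappa>: "0 < \<kappa>" and k: "ess_bounded k"
  shows "exp (- \<kappa> * \<bar>\<xi> - \<eta>\<bar>) * \<bar>LBINT s=ereal \<eta>..ereal \<xi>. k s\<bar> \<le> wnorm \<kappa> k \<xi>"
proof -
  let ?I = "{min \<eta> \<xi>..max \<eta> \<xi>}"
  have kb: "ess_bounded (\<lambda>s. \<bar>k s\<bar>)" using k by (auto simp: ess_bounded_def)
  have "exp (- \<kappa> * \<bar>\<xi> - \<eta>\<bar>) * \<bar>LBINT s=ereal \<eta>..ereal \<xi>. k s\<bar>
      \<le> exp (- \<kappa> * \<bar>\<xi> - \<eta>\<bar>) * (LINT s:?I|lborel. \<bar>k s\<bar>)"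
    by (intro mult_left_mono interval_integral_abs_le_set[OF k]) simp
  also have "\<dots> = (LINT s|lborel. exp (- \<kappa> * \<bar>\<xi> - \<eta>\<bar>) * (indicator ?I s *\<^sub>R \<bar>k s\<bar>))"
    unfolding set_lebesgue_integral_def by simp
  also have "\<dots> \<le> wnorm \<kappa> k \<xi>"
    unfolding wnorm_def
  proof (rule integral_mono)
    show "integrable lborel (\<lambda>s. exp (- \<kappa> * \<bar>\<xi> - \<eta>\<bar>) * (indicator ?I s *\<^sub>R \<bar>k s\<bar>))"
      using ess_bounded_set_integrable[OF kb, of "min \<eta> \<xi>" "max \<eta> \<xi>"] unfolding set_integrable_def
      by (rule integrable_mult_right)
    show "integrable lborel (\<lambda>\<eta>. exp (- \<kappa> * \<bar>\<xi> - \<eta>\<bar>) * \<bar>k \<eta>\<bar>)" by (rule wnorm_integrable[OF \<kappa> k])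
    fix s
    show "exp (- \<kappa> * \<bar>\<xi> - \<eta>\<bar>) * (indicator ?I s *\<^sub>R \<bar>k s\<bar>) \<le> exp (- \<kappa> * \<bar>\<xi> - s\<bar>) * \<bar>k s\<bar>"
    proof (cases "s \<in> ?I")
      case True
      then have "\<bar>\<xi> - s\<bar> \<le> \<bar>\<xi> - \<eta>\<bar>" by (auto simp: min_def max_def split: if_splits)
      then have "exp (- \<kappa> * \<bar>\<xi> - \<eta>\<bar>) \<le> exp (- \<kappa> * \<bar>\<xi> - s\<bar>)" using \<kappa> by simp
      then have "exp (- \<kappa> * \<bar>\<xi> - \<eta>\<bar>) * \<bar>k s\<bar> \<le> exp (- \<kappa> * \<bar>\<xi> - s\<bar>) * \<bar>k s\<bar>" by (rule mult_right_mono) simp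
      moreover have "indicator ?I s = (1::real)" using True by (rule indicator_eq_1_iff[THEN iffD2])
      ultimately show ?thesis by (simp only: real_scaleR_def mult_1)
    next
      case False
      then have "indicator ?I s = (0::real)" by (rule indicator_eq_0_iff[THEN iffD2])
      then show ?thesis by (simp only: real_scaleR_def) simp
    qed
  qed
  finally show ?thesis .
qed

text \<open>Each unit interval contributes at most exp \<kappa> times \<open>B\<close>; the summand
  1 comes from rounding the length up. A difference of kernel exponents thus grows at most linearly
  with a small slope, which the decay of the reference kernel absorbs.\<close>

lemma Icc_integral_le_wnorm_linear:
  assumes \<kappa>: "0 < \<kappa>" and k: "ess_bounded k" and B: "\<And>\<xi>. wnorm \<kappa> k \<xi> \<le> B" and ab: "a \<le> b"
  shows "(LINT s:{a..b}|lborel. \<bar>k s\<bar>) \<le> exp \<kappa> * B * (b - a + 1)"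
proof -
  have kb: "ess_bounded (\<lambda>s. \<bar>k s\<bar>)" using k by (auto simp: ess_bounded_def)
  have B0: "0 \<le> B" using order_trans[OF wnorm_nonneg B] .
  have unit: "(LINT s:{c..c + 1}|lborel. \<bar>k s\<bar>) \<le> exp \<kappa> * B" for c
  proof -
    have "exp (- \<kappa> * \<bar>(c + 1) - c\<bar>) * \<bar>LBINT s=ereal c..ereal (c + 1). \<bar>k s\<bar>\<bar> \<le> wnorm \<kappa> (\<lambda>s. \<bar>k s\<bar>) (c + 1)"
      by (rule interval_integral_abs_le_wnorm[OF \<kappa> kb])
    also have "\<dots> \<le> B" using B by (simp add: wnorm_abs)
    finally have "exp (- \<kappa>) * (LINT s:{c..c + 1}|lborel. \<bar>k s\<bar>) \<le> B"
      using abs_ge_self[of "LINT s:{c..c + 1}|lborel. \<bar>k s\<bar>"]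
      by (simp add: interval_integral_Icc) (meson exp_ge_zero mult_left_mono order_trans)
    then show ?thesis by (simp add: exp_minus field_simps)
  qed
  have n: "(LINT s:{a..a + real n}|lborel. \<bar>k s\<bar>) \<le> exp \<kappa> * B * real n" for n
  proof (induction n)
    case 0
    have "(LBINT s=ereal a..ereal a. \<bar>k s\<bar>) = (LINT s:{a..a}|lborel. \<bar>k s\<bar>)"
      by (rule interval_integral_Icc) simp
    then have "(LINT s:{a..a}|lborel. \<bar>k s\<bar>) = 0" by (simp only: interval_integral_endpoints_same)
    then show ?case by (simp only: of_nat_0 add_0_right mult_zero_right)
  next
    case (Suc n)
    have "(LINT s:{a..a + real (Suc n)}|lborel. \<bar>k s\<bar>)
      = (LINT s:{a..a + real n}|lborel. \<bar>k s\<bar>) + (LINT s:{a + real n..(a + real n) + 1}|lborel. \<bar>k s\<bar>)"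
      using interval_integral_split[OF kb, of a "a + real n" "a + real (Suc n)"]
      by (simp add: interval_integral_Icc add_ac)
    also have "\<dots> \<le> exp \<kappa> * B * real n + exp \<kappa> * B" by (intro add_mono Suc unit)
    finally show ?case by (simp add: distrib_left add.commute)
  qed
  obtain n where n': "b - a \<le> real n" "real n \<le> b - a + 1"
    using ab by (intro that[of "nat \<lceil>b - a\<rceil>"]) linarith+
  have "(LINT s:{a..b}|lborel. \<bar>k s\<bar>) \<le> (LINT s:{a..a + real n}|lborel. \<bar>k s\<bar>)"
    unfolding set_lebesgue_integral_def
    using ess_bounded_set_integrable[OF kb] n'(1) unfolding set_integrable_def
    by (intro integral_mono) (auto simp: indicator_def)
  also have "\<dots> \<le> exp \<kappa> * B * real n" by (rule n)
  also have "\<dots> \<le> exp \<kappa> * B * (b - a + 1)" using n' B0 by (intro mult_left_mono) auto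
  finally show ?thesis .
qed

text \<open>With \<open>A\<close> the whole line, the right or the left half-line this covers the
  integrals in P, S and in their x-derivatives.\<close>

definition NL :: "(real \<Rightarrow> real) \<Rightarrow> (real \<Rightarrow> real) \<Rightarrow> real set \<Rightarrow> real \<Rightarrow> real" where
  "NL k p A \<xi> = (LINT \<eta>:A|lborel. exp (- \<bar>LBINT s=ereal \<eta>..ereal \<xi>. k s\<bar>) * p \<eta>)"

lemma interval_integral_cong_AE':
  assumes "AE s in lborel. k s = k' s" "k \<in> borel_measurable borel" "k' \<in> borel_measurable borel"
  shows "(LBINT s=ereal \<eta>..ereal \<xi>. k s) = (LBINT s=ereal \<eta>..ereal \<xi>. k' s)"
proof -
  have *: "(LBINT s=ereal \<eta>..ereal \<xi>. k s) = (LBINT s=ereal \<eta>..ereal \<xi>. k' s)" if "\<eta> \<le> \<xi>" for \<eta> \<xi>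
    using assms that by (intro interval_lebesgue_integral_cong_AE) (auto elim!: eventually_mono)
  show ?thesis
  proof (cases "\<eta> \<le> \<xi>")
    case False
    then show ?thesis
      using *[of \<xi> \<eta>] by (subst (1 2) interval_integral_endpoints_reverse) simp
  qed (rule *)
qed

text \<open>Shifting the angles by multiples of 2 pi leaves the integrands unchanged only almost
  everywhere; the nonlocal terms nevertheless agree at every \<xi>.\<close>

lemma NL_cong_AE:
  assumes k: "ess_bounded k" "ess_bounded k'" "AE s in lborel. k s = k' s"
    and p: "ess_bounded p" "ess_bounded p'" "AE s in lborel. p s = p' s" and A: "A \<in> sets borel"
  shows "NL k p A \<xi> = NL k' p' A \<xi>"
proof -
  have e: "(LBINT s=ereal \<eta>..ereal \<xi>. k s) = (LBINT s=ereal \<eta>..ereal \<xi>. k' s)" for \<eta>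
    using k by (intro interval_integral_cong_AE') (auto simp: ess_bounded_def)
  have [measurable]: "(\<lambda>\<eta>. LBINT s=ereal \<eta>..ereal \<xi>. k' s) \<in> borel_measurable borel"
    by (rule borel_measurable_continuous_onI[OF interval_integral_continuous[OF k(2)]])
  note [measurable] = A
  have [measurable]: "p \<in> borel_measurable borel" "p' \<in> borel_measurable borel"
    using p by (auto simp: ess_bounded_def)
  show ?thesis
    unfolding NL_def e set_lebesgue_integral_def
    by (rule integral_cong_AE) (use p(3) in \<open>auto elim!: eventually_mono\<close>)
qed

text \<open>Convexity of the exponential. A constant \<open>c\<close> that bounds both exponentials
  is kept as a factor, so their decay survives in the difference.\<close>

lemma abs_exp_minus_diff_le:
  fixes a b :: real
  assumes "exp (- a) \<le> c" "exp (- b) \<le> c"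
  shows "\<bar>exp (- a) - exp (- b)\<bar> \<le> c * \<bar>a - b\<bar>"
proof -
  have *: "exp (- x) - exp (- y) \<le> exp (- x) * (y - x)" for x y :: real
  proof -
    have "exp (- y) = exp (- x) * exp (x - y)" by (simp flip: exp_add)
    moreover have "1 + (x - y) \<le> exp (x - y)" by (rule exp_ge_add_one_self)
    then have "exp (- x) * (1 + (x - y)) \<le> exp (- x) * exp (x - y)" by (intro mult_left_mono) auto
    ultimately show ?thesis by (simp add: algebra_simps)
  qed
  show ?thesis
  proof (cases "a \<le> b")
    case True
    then have "exp (- a) * (b - a) \<le> c * (b - a)" using assms by (intro mult_right_mono) auto
    moreover have "\<bar>a - b\<bar> = b - a" "exp (- b) \<le> exp (- a)" using True by auto
    ultimately show ?thesis using *[of a b] by (simp only: abs_of_nonneg[of "exp (- a) - exp (- b)"] diff_ge_0_iff_ge)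
  next
    case False
    then have "exp (- b) * (a - b) \<le> c * (a - b)" using assms by (intro mult_right_mono) auto
    moreover have "\<bar>a - b\<bar> = a - b" "exp (- a) \<le> exp (- b)" using False by auto
    ultimately show ?thesis using *[of b a]
      by (simp only: abs_minus_commute[of "exp (- a)"] abs_of_nonneg[of "exp (- b) - exp (- a)"] diff_ge_0_iff_ge)
  qed
qed

text \<open>The bound on \<open>exp \<kappa> * D\<close> lets the second exponent deviate from the
  first by at most 2 \<kappa> (\<bar>\<xi> - \<eta>\<bar> + 1). Of the rate 4 \<kappa> of the first
  kernel half remains, so both kernels are bounded by exp (m + 2 \<kappa>) times exp (-2 \<kappa>
  \<bar>\<xi> - \<eta>\<bar>). In the difference of the kernels one of the two remaining factors
  turns the difference of the exponents into \<open>D\<close>, and the other one is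
  integrable.\<close>

lemma NL_bounds:
  assumes \<kappa>: "0 < \<kappa>" and k: "ess_bounded k" and k': "ess_bounded k'"
    and decay: "\<And>\<eta> \<xi>. \<eta> \<le> \<xi> \<Longrightarrow> 4 * \<kappa> * (\<xi> - \<eta>) - m \<le> (LBINT s=ereal \<eta>..ereal \<xi>. k s)"
    and D: "\<And>\<xi>. wnorm \<kappa> (\<lambda>s. k s - k' s) \<xi> \<le> D" "exp \<kappa> * D \<le> 2 * \<kappa>"
    and p: "p \<in> borel_measurable borel" "AE s in lborel. \<bar>p s\<bar> \<le> N" "0 \<le> N" and p': "ess_bounded p'"
    and E: "\<And>\<xi>. wnorm \<kappa> (\<lambda>s. p s - p' s) \<xi> \<le> E" and A: "A \<in> sets borel" and m0: "0 \<le> m"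
  shows "\<bar>NL k p A \<xi>\<bar> \<le> exp (m + 2 * \<kappa>) * N * (2 / \<kappa>)"
    and "\<bar>NL k p A \<xi> - NL k' p' A \<xi>\<bar> \<le> exp (m + 2 * \<kappa>) * (D * N * (2 / \<kappa>) + E)"
proof -
  let ?C = "exp (m + 2 * \<kappa>)"
  let ?J = "\<lambda>\<eta>. LBINT s=ereal \<eta>..ereal \<xi>. k s" and ?J' = "\<lambda>\<eta>. LBINT s=ereal \<eta>..ereal \<xi>. k' s"
  let ?w = "\<lambda>\<eta>. exp (- \<kappa> * \<bar>\<xi> - \<eta>\<bar>)"
  have dk: "ess_bounded (\<lambda>s. k s - k' s)" by (rule ess_bounded_diff[OF k k'])
  have D0: "0 \<le> D" using order_trans[OF wnorm_nonneg D(1)] .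
  have pb: "ess_bounded p" using p by (auto simp: ess_bounded_def)
  have dp: "ess_bounded (\<lambda>s. p s - p' s)" by (rule ess_bounded_diff[OF pb p'])
  have [measurable]: "p \<in> borel_measurable borel" "p' \<in> borel_measurable borel" "A \<in> sets borel"
    using p p' A by (auto simp: ess_bounded_def)
  have Jm[measurable]: "?J \<in> borel_measurable borel" "?J' \<in> borel_measurable borel"
    using interval_integral_continuous[OF k] interval_integral_continuous[OF k'] borel_measurable_continuous_onI by auto
  have Jlow: "4 * \<kappa> * \<bar>\<xi> - \<eta>\<bar> - m \<le> \<bar>?J \<eta>\<bar>" for \<eta>
  proof (cases "\<eta> \<le> \<xi>")
    case True
    then show ?thesis using decay[OF True] by simp
  next
    case False
    then show ?thesis using decay[of \<xi> \<eta>] interval_integral_endpoints_reverse[of "ereal \<eta>" "ereal \<xi>" k] by simp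
  qed
  have dJ: "?J \<eta> - ?J' \<eta> = (LBINT s=ereal \<eta>..ereal \<xi>. k s - k' s)" for \<eta>
    using ess_bounded_interval_integrable[OF k] ess_bounded_interval_integrable[OF k'] by simp
  have dJ1: "\<bar>?J \<eta> - ?J' \<eta>\<bar> \<le> 2 * \<kappa> * (\<bar>\<xi> - \<eta>\<bar> + 1)" for \<eta>
  proof -
    have "\<bar>?J \<eta> - ?J' \<eta>\<bar> \<le> (LINT s:{min \<eta> \<xi>..max \<eta> \<xi>}|lborel. \<bar>k s - k' s\<bar>)"
      unfolding dJ by (rule interval_integral_abs_le_set[OF dk])
    also have "\<dots> \<le> exp \<kappa> * D * (max \<eta> \<xi> - min \<eta> \<xi> + 1)"
      by (rule Icc_integral_le_wnorm_linear[OF \<kappa> dk D(1)]) simp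
    also have "max \<eta> \<xi> - min \<eta> \<xi> + 1 = \<bar>\<xi> - \<eta>\<bar> + 1" by auto
    also have "exp \<kappa> * D * (\<bar>\<xi> - \<eta>\<bar> + 1) \<le> 2 * \<kappa> * (\<bar>\<xi> - \<eta>\<bar> + 1)"
      using D(2) by (intro mult_right_mono) auto
    finally show ?thesis .
  qed
  have ww: "?C * exp (- (2 * \<kappa> * \<bar>\<xi> - \<eta>\<bar>)) = exp (m + 2 * \<kappa> - 2 * \<kappa> * \<bar>\<xi> - \<eta>\<bar>)" for \<eta>
    by (simp flip: exp_add)
  have E1: "exp (- \<bar>?J \<eta>\<bar>) \<le> ?C * exp (- (2 * \<kappa> * \<bar>\<xi> - \<eta>\<bar>))" for \<eta>
  proof -
    have "0 \<le> \<kappa> * \<bar>\<xi> - \<eta>\<bar>" using \<kappa> by simp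
    then have "- \<bar>?J \<eta>\<bar> \<le> m + 2 * \<kappa> - 2 * \<kappa> * \<bar>\<xi> - \<eta>\<bar>" using Jlow[of \<eta>] \<kappa> by linarith
    then show ?thesis unfolding ww by simp
  qed
  have E2: "exp (- \<bar>?J' \<eta>\<bar>) \<le> ?C * exp (- (2 * \<kappa> * \<bar>\<xi> - \<eta>\<bar>))" for \<eta>
  proof -
    have "2 * \<kappa> * (\<bar>\<xi> - \<eta>\<bar> + 1) = 2 * (\<kappa> * \<bar>\<xi> - \<eta>\<bar>) + 2 * \<kappa>" by (simp add: algebra_simps)
    then have "- \<bar>?J' \<eta>\<bar> \<le> m + 2 * \<kappa> - 2 * \<kappa> * \<bar>\<xi> - \<eta>\<bar>"
      using Jlow[of \<eta>] dJ1[of \<eta>] by linarith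
    then show ?thesis unfolding ww by simp
  qed
  have w2: "exp (- (2 * \<kappa> * \<bar>\<xi> - \<eta>\<bar>)) = ?w \<eta> * ?w \<eta>" for \<eta> by (simp flip: exp_add)
  have wle: "?w \<eta> * ?w \<eta> \<le> ?w \<eta>" for \<eta> using \<kappa> by (simp add: mult_left_le)
  have Ew: "exp (- \<bar>?J \<eta>\<bar>) \<le> ?C * ?w \<eta>" "exp (- \<bar>?J' \<eta>\<bar>) \<le> ?C * ?w \<eta>" for \<eta>
  proof -
    have "?C * (?w \<eta> * ?w \<eta>) \<le> ?C * ?w \<eta>" by (intro mult_left_mono wle) simp
    then show "exp (- \<bar>?J \<eta>\<bar>) \<le> ?C * ?w \<eta>" "exp (- \<bar>?J' \<eta>\<bar>) \<le> ?C * ?w \<eta>"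
      using E1[of \<eta>] E2[of \<eta>] unfolding w2 by linarith+
  qed
  have dE: "\<bar>exp (- \<bar>?J \<eta>\<bar>) - exp (- \<bar>?J' \<eta>\<bar>)\<bar> \<le> ?C * D * ?w \<eta>" for \<eta>
  proof -
    have "\<bar>exp (- \<bar>?J \<eta>\<bar>) - exp (- \<bar>?J' \<eta>\<bar>)\<bar> \<le> ?C * exp (- (2 * \<kappa> * \<bar>\<xi> - \<eta>\<bar>)) * \<bar>\<bar>?J \<eta>\<bar> - \<bar>?J' \<eta>\<bar>\<bar>"
      by (rule abs_exp_minus_diff_le[OF E1 E2])
    also have "\<dots> \<le> ?C * exp (- (2 * \<kappa> * \<bar>\<xi> - \<eta>\<bar>)) * \<bar>?J \<eta> - ?J' \<eta>\<bar>"
      by (intro mult_left_mono abs_triangle_ineq3) auto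
    also have "\<dots> = ?C * ?w \<eta> * (?w \<eta> * \<bar>LBINT s=ereal \<eta>..ereal \<xi>. k s - k' s\<bar>)"
      unfolding w2 dJ by (simp only: mult.assoc)
    also have "\<dots> \<le> ?C * ?w \<eta> * D"
      by (intro mult_left_mono order_trans[OF interval_integral_abs_le_wnorm[OF \<kappa> dk] D(1)]) auto
    finally show ?thesis by (simp add: mult_ac)
  qed
  have iw: "integrable lborel ?w" by (rule integrable_exp_abs[OF \<kappa>])
  have int_gen: "integrable lborel (\<lambda>\<eta>. indicator A \<eta> * (exp (- \<bar>g \<eta>\<bar>) * r \<eta>))"
    if g: "\<And>\<eta>. exp (- \<bar>g \<eta>\<bar>) \<le> ?C * ?w \<eta>" and [measurable]: "g \<in> borel_measurable borel" and r: "ess_bounded r"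
    for g r :: "real \<Rightarrow> real"
  proof -
    obtain Cr where Cr: "AE x in lborel. \<bar>r x\<bar> \<le> Cr" using r by (auto simp: ess_bounded_def)
    have [measurable]: "r \<in> borel_measurable borel" using r by (simp add: ess_bounded_def)
    show ?thesis
    proof (rule Bochner_Integration.integrable_bound[OF integrable_mult_left[OF integrable_mult_right[OF iw, of ?C], of Cr]])
      show "AE \<eta> in lborel. norm (indicator A \<eta> * (exp (- \<bar>g \<eta>\<bar>) * r \<eta>)) \<le> norm (?C * ?w \<eta> * Cr)"
        using Cr
      proof eventually_elim
        case (elim \<eta>)
        have "norm (indicator A \<eta> * (exp (- \<bar>g \<eta>\<bar>) * r \<eta>)) \<le> exp (- \<bar>g \<eta>\<bar>) * \<bar>r \<eta>\<bar>"
          by (simp add: indicator_def abs_mult)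
        also have "\<dots> \<le> ?C * ?w \<eta> * Cr" using elim g by (intro mult_mono) auto
        finally show ?case by (simp add: abs_mult) (meson abs_ge_self mult_left_mono order_trans exp_ge_zero mult_nonneg_nonneg)
      qed
    qed measurable
  qed
  have i1: "integrable lborel (\<lambda>\<eta>. indicator A \<eta> * (exp (- \<bar>?J \<eta>\<bar>) * p \<eta>))"
    by (rule int_gen[OF Ew(1) Jm(1) pb])
  have i2: "integrable lborel (\<lambda>\<eta>. indicator A \<eta> * (exp (- \<bar>?J' \<eta>\<bar>) * p' \<eta>))"
    by (rule int_gen[OF Ew(2) Jm(2) p'])
  have "\<bar>NL k p A \<xi>\<bar> \<le> (LINT \<eta>|lborel. \<bar>indicator A \<eta> * (exp (- \<bar>?J \<eta>\<bar>) * p \<eta>)\<bar>)"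
    unfolding NL_def set_lebesgue_integral_def real_scaleR_def by (rule integral_abs_bound)
  also have "\<dots> \<le> (LINT \<eta>|lborel. ?C * N * ?w \<eta>)"
  proof (rule integral_mono_AE[OF integrable_abs[OF i1] integrable_mult_right[OF iw]])
    show "AE \<eta> in lborel. \<bar>indicator A \<eta> * (exp (- \<bar>?J \<eta>\<bar>) * p \<eta>)\<bar> \<le> ?C * N * ?w \<eta>"
      using p(2)
    proof eventually_elim
      case (elim \<eta>)
      have "\<bar>indicator A \<eta> * (exp (- \<bar>?J \<eta>\<bar>) * p \<eta>)\<bar> \<le> exp (- \<bar>?J \<eta>\<bar>) * \<bar>p \<eta>\<bar>"
        by (simp add: indicator_def abs_mult)
      also have "\<dots> \<le> ?C * ?w \<eta> * N" using elim Ew(1)[of \<eta>] by (intro mult_mono) auto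
      finally show ?case by (simp add: mult_ac)
    qed
  qed
  also have "\<dots> = ?C * N * (2 / \<kappa>)" using integral_exp_abs[OF \<kappa>, of \<xi>] by simp
  finally show "\<bar>NL k p A \<xi>\<bar> \<le> ?C * N * (2 / \<kappa>)" .
  let ?f = "\<lambda>\<eta>. indicator A \<eta> * (exp (- \<bar>?J \<eta>\<bar>) * p \<eta>) - indicator A \<eta> * (exp (- \<bar>?J' \<eta>\<bar>) * p' \<eta>)"
  have "NL k p A \<xi> - NL k' p' A \<xi> = (LINT \<eta>|lborel. ?f \<eta>)"
    unfolding NL_def set_lebesgue_integral_def real_scaleR_def by (rule Bochner_Integration.integral_diff[OF i1 i2, symmetric])
  then have "\<bar>NL k p A \<xi> - NL k' p' A \<xi>\<bar> \<le> (LINT \<eta>|lborel. \<bar>?f \<eta>\<bar>)"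
    using integral_abs_bound[of lborel ?f] by simp
  also have "\<dots> \<le> (LINT \<eta>|lborel. ?C * D * N * ?w \<eta> + ?C * (?w \<eta> * \<bar>p \<eta> - p' \<eta>\<bar>))"
  proof (rule integral_mono_AE)
    show "integrable lborel (\<lambda>\<eta>. \<bar>?f \<eta>\<bar>)" using i1 i2 by auto
    show "integrable lborel (\<lambda>\<eta>. ?C * D * N * ?w \<eta> + ?C * (?w \<eta> * \<bar>p \<eta> - p' \<eta>\<bar>))"
      by (intro Bochner_Integration.integrable_add integrable_mult_right iw wnorm_integrable[OF \<kappa> dp])
    show "AE \<eta> in lborel. \<bar>?f \<eta>\<bar> \<le> ?C * D * N * ?w \<eta> + ?C * (?w \<eta> * \<bar>p \<eta> - p' \<eta>\<bar>)"
      using p(2)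
    proof eventually_elim
      case (elim \<eta>)
      have "\<bar>?f \<eta>\<bar> \<le> \<bar>exp (- \<bar>?J \<eta>\<bar>) * p \<eta> - exp (- \<bar>?J' \<eta>\<bar>) * p' \<eta>\<bar>"
        by (simp add: indicator_def)
      \<comment> \<open>The difference of the kernels is paired with the reference source
        \<open>p\<close> and the perturbed kernel with \<open>p - p'\<close>. So the constant
        involves the bound \<open>N\<close> for \<open>p\<close> only.\<close>
      also have "\<dots> = \<bar>(exp (- \<bar>?J \<eta>\<bar>) - exp (- \<bar>?J' \<eta>\<bar>)) * p \<eta> + exp (- \<bar>?J' \<eta>\<bar>) * (p \<eta> - p' \<eta>)\<bar>"
        by (simp add: algebra_simps)
      also have "\<dots> \<le> \<bar>exp (- \<bar>?J \<eta>\<bar>) - exp (- \<bar>?J' \<eta>\<bar>)\<bar> * \<bar>p \<eta>\<bar> + exp (- \<bar>?J' \<eta>\<bar>) * \<bar>p \<eta> - p' \<eta>\<bar>"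
        by (rule order_trans[OF abs_triangle_ineq]) (simp add: abs_mult)
      also have "\<dots> \<le> (?C * D * ?w \<eta>) * N + (?C * ?w \<eta>) * \<bar>p \<eta> - p' \<eta>\<bar>"
        using elim dE[of \<eta>] Ew(2)[of \<eta>] D0 by (intro add_mono mult_mono) auto
      finally show ?case by (simp add: mult_ac)
    qed
  qed
  also have "\<dots> = ?C * D * N * (2 / \<kappa>) + ?C * wnorm \<kappa> (\<lambda>s. p s - p' s) \<xi>"
    unfolding wnorm_def
    using Bochner_Integration.integral_add[OF integrable_mult_right[OF iw, of "?C * D * N"] integrable_mult_right[OF wnorm_integrable[OF \<kappa> dp, of \<xi>], of ?C]]
      integral_exp_abs[OF \<kappa>, of \<xi>] by simp
  also have "\<dots> \<le> ?C * D * N * (2 / \<kappa>) + ?C * E" by (intro add_left_mono mult_left_mono E) auto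
  finally show "\<bar>NL k p A \<xi> - NL k' p' A \<xi>\<bar> \<le> ?C * (D * N * (2 / \<kappa>) + E)"
    by (simp add: distrib_left mult_ac)
qed

section \<open>Locally Lipschitz coefficient functions\<close>

lemma ess_bounded_abs: "ess_bounded f \<Longrightarrow> ess_bounded (\<lambda>x. \<bar>f x\<bar>)"
  unfolding ess_bounded_def abs_idempotent by (blast intro: borel_measurable_abs)

text \<open>The angles \<open>w\<close> and \<open>z\<close> are unrestricted: they occur only
  inside sines and cosines, and the weak norm could not keep them in a bounded range pointwise. One
  constant serves as bound and as Lipschitz constant, which keeps the rule for products
  simple.\<close>

definition lip_on :: "real \<Rightarrow> real \<Rightarrow> (real \<Rightarrow> real \<Rightarrow> real \<Rightarrow> real \<Rightarrow> real \<Rightarrow> real \<Rightarrow> real) \<Rightarrow> bool" where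
  "lip_on M K F \<longleftrightarrow> 0 \<le> K \<and> (\<forall>u v w z a b. \<bar>u\<bar> \<le> M \<and> \<bar>v\<bar> \<le> M \<and> \<bar>a\<bar> \<le> M \<and> \<bar>b\<bar> \<le> M \<longrightarrow>
     \<bar>F u v w z a b\<bar> \<le> K \<and> (\<forall>u' v' w' z' a' b'. \<bar>u'\<bar> \<le> M \<and> \<bar>v'\<bar> \<le> M \<and> \<bar>a'\<bar> \<le> M \<and> \<bar>b'\<bar> \<le> M \<longrightarrow>
     \<bar>F u v w z a b - F u' v' w' z' a' b'\<bar>
       \<le> K * (\<bar>u - u'\<bar> + \<bar>v - v'\<bar> + \<bar>w - w'\<bar> + \<bar>z - z'\<bar> + \<bar>a - a'\<bar> + \<bar>b - b'\<bar>)))"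

definition loclip :: "(real \<Rightarrow> real \<Rightarrow> real \<Rightarrow> real \<Rightarrow> real \<Rightarrow> real \<Rightarrow> real) \<Rightarrow> bool" where
  "loclip F \<longleftrightarrow> (\<forall>M. \<exists>K. lip_on M K F)"

lemma lip_on_nonneg: "lip_on M K F \<Longrightarrow> 0 \<le> K"
  unfolding lip_on_def by (rule conjunct1)

lemma lip_on_bound:
  assumes "lip_on M K F" "\<bar>u\<bar> \<le> M \<and> \<bar>v\<bar> \<le> M \<and> \<bar>a\<bar> \<le> M \<and> \<bar>b\<bar> \<le> M"
  shows "\<bar>F u v w z a b\<bar> \<le> K"
  using assms(1)[unfolded lip_on_def, THEN conjunct2, THEN spec, THEN spec, THEN spec, THEN spec, THEN spec, THEN spec, THEN mp, OF assms(2)]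
  by (rule conjunct1)

lemma lip_on_diff:
  assumes "lip_on M K F" "\<bar>u\<bar> \<le> M \<and> \<bar>v\<bar> \<le> M \<and> \<bar>a\<bar> \<le> M \<and> \<bar>b\<bar> \<le> M"
    "\<bar>u'\<bar> \<le> M \<and> \<bar>v'\<bar> \<le> M \<and> \<bar>a'\<bar> \<le> M \<and> \<bar>b'\<bar> \<le> M"
  shows "\<bar>F u v w z a b - F u' v' w' z' a' b'\<bar>
       \<le> K * (\<bar>u - u'\<bar> + \<bar>v - v'\<bar> + \<bar>w - w'\<bar> + \<bar>z - z'\<bar> + \<bar>a - a'\<bar> + \<bar>b - b'\<bar>)"
  using assms(1)[unfolded lip_on_def, THEN conjunct2, THEN spec, THEN spec, THEN spec, THEN spec, THEN spec, THEN spec, THEN mp, OF assms(2),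
      THEN conjunct2, THEN spec, THEN spec, THEN spec, THEN spec, THEN spec, THEN spec, THEN mp, OF assms(3)] .

lemma lip_onI:
  assumes "0 \<le> K"
    "\<And>u v w z a b. \<bar>u\<bar> \<le> M \<and> \<bar>v\<bar> \<le> M \<and> \<bar>a\<bar> \<le> M \<and> \<bar>b\<bar> \<le> M \<Longrightarrow> \<bar>F u v w z a b\<bar> \<le> K"
    "\<And>u v w z a b u' v' w' z' a' b'. \<bar>u\<bar> \<le> M \<and> \<bar>v\<bar> \<le> M \<and> \<bar>a\<bar> \<le> M \<and> \<bar>b\<bar> \<le> M \<Longrightarrow>
     \<bar>u'\<bar> \<le> M \<and> \<bar>v'\<bar> \<le> M \<and> \<bar>a'\<bar> \<le> M \<and> \<bar>b'\<bar> \<le> M \<Longrightarrow> \<bar>F u v w z a b - F u' v' w' z' a' b'\<bar>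
       \<le> K * (\<bar>u - u'\<bar> + \<bar>v - v'\<bar> + \<bar>w - w'\<bar> + \<bar>z - z'\<bar> + \<bar>a - a'\<bar> + \<bar>b - b'\<bar>)"
  shows "lip_on M K F"
  unfolding lip_on_def
  by (rule conjI[OF assms(1)], intro allI impI, rule conjI, erule assms(2), intro allI impI, erule (1) assms(3))

lemma loclip_const: "loclip (\<lambda>u v w z a b. c)"
  unfolding loclip_def by (intro allI exI[of _ "\<bar>c\<bar>"] lip_onI) auto

lemma le_sum6:
  fixes x1 :: real
  assumes "0 \<le> x1" "0 \<le> x2" "0 \<le> x3" "0 \<le> x4" "0 \<le> x5" "0 \<le> x6"
  shows "x1 \<le> x1 + x2 + x3 + x4 + x5 + x6" "x2 \<le> x1 + x2 + x3 + x4 + x5 + x6"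
    "x3 \<le> x1 + x2 + x3 + x4 + x5 + x6" "x4 \<le> x1 + x2 + x3 + x4 + x5 + x6"
    "x5 \<le> x1 + x2 + x3 + x4 + x5 + x6" "x6 \<le> x1 + x2 + x3 + x4 + x5 + x6"
  using assms by linarith+

lemma loclip_coord:
  "loclip (\<lambda>u v w z a b. u)" "loclip (\<lambda>u v w z a b. v)"
  "loclip (\<lambda>u v w z a b. a)" "loclip (\<lambda>u v w z a b. b)"
proof -
  have *: "y \<le> (\<bar>M\<bar> + 1) * s" if "y \<le> s" "0 \<le> y" for y s M :: real
  proof -
    have "1 * s \<le> (\<bar>M\<bar> + 1) * s" using that by (intro mult_right_mono) auto
    then show ?thesis using that by linarith
  qed
  have "lip_on M (\<bar>M\<bar> + 1) (\<lambda>u v w z a b. u)" "lip_on M (\<bar>M\<bar> + 1) (\<lambda>u v w z a b. v)"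
    "lip_on M (\<bar>M\<bar> + 1) (\<lambda>u v w z a b. a)" "lip_on M (\<bar>M\<bar> + 1) (\<lambda>u v w z a b. b)" for M
    by (rule lip_onI, simp, linarith, rule *, (rule le_sum6; simp), simp)+
  then show "loclip (\<lambda>u v w z a b. u)" "loclip (\<lambda>u v w z a b. v)"
    "loclip (\<lambda>u v w z a b. a)" "loclip (\<lambda>u v w z a b. b)"
    unfolding loclip_def by blast+
qed

lemma loclip_trig:
  fixes f :: "real \<Rightarrow> real"
  assumes "\<And>x. \<bar>f x\<bar> \<le> 1" "\<And>x y. \<bar>f x - f y\<bar> \<le> \<bar>x - y\<bar>"
  shows "loclip (\<lambda>u v w z a b. f w)" "loclip (\<lambda>u v w z a b. f z)"
proof -
  have *: "y \<le> 1 * s" if "y \<le> s" for y s :: real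
    using that by simp
  have "lip_on M 1 (\<lambda>u v w z a b. f w)" "lip_on M 1 (\<lambda>u v w z a b. f z)" for M
    by (rule lip_onI, simp, rule assms(1), rule *, rule order_trans[OF assms(2)], (rule le_sum6; simp))+
  then show "loclip (\<lambda>u v w z a b. f w)" "loclip (\<lambda>u v w z a b. f z)"
    unfolding loclip_def by blast+
qed

lemma sin_lipschitz: "\<bar>sin x - sin y\<bar> \<le> \<bar>x - y\<bar>" for x y :: real
proof -
  have "\<bar>sin x - sin y\<bar> = 2 * (\<bar>sin ((x - y) / 2)\<bar> * \<bar>cos ((x + y) / 2)\<bar>)"
    by (simp add: sin_diff_sin abs_mult)
  also have "\<dots> \<le> 2 * (\<bar>(x - y) / 2\<bar> * 1)"
    by (intro mult_left_mono mult_mono abs_sin_x_le_abs_x) auto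
  finally show ?thesis by simp
qed

lemma cos_lipschitz: "\<bar>cos x - cos y\<bar> \<le> \<bar>x - y\<bar>" for x y :: real
  using sin_lipschitz[of "pi / 2 - x" "pi / 2 - y"] by (simp add: sin_diff abs_minus_commute)

lemma loclip_sin_cos:
  "loclip (\<lambda>u v w z a b. sin w)" "loclip (\<lambda>u v w z a b. sin z)"
  "loclip (\<lambda>u v w z a b. sin (w / 2))" "loclip (\<lambda>u v w z a b. sin (z / 2))"
  "loclip (\<lambda>u v w z a b. cos (w / 2))" "loclip (\<lambda>u v w z a b. cos (z / 2))"
proof -
  have half: "\<bar>sin (x / 2) - sin (y / 2)\<bar> \<le> \<bar>x - y\<bar>" "\<bar>cos (x / 2) - cos (y / 2)\<bar> \<le> \<bar>x - y\<bar>" for x y :: real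
    using sin_lipschitz[of "x / 2" "y / 2"] cos_lipschitz[of "x / 2" "y / 2"] by linarith+
  show "loclip (\<lambda>u v w z a b. sin w)" "loclip (\<lambda>u v w z a b. sin z)"
    by (rule loclip_trig[of sin]; simp add: sin_lipschitz)+
  show "loclip (\<lambda>u v w z a b. sin (w / 2))" "loclip (\<lambda>u v w z a b. sin (z / 2))"
    by (rule loclip_trig[of "\<lambda>x. sin (x / 2)"]; simp add: half)+
  show "loclip (\<lambda>u v w z a b. cos (w / 2))" "loclip (\<lambda>u v w z a b. cos (z / 2))"
    by (rule loclip_trig[of "\<lambda>x. cos (x / 2)"]; simp add: half)+
qed

lemma loclip_add:
  assumes F: "loclip F" and G: "loclip G"
  shows "loclip (\<lambda>u v w z a b. F u v w z a b + G u v w z a b)"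
  unfolding loclip_def
proof
  fix M
  obtain K L where K: "lip_on M K F" and L: "lip_on M L G"
    using F G unfolding loclip_def by blast
  note K0 = lip_on_nonneg[OF K] and L0 = lip_on_nonneg[OF L]
  have N0: "0 \<le> K + L" using K0 L0 by simp
  have *: "\<bar>x + y\<bar> \<le> K + L" if "\<bar>x\<bar> \<le> K" "\<bar>y\<bar> \<le> L" for x y
    using that by linarith
  have **: "\<bar>(x + y) - (x' + y')\<bar> \<le> (K + L) * s"
    if "\<bar>x - x'\<bar> \<le> K * s" "\<bar>y - y'\<bar> \<le> L * s" for x y x' y' s
    using that unfolding distrib_right by linarith
  show "\<exists>N. lip_on M N (\<lambda>u v w z a b. F u v w z a b + G u v w z a b)"
    by (intro exI[of _ "K + L"] lip_onI N0 * ** lip_on_bound[OF K] lip_on_bound[OF L] lip_on_diff[OF K] lip_on_diff[OF L])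
qed

lemma loclip_mult:
  assumes F: "loclip F" and G: "loclip G"
  shows "loclip (\<lambda>u v w z a b. F u v w z a b * G u v w z a b)"
  unfolding loclip_def
proof
  fix M
  obtain K L where K: "lip_on M K F" and L: "lip_on M L G"
    using F G unfolding loclip_def by blast
  note K0 = lip_on_nonneg[OF K] and L0 = lip_on_nonneg[OF L]
  let ?N = "K * L + K * L"
  have N0: "0 \<le> ?N" using K0 L0 by simp
  have *: "\<bar>x * y\<bar> \<le> ?N" if "\<bar>x\<bar> \<le> K" "\<bar>y\<bar> \<le> L" for x y
  proof -
    have "\<bar>x * y\<bar> \<le> K * L" unfolding abs_mult using that K0 by (intro mult_mono) auto
    then show "\<bar>x * y\<bar> \<le> ?N" using mult_nonneg_nonneg[OF K0 L0] by linarith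
  qed
  have **: "\<bar>x * y - x' * y'\<bar> \<le> ?N * s"
    if "\<bar>y\<bar> \<le> L" "\<bar>x'\<bar> \<le> K" "\<bar>x - x'\<bar> \<le> K * s" "\<bar>y - y'\<bar> \<le> L * s" for x y x' y' s
  proof -
    have "\<bar>x * y - x' * y'\<bar> = \<bar>(x - x') * y + x' * (y - y')\<bar>" by (simp add: algebra_simps)
    also have "\<dots> \<le> \<bar>x - x'\<bar> * \<bar>y\<bar> + \<bar>x'\<bar> * \<bar>y - y'\<bar>"
      by (rule order_trans[OF abs_triangle_ineq]) (simp add: abs_mult)
    also have "\<dots> \<le> (K * s) * L + K * (L * s)"
      using that K0 order_trans[OF abs_ge_zero that(3)] by (intro add_mono mult_mono) auto
    finally show "\<bar>x * y - x' * y'\<bar> \<le> ?N * s" by (simp add: algebra_simps)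
  qed
  show "\<exists>N. lip_on M N (\<lambda>u v w z a b. F u v w z a b * G u v w z a b)"
    by (intro exI[of _ ?N] lip_onI N0 * ** lip_on_bound[OF K] lip_on_bound[OF L] lip_on_diff[OF K] lip_on_diff[OF L])
qed

lemma loclip_diff:
  assumes F: "loclip F" and G: "loclip G"
  shows "loclip (\<lambda>u v w z a b. F u v w z a b - G u v w z a b)"
  using loclip_add[OF F loclip_mult[OF loclip_const[of "-1"] G]] by simp

lemma loclip_power2:
  assumes F: "loclip F"
  shows "loclip (\<lambda>u v w z a b. (F u v w z a b)\<^sup>2)"
  unfolding power2_eq_square by (rule loclip_mult[OF F F])

lemmas loclip_intros = loclip_add loclip_diff loclip_mult loclip_power2 loclip_sin_cos loclip_coord loclip_const

text \<open>The coefficients of the system as functions of \<open>(U, V, W, Z)\<close> and of the nonlocal quantities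
  \<open>a = P\<^sub>1 + \<partial>\<^sub>x P\<^sub>2\<close> and \<open>b = S\<^sub>1 + \<partial>\<^sub>x S\<^sub>2\<close>; the weight \<open>q\<close> is split off.\<close>

definition coef_k where "coef_k u v w z a b = (cos (w / 2))\<^sup>2 * (cos (z / 2 :: real))\<^sup>2"
  for u v w z a b :: real
definition coef_p1 where "coef_p1 u v w z a b = u\<^sup>2 * v * (cos (w / 2))\<^sup>2 * (cos (z / 2))\<^sup>2
      + 1/4 * u * sin w * sin z + 1/2 * v * (sin (w / 2))\<^sup>2 * (cos (z / 2))\<^sup>2"
  for u v w z a b :: real
definition coef_s1 where "coef_s1 u v w z a b = u * v\<^sup>2 * (cos (w / 2))\<^sup>2 * (cos (z / 2))\<^sup>2
      + 1/2 * u * (cos (w / 2))\<^sup>2 * (sin (z / 2))\<^sup>2 + 1/4 * v * sin w * sin z"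
  for u v w z a b :: real
definition coef_p2 where "coef_p2 u v w z a b = (sin (w / 2))\<^sup>2 * sin z"
  for u v w z a b :: real
definition coef_s2 where "coef_s2 u v w z a b = sin w * (sin (z / 2))\<^sup>2"
  for u v w z a b :: real
definition coef_W where "coef_W u v w z a b = 2 * u\<^sup>2 * v * (cos (w / 2))\<^sup>2 - v * (sin (w / 2))\<^sup>2
      - 2 * a * (cos (w / 2))\<^sup>2"
  for u v w z a b :: real
definition coef_Z where "coef_Z u v w z a b = 2 * u * v\<^sup>2 * (cos (z / 2))\<^sup>2 - u * (sin (z / 2))\<^sup>2
      - 2 * b * (cos (z / 2))\<^sup>2"
  for u v w z a b :: real
definition coef_q where "coef_q u v w z a b = (u\<^sup>2 * v + 1/2 * v - a) * sin w + (u * v\<^sup>2 + 1/2 * u - b) * sin z"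
  for u v w z a b :: real

lemmas coef_defs = coef_k_def coef_p1_def coef_s1_def coef_p2_def coef_s2_def coef_W_def coef_Z_def coef_q_def

lemma loclip_coef:
  "loclip coef_k" "loclip coef_p1" "loclip coef_s1" "loclip coef_p2" "loclip coef_s2"
  "loclip coef_W" "loclip coef_Z" "loclip coef_q"
  unfolding coef_defs[abs_def] by (intro loclip_intros)+

section \<open>Periodicity in the angles and the system in reduced form\<close>

definition trig_periodic :: "(real \<Rightarrow> real \<Rightarrow> real \<Rightarrow> real \<Rightarrow> real \<Rightarrow> real \<Rightarrow> real) \<Rightarrow> bool" where
  "trig_periodic F \<longleftrightarrow> (\<forall>u v w z a b k l. F u v (w + 2 * pi * of_int k) (z + 2 * pi * of_int l) a b = F u v w z a b)"

text \<open>Sine and cosine of the half angle may change sign under a shift by 2 pi. In the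
  coefficients they occur squared, and the squares are functions of the cosine of the full
  angle.\<close>

lemma sin_cos_shift:
  fixes k :: int
  shows "sin (x + 2 * pi * of_int k) = sin x" "cos (x + 2 * pi * of_int k) = cos x"
    "(cos ((x + 2 * pi * of_int k) / 2))\<^sup>2 = (cos (x / 2))\<^sup>2"
    "(sin ((x + 2 * pi * of_int k) / 2))\<^sup>2 = (sin (x / 2))\<^sup>2"
proof -
  show s: "sin (x + 2 * pi * of_int k) = sin x" "cos (x + 2 * pi * of_int k) = cos x"
    by (simp_all add: sin_add cos_add)
  have c2: "(cos (y / 2))\<^sup>2 = (cos y + 1) / 2" for y :: real
    using cos_double_cos[of "y / 2"] by simp
  show c: "(cos ((x + 2 * pi * of_int k) / 2))\<^sup>2 = (cos (x / 2))\<^sup>2" unfolding c2 s ..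
  show "(sin ((x + 2 * pi * of_int k) / 2))\<^sup>2 = (sin (x / 2))\<^sup>2" unfolding sin_squared_eq c ..
qed

lemma trig_periodic_coef:
  "trig_periodic coef_k" "trig_periodic coef_p1" "trig_periodic coef_s1" "trig_periodic coef_p2" "trig_periodic coef_s2"
  "trig_periodic coef_W" "trig_periodic coef_Z" "trig_periodic coef_q"
  unfolding trig_periodic_def coef_defs sin_cos_shift by simp_all

text \<open>The right-hand side of the equation for \<open>U\<close>, namely minus the x-derivative
  of P1 minus P2; with the sources \<open>s1\<close> and \<open>s2\<close> it is the one for
  \<open>V\<close>.\<close>

definition nl_deriv :: "(real \<Rightarrow> real) \<Rightarrow> (real \<Rightarrow> real) \<Rightarrow> (real \<Rightarrow> real) \<Rightarrow> real \<Rightarrow> real" where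
  "nl_deriv k p p' \<xi> = - (1/2 * (NL k p {\<xi><..} \<xi> - NL k p {..<\<xi>} \<xi>)) - 1/8 * NL k p' UNIV \<xi>"

text \<open>P1 plus the x-derivative of P2, or the same with S: the only combinations through which
  nonlocal terms enter the equations for \<open>W\<close>, \<open>Z\<close> and
  \<open>q\<close>.\<close>

definition nl_potential :: "(real \<Rightarrow> real) \<Rightarrow> (real \<Rightarrow> real) \<Rightarrow> (real \<Rightarrow> real) \<Rightarrow> real \<Rightarrow> real" where
  "nl_potential k p p' \<xi> = 1/2 * NL k p UNIV \<xi> + 1/8 * (NL k p' {\<xi><..} \<xi> - NL k p' {..<\<xi>} \<xi>)"

text \<open>The two slots for nonlocal quantities are filled with 0, since the integrands of the
  kernel and of the sources do not involve them.\<close>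

definition weighted :: "(real \<Rightarrow> real \<Rightarrow> real \<Rightarrow> real \<Rightarrow> real \<Rightarrow> real \<Rightarrow> real) \<Rightarrow> state \<Rightarrow> real \<Rightarrow> real" where
  "weighted F = (\<lambda>(U, V, W, Z, q) \<eta>. q \<eta> * F (U \<eta>) (V \<eta>) (W \<eta>) (Z \<eta>) 0 0)"

lemma weighted_simp: "weighted F (U, V, W, Z, q) = (\<lambda>\<eta>. q \<eta> * F (U \<eta>) (V \<eta>) (W \<eta>) (Z \<eta>) 0 0)"
  by (simp add: weighted_def)

lemma nonloc_eq_NL:
  "nonloc c (U, V, W, Z, q) p \<xi> = c * NL (weighted coef_k (U, V, W, Z, q)) p UNIV \<xi>"
  "nonloc_x c (U, V, W, Z, q) p \<xi> = c * (NL (weighted coef_k (U, V, W, Z, q)) p {\<xi><..} \<xi>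
     - NL (weighted coef_k (U, V, W, Z, q)) p {..<\<xi>} \<xi>)"
  unfolding nonloc_def nonloc_x_def NL_def
  by (simp_all add: weighted_simp coef_k_def mult.assoc set_lebesgue_integral_def)

lemma source_eq_weighted:
  "p1 X = weighted coef_p1 X" "s1 X = weighted coef_s1 X" "p2 X = weighted coef_p2 X" "s2 X = weighted coef_s2 X"
  by (cases X; simp add: weighted_def coef_defs fun_eq_iff mult.assoc)+

definition potential_u :: "state \<Rightarrow> real \<Rightarrow> real" where
  "potential_u X = nl_potential (weighted coef_k X) (weighted coef_p1 X) (weighted coef_p2 X)"

definition potential_v :: "state \<Rightarrow> real \<Rightarrow> real" where
  "potential_v X = nl_potential (weighted coef_k X) (weighted coef_s1 X) (weighted coef_s2 X)"

lemma ode_rhs_eq: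
  fixes U V W Z q
  defines "X \<equiv> (U, V, W, Z, q)"
  shows "ode_rhs X =
    (nl_deriv (weighted coef_k X) (weighted coef_p1 X) (weighted coef_p2 X),
     nl_deriv (weighted coef_k X) (weighted coef_s1 X) (weighted coef_s2 X),
     \<lambda>\<xi>. coef_W (U \<xi>) (V \<xi>) (W \<xi>) (Z \<xi>) (potential_u X \<xi>) (potential_v X \<xi>),
     \<lambda>\<xi>. coef_Z (U \<xi>) (V \<xi>) (W \<xi>) (Z \<xi>) (potential_u X \<xi>) (potential_v X \<xi>),
     \<lambda>\<xi>. q \<xi> * coef_q (U \<xi>) (V \<xi>) (W \<xi>) (Z \<xi>) (potential_u X \<xi>) (potential_v X \<xi>))"
  unfolding X_def ode_rhs.simps Let_def nonloc_eq_NL source_eq_weighted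
  by (simp add: nl_deriv_def nl_potential_def potential_u_def potential_v_def coef_W_def coef_Z_def coef_q_def fun_eq_iff algebra_simps)

section \<open>Lipschitz estimate of the right-hand side in the weak norm\<close>

fun close :: "real \<Rightarrow> real \<Rightarrow> state \<Rightarrow> state \<Rightarrow> bool" where
  "close \<kappa> B (U, V, W, Z, q) (U', V', W', Z', q') \<longleftrightarrow> (\<forall>\<xi>. \<bar>U \<xi> - U' \<xi>\<bar> \<le> B \<and> \<bar>V \<xi> - V' \<xi>\<bar> \<le> B
     \<and> wnorm \<kappa> (\<lambda>\<eta>. W \<eta> - W' \<eta>) \<xi> \<le> B \<and> wnorm \<kappa> (\<lambda>\<eta>. Z \<eta> - Z' \<eta>) \<xi> \<le> B
     \<and> wnorm \<kappa> (\<lambda>\<eta>. q \<eta> - q' \<eta>) \<xi> \<le> B)"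

fun regular :: "state \<Rightarrow> bool" where
  "regular (U, V, W, Z, q) \<longleftrightarrow> U \<in> borel_measurable borel \<and> V \<in> borel_measurable borel
     \<and> ess_bounded W \<and> ess_bounded Z \<and> ess_bounded q"

text \<open>The condition is asymmetric on purpose: \<open>q\<close> is bounded by \<open>M\<close>,
  whereas \<open>q'\<close> is controlled only through \<open>q - q'\<close>. The function
  \<open>f\<close> has to agree with the weighted difference merely almost everywhere, which leaves
  room for shifted angles.\<close>

definition wlip :: "real \<Rightarrow> real \<Rightarrow> (real \<Rightarrow> real \<Rightarrow> real \<Rightarrow> real \<Rightarrow> real \<Rightarrow> real \<Rightarrow> real) \<Rightarrow> real \<Rightarrow> bool" where
  "wlip \<kappa> M F K \<longleftrightarrow> 0 \<le> K \<and>
    (\<forall>u v w z a b. \<bar>u\<bar> \<le> M \<and> \<bar>v\<bar> \<le> M \<and> \<bar>a\<bar> \<le> M \<and> \<bar>b\<bar> \<le> M \<longrightarrow> \<bar>F u v w z a b\<bar> \<le> K) \<and>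
    (\<forall>U V W Z q a b U' V' W' Z' q' a' b' B f \<xi>.
      (\<forall>\<eta>. \<bar>U \<eta>\<bar> \<le> M \<and> \<bar>V \<eta>\<bar> \<le> M \<and> \<bar>a \<eta>\<bar> \<le> M \<and> \<bar>b \<eta>\<bar> \<le> M) \<longrightarrow>
      (\<forall>\<eta>. \<bar>U' \<eta>\<bar> \<le> M \<and> \<bar>V' \<eta>\<bar> \<le> M \<and> \<bar>a' \<eta>\<bar> \<le> M \<and> \<bar>b' \<eta>\<bar> \<le> M) \<longrightarrow>
      (AE \<eta> in lborel. \<bar>q \<eta>\<bar> \<le> M) \<longrightarrow>
      close \<kappa> B (U, V, W, Z, q) (U', V', W', Z', q') \<longrightarrow> (\<forall>\<eta>. \<bar>a \<eta> - a' \<eta>\<bar> \<le> B \<and> \<bar>b \<eta> - b' \<eta>\<bar> \<le> B) \<longrightarrow>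
      ess_bounded (\<lambda>\<eta>. W \<eta> - W' \<eta>) \<longrightarrow> ess_bounded (\<lambda>\<eta>. Z \<eta> - Z' \<eta>) \<longrightarrow> ess_bounded (\<lambda>\<eta>. q \<eta> - q' \<eta>) \<longrightarrow>
      f \<in> borel_measurable borel \<longrightarrow>
      (AE \<eta> in lborel. f \<eta> = q \<eta> * F (U \<eta>) (V \<eta>) (W \<eta>) (Z \<eta>) (a \<eta>) (b \<eta>)
         - q' \<eta> * F (U' \<eta>) (V' \<eta>) (W' \<eta>) (Z' \<eta>) (a' \<eta>) (b' \<eta>)) \<longrightarrow>
      wnorm \<kappa> f \<xi> \<le> K * B)"

lemmas wlip_nonneg = wlip_def[THEN iffD1, THEN conjunct1]
lemmas wlip_bound = wlip_def[THEN iffD1, THEN conjunct2, THEN conjunct1, rule_format]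
lemmas wlip_wnorm = wlip_def[THEN iffD1, THEN conjunct2, THEN conjunct2, rule_format]

text \<open>Write q F - q' F' as (q - q') F' + q (F - F') and apply the pointwise Lipschitz bound of
  F before taking the weighted norm.\<close>

lemma loclip_imp_wlip:
  assumes F: "loclip F" and \<kappa>: "0 < \<kappa>" and M: "0 \<le> M"
  shows "\<exists>K. wlip \<kappa> M F K"
proof -
  obtain K where K: "lip_on M K F" using F unfolding loclip_def by blast
  note K0 = lip_on_nonneg[OF K]
  \<comment> \<open>The first \<open>K\<close> stems from \<open>q - q'\<close>. In the bracket, the
    four differences in \<open>U\<close>, \<open>V\<close>, \<open>a\<close>, \<open>b\<close> are
    pointwise at most \<open>B\<close>, and a constant has weighted norm 2/\<kappa> times its
    modulus; the two angles contribute \<open>B\<close> each.\<close>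
  let ?K = "K + M * K * (4 * (2 / \<kappa>) + 2)"
  have c0: "0 \<le> M * K * (4 * (2 / \<kappa>) + 2)" using K0 M \<kappa> by simp
  show ?thesis
    unfolding wlip_def
  proof (intro exI[of _ ?K] conjI allI impI)
    show "0 \<le> ?K" using K0 c0 by linarith
    show "\<bar>F u v w z a b\<bar> \<le> ?K" if "\<bar>u\<bar> \<le> M \<and> \<bar>v\<bar> \<le> M \<and> \<bar>a\<bar> \<le> M \<and> \<bar>b\<bar> \<le> M" for u v w z a b
      using lip_on_bound[OF K that, of w z] c0 by linarith
    fix U V W Z q a b U' V' W' Z' q' a' b' :: "real \<Rightarrow> real" and B f \<xi>
    assume b1': "\<forall>\<eta>. \<bar>U \<eta>\<bar> \<le> M \<and> \<bar>V \<eta>\<bar> \<le> M \<and> \<bar>a \<eta>\<bar> \<le> M \<and> \<bar>b \<eta>\<bar> \<le> M"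
      and b2': "\<forall>\<eta>. \<bar>U' \<eta>\<bar> \<le> M \<and> \<bar>V' \<eta>\<bar> \<le> M \<and> \<bar>a' \<eta>\<bar> \<le> M \<and> \<bar>b' \<eta>\<bar> \<le> M"
      and q: "AE \<eta> in lborel. \<bar>q \<eta>\<bar> \<le> M"
      and cl: "close \<kappa> B (U, V, W, Z, q) (U', V', W', Z', q')"
      and ab': "\<forall>\<eta>. \<bar>a \<eta> - a' \<eta>\<bar> \<le> B \<and> \<bar>b \<eta> - b' \<eta>\<bar> \<le> B"
      and eW: "ess_bounded (\<lambda>\<eta>. W \<eta> - W' \<eta>)" and eZ: "ess_bounded (\<lambda>\<eta>. Z \<eta> - Z' \<eta>)"
      and eq: "ess_bounded (\<lambda>\<eta>. q \<eta> - q' \<eta>)" and fm: "f \<in> borel_measurable borel"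
      and f: "AE \<eta> in lborel. f \<eta> = q \<eta> * F (U \<eta>) (V \<eta>) (W \<eta>) (Z \<eta>) (a \<eta>) (b \<eta>)
         - q' \<eta> * F (U' \<eta>) (V' \<eta>) (W' \<eta>) (Z' \<eta>) (a' \<eta>) (b' \<eta>)"
    note b1 = b1'[rule_format] and b2 = b2'[rule_format] and ab = ab'[rule_format]
    have sum4: "x1 + x2 + w + z + x3 + x4 \<le> 4 * B + (w + z)"
      if "x1 \<le> B" "x2 \<le> B" "x3 \<le> B" "x4 \<le> B" for x1 x2 x3 x4 w z
      using that by linarith
    have B0: "0 \<le> B" using order_trans[OF abs_ge_zero, of "a 0 - a' 0" B] ab by blast
    let ?dW = "\<lambda>\<eta>. \<bar>W \<eta> - W' \<eta>\<bar>" and ?dZ = "\<lambda>\<eta>. \<bar>Z \<eta> - Z' \<eta>\<bar>" and ?dq = "\<lambda>\<eta>. \<bar>q \<eta> - q' \<eta>\<bar>"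
    have eabs: "ess_bounded ?dW" "ess_bounded ?dZ" "ess_bounded ?dq"
      using eW eZ eq by (simp_all only: ess_bounded_abs)
    let ?g = "\<lambda>\<eta>. K * ?dq \<eta> + (M * K) * (4 * B + (?dW \<eta> + ?dZ \<eta>))"
    have g1: "ess_bounded (\<lambda>\<eta>. ?dW \<eta> + ?dZ \<eta>)" by (rule ess_bounded_add[OF eabs(1,2)])
    have g2: "ess_bounded (\<lambda>\<eta>. 4 * B + (?dW \<eta> + ?dZ \<eta>))" by (rule ess_bounded_add[OF ess_bounded_const g1])
    have g3: "ess_bounded (\<lambda>\<eta>. (M * K) * (4 * B + (?dW \<eta> + ?dZ \<eta>)))" by (rule ess_bounded_cmult[OF g2])
    have g4: "ess_bounded (\<lambda>\<eta>. K * ?dq \<eta>)" by (rule ess_bounded_cmult[OF eabs(3)])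
    have "AE \<eta> in lborel. \<bar>f \<eta>\<bar> \<le> \<bar>?g \<eta>\<bar>"
      using f q
    proof eventually_elim
      case (elim \<eta>)
      let ?F = "F (U \<eta>) (V \<eta>) (W \<eta>) (Z \<eta>) (a \<eta>) (b \<eta>)"
      let ?F' = "F (U' \<eta>) (V' \<eta>) (W' \<eta>) (Z' \<eta>) (a' \<eta>) (b' \<eta>)"
      have F': "\<bar>?F'\<bar> \<le> K" by (rule lip_on_bound[OF K b2])
      have dF: "\<bar>?F - ?F'\<bar> \<le> K * (4 * B + (?dW \<eta> + ?dZ \<eta>))"
      proof -
        have "\<bar>?F - ?F'\<bar> \<le> K * (\<bar>U \<eta> - U' \<eta>\<bar> + \<bar>V \<eta> - V' \<eta>\<bar> + ?dW \<eta> + ?dZ \<eta> + \<bar>a \<eta> - a' \<eta>\<bar> + \<bar>b \<eta> - b' \<eta>\<bar>)"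
          by (rule lip_on_diff[OF K b1 b2])
        also have "\<dots> \<le> K * (4 * B + (?dW \<eta> + ?dZ \<eta>))"
        proof (intro mult_left_mono K0)
          have "\<bar>U \<eta> - U' \<eta>\<bar> \<le> B" "\<bar>V \<eta> - V' \<eta>\<bar> \<le> B" using cl by auto
          then show "\<bar>U \<eta> - U' \<eta>\<bar> + \<bar>V \<eta> - V' \<eta>\<bar> + ?dW \<eta> + ?dZ \<eta> + \<bar>a \<eta> - a' \<eta>\<bar> + \<bar>b \<eta> - b' \<eta>\<bar>
            \<le> 4 * B + (?dW \<eta> + ?dZ \<eta>)"
            using ab[of \<eta>] by (elim conjE) (rule sum4)
        qed
        finally show ?thesis .
      qed
      have "\<bar>f \<eta>\<bar> = \<bar>(q \<eta> - q' \<eta>) * ?F' + q \<eta> * (?F - ?F')\<bar>" unfolding elim(1) by (simp add: algebra_simps)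
      also have "\<dots> \<le> ?dq \<eta> * \<bar>?F'\<bar> + \<bar>q \<eta>\<bar> * \<bar>?F - ?F'\<bar>"
        by (rule order_trans[OF abs_triangle_ineq]) (simp add: abs_mult)
      also have "\<dots> \<le> ?dq \<eta> * K + M * (K * (4 * B + (?dW \<eta> + ?dZ \<eta>)))"
        by (intro add_mono mult_mono order_refl abs_ge_zero F' dF elim(2) M)
      also have "\<dots> = ?g \<eta>" by (simp add: mult_ac)
      finally show ?case by linarith
    qed
    then have "wnorm \<kappa> f \<xi> \<le> wnorm \<kappa> ?g \<xi>"
      by (intro wnorm_mono[OF \<kappa> ess_bounded_add[OF g4 g3] fm])
    also have "\<dots> \<le> wnorm \<kappa> (\<lambda>\<eta>. K * ?dq \<eta>) \<xi> + wnorm \<kappa> (\<lambda>\<eta>. (M * K) * (4 * B + (?dW \<eta> + ?dZ \<eta>))) \<xi>"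
      by (rule wnorm_triangle[OF \<kappa> g4 g3])
    also have "\<dots> = K * wnorm \<kappa> (\<lambda>\<eta>. q \<eta> - q' \<eta>) \<xi> + (M * K) * wnorm \<kappa> (\<lambda>\<eta>. 4 * B + (?dW \<eta> + ?dZ \<eta>)) \<xi>"
      using K0 M by (simp only: wnorm_cmult wnorm_abs abs_of_nonneg mult_nonneg_nonneg)
    also have "\<dots> \<le> K * B + (M * K) * (4 * B * (2 / \<kappa>) + (B + B))"
    proof (intro add_mono mult_left_mono)
      show "wnorm \<kappa> (\<lambda>\<eta>. q \<eta> - q' \<eta>) \<xi> \<le> B" using cl by auto
      have "wnorm \<kappa> (\<lambda>\<eta>. 4 * B + (?dW \<eta> + ?dZ \<eta>)) \<xi> \<le> wnorm \<kappa> (\<lambda>\<eta>. 4 * B) \<xi> + wnorm \<kappa> (\<lambda>\<eta>. ?dW \<eta> + ?dZ \<eta>) \<xi>"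
        by (rule wnorm_triangle[OF \<kappa> ess_bounded_const g1])
      also have "wnorm \<kappa> (\<lambda>\<eta>. 4 * B) \<xi> = 4 * B * (2 / \<kappa>)" using wnorm_const[OF \<kappa>, of "4 * B" \<xi>] B0 by simp
      also have "wnorm \<kappa> (\<lambda>\<eta>. ?dW \<eta> + ?dZ \<eta>) \<xi> \<le> wnorm \<kappa> ?dW \<xi> + wnorm \<kappa> ?dZ \<xi>"
        by (rule wnorm_triangle[OF \<kappa> eabs(1,2)])
      also have "\<dots> \<le> B + B" unfolding wnorm_abs using cl by (intro add_mono) auto
      finally show "wnorm \<kappa> (\<lambda>\<eta>. 4 * B + (?dW \<eta> + ?dZ \<eta>)) \<xi> \<le> 4 * B * (2 / \<kappa>) + (B + B)" by simp
    qed (use K0 M in auto)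
    also have "\<dots> = ?K * B" by (simp add: algebra_simps)
    finally show "wnorm \<kappa> f \<xi> \<le> ?K * B" .
  qed
qed


lemma loclip_ess_bounded:
  assumes F: "loclip F" and q: "ess_bounded q" and b: "\<And>\<eta>. \<bar>U \<eta>\<bar> \<le> M \<and> \<bar>V \<eta>\<bar> \<le> M"
    and m: "(\<lambda>\<eta>. F (U \<eta>) (V \<eta>) (W \<eta>) (Z \<eta>) 0 0) \<in> borel_measurable borel"
  shows "ess_bounded (weighted F (U, V, W, Z, q))"
proof -
  have M: "0 \<le> M" using b[of 0] by linarith
  obtain K where K: "lip_on M K F" using F unfolding loclip_def by blast
  have "\<bar>F (U \<eta>) (V \<eta>) (W \<eta>) (Z \<eta>) 0 0\<bar> \<le> K" for \<eta>
    using b[of \<eta>] M by (intro lip_on_bound[OF K]) simp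
  then have "ess_bounded (\<lambda>\<eta>. F (U \<eta>) (V \<eta>) (W \<eta>) (Z \<eta>) 0 0)"
    by (intro ess_boundedI[OF m] AE_I2)
  then show ?thesis unfolding weighted_simp by (rule ess_bounded_mult[OF q])
qed

lemma coef_measurable:
  fixes U V W Z :: "real \<Rightarrow> real"
  assumes m: "U \<in> borel_measurable borel" "V \<in> borel_measurable borel"
    "W \<in> borel_measurable borel" "Z \<in> borel_measurable borel"
    and F: "F \<in> {coef_k, coef_p1, coef_s1, coef_p2, coef_s2}"
  shows "(\<lambda>\<eta>. F (U \<eta>) (V \<eta>) (W \<eta>) (Z \<eta>) 0 0) \<in> borel_measurable borel"
proof -
  have half: "(\<lambda>\<eta>. f \<eta> / 2) \<in> borel_measurable borel" if "f \<in> borel_measurable borel" for f :: "real \<Rightarrow> real"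
    using that by (intro borel_measurable_divide borel_measurable_const)
  note trig = measurable_compose[OF m(3) borel_measurable_sin] measurable_compose[OF m(4) borel_measurable_sin]
    measurable_compose[OF half[OF m(3)] borel_measurable_sin] measurable_compose[OF half[OF m(4)] borel_measurable_sin]
    measurable_compose[OF half[OF m(3)] borel_measurable_cos] measurable_compose[OF half[OF m(4)] borel_measurable_cos]
  have "(\<lambda>\<eta>. coef_k (U \<eta>) (V \<eta>) (W \<eta>) (Z \<eta>) 0 0) \<in> borel_measurable borel"
    "(\<lambda>\<eta>. coef_p1 (U \<eta>) (V \<eta>) (W \<eta>) (Z \<eta>) 0 0) \<in> borel_measurable borel"
    "(\<lambda>\<eta>. coef_s1 (U \<eta>) (V \<eta>) (W \<eta>) (Z \<eta>) 0 0) \<in> borel_measurable borel"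
    "(\<lambda>\<eta>. coef_p2 (U \<eta>) (V \<eta>) (W \<eta>) (Z \<eta>) 0 0) \<in> borel_measurable borel"
    "(\<lambda>\<eta>. coef_s2 (U \<eta>) (V \<eta>) (W \<eta>) (Z \<eta>) 0 0) \<in> borel_measurable borel"
    unfolding coef_defs
    by (intro borel_measurable_add borel_measurable_times borel_measurable_power borel_measurable_const m trig)+
  then show ?thesis using F by auto
qed

fun ref_bounds :: "real \<Rightarrow> real \<Rightarrow> real \<Rightarrow> state \<Rightarrow> bool" where
  "ref_bounds \<kappa> m M (U, V, W, Z, q) \<longleftrightarrow> regular (U, V, W, Z, q) \<and> (\<forall>\<xi>. \<bar>U \<xi>\<bar> \<le> M \<and> \<bar>V \<xi>\<bar> \<le> M) \<and>
     (AE \<xi> in lborel. \<bar>q \<xi>\<bar> \<le> M) \<and>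
     (\<forall>\<eta> \<xi>. \<eta> \<le> \<xi> \<longrightarrow> 4 * \<kappa> * (\<xi> - \<eta>) - m \<le> (LBINT s=ereal \<eta>..ereal \<xi>. weighted coef_k (U, V, W, Z, q) s))"

text \<open>The integer may vary with \<xi>, so the shift is a function and not a constant.\<close>

fun angle_shift :: "state \<Rightarrow> state \<Rightarrow> bool" where
  "angle_shift (U, V, W, Z, q) (U', V', W', Z', q') \<longleftrightarrow> U' = U \<and> V' = V \<and> q' = q \<and>
     ess_bounded W' \<and> ess_bounded Z' \<and>
     (AE \<xi> in lborel. \<exists>j::int. W' \<xi> = W \<xi> + 2 * pi * of_int j) \<and>
     (AE \<xi> in lborel. \<exists>j::int. Z' \<xi> = Z \<xi> + 2 * pi * of_int j)"

text \<open>The constants \<open>L\<close> and \<delta> are fixed before \<open>X\<close> and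
  \<open>Y\<close>, and quantitative bounds are imposed on \<open>X\<close> only. Closeness is
  assumed for the shifted state \<open>Ys\<close> but concluded for the right-hand side at
  \<open>Y\<close> itself, because the differential equation holds for \<open>Y\<close>.\<close>

lemma ode_rhs_lipschitz:
  assumes \<kappa>: "0 < \<kappa>" and m: "0 \<le> m" and M: "1 \<le> M"
  shows "\<exists>L \<delta>. 0 \<le> L \<and> 0 < \<delta> \<and> (\<forall>X Y Ys B. ref_bounds \<kappa> m M X \<longrightarrow> regular Y \<longrightarrow> angle_shift Y Ys \<longrightarrow>
    0 \<le> B \<longrightarrow> B \<le> \<delta> \<longrightarrow> close \<kappa> B X Ys \<longrightarrow> regular (ode_rhs X) \<longrightarrow> regular (ode_rhs Y) \<longrightarrow>
    close \<kappa> (L * B) (ode_rhs X) (ode_rhs Y))"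
proof -
  let ?S = "{coef_k, coef_p1, coef_s1, coef_p2, coef_s2}"
  have M1: "0 \<le> M + 1" using M by simp
  define KF where "KF = (\<lambda>F. SOME K. wlip \<kappa> (M + 1) F K)"
  have KF: "wlip \<kappa> (M + 1) F (KF F)" if "loclip F" for F
    unfolding KF_def by (rule someI_ex) (rule loclip_imp_wlip[OF that \<kappa> M1])
  note KF0 = KF[THEN wlip_nonneg] and KFb = KF[THEN wlip_bound]
  define K where "K = KF coef_k + KF coef_p1 + KF coef_s1 + KF coef_p2 + KF coef_s2 + 1"
  have K: "0 < K" "\<And>F. F \<in> ?S \<Longrightarrow> KF F \<le> K"
    unfolding K_def using loclip_coef[THEN KF0] by auto
  define N where "N = (M + 1) * K"
  have N0: "0 \<le> N" using M1 K(1) by (simp add: N_def)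
  define C where "C = exp (m + 2 * \<kappa>)"
  define N1 where "N1 = C * N * (2 / \<kappa>)"
  define L1 where "L1 = C * (K * N * (2 / \<kappa>) + K)"
  have N10: "0 \<le> N1" and L10: "0 \<le> L1"
    using N0 K(1) \<kappa> by (simp_all add: N1_def L1_def C_def)
  \<comment> \<open>\<open>M + 1\<close> bounds \<open>U\<close> and \<open>V\<close> of both
    states, \<open>N1\<close> the potentials of the reference state, and \<open>N1 + L1\<close>
    those of its neighbour, since B is at most 1.\<close>
  define M3 where "M3 = M + 1 + N1 + L1"
  have M3: "0 \<le> M3" "M + 1 \<le> M3" "N1 \<le> M3" "N1 + L1 \<le> M3" using M N10 L10 by (simp_all add: M3_def)
  obtain KW KZ Kq where wl: "wlip \<kappa> M3 coef_W KW" "wlip \<kappa> M3 coef_Z KZ" "wlip \<kappa> M3 coef_q Kq"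
    using loclip_coef(6-8)[THEN loclip_imp_wlip, OF \<kappa> M3(1)] by blast
  note KW = wlip_nonneg[OF wl(1)] and KZ = wlip_nonneg[OF wl(2)] and Kq = wlip_nonneg[OF wl(3)]
  note KWw = wlip_wnorm[OF wl(1)] and KZw = wlip_wnorm[OF wl(2)] and Kqw = wlip_wnorm[OF wl(3)]
  define L where "L = 2 * L1 + (KW + KZ + Kq) * (1 + L1)"
  have L0: "0 \<le> L" using L10 KW KZ Kq by (simp add: L_def)
  \<comment> \<open>The 1 keeps the neighbour's \<open>U\<close> and \<open>V\<close> below
    \<open>M + 1\<close>; the second entry is the smallness condition of \<open>NL_bounds\<close>
    for D = K B.\<close>
  define \<delta> where "\<delta> = min 1 (2 * \<kappa> / (exp \<kappa> * K))"
  have \<delta>: "0 < \<delta>" "\<delta> \<le> 1" "exp \<kappa> * (K * \<delta>) \<le> 2 * \<kappa>"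
  proof -
    show "0 < \<delta>" "\<delta> \<le> 1" using \<kappa> K(1) by (simp_all add: \<delta>_def)
    have "\<delta> \<le> 2 * \<kappa> / (exp \<kappa> * K)" by (simp add: \<delta>_def)
    then show "exp \<kappa> * (K * \<delta>) \<le> 2 * \<kappa>" using K(1) by (simp add: field_simps)
  qed
  show ?thesis
  proof (rule exI[of _ L], rule exI[of _ \<delta>], intro conjI L0 \<delta>(1) allI impI)
    fix X Y Ys B
    assume ref: "ref_bounds \<kappa> m M X" and regY: "regular Y" and shift: "angle_shift Y Ys"
      and B: "0 \<le> B" "B \<le> \<delta>" and clX: "close \<kappa> B X Ys" and rX: "regular (ode_rhs X)" and rY: "regular (ode_rhs Y)"
    obtain U V W Z q where X: "X = (U, V, W, Z, q)" by (cases X)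
    obtain U' V' W' Z' q' where Y: "Y = (U', V', W', Z', q')" by (cases Y)
    obtain W'' Z'' where Ys: "Ys = (U', V', W'', Z'', q')" using shift unfolding Y by (cases Ys) auto
    have reg: "regular (U, V, W, Z, q)" and UV: "\<And>\<xi>. \<bar>U \<xi>\<bar> \<le> M \<and> \<bar>V \<xi>\<bar> \<le> M" and q: "AE \<xi> in lborel. \<bar>q \<xi>\<bar> \<le> M"
      and decay: "\<And>\<eta> \<xi>. \<eta> \<le> \<xi> \<Longrightarrow> 4 * \<kappa> * (\<xi> - \<eta>) - m \<le> (LBINT s=ereal \<eta>..ereal \<xi>. weighted coef_k (U, V, W, Z, q) s)"
      using ref unfolding X ref_bounds.simps by blast+
    have W'': "ess_bounded W''" and Z'': "ess_bounded Z''"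
      and shW: "AE \<xi> in lborel. \<exists>j::int. W'' \<xi> = W' \<xi> + 2 * pi * of_int j"
      and shZ: "AE \<xi> in lborel. \<exists>j::int. Z'' \<xi> = Z' \<xi> + 2 * pi * of_int j"
      using shift unfolding Y Ys angle_shift.simps by blast+
    note reg' = regY[unfolded Y] and cl = clX[unfolded X Ys] and rr = rX[unfolded X] and rr' = rY[unfolded Y]
    let ?X = "(U, V, W, Z, q)" and ?X' = "(U', V', W', Z', q')" and ?X'' = "(U', V', W'', Z'', q')"
    have B1: "B \<le> 1" using B \<delta> by linarith
    have UV1: "\<forall>\<eta>. \<bar>U \<eta>\<bar> \<le> M + 1 \<and> \<bar>V \<eta>\<bar> \<le> M + 1"
    proof
      show "\<bar>U \<eta>\<bar> \<le> M + 1 \<and> \<bar>V \<eta>\<bar> \<le> M + 1" for \<eta> using UV[of \<eta>] by linarith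
    qed
    have UV': "\<forall>\<eta>. \<bar>U' \<eta>\<bar> \<le> M + 1 \<and> \<bar>V' \<eta>\<bar> \<le> M + 1"
    proof
      fix \<eta>
      have "\<bar>U \<eta> - U' \<eta>\<bar> \<le> B" "\<bar>V \<eta> - V' \<eta>\<bar> \<le> B" using cl by auto
      then show "\<bar>U' \<eta>\<bar> \<le> M + 1 \<and> \<bar>V' \<eta>\<bar> \<le> M + 1" using UV[of \<eta>] B1 by linarith
    qed
    have q1: "AE \<eta> in lborel. \<bar>q \<eta>\<bar> \<le> M + 1" using q by eventually_elim linarith
    note R = reg[unfolded regular.simps] and R' = reg'[unfolded regular.simps]
    have Wm: "W \<in> borel_measurable borel" "Z \<in> borel_measurable borel" "W' \<in> borel_measurable borel" "Z' \<in> borel_measurable borel"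
      "W'' \<in> borel_measurable borel" "Z'' \<in> borel_measurable borel"
      using R R' W'' Z'' ess_bounded_measurable by blast+
    have lip: "loclip F" "trig_periodic F" if "F \<in> ?S" for F
      using that loclip_coef trig_periodic_coef by auto
    have eb: "ess_bounded (weighted F ?X)" "ess_bounded (weighted F ?X')" "ess_bounded (weighted F ?X'')" if F: "F \<in> ?S" for F
      using R R' UV1 UV' Wm
      by (auto intro!: loclip_ess_bounded[OF lip(1)[OF F], where M = "M + 1"] coef_measurable[OF _ _ _ _ F])
    have ae_eq: "AE \<eta> in lborel. weighted F ?X' \<eta> = weighted F ?X'' \<eta>" if F: "F \<in> ?S" for F
      using shW shZ
    proof eventually_elim
      case (elim \<eta>)
      then show ?case using lip(2)[OF F] by (auto simp: weighted_simp trig_periodic_def)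
    qed
    have dW: "ess_bounded (\<lambda>\<eta>. W \<eta> - W'' \<eta>)" "ess_bounded (\<lambda>\<eta>. Z \<eta> - Z'' \<eta>)" "ess_bounded (\<lambda>\<eta>. q \<eta> - q' \<eta>)"
      using R R' W'' Z'' by (simp_all add: ess_bounded_diff)
    have w: "wnorm \<kappa> (\<lambda>s. weighted F ?X s - weighted F ?X'' s) \<xi> \<le> K * B" if F: "F \<in> ?S" for F \<xi>
    proof -
      have "wnorm \<kappa> (\<lambda>s. weighted F ?X s - weighted F ?X'' s) \<xi> \<le> KF F * B"
        by (rule wlip_wnorm[OF KF[OF lip(1)[OF F]], where a = "\<lambda>_. 0" and b = "\<lambda>_. 0" and a' = "\<lambda>_. 0" and b' = "\<lambda>_. 0",
              OF _ _ q1 cl _ dW ess_bounded_measurable[OF ess_bounded_diff[OF eb(1,3)[OF F]]]])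
           (use UV1 UV' B(1) M1 in \<open>simp_all add: weighted_simp\<close>)
      also have "\<dots> \<le> K * B" by (intro mult_right_mono K(2) F B(1))
      finally show ?thesis .
    qed
    have Nb: "AE s in lborel. \<bar>weighted F ?X s\<bar> \<le> N" if F: "F \<in> ?S" for F
      using q1
    proof eventually_elim
      case (elim s)
      have "\<bar>F (U s) (V s) (W s) (Z s) 0 0\<bar> \<le> KF F" using UV1 M by (intro KFb lip(1) F) simp
      also have "\<dots> \<le> K" by (rule K(2)[OF F])
      finally show ?case unfolding weighted_simp N_def abs_mult using elim M by (intro mult_mono) auto
    qed
    have dec: "exp \<kappa> * (K * B) \<le> 2 * \<kappa>"
    proof -
      have "exp \<kappa> * (K * B) \<le> exp \<kappa> * (K * \<delta>)" using B K(1) by (intro mult_left_mono) auto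
      then show ?thesis using \<delta>(3) by linarith
    qed
    have NLb: "\<bar>NL (weighted coef_k ?X) (weighted F ?X) A \<xi>\<bar> \<le> N1"
      and NLd: "\<bar>NL (weighted coef_k ?X) (weighted F ?X) A \<xi> - NL (weighted coef_k ?X') (weighted F ?X') A \<xi>\<bar> \<le> L1 * B"
      if F: "F \<in> ?S" and A: "A \<in> sets borel" for F A \<xi>
    proof -
      have kS: "coef_k \<in> ?S" by simp
      note nb = NL_bounds[OF \<kappa> eb(1)[OF kS] eb(3)[OF kS] decay w[OF kS] dec ess_bounded_measurable[OF eb(1)[OF F]] Nb[OF F] N0 eb(3)[OF F] w[OF F] A m, of \<xi>]
      show "\<bar>NL (weighted coef_k ?X) (weighted F ?X) A \<xi>\<bar> \<le> N1"
        using nb(1) unfolding N1_def C_def .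
      \<comment> \<open>The estimate just obtained concerns the shifted state; periodicity carries
        it over to the unshifted one.\<close>
      have "NL (weighted coef_k ?X') (weighted F ?X') A \<xi> = NL (weighted coef_k ?X'') (weighted F ?X'') A \<xi>"
        by (rule NL_cong_AE[OF eb(2,3)[OF kS] ae_eq[OF kS] eb(2,3)[OF F] ae_eq[OF F] A])
      moreover have "C * (K * B * N * (2 / \<kappa>) + K * B) = L1 * B" by (simp add: L1_def algebra_simps)
      ultimately show "\<bar>NL (weighted coef_k ?X) (weighted F ?X) A \<xi> - NL (weighted coef_k ?X') (weighted F ?X') A \<xi>\<bar> \<le> L1 * B"
        using nb(2) unfolding C_def by simp
    qed
    have deriv_d: "\<bar>nl_deriv (weighted coef_k ?X) (weighted F ?X) (weighted G ?X) \<xi>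
        - nl_deriv (weighted coef_k ?X') (weighted F ?X') (weighted G ?X') \<xi>\<bar> \<le> 2 * (L1 * B)"
      if F: "F \<in> ?S" "G \<in> ?S" for F G \<xi>
    proof -
      have num: "\<bar>- (1/2 * (a - b)) - 1/8 * c - (- (1/2 * (a' - b')) - 1/8 * c')\<bar> \<le> 2 * e"
        if "\<bar>a - a'\<bar> \<le> e" "\<bar>b - b'\<bar> \<le> e" "\<bar>c - c'\<bar> \<le> e" for a b c a' b' c' e :: real
        using that unfolding abs_le_iff by (intro conjI) (simp_all add: field_simps)
      show ?thesis unfolding nl_deriv_def by (rule num; rule NLd[OF F(1)] NLd[OF F(2)]; simp)
    qed
    have pot_b: "\<bar>nl_potential (weighted coef_k ?X) (weighted F ?X) (weighted G ?X) \<xi>\<bar> \<le> N1"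
      if F: "F \<in> ?S" "G \<in> ?S" for F G \<xi>
    proof -
      have num: "\<bar>1/2 * a + 1/8 * (b - c)\<bar> \<le> e" if "\<bar>a\<bar> \<le> e" "\<bar>b\<bar> \<le> e" "\<bar>c\<bar> \<le> e" for a b c e :: real
        using that unfolding abs_le_iff by (intro conjI) (simp_all add: field_simps)
      show ?thesis unfolding nl_potential_def by (rule num; rule NLb[OF F(1)] NLb[OF F(2)]; simp)
    qed
    have pot_d: "\<bar>nl_potential (weighted coef_k ?X) (weighted F ?X) (weighted G ?X) \<xi>
        - nl_potential (weighted coef_k ?X') (weighted F ?X') (weighted G ?X') \<xi>\<bar> \<le> L1 * B"
      if F: "F \<in> ?S" "G \<in> ?S" for F G \<xi>
    proof -
      have num: "\<bar>1/2 * a + 1/8 * (b - c) - (1/2 * a' + 1/8 * (b' - c'))\<bar> \<le> e"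
        if "\<bar>a - a'\<bar> \<le> e" "\<bar>b - b'\<bar> \<le> e" "\<bar>c - c'\<bar> \<le> e" for a b c a' b' c' e :: real
        using that unfolding abs_le_iff by (intro conjI) (simp_all add: field_simps)
      show ?thesis unfolding nl_potential_def by (rule num; rule NLd[OF F(1)] NLd[OF F(2)]; simp)
    qed
    have LB: "0 \<le> L1 * B" "L1 * B \<le> L1" using L10 B(1) B1 by (simp_all add: mult_left_le)
    have PS: "\<bar>potential_u ?X \<xi>\<bar> \<le> N1" "\<bar>potential_v ?X \<xi>\<bar> \<le> N1" "\<bar>potential_u ?X \<xi> - potential_u ?X' \<xi>\<bar> \<le> L1 * B" "\<bar>potential_v ?X \<xi> - potential_v ?X' \<xi>\<bar> \<le> L1 * B" for \<xi>
      unfolding potential_u_def potential_v_def by (rule pot_b pot_d; simp)+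
    \<comment> \<open>A common bound for the components, which differ by at most B, and for the
      potentials, which differ by at most L1 B.\<close>
    define B' where "B' = (1 + L1) * B"
    have B': "B \<le> B'" "L1 * B \<le> B'" using LB(1) B(1) by (simp_all add: B'_def algebra_simps)
    have cl': "close \<kappa> B' (U, V, W, Z, q) (U', V', W'', Z'', q')"
      using cl B'(1) by (auto intro: order_trans)
    have b1: "\<bar>U \<eta>\<bar> \<le> M3 \<and> \<bar>V \<eta>\<bar> \<le> M3 \<and> \<bar>potential_u ?X \<eta>\<bar> \<le> M3 \<and> \<bar>potential_v ?X \<eta>\<bar> \<le> M3" for \<eta>
      using UV1[rule_format, of \<eta>] PS(1,2)[of \<eta>] M3 by linarith
    have b2: "\<bar>U' \<eta>\<bar> \<le> M3 \<and> \<bar>V' \<eta>\<bar> \<le> M3 \<and> \<bar>potential_u ?X' \<eta>\<bar> \<le> M3 \<and> \<bar>potential_v ?X' \<eta>\<bar> \<le> M3" for \<eta>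
    proof -
      have num: "\<bar>y\<bar> \<le> M3" if "\<bar>x\<bar> \<le> N1" "\<bar>x - y\<bar> \<le> L1 * B" for x y
        using that M3(4) LB(2) by linarith
      show ?thesis using UV'[rule_format, of \<eta>] M3(2) num[OF PS(1,3)] num[OF PS(2,4)] by (meson order_trans)
    qed
    have ab: "\<bar>potential_u ?X \<eta> - potential_u ?X' \<eta>\<bar> \<le> B' \<and> \<bar>potential_v ?X \<eta> - potential_v ?X' \<eta>\<bar> \<le> B'" for \<eta>
      using PS(3,4)[of \<eta>] B' by linarith
    have q3: "AE \<eta> in lborel. \<bar>q \<eta>\<bar> \<le> M3" using q1 M3(2) by (auto elim!: eventually_mono)
    \<comment> \<open>The equations for \<open>W\<close> and \<open>Z\<close> carry no factor
      \<open>q\<close>, so \<open>wlip\<close> is applied to them with both weights equal to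
      1.\<close>
    have one3: "AE \<eta> in lborel. \<bar>1::real\<bar> \<le> M3" using M M3(2) by simp
    have cl1: "close \<kappa> B' (U, V, W, Z, \<lambda>_. 1) (U', V', W'', Z'', \<lambda>_. 1)"
      using cl' wnorm_const[OF \<kappa>, of 0] B' B by auto
    have d1: "ess_bounded (\<lambda>\<eta>. (1::real) - 1)" by (rule ess_bounded_const)
    have ae: "AE \<eta> in lborel. F (U' \<eta>) (V' \<eta>) (W' \<eta>) (Z' \<eta>) (a \<eta>) (b \<eta>) = F (U' \<eta>) (V' \<eta>) (W'' \<eta>) (Z'' \<eta>) (a \<eta>) (b \<eta>)"
      if "trig_periodic F" for F a b
      using shW shZ
    proof eventually_elim
      case (elim \<eta>)
      then show ?case using that by (auto simp: trig_periodic_def)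
    qed
    note rm = rr[unfolded ode_rhs_eq regular.simps] and rm' = rr'[unfolded ode_rhs_eq regular.simps]
    have rW: "wnorm \<kappa> (\<lambda>\<eta>. coef_W (U \<eta>) (V \<eta>) (W \<eta>) (Z \<eta>) (potential_u ?X \<eta>) (potential_v ?X \<eta>)
        - coef_W (U' \<eta>) (V' \<eta>) (W' \<eta>) (Z' \<eta>) (potential_u ?X' \<eta>) (potential_v ?X' \<eta>)) \<xi> \<le> KW * B'" for \<xi>
    proof (rule KWw[OF b1 b2 one3 cl1 ab dW(1,2) d1])
      show "(\<lambda>\<eta>. coef_W (U \<eta>) (V \<eta>) (W \<eta>) (Z \<eta>) (potential_u ?X \<eta>) (potential_v ?X \<eta>)
        - coef_W (U' \<eta>) (V' \<eta>) (W' \<eta>) (Z' \<eta>) (potential_u ?X' \<eta>) (potential_v ?X' \<eta>)) \<in> borel_measurable borel"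
        using rm rm' by (intro borel_measurable_diff ess_bounded_measurable) blast+
    qed (use ae[OF trig_periodic_coef(6), of "potential_u ?X'" "potential_v ?X'"] in \<open>auto elim!: eventually_mono\<close>)
    have rZ: "wnorm \<kappa> (\<lambda>\<eta>. coef_Z (U \<eta>) (V \<eta>) (W \<eta>) (Z \<eta>) (potential_u ?X \<eta>) (potential_v ?X \<eta>)
        - coef_Z (U' \<eta>) (V' \<eta>) (W' \<eta>) (Z' \<eta>) (potential_u ?X' \<eta>) (potential_v ?X' \<eta>)) \<xi> \<le> KZ * B'" for \<xi>
    proof (rule KZw[OF b1 b2 one3 cl1 ab dW(1,2) d1])
      show "(\<lambda>\<eta>. coef_Z (U \<eta>) (V \<eta>) (W \<eta>) (Z \<eta>) (potential_u ?X \<eta>) (potential_v ?X \<eta>)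
        - coef_Z (U' \<eta>) (V' \<eta>) (W' \<eta>) (Z' \<eta>) (potential_u ?X' \<eta>) (potential_v ?X' \<eta>)) \<in> borel_measurable borel"
        using rm rm' by (intro borel_measurable_diff ess_bounded_measurable) blast+
    qed (use ae[OF trig_periodic_coef(7), of "potential_u ?X'" "potential_v ?X'"] in \<open>auto elim!: eventually_mono\<close>)
    have rq: "wnorm \<kappa> (\<lambda>\<eta>. q \<eta> * coef_q (U \<eta>) (V \<eta>) (W \<eta>) (Z \<eta>) (potential_u ?X \<eta>) (potential_v ?X \<eta>)
        - q' \<eta> * coef_q (U' \<eta>) (V' \<eta>) (W' \<eta>) (Z' \<eta>) (potential_u ?X' \<eta>) (potential_v ?X' \<eta>)) \<xi> \<le> Kq * B'" for \<xi>
    proof (rule Kqw[OF b1 b2 q3 cl' ab dW])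
      show "(\<lambda>\<eta>. q \<eta> * coef_q (U \<eta>) (V \<eta>) (W \<eta>) (Z \<eta>) (potential_u ?X \<eta>) (potential_v ?X \<eta>)
        - q' \<eta> * coef_q (U' \<eta>) (V' \<eta>) (W' \<eta>) (Z' \<eta>) (potential_u ?X' \<eta>) (potential_v ?X' \<eta>)) \<in> borel_measurable borel"
        using rm rm' by (intro borel_measurable_diff ess_bounded_measurable) blast+
    qed (use ae[OF trig_periodic_coef(8), of "potential_u ?X'" "potential_v ?X'"] in \<open>auto elim!: eventually_mono\<close>)
    have le: "2 * (L1 * B) \<le> L * B" "KW * B' \<le> L * B" "KZ * B' \<le> L * B" "Kq * B' \<le> L * B"
    proof -
      have nn: "0 \<le> KW * B'" "0 \<le> KZ * B'" "0 \<le> Kq * B'" "0 \<le> L1 * B"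
        using KW KZ Kq LB(1) B'(1) B(1) by simp_all
      have "L * B = 2 * (L1 * B) + KW * B' + KZ * B' + Kq * B'"
        by (simp add: L_def B'_def algebra_simps)
      then show "2 * (L1 * B) \<le> L * B" "KW * B' \<le> L * B" "KZ * B' \<le> L * B" "Kq * B' \<le> L * B"
        using nn by linarith+
    qed
    show "close \<kappa> (L * B) (ode_rhs X) (ode_rhs Y)"
      unfolding X Y ode_rhs_eq close.simps
      by (intro allI conjI order_trans[OF deriv_d le(1)] order_trans[OF rW le(2)] order_trans[OF rZ le(3)] order_trans[OF rq le(4)])
         simp_all
  qed
qed

subsection \<open>A Gronwall argument without time integrals\<close>

text \<open>The growth condition is uniform in \<open>i\<close>, so the supremum over \<open>i\<close> (whose regularity in time is
  not clear) need not be formed.\<close>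

lemma barrier_gronwall:
  fixes \<phi> :: "'i \<Rightarrow> real \<Rightarrow> real"
  assumes T: "0 \<le> T" and L: "0 \<le> L" and d: "0 < d"
    and cont: "\<And>i t. 0 \<le> t \<Longrightarrow> t \<le> T \<Longrightarrow> isCont (\<phi> i) t"
    and init: "\<And>i. \<phi> i 0 \<le> d"
    and growth: "\<And>t B e. \<lbrakk>0 \<le> t; t \<le> T; 0 \<le> B; B \<le> \<delta>; \<And>i. \<phi> i t \<le> B; 0 < e\<rbrakk>
      \<Longrightarrow> \<exists>h0>0. \<forall>h i. 0 < h \<longrightarrow> h < h0 \<longrightarrow> \<phi> i (t + h) \<le> \<phi> i t + h * (L * B + e)"
    and small: "d * exp ((L + 1) * T) \<le> \<delta>"
    and t: "0 \<le> t" "t \<le> T"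
  shows "\<phi> i t \<le> d * exp ((L + 1) * t)"
proof -
  define \<beta> where "\<beta> = (\<lambda>t. d * exp ((L + 1) * t))"
  define S where "S = {t \<in> {0..T}. \<forall>s\<in>{0..t}. \<forall>i. \<phi> i s \<le> \<beta> s}"
  have S0: "0 \<in> S" using T init by (simp add: S_def \<beta>_def)
  have Sb: "bdd_above S" unfolding S_def by (intro bdd_aboveI[of _ T]) auto
  define r where "r = Sup S"
  have r: "0 \<le> r" "r \<le> T"
  proof -
    show "0 \<le> r" unfolding r_def by (rule cSup_upper[OF S0 Sb])
    show "r \<le> T" unfolding r_def by (rule cSup_least) (use S0 in \<open>auto simp: S_def\<close>)
  qed
  have below: "\<phi> i s \<le> \<beta> s" if s: "0 \<le> s" "s < r" for i s
  proof -
    obtain x where "x \<in> S" "s < x" using less_cSupD[of S s] S0 s unfolding r_def by auto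
    then show ?thesis using s by (auto simp: S_def)
  qed
  have at_r: "\<phi> i r \<le> \<beta> r" for i
  proof (cases "r = 0")
    case True
    then show ?thesis using init by (simp add: \<beta>_def)
  next
    case False
    then have r0: "0 < r" using r by simp
    show ?thesis
    proof (rule tendsto_le[of "at_left r"])
      have "isCont \<beta> r" unfolding \<beta>_def by (intro continuous_intros)
      then show "(\<beta> \<longlongrightarrow> \<beta> r) (at_left r)" by (simp add: isCont_def filterlim_at_split)
      show "(\<phi> i \<longlongrightarrow> \<phi> i r) (at_left r)" using cont[OF r, of i] by (simp add: isCont_def filterlim_at_split)
      show "\<forall>\<^sub>F s in at_left r. \<phi> i s \<le> \<beta> s"
        using eventually_at_left_real[OF r0] by (rule eventually_mono) (use below in auto)
    qed simp
  qed
  have upto_r: "\<phi> i s \<le> \<beta> s" if "0 \<le> s" "s \<le> r" for i s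
    using below[of s i] at_r[of i] that by (cases "s = r") auto
  have "r = T"
  proof (rule ccontr)
    assume "r \<noteq> T"
    then have rT: "r < T" using r by simp
    have \<beta>0: "0 < \<beta> r" using d by (simp add: \<beta>_def)
    have "\<beta> r \<le> \<beta> T" unfolding \<beta>_def using d L r by (intro mult_left_mono) (auto intro!: mult_left_mono)
    then have \<beta>\<delta>: "\<beta> r \<le> \<delta>" using small by (simp add: \<beta>_def)
    \<comment> \<open>The admissible error is taken to be the value of the barrier at r. It is
      absorbed by the 1 in the exponent L + 1, since 1 + (L+1) h is at most exp ((L+1) h); d > 0
      makes the value positive.\<close>
    obtain h0 where h0: "0 < h0" "\<And>h i. 0 < h \<Longrightarrow> h < h0 \<Longrightarrow> \<phi> i (r + h) \<le> \<phi> i r + h * (L * \<beta> r + \<beta> r)"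
      using growth[OF r less_imp_le[OF \<beta>0] \<beta>\<delta> at_r \<beta>0] by blast
    have step: "\<phi> i (r + h) \<le> \<beta> (r + h)" if h: "0 < h" "h < h0" for i h
    proof -
      have "\<phi> i (r + h) \<le> \<beta> r + h * (L * \<beta> r + \<beta> r)" using h0(2)[OF h, of i] at_r[of i] by linarith
      also have "\<dots> = \<beta> r * (1 + (L + 1) * h)" by (simp add: algebra_simps)
      also have "\<dots> \<le> \<beta> r * exp ((L + 1) * h)" using \<beta>0 by (intro mult_left_mono exp_ge_add_one_self) auto
      also have "\<dots> = \<beta> (r + h)" by (simp add: \<beta>_def exp_add distrib_left)
      finally show ?thesis .
    qed
    define h where "h = min (h0 / 2) (T - r)"
    have h: "0 < h" "h < h0" "r + h \<le> T" using h0(1) rT by (auto simp: h_def)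
    have "r + h \<in> S"
      unfolding S_def
    proof (intro CollectI conjI ballI allI)
      show "r + h \<in> {0..T}" using h r by auto
      fix s i assume s: "s \<in> {0..r + h}"
      show "\<phi> i s \<le> \<beta> s"
      proof (cases "s \<le> r")
        case True
        then show ?thesis using upto_r s by auto
      next
        case False
        then show ?thesis using step[of "s - r" i] s h by auto
      qed
    qed
    then have "r + h \<le> r" unfolding r_def by (rule cSup_upper[OF _ Sb])
    then show False using h by simp
  qed
  then show ?thesis using upto_r[of t i] t by (simp add: \<beta>_def)
qed

subsection \<open>First-order expansion in time\<close>

lemma Linf_norm_AE:
  assumes f: "f \<in> Linf_space"
  shows "AE x in lborel. \<bar>f x\<bar> \<le> Linf_norm f" "0 \<le> Linf_norm f"
proof -
  have [measurable]: "f \<in> borel_measurable borel" using f by (simp add: Linf_space_def)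
  obtain C where C: "AE x in lborel. \<bar>f x\<bar> \<le> C" using f by (auto simp: Linf_space_def)
  let ?s = "esssup lborel (\<lambda>x. ereal \<bar>f x\<bar>)"
  have "?s \<le> ereal C" using C by (intro esssup_I) (auto elim!: eventually_mono)
  moreover have "0 \<le> ?s"
  proof -
    have "esssup (lborel :: real measure) (\<lambda>x. 0 :: ereal) \<le> ?s" by (rule esssup_mono) auto
    moreover have "esssup (lborel :: real measure) (\<lambda>x. 0 :: ereal) = 0"
      by (rule esssup_const) simp
    ultimately show ?thesis by simp
  qed
  ultimately obtain r where r: "?s = ereal r" "0 \<le> r" by (cases ?s) auto
  then have n: "Linf_norm f = r" by (simp add: Linf_norm_def)
  show "0 \<le> Linf_norm f" using n r by simp
  have "AE x in lborel. ereal \<bar>f x\<bar> \<le> ?s" by (rule esssup_AE)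
  then show "AE x in lborel. \<bar>f x\<bar> \<le> Linf_norm f" unfolding r n by simp
qed

text \<open>What is needed of differentiability in E: a first-order expansion that is uniform in
  \<xi> for \<open>U\<close> and \<open>V\<close> and almost everywhere for \<open>W\<close>,
  \<open>Z\<close> and \<open>q\<close>.\<close>

fun lin_err :: "state \<Rightarrow> state \<Rightarrow> state \<Rightarrow> real \<Rightarrow> real \<Rightarrow> bool" where
  "lin_err (U1, V1, W1, Z1, q1) (U0, V0, W0, Z0, q0) (RU, RV, RW, RZ, Rq) h e \<longleftrightarrow>
    (\<forall>\<xi>. \<bar>U1 \<xi> - U0 \<xi> - h * RU \<xi>\<bar> \<le> \<bar>h\<bar> * e) \<and> (\<forall>\<xi>. \<bar>V1 \<xi> - V0 \<xi> - h * RV \<xi>\<bar> \<le> \<bar>h\<bar> * e) \<and>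
    (AE \<xi> in lborel. \<bar>W1 \<xi> - W0 \<xi> - h * RW \<xi>\<bar> \<le> \<bar>h\<bar> * e) \<and>
    (AE \<xi> in lborel. \<bar>Z1 \<xi> - Z0 \<xi> - h * RZ \<xi>\<bar> \<le> \<bar>h\<bar> * e) \<and>
    (AE \<xi> in lborel. \<bar>q1 \<xi> - q0 \<xi> - h * Rq \<xi>\<bar> \<le> \<bar>h\<bar> * e)"

lemma E_spaceD:
  assumes "(U, V, W, Z, q) \<in> E_space"
  shows "U \<in> H1_space" "V \<in> H1_space" "W \<in> Linf_space" "Z \<in> Linf_space" "q \<in> Linf_space"
    "W \<in> Lp_space 2" "Z \<in> Lp_space 2"
  using assms by (auto simp: E_space_def)

lemma E_space_regular: "X \<in> E_space \<Longrightarrow> regular X"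
  by (cases X) (simp add: E_spaceD H1_spaceD(2) ess_bounded_eq_Linf)

lemma H1_remainder_bound:
  assumes f1: "f1 \<in> H1_space" and f0: "f0 \<in> H1_space" and r: "r \<in> H1_space" and h: "h \<noteq> 0"
  shows "\<bar>f1 x - f0 x - h * r x\<bar> \<le> \<bar>h\<bar> * (3 * H1_norm ((\<lambda>\<xi>. 1 / h * (f1 - f0) \<xi>) - r))"
proof -
  have e: "(\<lambda>\<xi>. 1 / h * (f1 - f0) \<xi>) = (\<lambda>\<xi>. (1 / h) * f1 \<xi> + (- 1 / h) * f0 \<xi>)"
    by (simp add: fun_eq_iff algebra_simps)
  have "(\<lambda>\<xi>. 1 / h * (f1 - f0) \<xi>) - r \<in> H1_space"
    unfolding e by (rule H1_diff(1)[OF H1_lincomb(1)[OF f1 f0] r])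
  from H1_sup_bound[OF this, of x]
  have "\<bar>h\<bar> * \<bar>1 / h * (f1 x - f0 x) - r x\<bar> \<le> \<bar>h\<bar> * (3 * H1_norm ((\<lambda>\<xi>. 1 / h * (f1 - f0) \<xi>) - r))"
    by (intro mult_left_mono) auto
  moreover have "\<bar>h\<bar> * \<bar>1 / h * (f1 x - f0 x) - r x\<bar> = \<bar>f1 x - f0 x - h * r x\<bar>"
    using h by (simp add: algebra_simps flip: abs_mult)
  ultimately show ?thesis by simp
qed

lemma Linf_remainder_bound:
  assumes f1: "f1 \<in> Linf_space" and f0: "f0 \<in> Linf_space" and r: "r \<in> Linf_space" and h: "h \<noteq> 0"
  shows "AE x in lborel. \<bar>f1 x - f0 x - h * r x\<bar> \<le> \<bar>h\<bar> * Linf_norm ((\<lambda>\<xi>. 1 / h * (f1 - f0) \<xi>) - r)"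
    and "0 \<le> Linf_norm ((\<lambda>\<xi>. 1 / h * (f1 - f0) \<xi>) - r)"
proof -
  have e: "(\<lambda>\<xi>. 1 / h * (f1 - f0) \<xi>) - r = (\<lambda>\<xi>. 1 / h * (f1 \<xi> - f0 \<xi>) - r \<xi>)"
    by (simp add: fun_eq_iff)
  have m: "(\<lambda>\<xi>. 1 / h * (f1 - f0) \<xi>) - r \<in> Linf_space"
    unfolding e using f1 f0 r by (simp only: ess_bounded_eq_Linf[symmetric] ess_bounded_diff ess_bounded_cmult)
  show "0 \<le> Linf_norm ((\<lambda>\<xi>. 1 / h * (f1 - f0) \<xi>) - r)" by (rule Linf_norm_AE(2)[OF m])
  show "AE x in lborel. \<bar>f1 x - f0 x - h * r x\<bar> \<le> \<bar>h\<bar> * Linf_norm ((\<lambda>\<xi>. 1 / h * (f1 - f0) \<xi>) - r)"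
    using Linf_norm_AE(1)[OF m]
  proof (rule eventually_mono)
    fix x assume "\<bar>((\<lambda>\<xi>. 1 / h * (f1 - f0) \<xi>) - r) x\<bar> \<le> Linf_norm ((\<lambda>\<xi>. 1 / h * (f1 - f0) \<xi>) - r)"
    then have "\<bar>h\<bar> * \<bar>1 / h * (f1 x - f0 x) - r x\<bar> \<le> \<bar>h\<bar> * Linf_norm ((\<lambda>\<xi>. 1 / h * (f1 - f0) \<xi>) - r)"
      by (intro mult_left_mono) auto
    moreover have "\<bar>h\<bar> * \<bar>1 / h * (f1 x - f0 x) - r x\<bar> = \<bar>f1 x - f0 x - h * r x\<bar>"
      using h by (simp add: algebra_simps flip: abs_mult)
    ultimately show "\<bar>f1 x - f0 x - h * r x\<bar> \<le> \<bar>h\<bar> * Linf_norm ((\<lambda>\<xi>. 1 / h * (f1 - f0) \<xi>) - r)" by simp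
  qed
qed

text \<open>Each summand of \<open>E_norm\<close> is nonnegative and therefore at most the whole.
  The 3 compensates the constant in \<open>H1_sup_bound\<close>.\<close>

lemma lin_err_if_E_norm:
  assumes X1: "X1 \<in> E_space" and X0: "X0 \<in> E_space" and R: "R \<in> E_space" and h: "h \<noteq> 0"
    and le: "E_norm (scale_state (1 / h) (X1 - X0) - R) \<le> e / 3"
  shows "lin_err X1 X0 R h e"
proof -
  obtain U1 V1 W1 Z1 q1 where X1e: "X1 = (U1, V1, W1, Z1, q1)" by (cases X1) auto
  obtain U0 V0 W0 Z0 q0 where X0e: "X0 = (U0, V0, W0, Z0, q0)" by (cases X0) auto
  obtain RU RV RW RZ Rq where Re: "R = (RU, RV, RW, RZ, Rq)" by (cases R) auto
  note A = E_spaceD[OF X1[unfolded X1e]] and B = E_spaceD[OF X0[unfolded X0e]] and C = E_spaceD[OF R[unfolded Re]]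
  let ?r = "\<lambda>f1 f0 r. (\<lambda>\<xi>. 1 / h * (f1 - f0) \<xi>) - r"
  note lw = Linf_remainder_bound[OF A(3) B(3) C(3) h] and lz = Linf_remainder_bound[OF A(4) B(4) C(4) h]
    and lq = Linf_remainder_bound[OF A(5) B(5) C(5) h]
  note nn = W1p_norm_nonneg[of 2 "?r U1 U0 RU"] W1p_norm_nonneg[of 4 "?r U1 U0 RU"]
    W1p_norm_nonneg[of 2 "?r V1 V0 RV"] W1p_norm_nonneg[of 4 "?r V1 V0 RV"]
    Lp_norm_nonneg[of 2 "?r W1 W0 RW"] Lp_norm_nonneg[of 2 "?r Z1 Z0 RZ"] lw(2) lz(2) lq(2)
  have sum: "H1_norm (?r U1 U0 RU) + W1p_norm 4 (?r U1 U0 RU) + H1_norm (?r V1 V0 RV) + W1p_norm 4 (?r V1 V0 RV)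
     + Lp_norm 2 (?r W1 W0 RW) + Linf_norm (?r W1 W0 RW) + Lp_norm 2 (?r Z1 Z0 RZ) + Linf_norm (?r Z1 Z0 RZ)
     + Linf_norm (?r q1 q0 Rq) \<le> e / 3"
    using le unfolding X1e X0e Re by simp
  have parts: "3 * H1_norm (?r U1 U0 RU) \<le> e" "3 * H1_norm (?r V1 V0 RV) \<le> e"
    "Linf_norm (?r W1 W0 RW) \<le> e" "Linf_norm (?r Z1 Z0 RZ) \<le> e" "Linf_norm (?r q1 q0 Rq) \<le> e"
    using nn sum by linarith+
  have ae: "AE \<xi> in lborel. \<bar>f \<xi>\<bar> \<le> \<bar>h\<bar> * e"
    if "AE \<xi> in lborel. \<bar>f \<xi>\<bar> \<le> \<bar>h\<bar> * c" "c \<le> e" for f :: "real \<Rightarrow> real" and c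
    using that(1) by (rule eventually_mono) (meson abs_ge_zero mult_left_mono order_trans that(2))
  show ?thesis
    unfolding X1e X0e Re lin_err.simps
    by (intro conjI allI order_trans[OF H1_remainder_bound[OF A(1) B(1) C(1) h]]
        order_trans[OF H1_remainder_bound[OF A(2) B(2) C(2) h]] mult_left_mono parts abs_ge_zero
        ae[OF lw(1) parts(3)] ae[OF lz(1) parts(4)] ae[OF lq(1) parts(5)])
qed

lemma has_E_derivative_expansion:
  assumes X: "\<And>t. X t \<in> E_space" and d: "has_E_derivative X R t" and e: "0 < e"
  shows "\<exists>h0>0. \<forall>h. \<bar>h\<bar> < h0 \<longrightarrow> lin_err (X (t + h)) (X t) R h e"
proof -
  have R: "R \<in> E_space" and lim: "((\<lambda>h. E_norm (scale_state (1 / h) (X (t + h) - X t) - R)) \<longlongrightarrow> 0) (at 0)"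
    using d by (auto simp: has_E_derivative_def)
  have "\<forall>\<^sub>F h in at 0. E_norm (scale_state (1 / h) (X (t + h) - X t) - R) < e / 3"
    using e by (intro order_tendstoD(2)[OF lim]) auto
  then obtain h0 where h0: "0 < h0"
    "\<And>h. h \<noteq> 0 \<Longrightarrow> \<bar>h\<bar> < h0 \<Longrightarrow> E_norm (scale_state (1 / h) (X (t + h) - X t) - R) < e / 3"
    unfolding eventually_at by (auto simp: dist_real_def)
  have "lin_err (X (t + h)) (X t) R h e" if "\<bar>h\<bar> < h0" for h
  proof (cases "h = 0")
    case True
    then show ?thesis by (cases "X t"; cases R) simp
  next
    case False
    then show ?thesis
      using h0(2)[OF False that] by (intro lin_err_if_E_norm X R) auto
  qed
  then show ?thesis using h0(1) by blast
qed

text \<open>The component number and the point \<xi> together form one index, so that the five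
  families of distances become the single indexed family to which \<open>barrier_gronwall\<close>
  applies. All numbers from 4 on stand for \<open>q\<close>.\<close>

fun gap :: "real \<Rightarrow> nat \<times> real \<Rightarrow> state \<Rightarrow> state \<Rightarrow> real" where
  "gap \<kappa> (k, \<xi>) (U, V, W, Z, q) (U', V', W', Z', q') =
    (if k = 0 then \<bar>U \<xi> - U' \<xi>\<bar> else if k = 1 then \<bar>V \<xi> - V' \<xi>\<bar>
     else if k = 2 then wnorm \<kappa> (\<lambda>\<eta>. W \<eta> - W' \<eta>) \<xi> else if k = 3 then wnorm \<kappa> (\<lambda>\<eta>. Z \<eta> - Z' \<eta>) \<xi>
     else wnorm \<kappa> (\<lambda>\<eta>. q \<eta> - q' \<eta>) \<xi>)"

lemma close_iff_gap: "close \<kappa> B X X' \<longleftrightarrow> (\<forall>i. gap \<kappa> i X X' \<le> B)"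
proof -
  obtain U V W Z q where X: "X = (U, V, W, Z, q)" by (cases X) auto
  obtain U' V' W' Z' q' where X': "X' = (U', V', W', Z', q')" by (cases X') auto
  have "(\<forall>i. gap \<kappa> i X X' \<le> B) \<longleftrightarrow> (\<forall>k \<xi>. gap \<kappa> (k, \<xi>) X X' \<le> B)" by auto
  also have "\<dots> \<longleftrightarrow> close \<kappa> B X X'"
  proof
    assume l: "\<forall>k \<xi>. gap \<kappa> (k, \<xi>) X X' \<le> B"
    show "close \<kappa> B X X'"
      using l[rule_format, of 0] l[rule_format, of 1] l[rule_format, of 2] l[rule_format, of 3] l[rule_format, of 4]
      unfolding X X' by simp
  qed (simp add: X X')
  finally show ?thesis by simp
qed

lemma wnorm_expand:
  assumes \<kappa>: "0 < \<kappa>" and b: "ess_bounded f1" "ess_bounded f0" "ess_bounded r"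
    and e: "0 \<le> e" and le: "AE \<xi> in lborel. \<bar>f1 \<xi> - f0 \<xi> - h * r \<xi>\<bar> \<le> \<bar>h\<bar> * e"
  shows "\<bar>wnorm \<kappa> f1 \<xi> - wnorm \<kappa> f0 \<xi>\<bar> \<le> \<bar>h\<bar> * (wnorm \<kappa> r \<xi> + e * (2 / \<kappa>))"
proof -
  let ?e = "\<lambda>\<xi>. f1 \<xi> - f0 \<xi> - h * r \<xi>"
  have hr: "ess_bounded (\<lambda>\<xi>. h * r \<xi>)" by (rule ess_bounded_cmult[OF b(3)])
  have eb: "ess_bounded ?e" by (intro ess_bounded_diff b hr)
  have rem: "ess_bounded (\<lambda>\<xi>. h * r \<xi> + ?e \<xi>)" by (rule ess_bounded_add[OF hr eb])
  have "wnorm \<kappa> (\<lambda>\<xi>. h * r \<xi> + ?e \<xi>) \<xi> \<le> wnorm \<kappa> (\<lambda>\<xi>. h * r \<xi>) \<xi> + wnorm \<kappa> ?e \<xi>"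
    by (rule wnorm_triangle[OF \<kappa> hr eb])
  also have "\<dots> \<le> \<bar>h\<bar> * wnorm \<kappa> r \<xi> + \<bar>h\<bar> * e * (2 / \<kappa>)"
    using wnorm_le_const[OF \<kappa> ess_bounded_measurable[OF eb] le] e by (simp add: wnorm_cmult)
  finally have d: "wnorm \<kappa> (\<lambda>\<xi>. h * r \<xi> + ?e \<xi>) \<xi> \<le> \<bar>h\<bar> * (wnorm \<kappa> r \<xi> + e * (2 / \<kappa>))"
    by (simp add: algebra_simps)
  have "wnorm \<kappa> f1 \<xi> \<le> wnorm \<kappa> f0 \<xi> + wnorm \<kappa> (\<lambda>\<xi>. h * r \<xi> + ?e \<xi>) \<xi>"
    using wnorm_triangle[OF \<kappa> b(2) rem, of \<xi>] by simp
  moreover have "wnorm \<kappa> f0 \<xi> \<le> wnorm \<kappa> f1 \<xi> + wnorm \<kappa> (\<lambda>\<xi>. h * r \<xi> + ?e \<xi>) \<xi>"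
    using wnorm_triangle[OF \<kappa> b(1) ess_bounded_cmult[OF rem, of "-1"], of \<xi>]
      wnorm_cmult[of \<kappa> "-1" "\<lambda>\<xi>. h * r \<xi> + ?e \<xi>" \<xi>] by simp
  ultimately show ?thesis using d by linarith
qed

text \<open>The gaps contain absolute values and may fail to be differentiable in time. The reverse
  triangle inequality bounds their increments by the gap of the derivatives instead.\<close>

lemma gap_expand:
  assumes \<kappa>: "0 < \<kappa>" and e: "0 \<le> e"
    and reg: "regular X1" "regular X0" "regular R" "regular X1'" "regular X0'" "regular R'"
    and l: "lin_err X1 X0 R h e" and l': "lin_err X1' X0' R' h e"
  shows "\<bar>gap \<kappa> i X1 X1' - gap \<kappa> i X0 X0'\<bar> \<le> \<bar>h\<bar> * (gap \<kappa> i R R' + 2 * e * (1 + 2 / \<kappa>))"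
proof -
  obtain U1 V1 W1 Z1 q1 where X1: "X1 = (U1, V1, W1, Z1, q1)" by (cases X1) auto
  obtain U0 V0 W0 Z0 q0 where X0: "X0 = (U0, V0, W0, Z0, q0)" by (cases X0) auto
  obtain RU RV RW RZ Rq where R: "R = (RU, RV, RW, RZ, Rq)" by (cases R) auto
  obtain U1' V1' W1' Z1' q1' where X1': "X1' = (U1', V1', W1', Z1', q1')" by (cases X1') auto
  obtain U0' V0' W0' Z0' q0' where X0': "X0' = (U0', V0', W0', Z0', q0')" by (cases X0') auto
  obtain RU' RV' RW' RZ' Rq' where R': "R' = (RU', RV', RW', RZ', Rq')" by (cases R') auto
  obtain k \<xi> where i: "i = (k, \<xi>)" by (cases i)
  note rg = reg[unfolded X1 X0 R X1' X0' R' regular.simps]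
  note ll = l[unfolded X1 X0 R lin_err.simps] and ll' = l'[unfolded X1' X0' R' lin_err.simps]
  have he: "0 \<le> \<bar>h\<bar> * (2 * e)" "0 \<le> \<bar>h\<bar> * (2 * e * (2 / \<kappa>))" using e \<kappa> by simp_all
  have pt: "\<bar>\<bar>a1 - a1'\<bar> - \<bar>a0 - a0'\<bar>\<bar> \<le> \<bar>h\<bar> * (\<bar>r - r'\<bar> + 2 * e * (1 + 2 / \<kappa>))"
    if "\<bar>a1 - a0 - h * r\<bar> \<le> \<bar>h\<bar> * e" "\<bar>a1' - a0' - h * r'\<bar> \<le> \<bar>h\<bar> * e" for a1 a0 r a1' a0' r'
  proof -
    have "\<bar>\<bar>a1 - a1'\<bar> - \<bar>a0 - a0'\<bar>\<bar> \<le> \<bar>(a1 - a1') - (a0 - a0')\<bar>" by (rule abs_triangle_ineq3)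
    also have "\<dots> = \<bar>(a1 - a0 - h * r) - (a1' - a0' - h * r') + h * (r - r')\<bar>" by (simp add: algebra_simps)
    also have "\<dots> \<le> (\<bar>a1 - a0 - h * r\<bar> + \<bar>a1' - a0' - h * r'\<bar>) + \<bar>h * (r - r')\<bar>"
      by (rule order_trans[OF abs_triangle_ineq add_right_mono[OF abs_triangle_ineq4]])
    also have "\<dots> \<le> \<bar>h\<bar> * (2 * e) + \<bar>h\<bar> * \<bar>r - r'\<bar>" using that by (simp add: abs_mult)
    also have "\<dots> \<le> \<bar>h\<bar> * (\<bar>r - r'\<bar> + 2 * e * (1 + 2 / \<kappa>))" using he(2) by (simp add: algebra_simps)
    finally show ?thesis .
  qed
  have wn: "\<bar>wnorm \<kappa> (\<lambda>\<eta>. f1 \<eta> - f1' \<eta>) \<xi> - wnorm \<kappa> (\<lambda>\<eta>. f0 \<eta> - f0' \<eta>) \<xi>\<bar>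
      \<le> \<bar>h\<bar> * (wnorm \<kappa> (\<lambda>\<eta>. r \<eta> - r' \<eta>) \<xi> + 2 * e * (1 + 2 / \<kappa>))"
    if b: "ess_bounded f1" "ess_bounded f0" "ess_bounded r" "ess_bounded f1'" "ess_bounded f0'" "ess_bounded r'"
      and a: "AE \<xi> in lborel. \<bar>f1 \<xi> - f0 \<xi> - h * r \<xi>\<bar> \<le> \<bar>h\<bar> * e"
      and a': "AE \<xi> in lborel. \<bar>f1' \<xi> - f0' \<xi> - h * r' \<xi>\<bar> \<le> \<bar>h\<bar> * e" for f1 f0 r f1' f0' r'
  proof -
    have ae: "AE \<xi> in lborel. \<bar>(f1 \<xi> - f1' \<xi>) - (f0 \<xi> - f0' \<xi>) - h * (r \<xi> - r' \<xi>)\<bar> \<le> \<bar>h\<bar> * (2 * e)"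
      using a a'
    proof eventually_elim
      case (elim \<xi>)
      have "(f1 \<xi> - f1' \<xi>) - (f0 \<xi> - f0' \<xi>) - h * (r \<xi> - r' \<xi>) = (f1 \<xi> - f0 \<xi> - h * r \<xi>) - (f1' \<xi> - f0' \<xi> - h * r' \<xi>)"
        by (simp add: algebra_simps)
      then show ?case using elim abs_triangle_ineq4[of "f1 \<xi> - f0 \<xi> - h * r \<xi>" "f1' \<xi> - f0' \<xi> - h * r' \<xi>"] by simp
    qed
    have "\<bar>wnorm \<kappa> (\<lambda>\<eta>. f1 \<eta> - f1' \<eta>) \<xi> - wnorm \<kappa> (\<lambda>\<eta>. f0 \<eta> - f0' \<eta>) \<xi>\<bar>
      \<le> \<bar>h\<bar> * (wnorm \<kappa> (\<lambda>\<eta>. r \<eta> - r' \<eta>) \<xi> + (2 * e) * (2 / \<kappa>))"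
      by (rule wnorm_expand[OF \<kappa> ess_bounded_diff[OF b(1,4)] ess_bounded_diff[OF b(2,5)] ess_bounded_diff[OF b(3,6)] _ ae])
         (use e in simp)
    also have "\<dots> \<le> \<bar>h\<bar> * (wnorm \<kappa> (\<lambda>\<eta>. r \<eta> - r' \<eta>) \<xi> + 2 * e * (1 + 2 / \<kappa>))"
      using he(1) by (simp add: algebra_simps)
    finally show ?thesis .
  qed
  have W: "\<bar>wnorm \<kappa> (\<lambda>\<eta>. W1 \<eta> - W1' \<eta>) \<xi> - wnorm \<kappa> (\<lambda>\<eta>. W0 \<eta> - W0' \<eta>) \<xi>\<bar>
      \<le> \<bar>h\<bar> * (wnorm \<kappa> (\<lambda>\<eta>. RW \<eta> - RW' \<eta>) \<xi> + 2 * e * (1 + 2 / \<kappa>))"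
    by (rule wn) (use rg ll ll' in blast)+
  have Z: "\<bar>wnorm \<kappa> (\<lambda>\<eta>. Z1 \<eta> - Z1' \<eta>) \<xi> - wnorm \<kappa> (\<lambda>\<eta>. Z0 \<eta> - Z0' \<eta>) \<xi>\<bar>
      \<le> \<bar>h\<bar> * (wnorm \<kappa> (\<lambda>\<eta>. RZ \<eta> - RZ' \<eta>) \<xi> + 2 * e * (1 + 2 / \<kappa>))"
    by (rule wn) (use rg ll ll' in blast)+
  have q: "\<bar>wnorm \<kappa> (\<lambda>\<eta>. q1 \<eta> - q1' \<eta>) \<xi> - wnorm \<kappa> (\<lambda>\<eta>. q0 \<eta> - q0' \<eta>) \<xi>\<bar>
      \<le> \<bar>h\<bar> * (wnorm \<kappa> (\<lambda>\<eta>. Rq \<eta> - Rq' \<eta>) \<xi> + 2 * e * (1 + 2 / \<kappa>))"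
    by (rule wn) (use rg ll ll' in blast)+
  have U: "\<bar>\<bar>U1 \<xi> - U1' \<xi>\<bar> - \<bar>U0 \<xi> - U0' \<xi>\<bar>\<bar> \<le> \<bar>h\<bar> * (\<bar>RU \<xi> - RU' \<xi>\<bar> + 2 * e * (1 + 2 / \<kappa>))"
    by (rule pt) (use ll ll' in blast)+
  have V: "\<bar>\<bar>V1 \<xi> - V1' \<xi>\<bar> - \<bar>V0 \<xi> - V0' \<xi>\<bar>\<bar> \<le> \<bar>h\<bar> * (\<bar>RV \<xi> - RV' \<xi>\<bar> + 2 * e * (1 + 2 / \<kappa>))"
    by (rule pt) (use ll ll' in blast)+
  show ?thesis
    unfolding X1 X0 R X1' X0' R' i gap.simps using U V W Z q by (simp split del: if_split split: if_splits)
qed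

text \<open>The shifts \<omega> and \<zeta> are independent of time, so \<open>Ys\<close> has the
  same increments as \<open>Y\<close> and obeys the same first-order expansion, with derivative
  \<open>ode_rhs (Y t)\<close>. The Lipschitz hypothesis is required only while the gap is at most
  \<delta>, and \<open>small\<close> ensures that the barrier stays below \<delta>.\<close>

lemma flow_comparison:
  assumes X: "\<And>t. X t \<in> E_space" and dX: "\<And>t. has_E_derivative X (ode_rhs (X t)) t"
    and Y: "\<And>t. Y t \<in> E_space" and dY: "\<And>t. has_E_derivative Y (ode_rhs (Y t)) t"
    and Ys: "\<And>t. Ys t = (case Y t of (U, V, W, Z, q) \<Rightarrow> (U, V, \<lambda>\<xi>. W \<xi> + \<omega> \<xi>, \<lambda>\<xi>. Z \<xi> + \<zeta> \<xi>, q))"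
    and \<omega>: "ess_bounded \<omega>" "ess_bounded \<zeta>"
    and \<kappa>: "0 < \<kappa>" and T: "0 \<le> T" and L: "0 \<le> L" and d: "0 < d" and small: "d * exp ((L + 1) * T) \<le> \<delta>"
    and lip: "\<And>t B. \<lbrakk>\<bar>t\<bar> \<le> T; 0 \<le> B; B \<le> \<delta>; close \<kappa> B (X t) (Ys t)\<rbrakk>
      \<Longrightarrow> close \<kappa> (L * B) (ode_rhs (X t)) (ode_rhs (Y t))"
    and init: "close \<kappa> d (X 0) (Ys 0)" and t: "\<bar>t\<bar> \<le> T"
  shows "close \<kappa> (d * exp ((L + 1) * T)) (X t) (Ys t)"
proof -
  have RX: "ode_rhs (X t) \<in> E_space" and RY: "ode_rhs (Y t) \<in> E_space" for t
    using dX[of t] dY[of t] by (auto simp: has_E_derivative_def)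
  have regs: "regular (X t)" "regular (Y t)" "regular (ode_rhs (X t))" "regular (ode_rhs (Y t))" for t
    using X Y RX RY by (auto intro: E_space_regular)
  have regYs: "regular (Ys t)" for t
    using regs(2)[of t] \<omega> unfolding Ys by (cases "Y t") (auto intro: ess_bounded_add)
  have lYs: "lin_err (Ys s) (Ys t) R h e" if "lin_err (Y s) (Y t) R h e" for s t R h e
    using that unfolding Ys by (cases "Y s"; cases "Y t"; cases R) simp
  have exp1: "\<exists>h0>0. \<forall>h i. \<bar>h\<bar> < h0 \<longrightarrow>
      \<bar>gap \<kappa> i (X (t + h)) (Ys (t + h)) - gap \<kappa> i (X t) (Ys t)\<bar> \<le> \<bar>h\<bar> * (gap \<kappa> i (ode_rhs (X t)) (ode_rhs (Y t)) + e)"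
    if e: "0 < e" for t e
  proof -
    define e' where "e' = e / (2 * (1 + 2 / \<kappa>))"
    have p: "0 < 2 * (1 + 2 / \<kappa>)" using \<kappa> by (intro mult_pos_pos add_pos_pos divide_pos_pos) auto
    have cancel: "x / c * c = x" if "0 < c" for x c :: real using that by simp
    have e': "0 < e'" "2 * e' * (1 + 2 / \<kappa>) = e"
    proof -
      show "0 < e'" unfolding e'_def by (rule divide_pos_pos[OF e p])
      have "2 * e' * (1 + 2 / \<kappa>) = e' * (2 * (1 + 2 / \<kappa>))" by (simp only: mult_ac)
      also have "\<dots> = e" unfolding e'_def by (rule cancel[OF p])
      finally show "2 * e' * (1 + 2 / \<kappa>) = e" .
    qed
    obtain h1 where h1: "0 < h1" "\<And>h. \<bar>h\<bar> < h1 \<Longrightarrow> lin_err (X (t + h)) (X t) (ode_rhs (X t)) h e'"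
      using has_E_derivative_expansion[OF X dX e'(1), of t] by blast
    obtain h2 where h2: "0 < h2" "\<And>h. \<bar>h\<bar> < h2 \<Longrightarrow> lin_err (Y (t + h)) (Y t) (ode_rhs (Y t)) h e'"
      using has_E_derivative_expansion[OF Y dY e'(1), of t] by blast
    show ?thesis
    proof (intro exI[of _ "min h1 h2"] conjI allI impI)
      show "0 < min h1 h2" using h1(1) h2(1) by simp
      fix h i assume "\<bar>h\<bar> < min h1 h2"
      then have l: "lin_err (X (t + h)) (X t) (ode_rhs (X t)) h e'" "lin_err (Y (t + h)) (Y t) (ode_rhs (Y t)) h e'"
        using h1(2)[of h] h2(2)[of h] by auto
      show "\<bar>gap \<kappa> i (X (t + h)) (Ys (t + h)) - gap \<kappa> i (X t) (Ys t)\<bar> \<le> \<bar>h\<bar> * (gap \<kappa> i (ode_rhs (X t)) (ode_rhs (Y t)) + e)"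
        using gap_expand[OF \<kappa> less_imp_le[OF e'(1)] regs(1) regs(1) regs(3) regYs regYs regs(4) l(1) lYs[OF l(2)], of i]
        unfolding e'(2) .
    qed
  qed
  have cont: "isCont (\<lambda>t. gap \<kappa> i (X t) (Ys t)) t" for i t
  proof -
    obtain h0 where h0: "0 < h0" "\<And>h. \<bar>h\<bar> < h0 \<Longrightarrow>
      \<bar>gap \<kappa> i (X (t + h)) (Ys (t + h)) - gap \<kappa> i (X t) (Ys t)\<bar> \<le> \<bar>h\<bar> * (gap \<kappa> i (ode_rhs (X t)) (ode_rhs (Y t)) + 1)"
      using exp1[OF zero_less_one, of t] by blast
    let ?c = "gap \<kappa> i (ode_rhs (X t)) (ode_rhs (Y t)) + 1"
    have "((\<lambda>h. gap \<kappa> i (X (t + h)) (Ys (t + h)) - gap \<kappa> i (X t) (Ys t)) \<longlongrightarrow> 0) (at 0)"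
    proof (rule Lim_null_comparison)
      have "\<forall>\<^sub>F h in at (0::real). \<bar>h\<bar> < h0"
        using h0(1) by (auto simp: eventually_at dist_real_def)
      then show "\<forall>\<^sub>F h in at 0. norm (gap \<kappa> i (X (t + h)) (Ys (t + h)) - gap \<kappa> i (X t) (Ys t)) \<le> \<bar>h\<bar> * ?c"
        by (rule eventually_mono) (use h0(2) in auto)
      show "((\<lambda>h. \<bar>h\<bar> * ?c) \<longlongrightarrow> 0) (at 0)" by (auto intro!: tendsto_eq_intros)
    qed
    then show ?thesis unfolding isCont_iff by (simp add: LIM_zero_cancel)
  qed
  \<comment> \<open>The sign \<sigma> = 1 or -1 treats both directions of time at once; the
    expansion above holds for increments of either sign.\<close>
  have main: "gap \<kappa> i (X (\<sigma> * s)) (Ys (\<sigma> * s)) \<le> d * exp ((L + 1) * s)"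
    if \<sigma>: "\<bar>\<sigma>\<bar> = 1" and s: "0 \<le> s" "s \<le> T" for i s \<sigma>
  proof (rule barrier_gronwall[where \<phi> = "\<lambda>i s. gap \<kappa> i (X (\<sigma> * s)) (Ys (\<sigma> * s))", OF T L d _ _ _ small s])
    show "isCont (\<lambda>s. gap \<kappa> i (X (\<sigma> * s)) (Ys (\<sigma> * s))) r" for i r
      by (rule isCont_o2[OF _ cont]) (intro continuous_intros)
    show "gap \<kappa> i (X (\<sigma> * 0)) (Ys (\<sigma> * 0)) \<le> d" for i
      using init[unfolded close_iff_gap, rule_format, of i] by simp
    fix r B e :: real
    assume r: "0 \<le> r" "r \<le> T" and B: "0 \<le> B" "B \<le> \<delta>" and le: "\<And>i. gap \<kappa> i (X (\<sigma> * r)) (Ys (\<sigma> * r)) \<le> B" and e: "0 < e"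
    have "close \<kappa> (L * B) (ode_rhs (X (\<sigma> * r))) (ode_rhs (Y (\<sigma> * r)))"
      using r \<sigma> by (intro lip B) (auto simp: abs_mult close_iff_gap le)
    then have R: "gap \<kappa> i (ode_rhs (X (\<sigma> * r))) (ode_rhs (Y (\<sigma> * r))) \<le> L * B" for i
      unfolding close_iff_gap by (rule spec)
    obtain h0 where h0: "0 < h0" "\<And>h i. \<bar>h\<bar> < h0 \<Longrightarrow>
      \<bar>gap \<kappa> i (X (\<sigma> * r + h)) (Ys (\<sigma> * r + h)) - gap \<kappa> i (X (\<sigma> * r)) (Ys (\<sigma> * r))\<bar>
        \<le> \<bar>h\<bar> * (gap \<kappa> i (ode_rhs (X (\<sigma> * r))) (ode_rhs (Y (\<sigma> * r))) + e)"
      using exp1[OF e, of "\<sigma> * r"] by blast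
    show "\<exists>h0>0. \<forall>h i. 0 < h \<longrightarrow> h < h0 \<longrightarrow>
      gap \<kappa> i (X (\<sigma> * (r + h))) (Ys (\<sigma> * (r + h))) \<le> gap \<kappa> i (X (\<sigma> * r)) (Ys (\<sigma> * r)) + h * (L * B + e)"
    proof (intro exI[of _ h0] conjI allI impI h0(1))
      fix h i assume h: "0 < h" "h < h0"
      have "\<bar>\<sigma> * h\<bar> = h" using \<sigma> h by (simp add: abs_mult)
      then have "\<bar>gap \<kappa> i (X (\<sigma> * r + \<sigma> * h)) (Ys (\<sigma> * r + \<sigma> * h)) - gap \<kappa> i (X (\<sigma> * r)) (Ys (\<sigma> * r))\<bar>
        \<le> h * (gap \<kappa> i (ode_rhs (X (\<sigma> * r))) (ode_rhs (Y (\<sigma> * r))) + e)"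
        using h0(2)[of "\<sigma> * h" i] h by simp
      moreover have "h * (gap \<kappa> i (ode_rhs (X (\<sigma> * r))) (ode_rhs (Y (\<sigma> * r))) + e) \<le> h * (L * B + e)"
        using R[of i] h by (intro mult_left_mono) auto
      ultimately show "gap \<kappa> i (X (\<sigma> * (r + h))) (Ys (\<sigma> * (r + h))) \<le> gap \<kappa> i (X (\<sigma> * r)) (Ys (\<sigma> * r)) + h * (L * B + e)"
        unfolding distrib_left by linarith
    qed
  qed
  have "gap \<kappa> i (X t) (Ys t) \<le> d * exp ((L + 1) * \<bar>t\<bar>)" for i
    using main[of 1 "\<bar>t\<bar>" i] main[of "-1" "\<bar>t\<bar>" i] t by (cases "0 \<le> t") auto
  moreover have "d * exp ((L + 1) * \<bar>t\<bar>) \<le> d * exp ((L + 1) * T)"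
    using d L t by (auto intro!: mult_left_mono)
  ultimately show ?thesis unfolding close_iff_gap by (meson order_trans)
qed

subsection \<open>Bounds for one solution on a compact time interval\<close>

text \<open>Compactness of the interval in the form of bisection: bounds on adjacent intervals
  combine to their maximum by monotonicity, and every time has a neighbourhood with a common
  bound.\<close>

lemma local_to_compact:
  fixes P :: "real \<Rightarrow> real \<Rightarrow> bool"
  assumes loc: "\<And>t. \<exists>h0>0. \<exists>B. \<forall>h. \<bar>h\<bar> < h0 \<longrightarrow> P (t + h) B"
    and mono: "\<And>t B B'. P t B \<Longrightarrow> B \<le> B' \<Longrightarrow> P t B'"
  obtains B where "\<And>t. \<bar>t\<bar> \<le> T \<Longrightarrow> P t B"
proof (cases "0 \<le> T")
  case True
  define Q where "Q = (\<lambda>a b. \<exists>B. \<forall>t\<in>{a..b}. P t B)"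
  have "Q (- T) T"
  proof (rule Bolzano)
    show "- T \<le> T" using True by simp
    fix a b c assume ab: "Q a b" and bc: "Q b c" and "a \<le> b" "b \<le> c"
    obtain B1 where B1: "\<forall>t\<in>{a..b}. P t B1" using ab unfolding Q_def by (elim exE)
    obtain B2 where B2: "\<forall>t\<in>{b..c}. P t B2" using bc unfolding Q_def by (elim exE)
    have "P t (max B1 B2)" if "t \<in> {a..c}" for t
    proof (cases "t \<le> b")
      case True
      then have "P t B1" using B1 that by auto
      then show ?thesis by (rule mono) simp
    next
      case False
      then have "P t B2" using B2 that by auto
      then show ?thesis by (rule mono) simp
    qed
    then show "Q a c" unfolding Q_def by (intro exI[of _ "max B1 B2"] ballI)
  next
    fix x :: real
    obtain h0 B where h0: "0 < h0" "\<And>h. \<bar>h\<bar> < h0 \<Longrightarrow> P (x + h) B" using loc[of x] by blast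
    show "\<exists>d>0. \<forall>a b. a \<le> x \<and> x \<le> b \<and> b - a < d \<longrightarrow> Q a b"
    proof (intro exI[of _ h0] conjI allI impI h0(1))
      fix a b assume ab: "a \<le> x \<and> x \<le> b \<and> b - a < h0"
      have "P t B" if "t \<in> {a..b}" for t
      proof -
        have "\<bar>t - x\<bar> < h0" using that ab by auto
        from h0(2)[OF this] show ?thesis by simp
      qed
      then show "Q a b" unfolding Q_def by (intro exI[of _ B] ballI)
    qed
  qed
  then obtain B where "\<forall>t\<in>{-T..T}. P t B" unfolding Q_def by (elim exE)
  then have "P t B" if "\<bar>t\<bar> \<le> T" for t using that by (auto simp: abs_le_iff)
  then show thesis by (rule that)
next
  case False
  show thesis by (rule that[of 0]) (use False in linarith)
qed

text \<open>Where both angles are at most pi/2 in modulus, the two squared cosines are at least 1/2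
  and the integrand at least c/4. The remaining set costs at most c/4 times its measure. Writing the
  rate as 4 (c/16) matches \<open>NL_bounds\<close> with \<kappa> = c/16.\<close>

lemma kernel_decay:
  assumes reg: "ess_bounded W" "ess_bounded Z" "ess_bounded q"
    and k: "ess_bounded (weighted coef_k (U, V, W, Z, q))"
    and c: "0 < c" "AE \<xi> in lborel. c \<le> q \<xi>"
    and bad: "emeasure lborel {\<xi>. pi / 2 < \<bar>W \<xi>\<bar> \<or> pi / 2 < \<bar>Z \<xi>\<bar>} \<le> ennreal B" and B: "0 \<le> B"
    and le: "\<eta> \<le> \<xi>"
  shows "4 * (c / 16) * (\<xi> - \<eta>) - c / 4 * B \<le> (LBINT s=ereal \<eta>..ereal \<xi>. weighted coef_k (U, V, W, Z, q) s)"
proof -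
  let ?A = "{\<xi>. pi / 2 < \<bar>W \<xi>\<bar> \<or> pi / 2 < \<bar>Z \<xi>\<bar>}" and ?k = "weighted coef_k (U, V, W, Z, q)"
  have [measurable]: "W \<in> borel_measurable borel" "Z \<in> borel_measurable borel" "q \<in> borel_measurable borel"
    using reg by (auto simp: ess_bounded_def)
  have Am[measurable]: "?A \<in> sets borel" by measurable
  have Afin: "emeasure lborel ?A < \<infinity>" using bad by (simp add: le_less_trans)
  have Ai: "integrable lborel (indicator ?A :: real \<Rightarrow> real)"
    using Afin by (intro integrable_real_indicator) auto
  have half: "1 / 2 \<le> (cos (x / 2))\<^sup>2" if "\<not> pi / 2 < \<bar>x\<bar>" for x :: real
  proof -
    have "0 \<le> cos x" using that by (intro cos_ge_zero) auto
    then show ?thesis using cos_double_cos[of "x / 2"] by simp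
  qed
  have lower: "AE s in lborel. c / 4 * (1 - indicator ?A s) \<le> ?k s"
    using c(2)
  proof eventually_elim
    case (elim s)
    have q0: "0 \<le> q s" using elim c(1) by linarith
    show ?case
    proof (cases "s \<in> ?A")
      case True
      then have "indicator ?A s = (1::real)" by (rule indicator_eq_1_iff[THEN iffD2])
      moreover have "0 \<le> ?k s" unfolding weighted_simp coef_k_def using q0 by simp
      ultimately show ?thesis by simp
    next
      case False
      then have i: "indicator ?A s = (0::real)" by (rule indicator_eq_0_iff[THEN iffD2])
      have "c * (1 / 2 * (1 / 2)) \<le> q s * ((cos (W s / 2))\<^sup>2 * (cos (Z s / 2))\<^sup>2)"
        using False elim q0 by (intro mult_mono half) auto
      then show ?thesis unfolding i weighted_simp coef_k_def by simp
    qed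
  qed
  have i1: "set_integrable lborel {\<eta>..\<xi>} (\<lambda>s. c / 4)"
    by (rule borel_integrable_atLeastAtMost') (intro continuous_intros)
  have i2: "set_integrable lborel {\<eta>..\<xi>} (\<lambda>s. c / 4 * indicator ?A s)"
    by (intro set_integrable_mult_right set_integrable_UNIV_subset Ai) auto
  have "(LINT s:{\<eta>..\<xi>}|lborel. indicator ?A s) \<le> B"
  proof -
    have "(LINT s:{\<eta>..\<xi>}|lborel. indicator ?A s) \<le> (LINT s|lborel. indicator ?A s :: real)"
      by (rule set_integral_le_UNIV[OF Ai]) auto
    also have "\<dots> = measure lborel ?A" by simp
    also have "\<dots> \<le> B" unfolding measure_def using bad B by (metis enn2real_leI)
    finally show ?thesis .
  qed
  then have "c / 4 * (\<xi> - \<eta>) - c / 4 * B \<le> c / 4 * (\<xi> - \<eta>) - c / 4 * (LINT s:{\<eta>..\<xi>}|lborel. indicator ?A s)"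
    using c(1) by simp
  also have "\<dots> = (LINT s:{\<eta>..\<xi>}|lborel. c / 4 - c / 4 * indicator ?A s)"
    using set_integral_diff(2)[OF i1 i2] le by (simp add: set_integral_const)
  also have "\<dots> \<le> (LINT s:{\<eta>..\<xi>}|lborel. ?k s)"
    by (rule set_integral_mono_AE[OF set_integral_diff(1)[OF i1 i2] ess_bounded_set_integrable[OF k]])
       (use lower in \<open>auto simp: right_diff_distrib elim!: eventually_mono\<close>)
  also have "\<dots> = (LBINT s=ereal \<eta>..ereal \<xi>. ?k s)" using le by (simp add: interval_integral_Icc)
  finally show ?thesis by simp
qed

section \<open>A single solution: local continuity in time and bounds on compact time
  intervals\<close>

locale flow =
  fixes U V W Z q :: "real \<Rightarrow> real \<Rightarrow> real"
  assumes in_E: "\<And>t. (U t, V t, W t, Z t, q t) \<in> E_space"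
    and flow_deriv: "\<And>t. has_E_derivative (\<lambda>t. (U t, V t, W t, Z t, q t)) (ode_rhs (U t, V t, W t, Z t, q t)) t"
    and q_bounds: "\<And>T. 0 < T \<Longrightarrow> \<exists>c>0. \<exists>C. \<forall>t\<in>{-T..T}. AE \<xi> in lborel. c \<le> q t \<xi> \<and> q t \<xi> \<le> C"
begin

lemma local_continuity:
  assumes e: "0 < e"
  obtains h0 where "0 < h0"
    "\<And>h \<xi>. \<bar>h\<bar> < h0 \<Longrightarrow> \<bar>U (t + h) \<xi> - U t \<xi>\<bar> \<le> e"
    "\<And>h \<xi>. \<bar>h\<bar> < h0 \<Longrightarrow> \<bar>V (t + h) \<xi> - V t \<xi>\<bar> \<le> e"
    "\<And>h. \<bar>h\<bar> < h0 \<Longrightarrow> AE \<xi> in lborel. \<bar>W (t + h) \<xi> - W t \<xi>\<bar> \<le> e"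
    "\<And>h. \<bar>h\<bar> < h0 \<Longrightarrow> AE \<xi> in lborel. \<bar>Z (t + h) \<xi> - Z t \<xi>\<bar> \<le> e"
proof -
  obtain RU RV RW RZ Rq where R: "ode_rhs (U t, V t, W t, Z t, q t) = (RU, RV, RW, RZ, Rq)"
    by (cases "ode_rhs (U t, V t, W t, Z t, q t)")
  have RE: "(RU, RV, RW, RZ, Rq) \<in> E_space"
    using flow_deriv[of t] unfolding R by (simp add: has_E_derivative_def)
  note E = E_spaceD[OF RE]
  obtain h1 where h1: "0 < h1"
    "\<And>h. \<bar>h\<bar> < h1 \<Longrightarrow> lin_err (U (t + h), V (t + h), W (t + h), Z (t + h), q (t + h)) (U t, V t, W t, Z t, q t) (RU, RV, RW, RZ, Rq) h 1"
    using has_E_derivative_expansion[OF in_E flow_deriv zero_less_one, of t] unfolding R by blast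
  \<comment> \<open>It bounds every component of the derivative plus 1, where the 1 is the error
    allowed in the expansion; so e/c is a safe step length.\<close>
  define c where "c = 3 * H1_norm RU + 3 * H1_norm RV + Linf_norm RW + Linf_norm RZ + 1"
  note nn = W1p_norm_nonneg[of 2 RU] W1p_norm_nonneg[of 2 RV] Linf_norm_AE(2)[OF E(3)] Linf_norm_AE(2)[OF E(4)]
  have c: "0 < c" "3 * H1_norm RU + 1 \<le> c" "3 * H1_norm RV + 1 \<le> c" "Linf_norm RW + 1 \<le> c" "Linf_norm RZ + 1 \<le> c"
    using nn unfolding c_def by linarith+
  have small: "\<bar>x\<bar> \<le> e" if h: "\<bar>h\<bar> < e / c" and x: "\<bar>x - h * r\<bar> \<le> \<bar>h\<bar> * 1" and r: "\<bar>r\<bar> + 1 \<le> c" for h x r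
  proof -
    have "\<bar>x\<bar> \<le> \<bar>x - h * r\<bar> + \<bar>h * r\<bar>" by linarith
    also have "\<dots> \<le> \<bar>h\<bar> * (\<bar>r\<bar> + 1)" using x by (simp add: abs_mult distrib_left)
    also have "\<dots> \<le> \<bar>h\<bar> * c" using r by (intro mult_left_mono) auto
    also have "\<dots> \<le> e" using h c(1) by (simp add: pos_less_divide_eq)
    finally show ?thesis .
  qed
  have RUb: "\<bar>RU \<xi>\<bar> + 1 \<le> c" and RVb: "\<bar>RV \<xi>\<bar> + 1 \<le> c" for \<xi>
    using H1_sup_bound[OF E(1), of \<xi>] H1_sup_bound[OF E(2), of \<xi>] c by linarith+
  show thesis
  proof (rule that[of "min h1 (e / c)"])
    show "0 < min h1 (e / c)" using h1(1) e c(1) by simp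
    fix h assume "\<bar>h\<bar> < min h1 (e / c)"
    then have h: "\<bar>h\<bar> < h1" "\<bar>h\<bar> < e / c" by auto
    note l = h1(2)[OF h(1), unfolded lin_err.simps]
    show "\<bar>U (t + h) \<xi> - U t \<xi>\<bar> \<le> e" for \<xi> using l by (intro small[OF h(2) _ RUb]) blast
    show "\<bar>V (t + h) \<xi> - V t \<xi>\<bar> \<le> e" for \<xi> using l by (intro small[OF h(2) _ RVb]) blast
    have lW: "AE \<xi> in lborel. \<bar>W (t + h) \<xi> - W t \<xi> - h * RW \<xi>\<bar> \<le> \<bar>h\<bar> * 1"
      and lZ: "AE \<xi> in lborel. \<bar>Z (t + h) \<xi> - Z t \<xi> - h * RZ \<xi>\<bar> \<le> \<bar>h\<bar> * 1" using l by blast+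
    show "AE \<xi> in lborel. \<bar>W (t + h) \<xi> - W t \<xi>\<bar> \<le> e"
      using lW Linf_norm_AE(1)[OF E(3)]
    proof eventually_elim
      case (elim \<xi>)
      show ?case by (rule small[OF h(2) elim(1)]) (use elim(2) c in linarith)
    qed
    show "AE \<xi> in lborel. \<bar>Z (t + h) \<xi> - Z t \<xi>\<bar> \<le> e"
      using lZ Linf_norm_AE(1)[OF E(4)]
    proof eventually_elim
      case (elim \<xi>)
      show ?case by (rule small[OF h(2) elim(1)]) (use elim(2) c in linarith)
    qed
  qed
qed

lemma UV_H1: "U t \<in> H1_space" "V t \<in> H1_space"
  using E_spaceD[OF in_E] by auto

lemma sup_bound:
  obtains M where "\<And>t \<xi>. \<bar>t\<bar> \<le> T \<Longrightarrow> \<bar>U t \<xi>\<bar> \<le> M \<and> \<bar>V t \<xi>\<bar> \<le> M"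
proof -
  obtain M where "\<And>t. \<bar>t\<bar> \<le> T \<Longrightarrow> \<forall>\<xi>. \<bar>U t \<xi>\<bar> \<le> M \<and> \<bar>V t \<xi>\<bar> \<le> M"
  proof (rule local_to_compact[of "\<lambda>t M. \<forall>\<xi>. \<bar>U t \<xi>\<bar> \<le> M \<and> \<bar>V t \<xi>\<bar> \<le> M" T])
    fix t
    obtain h0 where h0: "0 < h0" "\<And>h \<xi>. \<bar>h\<bar> < h0 \<Longrightarrow> \<bar>U (t + h) \<xi> - U t \<xi>\<bar> \<le> 1"
      "\<And>h \<xi>. \<bar>h\<bar> < h0 \<Longrightarrow> \<bar>V (t + h) \<xi> - V t \<xi>\<bar> \<le> 1"
      by (rule local_continuity[of 1 t]) auto
    let ?M = "3 * H1_norm (U t) + 3 * H1_norm (V t) + 1"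
    have "\<bar>U (t + h) \<xi>\<bar> \<le> ?M \<and> \<bar>V (t + h) \<xi>\<bar> \<le> ?M" if "\<bar>h\<bar> < h0" for h \<xi>
      using h0(2,3)[OF that, of \<xi>] H1_sup_bound[OF UV_H1(1)[of t], of \<xi>] H1_sup_bound[OF UV_H1(2)[of t], of \<xi>]
        W1p_norm_nonneg[of 2 "U t"] W1p_norm_nonneg[of 2 "V t"] by linarith
    then show "\<exists>h0>0. \<exists>B. \<forall>h. \<bar>h\<bar> < h0 \<longrightarrow> (\<forall>\<xi>. \<bar>U (t + h) \<xi>\<bar> \<le> B \<and> \<bar>V (t + h) \<xi>\<bar> \<le> B)"
      using h0(1) by blast
  qed (use order_trans in blast)+
  then show thesis by (intro that) blast
qed

lemma uniform_vanishing:
  assumes e: "0 < e"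
  obtains R where "\<And>t \<xi>. \<bar>t\<bar> \<le> T \<Longrightarrow> R < \<bar>\<xi>\<bar> \<Longrightarrow> \<bar>U t \<xi>\<bar> \<le> e \<and> \<bar>V t \<xi>\<bar> \<le> e"
proof -
  obtain R where "\<And>t. \<bar>t\<bar> \<le> T \<Longrightarrow> \<forall>\<xi>. R < \<bar>\<xi>\<bar> \<longrightarrow> \<bar>U t \<xi>\<bar> \<le> e \<and> \<bar>V t \<xi>\<bar> \<le> e"
  proof (rule local_to_compact[of "\<lambda>t R. \<forall>\<xi>. R < \<bar>\<xi>\<bar> \<longrightarrow> \<bar>U t \<xi>\<bar> \<le> e \<and> \<bar>V t \<xi>\<bar> \<le> e" T])
    fix t
    have e2: "0 < e / 2" using e by simp
    obtain h0 where h0: "0 < h0" "\<And>h \<xi>. \<bar>h\<bar> < h0 \<Longrightarrow> \<bar>U (t + h) \<xi> - U t \<xi>\<bar> \<le> e / 2"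
      "\<And>h \<xi>. \<bar>h\<bar> < h0 \<Longrightarrow> \<bar>V (t + h) \<xi> - V t \<xi>\<bar> \<le> e / 2"
      by (rule local_continuity[OF e2, of t]) auto
    obtain R1 where R1: "\<And>x. R1 < \<bar>x\<bar> \<Longrightarrow> \<bar>U t x\<bar> < e / 2" using H1_vanish_at_infinity[OF UV_H1(1) e2] by blast
    obtain R2 where R2: "\<And>x. R2 < \<bar>x\<bar> \<Longrightarrow> \<bar>V t x\<bar> < e / 2" using H1_vanish_at_infinity[OF UV_H1(2) e2] by blast
    have "\<bar>U (t + h) \<xi>\<bar> \<le> e \<and> \<bar>V (t + h) \<xi>\<bar> \<le> e" if "\<bar>h\<bar> < h0" "max R1 R2 < \<bar>\<xi>\<bar>" for h \<xi>
    proof -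
      have "R1 < \<bar>\<xi>\<bar>" "R2 < \<bar>\<xi>\<bar>" using that(2) by auto
      then show ?thesis using h0(2,3)[OF that(1), of \<xi>] R1[of \<xi>] R2[of \<xi>] by linarith
    qed
    then show "\<exists>h0>0. \<exists>R. \<forall>h. \<bar>h\<bar> < h0 \<longrightarrow> (\<forall>\<xi>. R < \<bar>\<xi>\<bar> \<longrightarrow> \<bar>U (t + h) \<xi>\<bar> \<le> e \<and> \<bar>V (t + h) \<xi>\<bar> \<le> e)"
      using h0(1) by blast
  qed (use le_less_trans in blast)+
  then show thesis by (intro that) blast
qed

lemma W_Z_measurable[measurable]: "W t \<in> borel_measurable borel" "Z t \<in> borel_measurable borel" "q t \<in> borel_measurable borel"
  using E_spaceD[OF in_E[of t]] by (auto simp: Linf_space_def)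

text \<open>As long as the angles have moved by at most 1/2 since time t, exceeding pi/2 forces a
  modulus of at least 1 at time t, because pi/2 > 3/2. By Chebyshev's inequality the integral of W^2
  + Z^2 at time t bounds the measure for all nearby times.\<close>

lemma bad_set_bound:
  obtains B where "0 \<le> B"
    "\<And>t. \<bar>t\<bar> \<le> T \<Longrightarrow> emeasure lborel {\<xi>. pi / 2 < \<bar>W t \<xi>\<bar> \<or> pi / 2 < \<bar>Z t \<xi>\<bar>} \<le> ennreal B"
proof -
  let ?bad = "\<lambda>t. {\<xi>. pi / 2 < \<bar>W t \<xi>\<bar> \<or> pi / 2 < \<bar>Z t \<xi>\<bar>}"
  obtain B where B: "\<And>t. \<bar>t\<bar> \<le> T \<Longrightarrow> emeasure lborel (?bad t) \<le> ennreal B"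
  proof (rule local_to_compact[of "\<lambda>t B. emeasure lborel (?bad t) \<le> ennreal B" T])
    fix t
    obtain h0 where h0: "0 < h0" "\<And>h. \<bar>h\<bar> < h0 \<Longrightarrow> AE \<xi> in lborel. \<bar>W (t + h) \<xi> - W t \<xi>\<bar> \<le> 1 / 2"
      "\<And>h. \<bar>h\<bar> < h0 \<Longrightarrow> AE \<xi> in lborel. \<bar>Z (t + h) \<xi> - Z t \<xi>\<bar> \<le> 1 / 2"
      by (rule local_continuity[of "1 / 2" t]) auto
    let ?g = "\<lambda>\<xi>. (W t \<xi>)\<^sup>2 + (Z t \<xi>)\<^sup>2"
    have gi: "integrable lborel ?g"
      using E_spaceD(6,7)[OF in_E[of t]] by (auto simp: Lp_space_2_iff)
    have "emeasure lborel (?bad (t + h)) \<le> ennreal (LINT \<xi>|lborel. ?g \<xi>)" if h: "\<bar>h\<bar> < h0" for h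
    proof -
      have "emeasure lborel (?bad (t + h)) = (\<integral>\<^sup>+\<xi>. indicator (?bad (t + h)) \<xi> \<partial>lborel)"
        by (rule nn_integral_indicator[symmetric]) measurable
      also have "\<dots> \<le> (\<integral>\<^sup>+\<xi>. ennreal (?g \<xi>) \<partial>lborel)"
      proof (rule nn_integral_mono_AE)
        show "AE \<xi> in lborel. indicator (?bad (t + h)) \<xi> \<le> ennreal (?g \<xi>)"
          using h0(2,3)[OF h]
        proof eventually_elim
          case (elim \<xi>)
          show ?case
          proof (cases "\<xi> \<in> ?bad (t + h)")
            case True
            then have "pi / 2 < \<bar>W (t + h) \<xi>\<bar> \<or> pi / 2 < \<bar>Z (t + h) \<xi>\<bar>" by simp
            then have "1 \<le> \<bar>W t \<xi>\<bar> \<or> 1 \<le> \<bar>Z t \<xi>\<bar>" using elim pi_gt3 by (elim disjE) linarith+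
            then have "1 \<le> (W t \<xi>)\<^sup>2 \<or> 1 \<le> (Z t \<xi>)\<^sup>2" using one_le_power[of "\<bar>W t \<xi>\<bar>" 2] one_le_power[of "\<bar>Z t \<xi>\<bar>" 2] by auto
            then have "1 \<le> ?g \<xi>" using zero_le_power2[of "W t \<xi>"] zero_le_power2[of "Z t \<xi>"] by linarith
            from ennreal_leI[OF this] have "1 \<le> ennreal (?g \<xi>)" by (simp only: ennreal_1)
            then show ?thesis using True by simp
          qed simp
        qed
      qed
      also have "\<dots> = ennreal (LINT \<xi>|lborel. ?g \<xi>)" by (intro nn_integral_eq_integral gi AE_I2) simp
      finally show ?thesis .
    qed
    then show "\<exists>h0>0. \<exists>B. \<forall>h. \<bar>h\<bar> < h0 \<longrightarrow> emeasure lborel (?bad (t + h)) \<le> ennreal B"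
      using h0(1) by blast
  next
    fix t B B' assume "emeasure lborel (?bad t) \<le> ennreal B" "B \<le> B'"
    then show "emeasure lborel (?bad t) \<le> ennreal B'" by (meson ennreal_leI order_trans)
  qed blast
  show thesis
  proof (rule that[of "max 0 B"])
    fix t assume "\<bar>t\<bar> \<le> T"
    from B[OF this] show "emeasure lborel (?bad t) \<le> ennreal (max 0 B)"
      by (meson ennreal_leI max.cobounded2 order_trans)
  qed simp
qed

lemma U_continuous: "continuous_on UNIV (U t)" "continuous_on UNIV (V t)"
  using H1_spaceD(1)[OF UV_H1(1)] H1_spaceD(1)[OF UV_H1(2)] by auto

lemma U_jointly_continuous:
  "continuous_on UNIV (\<lambda>(t, \<xi>). U t \<xi>)" "continuous_on UNIV (\<lambda>(t, \<xi>). V t \<xi>)"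
proof -
  have *: "continuous_on UNIV (\<lambda>(t, \<xi>). F t \<xi>)"
    if loc: "\<And>t e. 0 < e \<Longrightarrow> \<exists>h0>0. \<forall>h \<xi>. \<bar>h\<bar> < h0 \<longrightarrow> \<bar>F (t + h) \<xi> - F t \<xi>\<bar> \<le> e"
      and c: "\<And>t. continuous_on UNIV (F t)" for F :: "real \<Rightarrow> real \<Rightarrow> real"
  proof (rule continuous_onI)
    fix x :: "real \<times> real" and e :: real assume e: "0 < e"
    obtain t \<xi> where x: "x = (t, \<xi>)" by (cases x)
    have e2: "0 < e / 2" using e by simp
    obtain h0 where h0: "0 < h0" "\<And>h \<xi>. \<bar>h\<bar> < h0 \<Longrightarrow> \<bar>F (t + h) \<xi> - F t \<xi>\<bar> \<le> e / 2" using loc[OF e2, of t] by blast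
    obtain d where d: "0 < d" "\<And>\<eta>. \<bar>\<eta> - \<xi>\<bar> < d \<Longrightarrow> \<bar>F t \<eta> - F t \<xi>\<bar> < e / 2"
      using c[of t, unfolded continuous_on_iff, rule_format, OF UNIV_I e2, of \<xi>] by (auto simp: dist_real_def)
    show "\<exists>d>0. \<forall>x'\<in>UNIV. dist x' x < d \<longrightarrow> dist (case x' of (t, \<xi>) \<Rightarrow> F t \<xi>) (case x of (t, \<xi>) \<Rightarrow> F t \<xi>) \<le> e"
    proof (intro exI[of _ "min h0 d"] conjI ballI impI)
      show "0 < min h0 d" using h0 d by simp
      fix x' assume x': "dist x' x < min h0 d"
      obtain s \<eta> where s: "x' = (s, \<eta>)" by (cases x')
      have "dist s t < min h0 d" "dist \<eta> \<xi> < min h0 d"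
        using x' dist_fst_le[of x' x] dist_snd_le[of x' x] by (auto simp: s x)
      then have "\<bar>F (t + (s - t)) \<eta> - F t \<eta>\<bar> \<le> e / 2" "\<bar>F t \<eta> - F t \<xi>\<bar> < e / 2"
        by (intro h0(2) d(2); simp add: dist_real_def)+
      then have "\<bar>F s \<eta> - F t \<xi>\<bar> \<le> e" unfolding add_diff_cancel_left' add.commute[of t] diff_add_cancel by linarith
      then show "dist (case x' of (t, \<xi>) \<Rightarrow> F t \<xi>) (case x of (t, \<xi>) \<Rightarrow> F t \<xi>) \<le> e"
        by (simp add: s x dist_real_def)
    qed
  qed
  have loc: "\<exists>h0>0. \<forall>h \<xi>. \<bar>h\<bar> < h0 \<longrightarrow> \<bar>U (t + h) \<xi> - U t \<xi>\<bar> \<le> e"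
    "\<exists>h0>0. \<forall>h \<xi>. \<bar>h\<bar> < h0 \<longrightarrow> \<bar>V (t + h) \<xi> - V t \<xi>\<bar> \<le> e" if "0 < e" for t e
    by (rule local_continuity[OF that, of t]; blast)+
  show "continuous_on UNIV (\<lambda>(t, \<xi>). U t \<xi>)" by (rule *[OF loc(1) U_continuous(1)])
  show "continuous_on UNIV (\<lambda>(t, \<xi>). V t \<xi>)" by (rule *[OF loc(2) U_continuous(2)])
qed

lemma regular_flow: "regular (U t, V t, W t, Z t, q t)" "regular (ode_rhs (U t, V t, W t, Z t, q t))"
  using E_space_regular[OF in_E[of t]] flow_deriv[of t] by (auto simp: has_E_derivative_def intro: E_space_regular)

end

lemma ode_solution_flow: "ode_solution u0 v0 U V W Z q \<Longrightarrow> flow U V W Z q"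
  unfolding ode_solution_def Let_def E_continuous_def by unfold_locales auto

subsection \<open>Convergence in Lagrangian coordinates\<close>

context Sigma_convergent
begin

lemma initial_values_tendsto:
  assumes e: "0 < e"
  shows "\<forall>\<^sub>F n in sequentially. \<forall>\<xi>. \<bar>u0 (y_init u0 v0 \<xi>) - u0n n (y_init (u0n n) (v0n n) \<xi>)\<bar> \<le> e
     \<and> \<bar>v0 (y_init u0 v0 \<xi>) - v0n n (y_init (u0n n) (v0n n) \<xi>)\<bar> \<le> e"
proof -
  let ?I = "\<lambda>n. LINT x|lborel. \<bar>excess (u0n n) (v0n n) x - excess u0 v0 x\<bar>"
  have yd: "\<bar>y_init u0 v0 \<xi> - y_init (u0n n) (v0n n) \<xi>\<bar> \<le> 2 * ?I n" for n \<xi>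
    using lag_dist[OF excess_density_excess[OF seq_in_Sigma] excess_density_excess[OF limit_in_Sigma], of n \<xi>]
    by (simp add: y_init_eq_lag limit_in_Sigma seq_in_Sigma abs_minus_commute)
  have *: "\<forall>\<^sub>F n in sequentially. \<forall>\<xi>. \<bar>f (y_init u0 v0 \<xi>) - fn n (y_init (u0n n) (v0n n) \<xi>)\<bar> \<le> e"
    if f: "f \<in> H1_space" and fn: "\<And>n. fn n \<in> H1_space" and lim: "(\<lambda>n. H1_norm (fn n - f)) \<longlonglongrightarrow> 0" for f fn
  proof -
    \<comment> \<open>First K makes the term H1_norm^2/K of the modulus of continuity at most e/3.
      With K then fixed, K times the distance of the labels tends to 0. The added 1 keeps K
      positive.\<close>
    define K where "K = 3 * ((H1_norm f)\<^sup>2 + 1) / e"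
    have K: "0 < K" "(H1_norm f)\<^sup>2 / K \<le> e / 3"
    proof -
      have N: "0 \<le> (H1_norm f)\<^sup>2" by simp
      show K0: "0 < K" unfolding K_def using N e by (intro divide_pos_pos mult_pos_pos add_nonneg_pos) auto
      have "e / 3 * K = (H1_norm f)\<^sup>2 + 1" unfolding K_def using e by simp
      then show "(H1_norm f)\<^sup>2 / K \<le> e / 3" using K0 by (simp add: pos_divide_le_eq)
    qed
    have "(\<lambda>n. K * (2 * ?I n) + 3 * H1_norm (fn n - f)) \<longlonglongrightarrow> K * (2 * 0) + 3 * 0"
      by (intro tendsto_intros excess_L1_tendsto lim)
    then have "\<forall>\<^sub>F n in sequentially. K * (2 * ?I n) + 3 * H1_norm (fn n - f) < e / 3"
      using e by (intro order_tendstoD(2)) auto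
    then show ?thesis
    proof eventually_elim
      case (elim n)
      show ?case
      proof
        fix \<xi>
        let ?y = "y_init u0 v0 \<xi>" and ?yn = "y_init (u0n n) (v0n n) \<xi>"
        have "\<bar>f ?y - f ?yn\<bar> \<le> K * \<bar>?y - ?yn\<bar> + (H1_norm f)\<^sup>2 / K" by (rule H1_modulus[OF f K(1)])
        moreover have "K * \<bar>?y - ?yn\<bar> \<le> K * (2 * ?I n)" using yd K(1) by (intro mult_left_mono) auto
        moreover have "\<bar>fn n ?yn - f ?yn\<bar> \<le> 3 * H1_norm (fn n - f)"
          using H1_sup_bound[OF H1_diff(1)[OF fn f], of n ?yn] by simp
        ultimately show "\<bar>f ?y - fn n ?yn\<bar> \<le> e" using K(2) elim e by linarith
      qed
    qed
  qed
  show ?thesis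
    using *[OF Sigma_spaceD(1)[OF limit_in_Sigma] Sigma_spaceD(1)[OF seq_in_Sigma] d_Sigma_parts_tendsto(1)]
      *[OF Sigma_spaceD(2)[OF limit_in_Sigma] Sigma_spaceD(2)[OF seq_in_Sigma] d_Sigma_parts_tendsto(2)]
    by eventually_elim blast
qed

lemma lagrangian_tendsto:
  assumes sol: "ode_solution u0 v0 U V W Z q"
    and soln: "\<And>n. ode_solution (u0n n) (v0n n) (Uk n) (Vk n) (Wk n) (Zk n) (qk n)"
    and T: "0 < T" and e: "0 < e"
  shows "\<forall>\<^sub>F n in sequentially. \<forall>t \<xi>. \<bar>t\<bar> \<le> T \<longrightarrow> \<bar>U t \<xi> - Uk n t \<xi>\<bar> \<le> e \<and> \<bar>V t \<xi> - Vk n t \<xi>\<bar> \<le> e"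
proof -
  interpret F: flow U V W Z q by (rule ode_solution_flow[OF sol])
  have Fn: "flow (Uk n) (Vk n) (Wk n) (Zk n) (qk n)" for n by (rule ode_solution_flow[OF soln])
  let ?X = "\<lambda>t. (U t, V t, W t, Z t, q t)" and ?Y = "\<lambda>n t. (Uk n t, Vk n t, Wk n t, Zk n t, qk n t)"
  let ?y = "y_init u0 v0" and ?yn = "\<lambda>n. y_init (u0n n) (v0n n)"
  obtain c C where c: "0 < c" and qb: "\<forall>t\<in>{-T..T}. AE \<xi> in lborel. c \<le> q t \<xi> \<and> q t \<xi> \<le> C"
    using F.q_bounds[OF T] by blast
  obtain M0 where M0: "\<And>t \<xi>. \<bar>t\<bar> \<le> T \<Longrightarrow> \<bar>U t \<xi>\<bar> \<le> M0 \<and> \<bar>V t \<xi>\<bar> \<le> M0" using F.sup_bound by blast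
  obtain B where B: "0 \<le> B" "\<And>t. \<bar>t\<bar> \<le> T \<Longrightarrow> emeasure lborel {\<xi>. pi / 2 < \<bar>W t \<xi>\<bar> \<or> pi / 2 < \<bar>Z t \<xi>\<bar>} \<le> ennreal B"
    using F.bad_set_bound by blast
  define M where "M = max 1 (max M0 C)"
  define \<kappa> where "\<kappa> = c / 16"
  have \<kappa>: "0 < \<kappa>" using c by (simp add: \<kappa>_def)
  have M: "1 \<le> M" by (simp add: M_def)
  have m: "0 \<le> c / 4 * B" using c B(1) by simp
  obtain L \<delta> where L: "0 \<le> L" "0 < \<delta>" and lip: "\<forall>X Y Ys B'. ref_bounds \<kappa> (c / 4 * B) M X \<longrightarrow> regular Y \<longrightarrow>
      angle_shift Y Ys \<longrightarrow> 0 \<le> B' \<longrightarrow> B' \<le> \<delta> \<longrightarrow> close \<kappa> B' X Ys \<longrightarrow> regular (ode_rhs X) \<longrightarrow> regular (ode_rhs Y) \<longrightarrow>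
      close \<kappa> (L * B') (ode_rhs X) (ode_rhs Y)"
    using ode_rhs_lipschitz[OF \<kappa> m M] by (elim exE conjE)
  \<comment> \<open>The admissible initial gap: after growth by the Gronwall factor it is still at
    most \<delta>, so that the Lipschitz estimate stays valid, and at most \<open>e\<close>.\<close>
  define d where "d = min e \<delta> / exp ((L + 1) * T)"
  have d: "0 < d" "d * exp ((L + 1) * T) \<le> \<delta>" "d * exp ((L + 1) * T) \<le> e"
    using e L(2) by (auto simp: d_def)
  let ?a = "\<lambda>\<xi>. 2 * arctan (wderiv u0 (?y \<xi>))" and ?b = "\<lambda>\<xi>. 2 * arctan (wderiv v0 (?y \<xi>))"
  let ?an = "\<lambda>n \<xi>. 2 * arctan (wderiv (u0n n) (?yn n \<xi>))" and ?bn = "\<lambda>n \<xi>. 2 * arctan (wderiv (v0n n) (?yn n \<xi>))"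
  note H = excess_density_excess[OF limit_in_Sigma] and Hn = excess_density_excess[OF seq_in_Sigma]
  note S = Sigma_spaceD[OF limit_in_Sigma] and Sn = Sigma_spaceD[OF seq_in_Sigma]
  have ym: "?y \<in> borel_measurable borel" "?yn n \<in> borel_measurable borel" for n
    using excess_density.lag_measurable[OF H] excess_density.lag_measurable[OF Hn]
    by (simp_all add: y_init_eq_lag limit_in_Sigma seq_in_Sigma)
  have arc: "ess_bounded (\<lambda>\<xi>. 2 * arctan (g (y \<xi>)))" if [measurable]: "g \<in> borel_measurable borel" "y \<in> borel_measurable borel"
    for g y :: "real \<Rightarrow> real"
    by (rule ess_boundedI[of _ pi]) (use two_arctan_bounds(1) in auto)
  have ebs: "ess_bounded ?a" "ess_bounded ?b" "ess_bounded (?an n)" "ess_bounded (?bn n)" for n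
    by (rule arc[OF H1_spaceD(5)[OF S(1)] ym(1)], rule arc[OF H1_spaceD(5)[OF S(2)] ym(1)],
        rule arc[OF H1_spaceD(5)[OF Sn(1)] ym(2)], rule arc[OF H1_spaceD(5)[OF Sn(2)] ym(2)])
  \<comment> \<open>Both brackets are multiples of 2 pi almost everywhere. They are chosen such that
    the angle of the reference solution minus the shifted angle at time 0 is exactly the difference
    of the two arctangents, whatever lifts the solutions use.\<close>
  define \<omega> where "\<omega> = (\<lambda>n \<xi>. (?an n \<xi> - Wk n 0 \<xi>) + (W 0 \<xi> - ?a \<xi>))"
  define \<zeta> where "\<zeta> = (\<lambda>n \<xi>. (?bn n \<xi> - Zk n 0 \<xi>) + (Z 0 \<xi> - ?b \<xi>))"
  note regF = F.regular_flow(1)[unfolded regular.simps] and regFn = flow.regular_flow(1)[OF Fn, unfolded regular.simps]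
  have \<omega>b: "ess_bounded (\<omega> n)" "ess_bounded (\<zeta> n)" for n
    unfolding \<omega>_def \<zeta>_def using ebs regF[of 0] regFn[of n 0]
    by (auto intro!: ess_bounded_add ess_bounded_diff)
  have sh: "AE \<xi> in lborel. \<exists>j::int. \<omega> n \<xi> = 2 * pi * of_int j" "AE \<xi> in lborel. \<exists>j::int. \<zeta> n \<xi> = 2 * pi * of_int j" for n
  proof -
    have diff: "\<exists>j::int. (x - a) + (b - z) = 2 * pi * of_int j"
      if ab: "\<exists>k::int. a = x + 2 * pi * of_int k" "\<exists>k::int. b = z + 2 * pi * of_int k" for x a b z :: real
    proof -
      obtain k l :: int where "a = x + 2 * pi * of_int k" "b = z + 2 * pi * of_int l" using ab by blast
      then show ?thesis by (intro exI[of _ "l - k"]) (simp add: algebra_simps)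
    qed
    have A: "AE \<xi> in lborel. \<exists>k::int. W 0 \<xi> = ?a \<xi> + 2 * pi * of_int k" "AE \<xi> in lborel. \<exists>k::int. Z 0 \<xi> = ?b \<xi> + 2 * pi * of_int k"
      using sol by (simp_all add: ode_solution_def Let_def)
    have An: "AE \<xi> in lborel. \<exists>k::int. Wk n 0 \<xi> = ?an n \<xi> + 2 * pi * of_int k" "AE \<xi> in lborel. \<exists>k::int. Zk n 0 \<xi> = ?bn n \<xi> + 2 * pi * of_int k"
      using soln[of n] by (simp_all add: ode_solution_def Let_def)
    show "AE \<xi> in lborel. \<exists>j::int. \<omega> n \<xi> = 2 * pi * of_int j"
      using A(1) An(1) unfolding \<omega>_def by eventually_elim (rule diff)
    show "AE \<xi> in lborel. \<exists>j::int. \<zeta> n \<xi> = 2 * pi * of_int j"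
      using A(2) An(2) unfolding \<zeta>_def by eventually_elim (rule diff)
  qed
  define Ys where "Ys = (\<lambda>n t. (Uk n t, Vk n t, \<lambda>\<xi>. Wk n t \<xi> + \<omega> n \<xi>, \<lambda>\<xi>. Zk n t \<xi> + \<zeta> n \<xi>, qk n t))"
  have evW: "\<forall>\<^sub>F n in sequentially. \<forall>\<xi>. wnorm \<kappa> (\<lambda>\<eta>. ?an n \<eta> - ?a \<eta>) \<xi> \<le> d"
    using arctan_lag_tendsto[OF H Hn excess_L1_tendsto H1_spaceD(5)[OF S(1)] H1_spaceD(5)[OF Sn(1)]
        H1_spaceD(6)[OF S(1)] H1_spaceD(6)[OF Sn(1)] wderiv_L2_tendsto(1) \<kappa> d(1)]
    by (simp only: y_init_eq_lag[OF limit_in_Sigma] y_init_eq_lag[OF seq_in_Sigma])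
  have evZ: "\<forall>\<^sub>F n in sequentially. \<forall>\<xi>. wnorm \<kappa> (\<lambda>\<eta>. ?bn n \<eta> - ?b \<eta>) \<xi> \<le> d"
    using arctan_lag_tendsto[OF H Hn excess_L1_tendsto H1_spaceD(5)[OF S(2)] H1_spaceD(5)[OF Sn(2)]
        H1_spaceD(6)[OF S(2)] H1_spaceD(6)[OF Sn(2)] wderiv_L2_tendsto(2) \<kappa> d(1)]
    by (simp only: y_init_eq_lag[OF limit_in_Sigma] y_init_eq_lag[OF seq_in_Sigma])
  show ?thesis
    using initial_values_tendsto[OF d(1)] evW evZ
  proof eventually_elim
    case (elim n)
    have ini: "U 0 \<xi> = u0 (?y \<xi>)" "V 0 \<xi> = v0 (?y \<xi>)" "Uk n 0 \<xi> = u0n n (?yn n \<xi>)" "Vk n 0 \<xi> = v0n n (?yn n \<xi>)" for \<xi>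
      using sol soln[of n] by (simp_all add: ode_solution_def Let_def)
    have q0: "AE \<xi> in lborel. q 0 \<xi> = 1" "AE \<xi> in lborel. qk n 0 \<xi> = 1"
      using sol soln[of n] by (simp_all add: ode_solution_def Let_def)
    have wneg: "wnorm \<kappa> (\<lambda>\<eta>. f \<eta> - g \<eta>) \<xi> = wnorm \<kappa> (\<lambda>\<eta>. g \<eta> - f \<eta>) \<xi>" for f g \<xi>
      unfolding wnorm_def by (simp add: abs_minus_commute)
    have cl0: "close \<kappa> d (?X 0) (Ys n 0)"
      unfolding Ys_def close.simps
    proof (intro allI conjI)
      fix \<xi>
      show "\<bar>U 0 \<xi> - Uk n 0 \<xi>\<bar> \<le> d" "\<bar>V 0 \<xi> - Vk n 0 \<xi>\<bar> \<le> d" using elim(1) by (simp_all add: ini)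
      have "(\<lambda>\<eta>. W 0 \<eta> - (Wk n 0 \<eta> + \<omega> n \<eta>)) = (\<lambda>\<eta>. ?a \<eta> - ?an n \<eta>)" by (simp add: \<omega>_def)
      then show "wnorm \<kappa> (\<lambda>\<eta>. W 0 \<eta> - (Wk n 0 \<eta> + \<omega> n \<eta>)) \<xi> \<le> d"
        using elim(2) wneg[of ?a "?an n" \<xi>] by simp
      have "(\<lambda>\<eta>. Z 0 \<eta> - (Zk n 0 \<eta> + \<zeta> n \<eta>)) = (\<lambda>\<eta>. ?b \<eta> - ?bn n \<eta>)" by (simp add: \<zeta>_def)
      then show "wnorm \<kappa> (\<lambda>\<eta>. Z 0 \<eta> - (Zk n 0 \<eta> + \<zeta> n \<eta>)) \<xi> \<le> d"
        using elim(3) wneg[of ?b "?bn n" \<xi>] by simp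
      have "wnorm \<kappa> (\<lambda>\<eta>. q 0 \<eta> - qk n 0 \<eta>) \<xi> \<le> 0 * (2 / \<kappa>)"
      proof (rule wnorm_le_const[OF \<kappa>])
        show "(\<lambda>\<eta>. q 0 \<eta> - qk n 0 \<eta>) \<in> borel_measurable borel"
          using regF[of 0] regFn[of n 0] by (intro borel_measurable_diff ess_bounded_measurable) blast+
        show "AE x in lborel. \<bar>q 0 x - qk n 0 x\<bar> \<le> 0" using q0 by eventually_elim simp
      qed simp
      then show "wnorm \<kappa> (\<lambda>\<eta>. q 0 \<eta> - qk n 0 \<eta>) \<xi> \<le> d" using d(1) by simp
    qed
    have lip': "close \<kappa> (L * B') (ode_rhs (?X t)) (ode_rhs (?Y n t))"
      if t: "\<bar>t\<bar> \<le> T" and B': "0 \<le> B'" "B' \<le> \<delta>" and cl: "close \<kappa> B' (?X t) (Ys n t)" for t B'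
    proof (rule lip[rule_format, OF _ flow.regular_flow(1)[OF Fn] _ B' cl F.regular_flow(2) flow.regular_flow(2)[OF Fn]])
      have tT: "t \<in> {-T..T}" using t by auto
      have UVb: "\<bar>U t \<xi>\<bar> \<le> M \<and> \<bar>V t \<xi>\<bar> \<le> M" for \<xi> using M0[OF t, of \<xi>] by (auto simp: M_def)
      have qM: "AE \<xi> in lborel. \<bar>q t \<xi>\<bar> \<le> M"
        using qb[rule_format, OF tT] by eventually_elim (use c in \<open>auto simp: M_def\<close>)
      have kb: "ess_bounded (weighted coef_k (U t, V t, W t, Z t, q t))"
      proof (rule loclip_ess_bounded[OF loclip_coef(1) _ M0[OF t]])
        show "ess_bounded (q t)" using regF[of t] by blast
        show "(\<lambda>\<eta>. coef_k (U t \<eta>) (V t \<eta>) (W t \<eta>) (Z t \<eta>) 0 0) \<in> borel_measurable borel"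
          by (rule coef_measurable[OF H1_spaceD(2)[OF F.UV_H1(1)] H1_spaceD(2)[OF F.UV_H1(2)]
                F.W_Z_measurable(1) F.W_Z_measurable(2)]) simp
      qed
      have cq: "AE \<xi> in lborel. c \<le> q t \<xi>" using qb[rule_format, OF tT] by eventually_elim simp
      have dec: "4 * \<kappa> * (\<xi> - \<eta>) - c / 4 * B \<le> (LBINT s=ereal \<eta>..ereal \<xi>. weighted coef_k (U t, V t, W t, Z t, q t) s)"
        if "\<eta> \<le> \<xi>" for \<eta> \<xi>
        unfolding \<kappa>_def using regF[of t] by (intro kernel_decay[OF _ _ _ kb c cq B(2)[OF t] B(1) that]) blast+
      show "ref_bounds \<kappa> (c / 4 * B) M (?X t)"
        unfolding ref_bounds.simps by (intro conjI allI impI F.regular_flow(1) UVb[THEN conjunct1] UVb[THEN conjunct2] qM dec)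
      have "ess_bounded (\<lambda>\<xi>. Wk n t \<xi> + \<omega> n \<xi>)" "ess_bounded (\<lambda>\<xi>. Zk n t \<xi> + \<zeta> n \<xi>)"
        using regFn[of n t] \<omega>b by (auto intro: ess_bounded_add)
      then show "angle_shift (?Y n t) (Ys n t)"
        unfolding Ys_def angle_shift.simps using sh[of n] by simp
    qed
    have fin: "close \<kappa> (d * exp ((L + 1) * T)) (?X t) (Ys n t)" if t: "\<bar>t\<bar> \<le> T" for t
      by (rule flow_comparison[where X = ?X and Y = "?Y n" and Ys = "Ys n" and \<omega> = "\<omega> n" and \<zeta> = "\<zeta> n", OF F.in_E F.flow_deriv flow.in_E[OF Fn] flow.flow_deriv[OF Fn] _ \<omega>b(1)[of n] \<omega>b(2)[of n]
            \<kappa> less_imp_le[OF T] L(1) d(1,2) lip' cl0 t])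
         (simp_all add: Ys_def)
    show ?case
    proof (intro allI impI)
      fix t \<xi> assume "\<bar>t\<bar> \<le> T"
      from fin[OF this] have "\<bar>U t \<xi> - Uk n t \<xi>\<bar> \<le> d * exp ((L + 1) * T)" "\<bar>V t \<xi> - Vk n t \<xi>\<bar> \<le> d * exp ((L + 1) * T)"
        unfolding Ys_def close.simps by blast+
      then show "\<bar>U t \<xi> - Uk n t \<xi>\<bar> \<le> e \<and> \<bar>V t \<xi> - Vk n t \<xi>\<bar> \<le> e" using d(3) by linarith
    qed
  qed
qed

end

subsection \<open>Back to Eulerian coordinates\<close>

text \<open>On the fixed domain from 0 to 1 the time occurs only in the integrand. Joint continuity
  then follows from continuity of integrals with parameters, and negative times need no separate
  treatment.\<close>

lemma interval_integral_rescale: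
  fixes f :: "real \<Rightarrow> real"
  assumes f: "continuous_on UNIV f"
  shows "(LBINT \<tau>=ereal 0..ereal t. f \<tau>) = integral {0..1} (\<lambda>s. t * f (t * s))"
proof -
  have fc: "continuous_on A (\<lambda>s. f (t * s))" for A
    by (rule continuous_on_compose2[OF f]) (auto intro!: continuous_intros)
  have "(LBINT s=ereal 0..ereal 1. t *\<^sub>R f (t * s)) = (LBINT \<tau>=ereal (t * 0)..ereal (t * 1). f \<tau>)"
    by (rule interval_integral_substitution_finite)
       (auto intro!: derivative_eq_intros continuous_on_subset[OF f] continuous_intros)
  then have "(LBINT \<tau>=ereal 0..ereal t. f \<tau>) = (LBINT s=ereal 0..ereal 1. t * f (t * s))" by simp
  also have "\<dots> = integral {0..1} (\<lambda>s. t * f (t * s))"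
    by (rule interval_integral_eq_integral) (auto intro!: borel_integrable_atLeastAtMost' continuous_intros fc)
  finally show ?thesis .
qed

lemma interval_integral_abs_le:
  fixes f :: "real \<Rightarrow> real"
  assumes f: "continuous_on UNIV f" and b: "\<And>\<tau>. \<bar>\<tau>\<bar> \<le> \<bar>t\<bar> \<Longrightarrow> \<bar>f \<tau>\<bar> \<le> B"
  shows "\<bar>LBINT \<tau>=ereal 0..ereal t. f \<tau>\<bar> \<le> \<bar>t\<bar> * B"
proof -
  have fc: "continuous_on A (\<lambda>s. f (t * s))" for A
    by (rule continuous_on_compose2[OF f]) (auto intro!: continuous_intros)
  have "norm (integral {0..1} (\<lambda>s. t * f (t * s))) \<le> (\<bar>t\<bar> * B) * (1 - 0)"
  proof (rule integral_bound)
    show "norm (t * f (t * s)) \<le> \<bar>t\<bar> * B" if "s \<in> {0..1}" for s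
    proof -
      have "\<bar>t * s\<bar> \<le> \<bar>t\<bar>" using that by (simp add: abs_mult mult_left_le)
      then show ?thesis by (simp add: abs_mult mult_left_mono b)
    qed
  qed (auto intro!: continuous_intros fc)
  then show ?thesis by (simp add: interval_integral_rescale[OF f])
qed

locale eulerian = flow U V W Z q for U V W Z q +
  fixes u0 v0 :: "real \<Rightarrow> real"
  assumes in_Sigma: "(u0, v0) \<in> Sigma_space"
begin

sublocale H: excess_density "excess u0 v0"
  by (rule excess_density_excess[OF in_Sigma])

definition y :: "real \<Rightarrow> real \<Rightarrow> real" where
  "y t \<xi> = char_y u0 v0 U V t \<xi>"

lemma y_eq: "y t \<xi> = H.lag \<xi> + (LBINT \<tau>=ereal 0..ereal t. U \<tau> \<xi> * V \<tau> \<xi>)"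
  by (simp add: y_def char_y_def y_init_eq_lag[OF in_Sigma])

lemma UV_time_continuous: "continuous_on UNIV (\<lambda>\<tau>. U \<tau> \<xi> * V \<tau> \<xi>)"
proof -
  have "continuous_on UNIV (\<lambda>\<tau>. U \<tau> \<xi>)"
    using continuous_on_compose2[OF U_jointly_continuous(1), of UNIV "\<lambda>\<tau>. (\<tau>, \<xi>)"] by (simp add: continuous_intros)
  moreover have "continuous_on UNIV (\<lambda>\<tau>. V \<tau> \<xi>)"
    using continuous_on_compose2[OF U_jointly_continuous(2), of UNIV "\<lambda>\<tau>. (\<tau>, \<xi>)"] by (simp add: continuous_intros)
  ultimately show ?thesis by (rule continuous_on_mult)
qed

lemma y_displacement:
  obtains K where "0 \<le> K" "\<And>t \<xi>. \<bar>t\<bar> \<le> T \<Longrightarrow> \<bar>y t \<xi> - H.lag \<xi>\<bar> \<le> K"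
proof -
  obtain M where M: "\<And>t \<xi>. \<bar>t\<bar> \<le> T \<Longrightarrow> \<bar>U t \<xi>\<bar> \<le> M \<and> \<bar>V t \<xi>\<bar> \<le> M" using sup_bound by blast
  show thesis
  proof (rule that[of "\<bar>T\<bar> * (M * M)"])
    show "0 \<le> \<bar>T\<bar> * (M * M)" by simp
    fix t \<xi> assume t: "\<bar>t\<bar> \<le> T"
    have M0: "0 \<le> M" using M[OF t, of 0] by linarith
    have "\<bar>LBINT \<tau>=ereal 0..ereal t. U \<tau> \<xi> * V \<tau> \<xi>\<bar> \<le> \<bar>t\<bar> * (M * M)"
    proof (rule interval_integral_abs_le[OF UV_time_continuous])
      fix \<tau> assume "\<bar>\<tau>\<bar> \<le> \<bar>t\<bar>"
      then have "\<bar>U \<tau> \<xi>\<bar> \<le> M \<and> \<bar>V \<tau> \<xi>\<bar> \<le> M" using t by (intro M) linarith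
      then show "\<bar>U \<tau> \<xi> * V \<tau> \<xi>\<bar> \<le> M * M" unfolding abs_mult using M0 by (intro mult_mono) auto
    qed
    also have "\<dots> \<le> \<bar>T\<bar> * (M * M)" using t by (intro mult_right_mono) auto
    finally show "\<bar>y t \<xi> - H.lag \<xi>\<bar> \<le> \<bar>T\<bar> * (M * M)" by (simp add: y_eq)
  qed
qed

lemma y_jointly_continuous: "continuous_on UNIV (\<lambda>(t, \<xi>). y t \<xi>)"
proof -
  let ?f = "\<lambda>p s. fst p * (U (fst p * s) (snd p) * V (fst p * s) (snd p))"
  have cU: "continuous_on (UNIV \<times> cbox 0 1) (\<lambda>p. U (fst (fst p) * snd p) (snd (fst p)))"
    using continuous_on_compose2[OF U_jointly_continuous(1), of "UNIV \<times> cbox 0 1" "\<lambda>p. (fst (fst p) * snd p, snd (fst p))"]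
    by (simp add: continuous_intros)
  have cV: "continuous_on (UNIV \<times> cbox 0 1) (\<lambda>p. V (fst (fst p) * snd p) (snd (fst p)))"
    using continuous_on_compose2[OF U_jointly_continuous(2), of "UNIV \<times> cbox 0 1" "\<lambda>p. (fst (fst p) * snd p, snd (fst p))"]
    by (simp add: continuous_intros)
  have "continuous_on (UNIV \<times> cbox 0 1) (\<lambda>(p :: real \<times> real, s :: real). ?f p s)"
    unfolding split_beta by (intro continuous_intros cU cV)
  then have "continuous_on UNIV (\<lambda>p. integral (cbox 0 1) (?f p))"
    by (rule integral_continuous_on_param)
  moreover have "continuous_on UNIV (\<lambda>p :: real \<times> real. H.lag (snd p))"
    by (rule continuous_on_compose2[OF H.lag_continuous]) (auto intro!: continuous_intros)
  ultimately have "continuous_on UNIV (\<lambda>p. H.lag (snd p) + integral (cbox 0 1) (?f p))"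
    by (intro continuous_on_add)
  then show ?thesis
    unfolding split_beta y_eq interval_integral_rescale[OF UV_time_continuous] by (simp add: box_real)
qed

lemma y_surj: "\<exists>\<xi>. y t \<xi> = x"
proof -
  obtain K where K: "0 \<le> K" "\<And>s \<xi>. \<bar>s\<bar> \<le> \<bar>t\<bar> \<Longrightarrow> \<bar>y s \<xi> - H.lag \<xi>\<bar> \<le> K" using y_displacement by blast
  \<comment> \<open>At time 0 these two labels sit at x - K and x + K, and no characteristic moves
    by more than K; so the intermediate value theorem applies between them.\<close>
  have lo: "y t (H.cumul (x - K)) \<le> x" and hi: "x \<le> y t (H.cumul (x + K))"
    using K(2)[of t "H.cumul (x - K)"] K(2)[of t "H.cumul (x + K)"] by simp_all
  have "H.cumul (x - K) \<le> H.cumul (x + K)"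
    using strict_mono_less_eq[OF H.cumul_strict_mono] K(1) by simp
  moreover have "continuous_on UNIV (y t)"
    using continuous_on_compose2[OF y_jointly_continuous, of UNIV "\<lambda>\<xi>. (t, \<xi>)"] by (simp add: continuous_intros)
  ultimately show ?thesis
    using IVT'[of "y t", OF lo hi] continuous_on_subset by blast
qed

text \<open>The map \<open>(t, \<xi>) \<mapsto> (t, y t \<xi>)\<close> is continuous, onto and proper, so continuity in Lagrangian
  coordinates descends to Eulerian ones.\<close>

lemma eulerian_continuous:
  assumes F: "continuous_on UNIV (\<lambda>(t, \<xi>). F t \<xi>)" and f: "\<And>t \<xi>. f t (y t \<xi>) = (F t \<xi> :: real)"
  shows "continuous_on UNIV (\<lambda>(t, x). f t x)"
proof (rule continuous_onI)
  fix p :: "real \<times> real" and e :: real assume e: "0 < e"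
  let ?g = "\<lambda>(t, x). f t x"
  show "\<exists>d>0. \<forall>p'\<in>UNIV. dist p' p < d \<longrightarrow> dist (?g p') (?g p) \<le> e"
  proof (rule ccontr)
    assume "\<not> ?thesis"
    then have "\<exists>p'. dist p' p < 1 / real (Suc n) \<and> e < dist (?g p') (?g p)" for n :: nat
      by (metis UNIV_I not_le of_nat_0_less_iff zero_less_Suc zero_less_divide_1_iff)
    then obtain P where P: "\<And>n. dist (P n) p < 1 / real (Suc n)" "\<And>n. e < dist (?g (P n)) (?g p)" by metis
    have "P \<longlonglongrightarrow> p"
    proof (rule metric_LIMSEQ_I)
      fix r :: real assume "0 < r"
      then obtain N where N: "inverse (real (Suc N)) < r" using reals_Archimedean by blast
      have "dist (P n) p < r" if "N \<le> n" for n
      proof -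
        have "1 / real (Suc n) \<le> inverse (real (Suc N))" using that by (simp add: field_simps)
        then show ?thesis using P(1)[of n] N by linarith
      qed
      then show "\<exists>no. \<forall>n\<ge>no. dist (P n) p < r" by blast
    qed
    then have Pt: "(\<lambda>n. fst (P n)) \<longlonglongrightarrow> fst p" and Px: "(\<lambda>n. snd (P n)) \<longlonglongrightarrow> snd p"
      by (auto intro: tendsto_fst tendsto_snd)
    obtain T where T: "\<And>n. \<bar>fst (P n)\<bar> \<le> T"
      using convergent_imp_Bseq[OF convergentI[OF Pt]] by (auto simp: Bseq_def)
    obtain R where R: "\<And>n. \<bar>snd (P n)\<bar> \<le> R"
      using convergent_imp_Bseq[OF convergentI[OF Px]] by (auto simp: Bseq_def)
    have "\<forall>n. \<exists>\<xi>. y (fst (P n)) \<xi> = snd (P n)" using y_surj by blast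
    from choice[OF this] obtain \<Xi> where \<Xi>': "\<forall>n. y (fst (P n)) (\<Xi> n) = snd (P n)" by (elim exE)
    note \<Xi> = \<Xi>'[rule_format]
    obtain K where K: "\<And>t \<xi>. \<bar>t\<bar> \<le> T \<Longrightarrow> \<bar>y t \<xi> - H.lag \<xi>\<bar> \<le> K" using y_displacement by blast
    \<comment> \<open>Properness: bounded positions at bounded times have bounded initial positions,
      since displacements are bounded, hence bounded labels.\<close>
    have "\<Xi> n \<in> {H.cumul (- (R + K))..H.cumul (R + K)}" for n
    proof -
      have "\<bar>H.lag (\<Xi> n)\<bar> \<le> R + K" using K[OF T, of n "\<Xi> n"] R[of n] unfolding \<Xi> by linarith
      then have "H.cumul (- (R + K)) \<le> H.cumul (H.lag (\<Xi> n))" "H.cumul (H.lag (\<Xi> n)) \<le> H.cumul (R + K)"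
        unfolding strict_mono_less_eq[OF H.cumul_strict_mono] by linarith+
      then show ?thesis by simp
    qed
    then obtain l r where r: "strict_mono r" and l: "(\<Xi> \<circ> r) \<longlonglongrightarrow> l"
      using compact_Icc[unfolded compact_def, rule_format, of \<Xi>] by blast
    have sub: "(\<lambda>n. (fst (P (r n)), \<Xi> (r n))) \<longlonglongrightarrow> (fst p, l)"
      using LIMSEQ_subseq_LIMSEQ[OF Pt r] l by (intro tendsto_Pair) (simp_all add: o_def)
    have "(\<lambda>n. (\<lambda>(t, \<xi>). y t \<xi>) (fst (P (r n)), \<Xi> (r n))) \<longlonglongrightarrow> (\<lambda>(t, \<xi>). y t \<xi>) (fst p, l)"
      by (rule continuous_on_tendsto_compose[OF y_jointly_continuous sub]) auto
    then have "(\<lambda>n. snd (P (r n))) \<longlonglongrightarrow> y (fst p) l" by (simp add: \<Xi>)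
    then have yl: "y (fst p) l = snd p"
      using LIMSEQ_subseq_LIMSEQ[OF Px r] by (auto simp: o_def intro: LIMSEQ_unique)
    \<comment> \<open>The limit label l is just one of possibly many labels of the point p. By
      \<open>f\<close> all of them give the same value of F, so the limit is the value of f at
      p.\<close>
    have "(\<lambda>n. (\<lambda>(t, \<xi>). F t \<xi>) (fst (P (r n)), \<Xi> (r n))) \<longlonglongrightarrow> (\<lambda>(t, \<xi>). F t \<xi>) (fst p, l)"
      by (rule continuous_on_tendsto_compose[OF F sub]) auto
    then have "(\<lambda>n. f (fst (P (r n))) (snd (P (r n)))) \<longlonglongrightarrow> f (fst p) (snd p)"
      unfolding prod.case f[symmetric] \<Xi> yl .
    then have "(\<lambda>n. ?g (P (r n))) \<longlonglongrightarrow> ?g p" by (simp add: split_beta)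
    from metric_LIMSEQ_D[OF this e] obtain n where "dist (?g (P (r n))) (?g p) < e" by blast
    then show False using P(2)[of "r n"] by linarith
  qed
qed

text \<open>A large position forces a large label, since \<bar>lag \<xi>\<bar> \<le>
  \<bar>\<xi>\<bar> and displacements are bounded; so f inherits decay at infinity from F. Near the
  origin the Heine-Cantor theorem applies.\<close>

lemma eulerian_uniform_continuity:
  assumes F: "continuous_on UNIV (\<lambda>(t, \<xi>). F t \<xi>)" and f: "\<And>t \<xi>. f t (y t \<xi>) = (F t \<xi> :: real)"
    and van: "\<And>e. 0 < e \<Longrightarrow> \<exists>R. \<forall>t \<xi>. \<bar>t\<bar> \<le> T \<longrightarrow> R < \<bar>\<xi>\<bar> \<longrightarrow> \<bar>F t \<xi>\<bar> \<le> e" and e: "0 < e"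
  obtains d where "0 < d" "\<And>t x x'. \<bar>t\<bar> \<le> T \<Longrightarrow> \<bar>x - x'\<bar> < d \<Longrightarrow> \<bar>f t x - f t x'\<bar> \<le> e"
proof -
  obtain R where R: "\<forall>t \<xi>. \<bar>t\<bar> \<le> T \<longrightarrow> R < \<bar>\<xi>\<bar> \<longrightarrow> \<bar>F t \<xi>\<bar> \<le> e / 2"
    using van[of "e / 2"] e by (meson half_gt_zero)
  obtain K where K: "\<And>t \<xi>. \<bar>t\<bar> \<le> T \<Longrightarrow> \<bar>y t \<xi> - H.lag \<xi>\<bar> \<le> K" using y_displacement by blast
  have lag0: "H.lag 0 = 0" using H.lag_cumul[of 0] H.cumul_0 by simp
  have far: "\<bar>f t x\<bar> \<le> e / 2" if t: "\<bar>t\<bar> \<le> T" and x: "R + K < \<bar>x\<bar>" for t x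
  proof -
    obtain \<xi> where \<xi>: "y t \<xi> = x" using y_surj by blast
    have "R < \<bar>H.lag \<xi>\<bar>" using K[OF t, of \<xi>] x \<xi> by linarith
    moreover have "\<bar>H.lag \<xi>\<bar> \<le> \<bar>\<xi>\<bar>" using H.lag_lipschitz[of \<xi> 0] lag0 by simp
    ultimately have "\<bar>F t \<xi>\<bar> \<le> e / 2" using R t by (meson less_le_trans)
    then show ?thesis using f[of t \<xi>] \<xi> by simp
  qed
  \<comment> \<open>The margin 1 matches the bound \<open>min d 1\<close>: two points at distance
    less than 1 either both lie in the rectangle or are both beyond R + K, where each value is at
    most e/2.\<close>
  let ?Q = "{-T..T} \<times> {-(R + K + 1)..R + K + 1}"
  have "uniformly_continuous_on ?Q (\<lambda>(t, x). f t x)"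
    by (intro compact_uniformly_continuous continuous_on_subset[OF eulerian_continuous[OF F f]] compact_Times compact_Icc) auto
  then obtain d where d: "0 < d" "\<And>p p'. p \<in> ?Q \<Longrightarrow> p' \<in> ?Q \<Longrightarrow> dist p' p < d \<Longrightarrow>
      dist ((\<lambda>(t, x). f t x) p') ((\<lambda>(t, x). f t x) p) < e"
    using e unfolding uniformly_continuous_on_def by meson
  show thesis
  proof (rule that[of "min d 1"])
    show "0 < min d 1" using d(1) by simp
    fix t x x' assume t: "\<bar>t\<bar> \<le> T" and x: "\<bar>x - x'\<bar> < min d 1"
    show "\<bar>f t x - f t x'\<bar> \<le> e"
    proof (cases "\<bar>x\<bar> \<le> R + K + 1 \<and> \<bar>x'\<bar> \<le> R + K + 1")
      case True
      then have "(t, x) \<in> ?Q" "(t, x') \<in> ?Q" using t by auto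
      from d(2)[OF this(2,1)] show ?thesis using x by (simp add: dist_Pair_Pair dist_real_def)
    next
      case False
      then have "R + K < \<bar>x\<bar>" "R + K < \<bar>x'\<bar>" using x by auto
      then show ?thesis using far[OF t, of x] far[OF t, of x'] by linarith
    qed
  qed
qed

end

section \<open>The norm on the strip and the final estimate\<close>

lemma strip_norm_le:
  assumes f: "continuous_on UNIV (\<lambda>(t, x). f t x)" and le: "\<And>t x. \<bar>t\<bar> \<le> T \<Longrightarrow> \<bar>f t x\<bar> \<le> e"
  shows "strip_norm T f \<le> ereal e"
  unfolding strip_norm_def
proof (rule esssup_I)
  have m: "(\<lambda>p. f (fst p) (snd p)) \<in> borel_measurable borel"
    using borel_measurable_continuous_onI[OF f] unfolding split_beta .
  have "(\<lambda>p. ereal \<bar>f (fst p) (snd p)\<bar>) \<in> borel_measurable (lborel :: (real \<times> real) measure)"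
    using m by simp
  then show "(\<lambda>(t, x). ereal \<bar>f t x\<bar>) \<in> borel_measurable (restrict_space lborel ({-T..T} \<times> UNIV))"
    unfolding split_beta by (rule measurable_restrict_space1)
  show "AE p in restrict_space lborel ({-T..T} \<times> UNIV). (case p of (t, x) \<Rightarrow> ereal \<bar>f t x\<bar>) \<le> ereal e"
    by (rule AE_I2) (auto simp: space_restrict_space intro!: le)
qed

text \<open>An essential supremum in the extended reals is minus infinity over a null space, so even
  for moduli its sign rests on the strip having positive measure.\<close>

lemma strip_norm_nonneg:
  assumes T: "0 < T" and f: "continuous_on UNIV (\<lambda>(t, x). f t x)"
  shows "0 \<le> strip_norm T f"
proof -
  let ?S = "{-T..T} \<times> (UNIV :: real set)"
  let ?M = "restrict_space (lborel :: (real \<times> real) measure) ?S"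
  have S: "?S \<in> sets (lborel :: (real \<times> real) measure)"
    by (simp add: borel_closed closed_Times)
  have "emeasure ?M (space ?M) = emeasure (lborel \<Otimes>\<^sub>M lborel) ?S"
    using S by (simp add: emeasure_restrict_space space_restrict_space lborel_prod)
  also have "\<dots> = emeasure lborel {-T..T} * emeasure lborel (UNIV :: real set)"
    by (rule lborel.emeasure_pair_measure_Times) auto
  also have "\<dots> \<noteq> 0" using T by simp
  finally have "esssup ?M (\<lambda>_. 0 :: ereal) = 0" by (rule esssup_const)
  moreover have "esssup ?M (\<lambda>_. 0 :: ereal) \<le> strip_norm T f"
    unfolding strip_norm_def by (rule esssup_mono) auto
  ultimately show ?thesis by simp
qed

lemma continuous_on_diff_curried:
  fixes f g :: "real \<Rightarrow> real \<Rightarrow> real"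
  assumes "continuous_on UNIV (\<lambda>(t, x). f t x)" "continuous_on UNIV (\<lambda>(t, x). g t x)"
  shows "continuous_on UNIV (\<lambda>(t, x). (f - g) t x)"
  using continuous_on_diff[OF assms] by (simp add: split_beta)

theorem proposition6p5:
  fixes u0 v0 :: "real \<Rightarrow> real"
    and u0n v0n :: "nat \<Rightarrow> real \<Rightarrow> real"
    and u v :: "real \<Rightarrow> real \<Rightarrow> real"
    and un vn :: "nat \<Rightarrow> real \<Rightarrow> real \<Rightarrow> real"
  assumes "(u0, v0) \<in> Sigma_space"
    and "\<And>n. (u0n n, v0n n) \<in> Sigma_space"
    and "(\<lambda>n. d_Sigma (u0n n, v0n n) (u0, v0)) \<longlonglongrightarrow> 0"
    and "constructed_solution u0 v0 u v"
    and "\<And>n. constructed_solution (u0n n) (v0n n) (un n) (vn n)"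
  shows "\<forall>T>0. (\<lambda>n. strip_norm T (un n - u) + strip_norm T (vn n - v)) \<longlonglongrightarrow> 0"
proof (intro allI impI)
  fix T :: real assume T: "0 < T"
  interpret S: Sigma_convergent u0 v0 u0n v0n
    using assms(1-3) by unfold_locales
  obtain U V W Z q where sol: "ode_solution u0 v0 U V W Z q"
    and rep: "\<forall>t x \<xi>. x = char_y u0 v0 U V t \<xi> \<longrightarrow> u t x = U t \<xi> \<and> v t x = V t \<xi>"
    using assms(4) unfolding constructed_solution_def by (elim exE conjE)
  note uv = rep[rule_format, OF refl, THEN conjunct1] rep[rule_format, OF refl, THEN conjunct2]
  have "\<forall>n. \<exists>U V W Z q. ode_solution (u0n n) (v0n n) U V W Z q \<and>
    (\<forall>t x \<xi>. x = char_y (u0n n) (v0n n) U V t \<xi> \<longrightarrow> un n t x = U t \<xi> \<and> vn n t x = V t \<xi>)"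
    using assms(5) unfolding constructed_solution_def ..
  then obtain Uk Vk Wk Zk qk where soln_rep: "\<forall>n. ode_solution (u0n n) (v0n n) (Uk n) (Vk n) (Wk n) (Zk n) (qk n) \<and>
    (\<forall>t x \<xi>. x = char_y (u0n n) (v0n n) (Uk n) (Vk n) t \<xi> \<longrightarrow> un n t x = Uk n t \<xi> \<and> vn n t x = Vk n t \<xi>)"
    unfolding choice_iff by (elim exE)
  have soln: "ode_solution (u0n n) (v0n n) (Uk n) (Vk n) (Wk n) (Zk n) (qk n)"
    and repn: "x = char_y (u0n n) (v0n n) (Uk n) (Vk n) t \<xi> \<Longrightarrow> un n t x = Uk n t \<xi> \<and> vn n t x = Vk n t \<xi>" for n t x \<xi>
    using soln_rep by simp_all
  note uvn = repn[OF refl, THEN conjunct1] repn[OF refl, THEN conjunct2]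
  interpret E: eulerian U V W Z q u0 v0
    using ode_solution_flow[OF sol] assms(1) by (simp add: eulerian_def eulerian_axioms_def)
  have En: "eulerian (Uk n) (Vk n) (Wk n) (Zk n) (qk n) (u0n n) (v0n n)" for n
    using ode_solution_flow[OF soln] assms(2) by (simp add: eulerian_def eulerian_axioms_def)
  let ?yn = "\<lambda>n. eulerian.y (Uk n) (Vk n) (u0n n) (v0n n)"
  note uvy = uv[folded E.y_def] and uvny = uvn[folded eulerian.y_def[OF En]]
  have cu: "continuous_on UNIV (\<lambda>(t, x). u t x)" and cv: "continuous_on UNIV (\<lambda>(t, x). v t x)"
    by (rule E.eulerian_continuous[OF E.U_jointly_continuous(1) uvy(1)],
        rule E.eulerian_continuous[OF E.U_jointly_continuous(2) uvy(2)])
  have Fn: "flow (Uk n) (Vk n) (Wk n) (Zk n) (qk n)" for n by (rule ode_solution_flow[OF soln])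
  have cun: "continuous_on UNIV (\<lambda>(t, x). un n t x)" and cvn: "continuous_on UNIV (\<lambda>(t, x). vn n t x)" for n
    by (rule eulerian.eulerian_continuous[OF En flow.U_jointly_continuous(1)[OF Fn] uvny(1)],
        rule eulerian.eulerian_continuous[OF En flow.U_jointly_continuous(2)[OF Fn] uvny(2)])
  note cd = continuous_on_diff_curried[OF cun cu] continuous_on_diff_curried[OF cvn cv]
  obtain M where M: "\<And>t \<xi>. \<bar>t\<bar> \<le> T \<Longrightarrow> \<bar>U t \<xi>\<bar> \<le> M \<and> \<bar>V t \<xi>\<bar> \<le> M" using E.sup_bound by blast
  have M0: "0 \<le> M" using M[of 0 0] T by auto
  have key: "\<forall>\<^sub>F n in sequentially. \<forall>t x. \<bar>t\<bar> \<le> T \<longrightarrow> \<bar>un n t x - u t x\<bar> \<le> e \<and> \<bar>vn n t x - v t x\<bar> \<le> e"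
    if e: "0 < e" for e
  proof -
    have e2: "0 < e / 2" using e by simp
    have van: "\<exists>R. \<forall>t \<xi>. \<bar>t\<bar> \<le> T \<longrightarrow> R < \<bar>\<xi>\<bar> \<longrightarrow> \<bar>U t \<xi>\<bar> \<le> r" "\<exists>R. \<forall>t \<xi>. \<bar>t\<bar> \<le> T \<longrightarrow> R < \<bar>\<xi>\<bar> \<longrightarrow> \<bar>V t \<xi>\<bar> \<le> r"
      if r: "0 < r" for r
      by (rule E.uniform_vanishing[OF r, of T], blast)+
    obtain d1 where d1: "0 < d1" "\<And>t x x'. \<bar>t\<bar> \<le> T \<Longrightarrow> \<bar>x - x'\<bar> < d1 \<Longrightarrow> \<bar>u t x - u t x'\<bar> \<le> e / 2"
      using E.eulerian_uniform_continuity[OF E.U_jointly_continuous(1) uvy(1) van(1) e2] by blast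
    obtain d2 where d2: "0 < d2" "\<And>t x x'. \<bar>t\<bar> \<le> T \<Longrightarrow> \<bar>x - x'\<bar> < d2 \<Longrightarrow> \<bar>v t x - v t x'\<bar> \<le> e / 2"
      using E.eulerian_uniform_continuity[OF E.U_jointly_continuous(2) uvy(2) van(2) e2] by blast
    define d where "d = min d1 d2"
    have d: "0 < d" using d1(1) d2(1) by (simp add: d_def)
    \<comment> \<open>The 1 yields the bound M + 1 for the approximating V, e/2 is the direct error,
      and the third entry keeps the accumulated error of the characteristics up to time T at most
      d/4.\<close>
    define r where "r = min (min 1 (e / 2)) (d / (4 * (T * (2 * M + 1))))"
    have TM: "0 < T * (2 * M + 1)" using T M0 by simp
    have r: "0 < r" "r \<le> 1" "r \<le> e / 2" "T * (r * (2 * M + 1)) \<le> d / 4"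
    proof -
      show "0 < r" "r \<le> 1" "r \<le> e / 2" using d e TM by (simp_all add: r_def)
      have "r \<le> d / (4 * (T * (2 * M + 1)))" by (simp add: r_def)
      then have "r * (4 * (T * (2 * M + 1))) \<le> d" using TM by (simp only: pos_le_divide_eq mult_pos_pos zero_less_numeral)
      then show "T * (r * (2 * M + 1)) \<le> d / 4" by (simp add: algebra_simps)
    qed
    have lim: "(\<lambda>n. 2 * (LINT x|lborel. \<bar>excess (u0n n) (v0n n) x - excess u0 v0 x\<bar>)) \<longlonglongrightarrow> 2 * 0"
      by (intro tendsto_intros S.excess_L1_tendsto)
    have ev: "\<forall>\<^sub>F n in sequentially. 2 * (LINT x|lborel. \<bar>excess (u0n n) (v0n n) x - excess u0 v0 x\<bar>) < d / 4"
      by (rule order_tendstoD(2)[OF lim]) (use d in simp)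
    show ?thesis
      using ev S.lagrangian_tendsto[OF sol soln T r(1)]
    proof eventually_elim
      case (elim n)
      have yd: "\<bar>?yn n t \<xi> - E.y t \<xi>\<bar> < d" if t: "\<bar>t\<bar> \<le> T" for t \<xi>
      proof -
        let ?f = "\<lambda>\<tau>. U \<tau> \<xi> * V \<tau> \<xi>" and ?fn = "\<lambda>\<tau>. Uk n \<tau> \<xi> * Vk n \<tau> \<xi>"
        have c: "continuous_on UNIV ?f" "continuous_on UNIV ?fn"
          by (rule E.UV_time_continuous, rule eulerian.UV_time_continuous[OF En])
        have i: "interval_lebesgue_integrable lborel (ereal 0) (ereal t) g" if "continuous_on UNIV g" for g :: "real \<Rightarrow> real"
        proof -
          have "set_integrable lborel (einterval (ereal a) (ereal b)) g" for a b
            by (rule set_integrable_subset[of _ "{a..b}"])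
               (auto intro!: borel_integrable_atLeastAtMost' continuous_on_subset[OF that])
          then show ?thesis by (simp add: interval_lebesgue_integrable_def)
        qed
        have "\<bar>LBINT \<tau>=ereal 0..ereal t. ?fn \<tau> - ?f \<tau>\<bar> \<le> \<bar>t\<bar> * (r * (2 * M + 1))"
        proof (rule interval_integral_abs_le)
          show "continuous_on UNIV (\<lambda>\<tau>. ?fn \<tau> - ?f \<tau>)" by (intro continuous_on_diff c)
          fix \<tau> assume "\<bar>\<tau>\<bar> \<le> \<bar>t\<bar>"
          then have \<tau>: "\<bar>\<tau>\<bar> \<le> T" using t by linarith
          have D: "\<bar>U \<tau> \<xi> - Uk n \<tau> \<xi>\<bar> \<le> r" "\<bar>V \<tau> \<xi> - Vk n \<tau> \<xi>\<bar> \<le> r" using elim(2) \<tau> by auto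
          have UV: "\<bar>U \<tau> \<xi>\<bar> \<le> M" "\<bar>V \<tau> \<xi>\<bar> \<le> M" using M[OF \<tau>] by auto
          have Vk: "\<bar>Vk n \<tau> \<xi>\<bar> \<le> M + 1" using UV D r by linarith
          \<comment> \<open>The products are split so that only \<open>Vk n\<close> needs a bound
            among the approximating functions, and it has one by closeness to
            \<open>V\<close>.\<close>
          have "?fn \<tau> - ?f \<tau> = (Uk n \<tau> \<xi> - U \<tau> \<xi>) * Vk n \<tau> \<xi> + U \<tau> \<xi> * (Vk n \<tau> \<xi> - V \<tau> \<xi>)" by (simp add: algebra_simps)
          then have "\<bar>?fn \<tau> - ?f \<tau>\<bar> \<le> \<bar>Uk n \<tau> \<xi> - U \<tau> \<xi>\<bar> * \<bar>Vk n \<tau> \<xi>\<bar> + \<bar>U \<tau> \<xi>\<bar> * \<bar>Vk n \<tau> \<xi> - V \<tau> \<xi>\<bar>"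
            by (metis abs_mult abs_triangle_ineq)
          also have "\<dots> \<le> r * (M + 1) + M * r"
            using D Vk UV r(1) M0 by (intro add_mono mult_mono) (auto simp: abs_minus_commute)
          finally show "\<bar>?fn \<tau> - ?f \<tau>\<bar> \<le> r * (2 * M + 1)" by (simp add: algebra_simps)
        qed
        also have "\<dots> \<le> T * (r * (2 * M + 1))" using t r(1) M0 by (intro mult_right_mono) auto
        also note r(4)
        finally have I: "\<bar>(LBINT \<tau>=ereal 0..ereal t. ?fn \<tau>) - (LBINT \<tau>=ereal 0..ereal t. ?f \<tau>)\<bar> \<le> d / 4"
          using i[OF c(1)] i[OF c(2)] by simp
        have "\<bar>excess_density.lag (excess (u0n n) (v0n n)) \<xi> - E.H.lag \<xi>\<bar> < d / 4"
          using lag_dist[OF excess_density_excess[OF assms(2)] excess_density_excess[OF assms(1)], of n \<xi>] elim(1) by linarith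
        then show ?thesis using I d unfolding E.y_eq eulerian.y_eq[OF En] by linarith
      qed
      show ?case
      proof (intro allI impI)
        fix t x assume t: "\<bar>t\<bar> \<le> T"
        \<comment> \<open>The label is taken from the approximating flow, so un at x is an exact
          Lagrangian value. The limit flow carries the same label to a point within d of x, and the
          uniform continuity of u and v bridges this distance.\<close>
        obtain \<xi> where x: "?yn n t \<xi> = x" using eulerian.y_surj[OF En] by blast
        have near: "\<bar>x - E.y t \<xi>\<bar> < d1" "\<bar>x - E.y t \<xi>\<bar> < d2" using yd[OF t, of \<xi>] x by (simp_all add: d_def)
        have "\<bar>u t x - U t \<xi>\<bar> \<le> e / 2" "\<bar>v t x - V t \<xi>\<bar> \<le> e / 2"
          using d1(2)[OF t near(1)] d2(2)[OF t near(2)] uvy by simp_all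
        moreover have "un n t x = Uk n t \<xi>" "vn n t x = Vk n t \<xi>" using uvny[of n t \<xi>] x by simp_all
        moreover have "\<bar>U t \<xi> - Uk n t \<xi>\<bar> \<le> r" "\<bar>V t \<xi> - Vk n t \<xi>\<bar> \<le> r" using elim(2) t by auto
        ultimately show "\<bar>un n t x - u t x\<bar> \<le> e \<and> \<bar>vn n t x - v t x\<bar> \<le> e" using r(3) by linarith
      qed
    qed
  qed
  let ?s = "\<lambda>n. strip_norm T (un n - u) + strip_norm T (vn n - v)"
  show "?s \<longlonglongrightarrow> 0"
  proof (rule order_tendstoI)
    fix a :: ereal assume "a < 0"
    moreover have "0 \<le> ?s n" for n
      by (intro add_nonneg_nonneg strip_norm_nonneg T cd)
    ultimately show "\<forall>\<^sub>F n in sequentially. a < ?s n" by (meson always_eventually less_le_trans)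
  next
    fix a :: ereal assume "0 < a"
    \<comment> \<open>Passing to a real z below the bound \<open>a\<close> covers the case of
      infinite \<open>a\<close> too.\<close>
    then obtain z where z: "0 < ereal z" "ereal z < a" using ereal_dense2 by blast
    then have z2: "0 < z / 2" by simp
    show "\<forall>\<^sub>F n in sequentially. ?s n < a"
      using key[OF z2]
    proof eventually_elim
      case (elim n)
      have "?s n \<le> ereal (z / 2) + ereal (z / 2)"
        by (intro add_mono strip_norm_le cd) (use elim in auto)
      then show ?case using z(2) by simp
    qed
  qed
qed

end
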